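(* Let $M$ be a compact Riemannian manifold of dimension $d\ge2$ with volume measure $Leb$. Endow $\mathrm{Aut}_{Leb}(M)\times L^\infty(M,SL(2,\mathbb{R}))$ with the separate topology associated with the weak topology $\mathcal{W}$ on $\mathrm{Aut}_{Leb}(M)$ and the $L^\infty$-norm topology on $L^\infty(M,SL(2,\mathbb{R}))$. There exists a residual subset $\mathcal{R}\subset \mathrm{Aut}_{Leb}(M)\times L^\infty(M,SL(2,\mathbb{R}))$ such that, for every $(f,A)\in\mathcal{R}$, either $(f,A)$ has trivial spectrum or the cocycle $(f,A)$ is uniformly hyperbolic.
   Context: $\mathrm{Aut}_{Leb}(M)$ is the space of bi-measurable bijections of $M$ preserving $Leb$ (identified when equal a.e.), with the weak topology $\mathcal{W}$: $f_n\to f$ iff $Leb(f_n(K)\,\triangle\, f(K))\to0$ for every measurable $K\subset M$. $L^\infty(M,SL(2,\mathbb{R}))$ is the space of essentially bounded measurable maps $A:M\to SL(2,\mathbb{R})$ with distance $\|A-B\|_\infty=\operatorname{ess\,sup}_{x}\|A(x)-B(x)\|+\operatorname{ess\,sup}_x\|A^{-1}(x)-B^{-1}(x)\|$, where $A^{-1}(x)$ is the inverse matrix of $A(x)$. Separate topology on a product $X\times Y$ of topological spaces: $U\subset X\times Y$ is open iff for every $(x,y)\in U$ the sections $\{x'\in X:(x',y)\in U\}$ and $\{y'\in Y:(x,y')\in U\}$ are open in $X$ and $Y$ respectively. A subset is residual if it contains a countable intersection of open dense sets. For $(f,A)$ put $A^n(x)=A(f^{n-1}(x))\cdots A(f(x))A(x)$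 for $n\ge1$ and $\lambda^+(f,A,x)=\lim_{n\to+\infty}\frac1n\log\|A^n(x)\|\ge0$, which exists for $Leb$-a.e. $x$; the Lyapunov exponents at $x$ are $\pm\lambda^+(f,A,x)$. The pair has trivial spectrum if all Lyapunov exponents are equal, i.e. $\lambda^+(f,A,x)=0$ for $Leb$-a.e. $x$. The cocycle $(f,A)$ is uniformly hyperbolic if there are $C>0$, $\theta\in(0,1)$ and a measurable splitting $\mathbb{R}^2=E^s_x\oplus E^u_x$ into one-dimensional subspaces, defined for $Leb$-a.e. $x$, with $A(x)E^{*}_x=E^{*}_{f(x)}$ for $*\in\{s,u\}$, and $\|A^n(x)|_{E^s_x}\|\le C\theta^n$, $\|(A^n(x)|_{E^u_x})^{-1}\|\le C\theta^n$ for all $n\ge1$ and $Leb$-a.e. $x$. *)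

theory Defs
  imports "HOL-Analysis.Analysis" "HOL-Probability.Essential_Supremum"
begin

section \<open>Compact Riemannian manifolds and their volume measure\<close>

text \<open>\<open>C_on k S f\<close>: on the open set \<open>S\<close> the map \<open>f\<close> is \<open>k\<close> times differentiable with continuous
  derivatives; higher derivatives are taken through directional derivatives in fixed directions.\<close>

primrec C_on :: "nat \<Rightarrow> 'a::real_normed_vector set \<Rightarrow> ('a \<Rightarrow> 'b::real_normed_vector) \<Rightarrow> bool" where
  "C_on 0 S f \<longleftrightarrow> continuous_on S f"
| "C_on (Suc k) S f \<longleftrightarrow> (\<forall>x\<in>S. f differentiable (at x)) \<and>
     (\<forall>v. C_on k S (\<lambda>x. frechet_derivative f (at x) v))"

definition smooth_on :: "'a::real_normed_vector set \<Rightarrow> ('a \<Rightarrow> 'b::real_normed_vector) \<Rightarrow> bool" where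
  "smooth_on S f \<longleftrightarrow> (\<forall>k. C_on k S f)"

text \<open>A chart is a pair \<open>(U, \<phi>)\<close>; only the values of \<open>\<phi>\<close> on \<open>U\<close> matter. \<open>transition c d\<close> is
  \<open>\<psi> \<circ> \<phi>\<inverse>\<close> for \<open>c = (U, \<phi>)\<close>, \<open>d = (V, \<psi>)\<close>.\<close>

type_synonym ('a, 'n) chart = "'a set \<times> ('a \<Rightarrow> real ^ 'n)"

definition is_chart :: "'a topology \<Rightarrow> ('a, 'n::finite) chart \<Rightarrow> bool" where
  "is_chart M = (\<lambda>(U, \<phi>). openin M U \<and> open (\<phi> ` U) \<and>
     homeomorphic_map (subtopology M U) (top_of_set (\<phi> ` U)) \<phi>)"

definition chart_inv :: "('a, 'n::finite) chart \<Rightarrow> real ^ 'n \<Rightarrow> 'a" where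
  "chart_inv c = inv_into (fst c) (snd c)"

definition transition :: "('a, 'n::finite) chart \<Rightarrow> ('a, 'n) chart \<Rightarrow> real ^ 'n \<Rightarrow> real ^ 'n" where
  "transition c d = snd d \<circ> chart_inv c"

text \<open>Smooth manifolds without boundary, of dimension \<open>CARD('n)\<close>. The atlas is not required to be
  maximal.\<close>

locale smooth_manifold =
  fixes M :: "'a topology" and atlas :: "('a, 'n::finite) chart set"
  assumes Hausdorff: "Hausdorff_space M"
    and second_countable: "second_countable M"
    and charts: "\<And>c. c \<in> atlas \<Longrightarrow> is_chart M c"
    and covering: "(\<Union>c\<in>atlas. fst c) = topspace M"
    and compatible: "\<And>c d. c \<in> atlas \<Longrightarrow> d \<in> atlas \<Longrightarrow>
      smooth_on (snd c ` (fst c \<inter> fst d)) (transition c d)"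

text \<open>A Riemannian metric is given by its Gram matrices in the charts of the atlas: \<open>g c p\<close> is the
  matrix of the inner product on the tangent space at \<open>p\<close> with respect to the coordinate basis of
  the chart \<open>c\<close>. The transformation rule \<open>g\<^sub>c = J\<^sup>T g\<^sub>d J\<close>, where \<open>J\<close> is the Jacobian matrix of the
  coordinate change from \<open>c\<close> to \<open>d\<close>, says that these matrices define one inner product.\<close>

locale riemannian_manifold = smooth_manifold M atlas
  for M :: "'a topology" and atlas :: "('a, 'n::finite) chart set" +
  fixes g :: "('a, 'n) chart \<Rightarrow> 'a \<Rightarrow> real ^ 'n ^ 'n"
  assumes metric_symmetric: "\<And>c p. c \<in> atlas \<Longrightarrow> p \<in> fst c \<Longrightarrow> transpose (g c p) = g c p"
    and metric_positive: "\<And>c p v. c \<in> atlas \<Longrightarrow> p \<in> fst c \<Longrightarrow> v \<noteq> 0 \<Longrightarrow> v \<bullet> (g c p *v v) > 0"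
    and metric_smooth: "\<And>c. c \<in> atlas \<Longrightarrow> smooth_on (snd c ` fst c) (\<lambda>y. g c (chart_inv c y))"
    and metric_transform: "\<And>c d p J. c \<in> atlas \<Longrightarrow> d \<in> atlas \<Longrightarrow> p \<in> fst c \<inter> fst d \<Longrightarrow>
      J = matrix (frechet_derivative (transition c d) (at (snd c p))) \<Longrightarrow>
      g c p = transpose J ** g d p ** J"

locale compact_riemannian_manifold = riemannian_manifold +
  assumes compact: "compact_space M"

text \<open>The volume measure is the Borel measure given by \<open>sqrt (det g) dy\<close> in every chart. It is uniquely
  determined by this, since countably many charts cover \<open>M\<close>.\<close>

definition is_volume_measure ::
  "'a topology \<Rightarrow> ('a, 'n::finite) chart set \<Rightarrow> (('a, 'n) chart \<Rightarrow> 'a \<Rightarrow> real ^ 'n ^ 'n) \<Rightarrow>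
    'a measure \<Rightarrow> bool" where
  "is_volume_measure M atlas g Leb \<longleftrightarrow>
     space Leb = topspace M \<and> sets Leb = sigma_sets (topspace M) {U. openin M U} \<and>
     (\<forall>c\<in>atlas. \<forall>B\<in>sets Leb. B \<subseteq> fst c \<longrightarrow>
       emeasure Leb B =
         (\<integral>\<^sup>+y\<in>snd c ` B. ennreal (sqrt (det (g c (chart_inv c y)))) \<partial>lborel))"


section \<open>Almost everywhere equality\<close>

definition ae_equal :: "'a measure \<Rightarrow> ('a \<Rightarrow> 'b) set \<Rightarrow> (('a \<Rightarrow> 'b) \<times> ('a \<Rightarrow> 'b)) set" where
  "ae_equal L S = {(f, g). f \<in> S \<and> g \<in> S \<and> (AE x in L. f x = g x)}"

lemma equiv_ae_equal: "equiv S (ae_equal L S)"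
proof (rule equivI)
  show "ae_equal L S \<subseteq> S \<times> S" by (auto simp: ae_equal_def)
  show "refl_on S (ae_equal L S)" by (auto simp: ae_equal_def refl_on_def)
  show "sym (ae_equal L S)" by (auto simp: ae_equal_def sym_def eq_commute)
  show "trans (ae_equal L S)"
  proof (rule transI)
    fix x y z assume "(x, y) \<in> ae_equal L S" "(y, z) \<in> ae_equal L S"
    then have "x \<in> S" "z \<in> S" "AE t in L. x t = y t" "AE t in L. y t = z t"
      by (auto simp: ae_equal_def)
    moreover from this(3,4) have "AE t in L. x t = z t" by eventually_elim simp
    ultimately show "(x, z) \<in> ae_equal L S" by (simp add: ae_equal_def)
  qed
qed


section \<open>The automorphism group with the weak topology\<close>

definition automorphisms :: "'a measure \<Rightarrow> ('a \<Rightarrow> 'a) set" where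
  "automorphisms L = {f. bij_betw f (space L) (space L) \<and> f \<in> measurable L L \<and>
     inv_into (space L) f \<in> measurable L L \<and> distr L L f = L}"

definition Aut :: "'a measure \<Rightarrow> ('a \<Rightarrow> 'a) set set" where
  "Aut L = automorphisms L // ae_equal L (automorphisms L)"

text \<open>The weak topology is generated by the sets of all \<open>f\<close> with \<open>L (f K \<triangle> g K) < e\<close>. By
  \<open>limitin_weak_topology\<close>, \<open>f\<^sub>n\<close> converges to \<open>f\<close> iff \<open>L (f\<^sub>n K \<triangle> f K)\<close> tends to 0 for every
  measurable \<open>K\<close>.\<close>

definition weak_topology :: "'a measure \<Rightarrow> ('a \<Rightarrow> 'a) set topology" where
  "weak_topology L = topology_generated_by
     {{F \<in> Aut L. \<forall>f\<in>F. measure L (sym_diff (f ` K) (g ` K)) < e} |g K e.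
       g \<in> automorphisms L \<and> K \<in> sets L \<and> e > 0}"

lemma automorphism_image_sets:
  assumes "f \<in> automorphisms L" "K \<in> sets L"
  shows "f ` K \<in> sets L" and "emeasure L (f ` K) = emeasure L K"
proof -
  have b: "bij_betw f (space L) (space L)" and m: "f \<in> measurable L L"
    and mi: "inv_into (space L) f \<in> measurable L L" and d: "distr L L f = L"
    using assms(1) by (auto simp: automorphisms_def)
  have K: "K \<subseteq> space L" using assms(2) sets.sets_into_space by auto
  have "f ` K = inv_into (space L) f -` K \<inter> space L"
  proof (intro equalityI subsetI)
    fix y assume "y \<in> f ` K"
    then obtain k where k: "k \<in> K" "y = f k" by blast
    with K have "k \<in> space L" by blast
    then show "y \<in> inv_into (space L) f -` K \<inter> space L"
      using b k by (auto simp: bij_betw_def)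
  next
    fix y assume "y \<in> inv_into (space L) f -` K \<inter> space L"
    then have "inv_into (space L) f y \<in> K" "f (inv_into (space L) f y) = y"
      using b by (auto simp: bij_betw_def f_inv_into_f)
    then show "y \<in> f ` K" by (rule rev_image_eqI[OF _ sym])
  qed
  then show s: "f ` K \<in> sets L" using mi assms(2) by (metis measurable_sets)
  have "f -` (f ` K) \<inter> space L = K"
    using b K by (auto simp: bij_betw_def inj_on_def subset_iff)
  then show "emeasure L (f ` K) = emeasure L K"
    using emeasure_distr[OF m s] d by simp
qed

lemma ae_equal_image:
  assumes "(f, f') \<in> ae_equal L (automorphisms L)" "K \<in> sets L"
  shows "emeasure L (sym_diff (f ` K) (f' ` K)) = 0"
proof -
  have f: "f \<in> automorphisms L" and f': "f' \<in> automorphisms L"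
    and ae: "AE x in L. f x = f' x"
    using assms(1) by (auto simp: ae_equal_def)
  obtain N where N: "{x\<in>space L. f x \<noteq> f' x} \<subseteq> N" "N \<in> sets L" "emeasure L N = 0"
    using ae by (auto elim: AE_E)
  have K: "K \<subseteq> space L" using assms(2) sets.sets_into_space by auto
  have "sym_diff (f ` K) (f' ` K) \<subseteq> f ` N \<union> f' ` N"
    using N(1) K by (force simp: subset_iff)
  moreover have "f ` N \<union> f' ` N \<in> null_sets L"
    using automorphism_image_sets[OF f N(2)] automorphism_image_sets[OF f' N(2)] N(3)
    by (intro null_sets.Un) (auto simp: null_sets_def)
  ultimately show ?thesis
    using automorphism_image_sets[OF f assms(2)] automorphism_image_sets[OF f' assms(2)]
    by (meson null_setsD1 null_sets_subset sets.Diff sets.Un)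
qed

lemma measure_sym_diff_triangle:
  assumes "finite_measure L" "A \<in> sets L" "B \<in> sets L" "C \<in> sets L"
  shows "measure L (sym_diff A C) \<le> measure L (sym_diff A B) + measure L (sym_diff B C)"
proof -
  interpret finite_measure L by fact
  have "measure L (sym_diff A C) \<le> measure L (sym_diff A B \<union> sym_diff B C)"
    by (rule finite_measure_mono) (use assms in auto)
  also have "\<dots> \<le> measure L (sym_diff A B) + measure L (sym_diff B C)"
    by (rule measure_subadditive) (use assms in \<open>auto simp: emeasure_eq_measure\<close>)
  finally show ?thesis .
qed

lemma id_automorphism: "(\<lambda>x. x) \<in> automorphisms L"
proof -
  have "inv_into (space L) (\<lambda>x. x) \<in> measurable L L \<longleftrightarrow> (\<lambda>x. x) \<in> measurable L L"
    by (rule measurable_cong) (auto intro: inv_into_f_eq)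
  moreover have "distr L L (\<lambda>x. x) = L" by (rule distr_id2) auto
  ultimately show ?thesis by (auto simp: automorphisms_def bij_betw_def)
qed

lemma topspace_weak_topology: "topspace (weak_topology L) = Aut L"
proof -
  have "Aut L \<in> {{F \<in> Aut L. \<forall>f\<in>F. measure L (sym_diff (f ` K) (g ` K)) < e} |g K e.
       g \<in> automorphisms L \<and> K \<in> sets L \<and> e > 0}"
    by (rule CollectI, rule exI[of _ "\<lambda>x. x"], rule exI[of _ "{}"], rule exI[of _ 1])
      (use id_automorphism in auto)
  then show ?thesis unfolding weak_topology_def topology_generated_by_topspace by blast
qed

lemma limitin_weak_topology:
  assumes L: "finite_measure L" and f: "f \<in> automorphisms L"
    and fn: "\<And>n. fn n \<in> automorphisms L"
  defines "cls \<equiv> \<lambda>f. ae_equal L (automorphisms L) `` {f}"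
  shows "limitin (weak_topology L) (\<lambda>n. cls (fn n)) (cls f) sequentially \<longleftrightarrow>
    (\<forall>K\<in>sets L. (\<lambda>n. measure L (sym_diff (fn n ` K) (f ` K))) \<longlonglongrightarrow> 0)"
proof -
  interpret finite_measure L by fact
  note im = automorphism_image_sets(1)
  have cls: "cls h \<in> Aut L" "h \<in> cls h" if "h \<in> automorphisms L" for h
    unfolding cls_def Aut_def using that equiv_class_self[OF equiv_ae_equal] by (blast intro: quotientI)+
  have mem: "h' \<in> automorphisms L" "measure L (sym_diff (h' ` K) (h ` K)) = 0"
    if "h' \<in> cls h" "K \<in> sets L" for h h' K
  proof -
    show "h' \<in> automorphisms L" using that by (auto simp: cls_def ae_equal_def)
    show "measure L (sym_diff (h' ` K) (h ` K)) = 0"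
      using ae_equal_image[of h h' L K] that by (simp add: cls_def measure_def Un_commute)
  qed
  show ?thesis
  proof
    assume lim: "limitin (weak_topology L) (\<lambda>n. cls (fn n)) (cls f) sequentially"
    show "\<forall>K\<in>sets L. (\<lambda>n. measure L (sym_diff (fn n ` K) (f ` K))) \<longlonglongrightarrow> 0"
    proof (intro ballI LIMSEQ_I)
      fix K and e :: real assume K: "K \<in> sets L" and e: "0 < e"
      let ?U = "{F \<in> Aut L. \<forall>h\<in>F. measure L (sym_diff (h ` K) (f ` K)) < e}"
      have "openin (weak_topology L) ?U"
        unfolding weak_topology_def by (rule topology_generated_by_Basis) (use f K e in blast)
      moreover have "cls f \<in> ?U" using cls(1)[OF f] mem(2)[OF _ K] e by auto
      ultimately have "eventually (\<lambda>n. cls (fn n) \<in> ?U) sequentially"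
        using lim unfolding limitin_def by blast
      then have "eventually (\<lambda>n. measure L (sym_diff (fn n ` K) (f ` K)) < e) sequentially"
        by eventually_elim (use cls(2)[OF fn] in blast)
      then show "\<exists>no. \<forall>n\<ge>no. norm (measure L (sym_diff (fn n ` K) (f ` K)) - 0) < e"
        by (simp add: eventually_sequentially)
    qed
  next
    assume conv: "\<forall>K\<in>sets L. (\<lambda>n. measure L (sym_diff (fn n ` K) (f ` K))) \<longlonglongrightarrow> 0"
    have "eventually (\<lambda>n. cls (fn n) \<in> U) sequentially"
      if "generate_topology_on {{F \<in> Aut L. \<forall>f\<in>F. measure L (sym_diff (f ` K) (g ` K)) < e} |g K e.
       g \<in> automorphisms L \<and> K \<in> sets L \<and> e > 0} U" "cls f \<in> U" for U
      using that
    proof (induction rule: generate_topology_on.induct)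
      case Empty then show ?case by simp
    next
      case (Int a b) then show ?case by (auto intro: eventually_conj)
    next
      case (UN \<K>)
      then obtain k where "k \<in> \<K>" "cls f \<in> k" by blast
      with UN.IH have "eventually (\<lambda>n. cls (fn n) \<in> k) sequentially" by blast
      then show ?case by eventually_elim (use \<open>k \<in> \<K>\<close> in blast)
    next
      case (Basis s)
      then obtain g K e where g: "g \<in> automorphisms L" and K: "K \<in> sets L" and e: "e > 0"
        and s: "s = {F \<in> Aut L. \<forall>f\<in>F. measure L (sym_diff (f ` K) (g ` K)) < e}" by blast
      let ?m = "measure L (sym_diff (f ` K) (g ` K))"
      have "?m < e" using Basis.prems cls(2)[OF f] unfolding s by blast
      then have "eventually (\<lambda>n. measure L (sym_diff (fn n ` K) (f ` K)) < e - ?m) sequentially"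
        using conv K by (intro order_tendstoD(2)[where y=0]) auto
      then show ?case
      proof eventually_elim
        case (elim n)
        have "measure L (sym_diff (h ` K) (g ` K)) < e" if h: "h \<in> cls (fn n)" for h
          using measure_sym_diff_triangle[OF L im[OF mem(1)[OF h K] K] im[OF fn K] im[OF g K], of n]
            measure_sym_diff_triangle[OF L im[OF fn K] im[OF f K] im[OF g K], of n]
            mem(2)[OF h K] elim by linarith
        then show ?case unfolding s using cls(1)[OF fn] by blast
      qed
    qed
    then show "limitin (weak_topology L) (\<lambda>n. cls (fn n)) (cls f) sequentially"
      unfolding limitin_def topspace_weak_topology
      using cls(1)[OF f] by (auto simp: weak_topology_def openin_topology_generated_by_iff)
  qed
qed


section \<open>Bounded cocycles in SL(2,R)\<close>

text \<open>The operator norm for the Euclidean norm; the norm of the type \<open>real ^ 2 ^ 2\<close> is the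
  Frobenius norm.\<close>

definition opnorm :: "real ^ 'n ^ 'm \<Rightarrow> real" where
  "opnorm A = onorm ((*v) A)"

definition bounded_SL2 :: "'a measure \<Rightarrow> ('a \<Rightarrow> real ^ 2 ^ 2) set" where
  "bounded_SL2 L = {A. A \<in> borel_measurable L \<and> (\<forall>x\<in>space L. det (A x) = 1) \<and>
     (\<exists>C. AE x in L. opnorm (A x) \<le> C)}"

definition Linf_SL2 :: "'a measure \<Rightarrow> ('a \<Rightarrow> real ^ 2 ^ 2) set set" where
  "Linf_SL2 L = bounded_SL2 L // ae_equal L (bounded_SL2 L)"

definition ess_sup :: "'a measure \<Rightarrow> ('a \<Rightarrow> real) \<Rightarrow> real" where
  "ess_sup L h = real_of_ereal (esssup L (\<lambda>x. ereal (h x)))"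

definition cocycle_dist :: "'a measure \<Rightarrow> ('a \<Rightarrow> real ^ 2 ^ 2) \<Rightarrow> ('a \<Rightarrow> real ^ 2 ^ 2) \<Rightarrow> real" where
  "cocycle_dist L A B = ess_sup L (\<lambda>x. opnorm (A x - B x)) +
     ess_sup L (\<lambda>x. opnorm (matrix_inv (A x) - matrix_inv (B x)))"

text \<open>The distance of two classes is that of any representatives; see \<open>Linf_dist_class\<close>.\<close>

definition Linf_dist ::
  "'a measure \<Rightarrow> ('a \<Rightarrow> real ^ 2 ^ 2) set \<Rightarrow> ('a \<Rightarrow> real ^ 2 ^ 2) set \<Rightarrow> real" where
  "Linf_dist L \<A> \<B> = (if \<A> \<in> Linf_SL2 L \<and> \<B> \<in> Linf_SL2 L
     then the_elem (\<Union>A\<in>\<A>. \<Union>B\<in>\<B>. {cocycle_dist L A B}) else 0)"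

definition Linf_topology :: "'a measure \<Rightarrow> ('a \<Rightarrow> real ^ 2 ^ 2) set topology" where
  "Linf_topology L = Metric_space.mtopology (Linf_SL2 L) (Linf_dist L)"

lemma bounded_linear_matrix: "bounded_linear ((*v) (A :: real ^ 'n ^ 'm))"
  by (rule matrix_vector_mul_bounded_linear)

lemma opnorm_nonneg: "0 \<le> opnorm A"
  unfolding opnorm_def by (rule onorm_pos_le[OF bounded_linear_matrix])

lemma opnorm_triangle: "opnorm (A + B) \<le> opnorm A + opnorm B"
proof -
  have "(*v) (A + B) = (\<lambda>x. A *v x + B *v x)"
    by (simp add: fun_eq_iff matrix_vector_mult_add_rdistrib)
  then show ?thesis unfolding opnorm_def
    using onorm_triangle[OF bounded_linear_matrix[of A] bounded_linear_matrix[of B]] by simp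
qed

lemma opnorm_minus: "opnorm (- A) = opnorm A"
proof -
  have "(*v) (- A) = (\<lambda>x. - (A *v x))"
    by (auto simp: matrix_vector_mult_def vec_eq_iff sum_negf)
  then show ?thesis unfolding opnorm_def by (simp add: onorm_neg)
qed

lemma entry_le_opnorm: "\<bar>A $ i $ j\<bar> \<le> opnorm A"
  unfolding opnorm_def by (rule matrix_component_le_onorm)

lemma opnorm_le_sum: "opnorm A \<le> (\<Sum>i\<in>UNIV. \<Sum>j\<in>UNIV. \<bar>A $ i $ j\<bar>)"
  unfolding opnorm_def by (rule onorm_le_matrix_component_sum)

lemma opnorm_eq_0: "opnorm A = 0 \<longleftrightarrow> A = 0"
proof
  assume "opnorm A = 0"
  then show "A = 0" using entry_le_opnorm[of A] by (auto simp: vec_eq_iff)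
qed (use opnorm_le_sum[of A] opnorm_nonneg[of A] in auto)

lemma continuous_opnorm: "continuous_on UNIV (opnorm :: real ^ 'n ^ 'm \<Rightarrow> real)"
proof -
  have lip: "\<bar>opnorm A - opnorm B\<bar> \<le> opnorm (A - B)" for A B :: "real ^ 'n ^ 'm"
    using opnorm_triangle[of "A - B" B] opnorm_triangle[of "B - A" A] opnorm_minus[of "A - B"]
    by simp
  have "((\<lambda>A. opnorm A) \<longlongrightarrow> opnorm B) (at B)" for B :: "real ^ 'n ^ 'm"
  proof (rule Lim_null_comparison[where g = "\<lambda>A. \<Sum>i\<in>UNIV. \<Sum>j\<in>UNIV. \<bar>(A - B) $ i $ j\<bar>",
        THEN LIM_zero_cancel])
    show "\<forall>\<^sub>F A in at B. norm (opnorm A - opnorm B) \<le> (\<Sum>i\<in>UNIV. \<Sum>j\<in>UNIV. \<bar>(A - B) $ i $ j\<bar>)"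
      using order_trans[OF lip opnorm_le_sum] by (simp add: eventually_at_topological)
    have "((\<lambda>A. \<Sum>i\<in>UNIV. \<Sum>j\<in>UNIV. \<bar>(A - B) $ i $ j\<bar>) \<longlongrightarrow>
        (\<Sum>i\<in>UNIV. \<Sum>j\<in>UNIV. \<bar>(B - B) $ i $ j\<bar>)) (at B)"
      by (intro tendsto_intros)
    then show "((\<lambda>A. \<Sum>i\<in>UNIV. \<Sum>j\<in>UNIV. \<bar>(A - B) $ i $ j\<bar>) \<longlongrightarrow> 0) (at B)" by simp
  qed
  then show ?thesis by (simp add: continuous_on_def)
qed

definition adj2 :: "real ^ 2 ^ 2 \<Rightarrow> real ^ 2 ^ 2" where
  "adj2 A = (\<chi> i j. if i = j then A $ (if i = 1 then 2 else 1) $ (if i = 1 then 2 else 1) else - A $ i $ j)"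

lemma matrix_inv_SL2: "det A = 1 \<Longrightarrow> matrix_inv A = adj2 A" for A :: "real ^ 2 ^ 2"
proof -
  assume d: "det A = 1"
  have *: "A ** adj2 A = mat 1" "adj2 A ** A = mat 1"
    using d by (auto simp: adj2_def matrix_matrix_mult_def mat_def vec_eq_iff sum_2 det_2 forall_2
        algebra_simps)
  then have "invertible A" unfolding invertible_def by blast
  then have "matrix_inv A ** A = mat 1" unfolding invertible_def matrix_inv_def by (rule someI2_ex) auto
  then have "matrix_inv A ** (A ** adj2 A) = adj2 A" by (simp add: matrix_mul_assoc)
  then show ?thesis using *(1) by simp
qed

lemma adj2_diff: "adj2 A - adj2 B = adj2 (A - B)"
  by (auto simp: adj2_def vec_eq_iff)

lemma continuous_adj2: "continuous_on UNIV adj2"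
proof -
  have "continuous_on UNIV (\<lambda>A :: real ^ 2 ^ 2. if i = j
      then A $ (if i = 1 then 2 else 1) $ (if i = 1 then 2 else 1) else - A $ i $ j)" for i j
    by (cases "i = j") (simp_all add: continuous_on_minus continuous_on_component)
  then show ?thesis unfolding adj2_def by (intro continuous_on_vec_lambda)
qed

lemma ess_sup_bounds:
  assumes h: "h \<in> borel_measurable L" and nn: "\<And>x. 0 \<le> h x" and bd: "AE x in L. h x \<le> C"
  shows "0 \<le> ess_sup L h" and "AE x in L. h x \<le> ess_sup L h"
    and "\<And>c. 0 \<le> c \<Longrightarrow> AE x in L. h x \<le> c \<Longrightarrow> ess_sup L h \<le> c"
proof -
  let ?e = "esssup L (\<lambda>x. ereal (h x))"
  have m: "(\<lambda>x. ereal (h x)) \<in> borel_measurable L" using h by simp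
  have up: "?e \<le> ereal c" if "AE x in L. h x \<le> c" for c
    using esssup_I[OF m, of "ereal c"] that by simp
  have ae: "AE x in L. ereal (h x) \<le> ?e" by (rule esssup_AE)
  show 0: "0 \<le> ess_sup L h"
  proof (cases "emeasure L (space L) = 0")
    case True
    then have "?e = - \<infinity>" using esssup_zero_space[OF True m] by simp
    then show ?thesis by (simp add: ess_sup_def)
  next
    case False
    have "esssup L (\<lambda>x. 0 :: ereal) \<le> ?e" by (rule esssup_mono) (use nn in auto)
    then show ?thesis using esssup_const[OF False, of "0 :: ereal"]
      by (simp add: ess_sup_def real_of_ereal_pos)
  qed
  show "ess_sup L h \<le> c" if "0 \<le> c" "AE x in L. h x \<le> c" for c
    using up[OF that(2)] that(1) unfolding ess_sup_def by (cases ?e) auto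
  show "AE x in L. h x \<le> ess_sup L h"
  proof (rule AE_mp[OF ae AE_I2], rule impI)
    fix x assume "ereal (h x) \<le> ?e"
    then show "h x \<le> ess_sup L h" using up[OF bd] unfolding ess_sup_def by (cases ?e) auto
  qed
qed

lemma bounded_SL2_diff:
  assumes A: "A \<in> bounded_SL2 L" and B: "B \<in> bounded_SL2 L"
  shows "(\<lambda>x. opnorm (A x - B x)) \<in> borel_measurable L" (is ?m1)
    and "(\<lambda>x. opnorm (matrix_inv (A x) - matrix_inv (B x))) \<in> borel_measurable L" (is ?m2)
    and "\<exists>C. AE x in L. opnorm (A x - B x) \<le> C" (is ?b1)
    and "\<exists>C. AE x in L. opnorm (matrix_inv (A x) - matrix_inv (B x)) \<le> C" (is ?b2)
proof -
  have AB [measurable]: "A \<in> borel_measurable L" "B \<in> borel_measurable L"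
    using A B by (auto simp: bounded_SL2_def)
  have D [measurable]: "(\<lambda>x. A x - B x) \<in> borel_measurable L" by measurable
  have inv: "matrix_inv (A x) - matrix_inv (B x) = adj2 (A x - B x)" if "x \<in> space L" for x
    using that A B by (simp add: bounded_SL2_def matrix_inv_SL2 adj2_diff)
  have c [measurable]: "opnorm \<in> borel_measurable borel" "adj2 \<in> borel_measurable borel"
    using continuous_opnorm continuous_adj2 by (auto intro: borel_measurable_continuous_onI)
  show ?m1 by measurable
  have m: "(\<lambda>x. opnorm (adj2 (A x - B x))) \<in> borel_measurable L" by measurable
  show ?m2 by (rule measurable_cong[THEN iffD2, OF _ m]) (simp add: inv)
  obtain C C' where AE: "AE x in L. opnorm (A x) \<le> C" "AE x in L. opnorm (B x) \<le> C'"
    using A B by (auto simp: bounded_SL2_def)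
  have bd: "AE x in L. opnorm (A x - B x) \<le> C + C'"
    using AE
  proof eventually_elim
    case (elim x)
    then show ?case using opnorm_triangle[of "A x" "- B x"] opnorm_minus[of "B x"] by simp
  qed
  then show ?b1 by blast
  have "AE x in L. opnorm (matrix_inv (A x) - matrix_inv (B x)) \<le> 4 * (C + C')"
    using bd AE_space
  proof eventually_elim
    case (elim x)
    have "opnorm (adj2 (A x - B x)) \<le> (\<Sum>i\<in>UNIV. \<Sum>j\<in>UNIV. \<bar>adj2 (A x - B x) $ i $ j\<bar>)"
      by (rule opnorm_le_sum)
    also have "\<dots> = (\<Sum>i\<in>UNIV. \<Sum>j\<in>UNIV. \<bar>(A x - B x) $ i $ j\<bar>)"
      by (simp add: sum_2 adj2_def)
    also have "\<dots> \<le> 4 * opnorm (A x - B x)"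
      using entry_le_opnorm[of "A x - B x" 1 1] entry_le_opnorm[of "A x - B x" 1 2]
        entry_le_opnorm[of "A x - B x" 2 1] entry_le_opnorm[of "A x - B x" 2 2]
      by (simp add: sum_2)
    finally show ?case using elim inv by simp
  qed
  then show ?b2 by blast
qed

lemma cocycle_dist_props:
  assumes A: "A \<in> bounded_SL2 L" and B: "B \<in> bounded_SL2 L"
  shows "0 \<le> cocycle_dist L A B"
    and "cocycle_dist L A B = cocycle_dist L B A"
    and "cocycle_dist L A B = 0 \<longleftrightarrow> (AE x in L. A x = B x)"
    and "C \<in> bounded_SL2 L \<Longrightarrow> cocycle_dist L A C \<le> cocycle_dist L A B + cocycle_dist L B C"
proof -
  let ?d = "\<lambda>A B x. opnorm (A x - B x)"
  let ?i = "\<lambda>A B x. opnorm (matrix_inv (A x) - matrix_inv (B x))"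
  have d: "0 \<le> ess_sup L (?d A B)" "AE x in L. ?d A B x \<le> ess_sup L (?d A B)"
    "\<And>c. 0 \<le> c \<Longrightarrow> AE x in L. ?d A B x \<le> c \<Longrightarrow> ess_sup L (?d A B) \<le> c"
    if "A \<in> bounded_SL2 L" "B \<in> bounded_SL2 L" for A B
    using bounded_SL2_diff(1,3)[OF that] ess_sup_bounds[of "?d A B" L] opnorm_nonneg by blast+
  have i: "0 \<le> ess_sup L (?i A B)" "AE x in L. ?i A B x \<le> ess_sup L (?i A B)"
    "\<And>c. 0 \<le> c \<Longrightarrow> AE x in L. ?i A B x \<le> c \<Longrightarrow> ess_sup L (?i A B) \<le> c"
    if "A \<in> bounded_SL2 L" "B \<in> bounded_SL2 L" for A B
    using bounded_SL2_diff(2,4)[OF that] ess_sup_bounds[of "?i A B" L] opnorm_nonneg by blast+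
  show "0 \<le> cocycle_dist L A B"
    using d(1)[OF A B] i(1)[OF A B] by (simp add: cocycle_dist_def)
  have "?d A B = ?d B A" "?i A B = ?i B A"
    using opnorm_minus[of "A x - B x" for x] opnorm_minus[of "matrix_inv (A x) - matrix_inv (B x)" for x]
    by (simp_all add: fun_eq_iff)
  then show "cocycle_dist L A B = cocycle_dist L B A" by (simp add: cocycle_dist_def)
  show "cocycle_dist L A B = 0 \<longleftrightarrow> (AE x in L. A x = B x)"
  proof
    assume "cocycle_dist L A B = 0"
    then have "ess_sup L (?d A B) = 0"
      using d(1)[OF A B] i(1)[OF A B] by (simp add: cocycle_dist_def)
    with d(2)[OF A B] have "AE x in L. ?d A B x \<le> 0" by simp
    then show "AE x in L. A x = B x"
    proof eventually_elim
      case (elim x)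
      then have "opnorm (A x - B x) = 0" using opnorm_nonneg[of "A x - B x"] by simp
      then show ?case by (simp add: opnorm_eq_0)
    qed
  next
    assume ae: "AE x in L. A x = B x"
    have z: "opnorm (0 :: real ^ 2 ^ 2) = 0" by (simp add: opnorm_eq_0)
    have "AE x in L. ?d A B x \<le> 0" "AE x in L. ?i A B x \<le> 0"
      using ae by (eventually_elim, simp add: z)+
    then show "cocycle_dist L A B = 0"
      using d(1)[OF A B] d(3)[OF A B, of 0] i(1)[OF A B] i(3)[OF A B, of 0]
      unfolding cocycle_dist_def by force
  qed
  show "cocycle_dist L A C \<le> cocycle_dist L A B + cocycle_dist L B C" if C: "C \<in> bounded_SL2 L"
  proof -
    have tri: "opnorm (X - Z) \<le> opnorm (X - Y) + opnorm (Y - Z)" for X Y Z :: "real ^ 2 ^ 2"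
      using opnorm_triangle[of "X - Y" "Y - Z"] by simp
    have "AE x in L. ?d A C x \<le> ess_sup L (?d A B) + ess_sup L (?d B C)"
      using d(2)[OF A B] d(2)[OF B C]
    proof eventually_elim
      case (elim x) then show ?case using tri[of "A x" "C x" "B x"] by linarith
    qed
    then have 1: "ess_sup L (?d A C) \<le> ess_sup L (?d A B) + ess_sup L (?d B C)"
      using d(1)[OF A B] d(1)[OF B C] by (intro d(3)[OF A C]) auto
    have "AE x in L. ?i A C x \<le> ess_sup L (?i A B) + ess_sup L (?i B C)"
      using i(2)[OF A B] i(2)[OF B C]
    proof eventually_elim
      case (elim x)
      then show ?case using tri[of "matrix_inv (A x)" "matrix_inv (C x)" "matrix_inv (B x)"] by linarith
    qed
    then have 2: "ess_sup L (?i A C) \<le> ess_sup L (?i A B) + ess_sup L (?i B C)"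
      using i(1)[OF A B] i(1)[OF B C] by (intro i(3)[OF A C]) auto
    show ?thesis using 1 2 by (simp add: cocycle_dist_def)
  qed
qed

lemma Linf_dist_class:
  assumes \<A>: "\<A> \<in> Linf_SL2 L" and \<B>: "\<B> \<in> Linf_SL2 L" and A: "A \<in> \<A>" and B: "B \<in> \<B>"
  shows "Linf_dist L \<A> \<B> = cocycle_dist L A B"
proof -
  have sub: "A \<in> bounded_SL2 L" if "A \<in> \<A>" "\<A> \<in> Linf_SL2 L" for A \<A>
    using that by (auto simp: Linf_SL2_def quotient_def ae_equal_def)
  have zero: "cocycle_dist L A A' = 0" if "A \<in> \<A>" "A' \<in> \<A>" "\<A> \<in> Linf_SL2 L" for A A' \<A>
  proof -
    have "(A, A') \<in> ae_equal L (bounded_SL2 L)"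
      using that quotient_eq_iff[OF equiv_ae_equal] unfolding Linf_SL2_def by blast
    then show ?thesis
      using cocycle_dist_props(3)[OF sub[OF that(1,3)] sub[OF that(2,3)]] by (simp add: ae_equal_def)
  qed
  have "cocycle_dist L A' B' = cocycle_dist L A B" if A': "A' \<in> \<A>" and B': "B' \<in> \<B>" for A' B'
  proof -
    note s = sub[OF A \<A>] sub[OF A' \<A>] sub[OF B \<B>] sub[OF B' \<B>]
    note t = cocycle_dist_props(4)
    have "cocycle_dist L A' B' \<le> cocycle_dist L A B"
      using t[OF s(2,1,4)] t[OF s(1,3,4)] zero[OF A' A \<A>] zero[OF B B' \<B>] by linarith
    moreover have "cocycle_dist L A B \<le> cocycle_dist L A' B'"
      using t[OF s(1,2,3)] t[OF s(2,4,3)] zero[OF A A' \<A>] zero[OF B' B \<B>] by linarith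
    ultimately show ?thesis by simp
  qed
  then have "(\<Union>A\<in>\<A>. \<Union>B\<in>\<B>. {cocycle_dist L A B}) = {cocycle_dist L A B}"
    using A B by blast
  then show ?thesis using \<A> \<B> by (simp add: Linf_dist_def)
qed

lemma Metric_space_Linf: "Metric_space (Linf_SL2 L) (Linf_dist L)"
proof -
  note eq = equiv_ae_equal[of "bounded_SL2 L" L]
  have rep: "\<exists>A. A \<in> \<A> \<and> A \<in> bounded_SL2 L" if "\<A> \<in> Linf_SL2 L" for \<A>
    using that equiv_class_self[OF eq] by (auto simp: Linf_SL2_def elim!: quotientE)
  have r: "Linf_dist L \<A> \<B> = Linf_dist L \<B> \<A>" "0 \<le> Linf_dist L \<A> \<B>"
    "Linf_dist L \<A> \<B> = 0 \<longleftrightarrow> \<A> = \<B>"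
    if ab: "\<A> \<in> Linf_SL2 L" "\<B> \<in> Linf_SL2 L" for \<A> \<B>
  proof -
    obtain A B where A: "A \<in> \<A>" "A \<in> bounded_SL2 L" and B: "B \<in> \<B>" "B \<in> bounded_SL2 L"
      using rep ab by meson
    note p = cocycle_dist_props[OF A(2) B(2)] Linf_dist_class[OF ab A(1) B(1)]
      Linf_dist_class[OF ab(2,1) B(1) A(1)]
    show "Linf_dist L \<A> \<B> = Linf_dist L \<B> \<A>" "0 \<le> Linf_dist L \<A> \<B>" using p by auto
    have "(AE x in L. A x = B x) \<longleftrightarrow> (A, B) \<in> ae_equal L (bounded_SL2 L)"
      using A B by (simp add: ae_equal_def)
    also have "\<dots> \<longleftrightarrow> \<A> = \<B>"
      using quotient_eq_iff[OF eq _ _ A(1) B(1)] ab by (auto simp: Linf_SL2_def)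
    finally show "Linf_dist L \<A> \<B> = 0 \<longleftrightarrow> \<A> = \<B>" using p by simp
  qed
  show ?thesis
  proof
    fix \<A> \<B> \<C>
    show "0 \<le> Linf_dist L \<A> \<B>" "Linf_dist L \<A> \<B> = Linf_dist L \<B> \<A>"
      using r[of \<A> \<B>] by (auto simp: Linf_dist_def)
    assume abc: "\<A> \<in> Linf_SL2 L" "\<B> \<in> Linf_SL2 L"
    show "Linf_dist L \<A> \<B> = 0 \<longleftrightarrow> \<A> = \<B>" by (rule r(3)[OF abc])
    assume c: "\<C> \<in> Linf_SL2 L"
    obtain A B C where A: "A \<in> \<A>" "A \<in> bounded_SL2 L" and B: "B \<in> \<B>" "B \<in> bounded_SL2 L"
      and C: "C \<in> \<C>" "C \<in> bounded_SL2 L"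
      using rep abc c by meson
    show "Linf_dist L \<A> \<C> \<le> Linf_dist L \<A> \<B> + Linf_dist L \<B> \<C>"
      using cocycle_dist_props(4)[OF A(2) B(2) C(2)] Linf_dist_class[OF abc A(1) B(1)]
        Linf_dist_class[OF abc(2) c B(1) C(1)] Linf_dist_class[OF abc(1) c A(1) C(1)] by simp
  qed
qed

section \<open>The separate topology and residual sets\<close>

definition separate_topology :: "'a topology \<Rightarrow> 'b topology \<Rightarrow> ('a \<times> 'b) topology" where
  "separate_topology X Y = topology (\<lambda>U. U \<subseteq> topspace X \<times> topspace Y \<and>
     (\<forall>(x, y)\<in>U. openin X {x'. (x', y) \<in> U} \<and> openin Y {y'. (x, y') \<in> U}))"

lemma openin_separate_topology:
  "openin (separate_topology X Y) U \<longleftrightarrow> U \<subseteq> topspace X \<times> topspace Y \<and>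
     (\<forall>(x, y)\<in>U. openin X {x'. (x', y) \<in> U} \<and> openin Y {y'. (x, y') \<in> U})"
proof -
  let ?P = "\<lambda>U. U \<subseteq> topspace X \<times> topspace Y \<and>
     (\<forall>(x, y)\<in>U. openin X {x'. (x', y) \<in> U} \<and> openin Y {y'. (x, y') \<in> U})"
  have eq: "?P U \<longleftrightarrow> U \<subseteq> topspace X \<times> topspace Y \<and>
     (\<forall>y. openin X {x'. (x', y) \<in> U}) \<and> (\<forall>x. openin Y {y'. (x, y') \<in> U})" for U
  proof -
    have "openin X {x'. (x', y) \<in> U}" if "?P U" for y
      using that by (cases "\<exists>x. (x, y) \<in> U") auto
    moreover have "openin Y {y'. (x, y') \<in> U}" if "?P U" for x
      using that by (cases "\<exists>y. (x, y) \<in> U") auto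
    ultimately show ?thesis by (intro iffI) auto
  qed
  have "istopology ?P"
    unfolding istopology_def
  proof (rule conjI; intro allI impI)
    fix S T assume S: "?P S" and T: "?P T"
    have 1: "{x'. (x', y) \<in> S \<inter> T} = {x'. (x', y) \<in> S} \<inter> {x'. (x', y) \<in> T}" for y by auto
    have 2: "{y'. (x, y') \<in> S \<inter> T} = {y'. (x, y') \<in> S} \<inter> {y'. (x, y') \<in> T}" for x by auto
    show "?P (S \<inter> T)" using S T unfolding eq 1 2 by blast
  next
    fix \<K> assume K: "\<forall>S\<in>\<K>. ?P S"
    have 1: "{x'. (x', y) \<in> \<Union>\<K>} = (\<Union>S\<in>\<K>. {x'. (x', y) \<in> S})" for y by auto
    have 2: "{y'. (x, y') \<in> \<Union>\<K>} = (\<Union>S\<in>\<K>. {y'. (x, y') \<in> S})" for x by auto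
    show "?P (\<Union>\<K>)" using K unfolding eq 1 2 by blast
  qed
  then show ?thesis unfolding separate_topology_def by (simp add: topology_inverse')
qed

lemma topspace_separate_topology:
  "topspace (separate_topology X Y) = topspace X \<times> topspace Y"
proof -
  have "openin (separate_topology X Y) (topspace X \<times> topspace Y)"
    unfolding openin_separate_topology by auto
  then show ?thesis
    by (metis openin_separate_topology openin_subset openin_topspace subset_antisym)
qed

definition residual_in :: "'a topology \<Rightarrow> 'a set \<Rightarrow> bool" where
  "residual_in X R \<longleftrightarrow> R \<subseteq> topspace X \<and>
     (\<exists>\<G>. countable \<G> \<and> (\<forall>G\<in>\<G>. openin X G \<and> X closure_of G = topspace X) \<and>
        topspace X \<inter> \<Inter>\<G> \<subseteq> R)"


section \<open>Lyapunov exponents and uniform hyperbolicity\<close>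

primrec cocycle :: "('a \<Rightarrow> 'a) \<Rightarrow> ('a \<Rightarrow> real ^ 2 ^ 2) \<Rightarrow> nat \<Rightarrow> 'a \<Rightarrow> real ^ 2 ^ 2" where
  "cocycle f A 0 x = mat 1"
| "cocycle f A (Suc n) x = A ((f ^^ n) x) ** cocycle f A n x"

definition lyapunov_exponent :: "('a \<Rightarrow> 'a) \<Rightarrow> ('a \<Rightarrow> real ^ 2 ^ 2) \<Rightarrow> 'a \<Rightarrow> real" where
  "lyapunov_exponent f A x = lim (\<lambda>n. ln (opnorm (cocycle f A n x)) / real n)"

definition trivial_spectrum :: "'a measure \<Rightarrow> ('a \<Rightarrow> 'a) \<Rightarrow> ('a \<Rightarrow> real ^ 2 ^ 2) \<Rightarrow> bool" where
  "trivial_spectrum L f A \<longleftrightarrow> (AE x in L. lyapunov_exponent f A x = 0)"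

text \<open>\<open>onorm_on E T\<close> is the operator norm of the restriction of \<open>T\<close> to the subspace \<open>E\<close>; as for
  \<open>onorm\<close>, the vector 0 only contributes \<open>0 / 0 = 0\<close> to the supremum.\<close>

definition onorm_on :: "'a::real_normed_vector set \<Rightarrow> ('a \<Rightarrow> 'b::real_normed_vector) \<Rightarrow> real" where
  "onorm_on E T = (SUP v\<in>E. norm (T v) / norm v)"

text \<open>Measurability of \<open>x \<mapsto> E x\<close> as a map into the projective line with its Borel sets: the open
  sets of the projective line are exactly the sets of the lines meeting an open \<open>U \<subseteq> \<real>\<^sup>2 - {0}\<close>. (An
  open \<open>U\<close> containing 0 is met by all lines.)\<close>

definition measurable_line_field :: "'a measure \<Rightarrow> ('a \<Rightarrow> (real ^ 2) set) \<Rightarrow> bool" where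
  "measurable_line_field L E \<longleftrightarrow>
     (\<forall>x\<in>space L. subspace (E x) \<and> dim (E x) = 1) \<and>
     (\<forall>U. open U \<longrightarrow> {x \<in> space L. E x \<inter> U \<noteq> {}} \<in> sets L)"

text \<open>The line fields \<open>Es\<close>, \<open>Eu\<close> are total functions here, but transversality, invariance and the
  estimates are only required almost everywhere: a measurable line field defined almost everywhere
  extends measurably by a constant line.\<close>

definition uniformly_hyperbolic :: "'a measure \<Rightarrow> ('a \<Rightarrow> 'a) \<Rightarrow> ('a \<Rightarrow> real ^ 2 ^ 2) \<Rightarrow> bool" where
  "uniformly_hyperbolic L f A \<longleftrightarrow>
     (\<exists>C>0. \<exists>\<theta>. 0 < \<theta> \<and> \<theta> < 1 \<and> (\<exists>Es Eu.
       measurable_line_field L Es \<and> measurable_line_field L Eu \<and>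
       (AE x in L.
          Es x \<inter> Eu x = {0} \<and> {v + w |v w. v \<in> Es x \<and> w \<in> Eu x} = UNIV \<and>
          (*v) (A x) ` Es x = Es (f x) \<and> (*v) (A x) ` Eu x = Eu (f x) \<and>
          (\<forall>n\<ge>1. let T = (*v) (cocycle f A n x) in
             onorm_on (Es x) T \<le> C * \<theta> ^ n \<and>
             onorm_on (T ` Eu x) (inv_into (Eu x) T) \<le> C * \<theta> ^ n))))"

end

theory Submission
  imports Defs "HOL-Complex_Analysis.Conformal_Mappings" "HOL-Probability.Distribution_Functions"
begin

text \<open>Call \<open>A\<close> robustly hyperbolic if, for some \<open>\<delta> > 0\<close>, every finite product of matrices \<open>\<delta>\<close>-close to
  essential values of \<open>A\<close> has \<open>\<bar>trace\<bar> > 2\<close>. This does not involve \<open>f\<close> and is an open condition on \<open>A\<close>.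
  Applied to the words rotated by small angles, Schwarz's lemma shows that all these products grow
  exponentially in the length of the word, so \<open>(f, A)\<close> is uniformly hyperbolic for every
  automorphism \<open>f\<close>.

  If \<open>A\<close> is not robustly hyperbolic, there is an elliptic word of matrices arbitrarily close to essential
  values of \<open>A\<close>. Approximate \<open>f\<close> weakly by a periodic \<open>h\<close> whose orbits follow itineraries of \<open>f\<close> for a
  long time and then spell many copies of that word. Small rotations of the letters of the
  word turn the product over one period into a matrix of trace 0, whose square is \<open>- mat 1\<close>: the
  perturbed cocycle is bounded on these orbits. For given \<open>\<epsilon>\<close>, smallness of the growth rate outside a set of measure
  \<open>\<epsilon>\<close> is witnessed in finite time, hence it is open in each variable. So the pairs that are
  robustly hyperbolic or have \<open>\<epsilon>\<close>-small growth form a dense open set, and \<open>\<R>\<close> is the intersection of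
  these sets over \<open>\<epsilon> = 1, 1/2, 1/3, \<dots>\<close>.\<close>

section \<open>Products of matrices in \<open>SL(2, \<real>)\<close>\<close>

text \<open>Weak approximations of \<open>f\<close> may visit any sets of positive measure in any
  order on short stretches of their orbits; so only the set of essential values of \<open>A\<close>
  can obstruct the destruction of exponents, and this dictates a hyperbolicity condition on words
  instead of orbits. The difficulty is then the block that follows \<open>f\<close>: its length is
  chosen after the closing word, and its product is uncontrolled and possibly huge. Repeating an
  elliptic word \<open>m'\<close> times solves this: the rotated copies lie in one group conjugate
  to the rotations, a turn of at most \<open>pi / m'\<close> per copy adds up to any angle between 0
  and \<pi>, and some angle in this range kills the trace whatever matrix stands next to it. The
  size of the perturbation does not depend on the block. The second obstacle is the separate
  topology: a separately open set need not contain a product of neighbourhoods, so tolerances for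
  \<open>f\<close> and for \<open>A\<close> cannot simply be chosen together; Baire's theorem in the
  complete space of cocycles supplies them. An exponent is not determined by finitely many iterates,
  which is why the open condition speaks of one finite time and allows exceptional points.\<close>

lemma trace_2 [simp]: "trace (A :: 'a::comm_ring_1 ^ 2 ^ 2) = A $ 1 $ 1 + A $ 2 $ 2"
  by (simp add: trace_def sum_2)

lemma matrix_mult_2:
  fixes A B :: "'a::comm_ring_1 ^ 2 ^ 2"
  shows "(A ** B) $ i $ j = A $ i $ 1 * B $ 1 $ j + A $ i $ 2 * B $ 2 $ j"
  by (simp add: matrix_matrix_mult_def sum_2)

lemma matrix_vector_mult_2:
  fixes A :: "'a::comm_ring_1 ^ 2 ^ 2"
  shows "(A *v v) $ i = A $ i $ 1 * v $ 1 + A $ i $ 2 * v $ 2"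
  by (simp add: matrix_vector_mult_def sum_2)

lemma matrix_eq_2: "A = B \<longleftrightarrow> A $ 1 $ 1 = B $ 1 $ 1 \<and> A $ 1 $ 2 = B $ 1 $ 2 \<and>
    A $ 2 $ 1 = B $ 2 $ 1 \<and> A $ 2 $ 2 = B $ 2 $ (2::2)"
  for A B :: "'a ^ 2 ^ 2"
  by (auto simp: vec_eq_iff forall_2)

lemma norm_matrix_2: "(norm A)\<^sup>2 = (A $ 1 $ 1)\<^sup>2 + (A $ 1 $ 2)\<^sup>2 + (A $ 2 $ 1)\<^sup>2 + (A $ 2 $ 2)\<^sup>2"
  for A :: "real ^ 2 ^ 2"
  by (simp add: norm_vec_def L2_set_def sum_2 sum_nonneg)

definition rot :: "real \<Rightarrow> real ^ 2 ^ 2" where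
  "rot t = vector [vector [cos t, - sin t], vector [sin t, cos t]]"

lemma rot_entries [simp]: "rot t $ 1 $ 1 = cos t" "rot t $ 1 $ 2 = - sin t"
    "rot t $ 2 $ 1 = sin t" "rot t $ 2 $ 2 = cos t"
  by (simp_all add: rot_def)

lemma mat_1_entries [simp]: "(mat 1 :: 'a::comm_ring_1 ^ 2 ^ 2) $ 1 $ 1 = 1" "(mat 1 :: 'a ^ 2 ^ 2) $ 1 $ 2 = 0"
    "(mat 1 :: 'a ^ 2 ^ 2) $ 2 $ 1 = 0" "(mat 1 :: 'a ^ 2 ^ 2) $ 2 $ 2 = 1"
  by (simp_all add: mat_def)

lemma det_rot [simp]: "det (rot t) = 1"
  by (simp add: det_2 flip: power2_eq_square)

primrec wprod :: "(real ^ 2 ^ 2) list \<Rightarrow> real ^ 2 ^ 2" where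
  "wprod [] = mat 1"
| "wprod (B # Bs) = B ** wprod Bs"

lemma wprod_append: "wprod (Bs @ Cs) = wprod Bs ** wprod Cs"
  by (induction Bs) (simp_all add: matrix_mul_assoc)

lemma det_wprod: "(\<And>B. B \<in> set Bs \<Longrightarrow> det B = 1) \<Longrightarrow> det (wprod Bs) = 1"
  by (induction Bs) (simp_all add: det_mul)

section \<open>Words rotated by a complex angle\<close>

definition cmat :: "real ^ 2 ^ 2 \<Rightarrow> complex ^ 2 ^ 2" where
  "cmat B = (\<chi> i j. of_real (B $ i $ j))"

definition crot :: "complex \<Rightarrow> complex ^ 2 ^ 2" where
  "crot z = vector [vector [cos z, - sin z], vector [sin z, cos z]]"

lemma crot_entries [simp]: "crot t $ 1 $ 1 = cos t" "crot t $ 1 $ 2 = - sin t"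
    "crot t $ 2 $ 1 = sin t" "crot t $ 2 $ 2 = cos t"
  by (simp_all add: crot_def)

lemma cmat_entries [simp]: "cmat B $ i $ j = of_real (B $ i $ j)"
  by (simp add: cmat_def)

text \<open>One common angle for all letters makes the product a function of a single complex
  variable, to which the maximum principle applies.\<close>

primrec crword :: "complex \<Rightarrow> (real ^ 2 ^ 2) list \<Rightarrow> complex ^ 2 ^ 2" where
  "crword z [] = mat 1"
| "crword z (B # Bs) = (crot z ** cmat B) ** crword z Bs"

lemma crot_of_real: "crot (of_real t) = cmat (rot t)"
  by (simp add: matrix_eq_2 cos_of_real sin_of_real)

lemma crot_add: "crot (z + w) = crot z ** crot w"
  by (simp add: matrix_eq_2 matrix_mult_2 cos_add sin_add algebra_simps)

lemma cmat_mult: "cmat (A ** B) = cmat A ** cmat B"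
  by (simp add: matrix_eq_2 matrix_mult_2)

lemma crword_of_real: "crword (of_real t) Bs = cmat (wprod (map (\<lambda>B. rot t ** B) Bs))"
  by (induction Bs) (simp_all add: crot_of_real cmat_mult matrix_eq_2[of "mat 1"])

lemma det_crword: "(\<And>B. B \<in> set Bs \<Longrightarrow> det B = 1) \<Longrightarrow> det (crword z Bs) = 1"
proof (induction Bs)
  case (Cons B Bs)
  have "det B = 1" using Cons.prems by simp
  then have "det (cmat B) = 1" by (simp add: det_2 flip: of_real_mult of_real_diff)
  moreover have "det (crot z) = 1" by (simp add: det_2 flip: power2_eq_square)
  ultimately show ?case using Cons by (simp add: det_mul)
qed simp

lemma crword_cnj: "crword (cnj z) Bs $ i $ j = cnj (crword z Bs $ i $ j)"
proof (induction Bs arbitrary: i j)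
  case Nil
  then show ?case by (simp add: mat_def)
next
  case (Cons B Bs)
  have "i = 1 \<or> i = 2" by (rule exhaust_2)
  then show ?case by (auto simp: matrix_mult_2 Cons cnj_cos cnj_sin)
qed

lemma holomorphic_crword: "(\<lambda>z. crword z Bs $ i $ j) holomorphic_on S"
proof (induction Bs arbitrary: i j)
  case (Cons B Bs)
  have "i = 1 \<or> i = 2" by (rule exhaust_2)
  then show ?case by (auto simp: matrix_mult_2 intro!: holomorphic_intros Cons)
qed simp

text \<open>The indefinite Hermitian form preserved by SL(2, R): its sign tells whether the ratio of
  \<open>v $ 2\<close> to \<open>v $ 1\<close> lies in the upper or in the lower half-plane, and
  real vectors are null.\<close>

definition cform :: "complex ^ 2 \<Rightarrow> real" where
  "cform v = Im (v $ 2 * cnj (v $ 1))"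

lemma cform_cmat: "cform (cmat B *v v) = det B * cform v"
  by (simp add: cform_def matrix_vector_mult_2 det_2 algebra_simps)

text \<open>The cosine and sine of \<open>\<i> * y\<close> are \<open>cosh y\<close> and
  \<open>\<i> * sinh y\<close>, so an imaginary rotation adds a definite term to the form; for
  positive \<open>y\<close> it maps the closed upper half-plane into the open one. This is the only
  source of expansion in the complexified words.\<close>

lemma cform_crot_imaginary:
  "cform (crot (\<i> * of_real y) *v v) =
    cosh (2 * y) * cform v + sinh (2 * y) * ((norm (v $ 1))\<^sup>2 + (norm (v $ 2))\<^sup>2) / 2"
proof -
  have c: "cos (\<i> * complex_of_real y) = of_real (cosh y)" "sin (\<i> * complex_of_real y) = \<i> * of_real (sinh y)"
    by (simp_all add: complex_eq_iff Re_cos Im_cos Re_sin Im_sin cosh_field_def sinh_field_def)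
  have d: "cosh (2 * y) = (cosh y)\<^sup>2 + (sinh y)\<^sup>2" "sinh (2 * y) = 2 * sinh y * cosh y"
    by (simp_all add: cosh_double sinh_double)
  show ?thesis
    unfolding cform_def matrix_vector_mult_2 crot_entries c cmod_power2 d
    by (simp add: power2_eq_square field_simps)
qed

lemma det_cmat: "det (cmat B) = of_real (det B)"
  by (simp add: det_2)

lemma det_crot: "det (crot z) = 1"
  by (simp add: det_2 flip: power2_eq_square)

lemma matrix_vector_eq_0:
  fixes A :: "'a::field ^ 2 ^ 2"
  assumes "det A \<noteq> 0" "A *v v = 0"
  shows "v = 0"
  using assms invertible_det_nz matrix_left_invertible_ker unfolding invertible_def by blast

text \<open>The form is at most half the squared norm, so the definite term dominates
  \<open>sinh (2 * y)\<close> times the modulus of the form. Both bounds hold for either sign; the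
  first is the sharp one on vectors with nonnegative form, the second on the others. On null vectors
  they give only nonnegativity, hence the strict third claim.\<close>

lemma cform_letter:
  fixes z :: complex
  assumes B: "det B = 1" and y: "Im z \<ge> 0"
  defines "w \<equiv> \<lambda>v. (crot z ** cmat B) *v v"
  shows "exp (2 * Im z) * cform v \<le> cform (w v)" "exp (- (2 * Im z)) * cform v \<le> cform (w v)"
    "Im z > 0 \<Longrightarrow> v \<noteq> 0 \<Longrightarrow> cform v \<ge> 0 \<Longrightarrow> cform (w v) > 0"
proof -
  define y where "y = Im z"
  define u where "u = cmat B *v v"
  define E where "E = (norm (u $ 1))\<^sup>2 + (norm (u $ 2))\<^sup>2"
  have z: "z = of_real (Re z) + \<i> * of_real y" by (simp add: complex_eq_iff y_def)
  have "w v = cmat (rot (Re z)) *v (crot (\<i> * of_real y) *v u)"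
    unfolding w_def u_def
    by (subst z) (simp add: crot_add crot_of_real matrix_vector_mul_assoc matrix_mul_assoc)
  then have eq: "cform (w v) = cosh (2 * y) * cform u + sinh (2 * y) * (E / 2)"
    by (simp add: cform_cmat cform_crot_imaginary E_def)
  have uv: "cform u = cform v" using B by (simp add: u_def cform_cmat)
  have "\<bar>cform u\<bar> \<le> norm (u $ 2) * norm (u $ 1)"
    using abs_Im_le_cmod[of "u $ 2 * cnj (u $ 1)"] by (simp add: cform_def norm_mult)
  also have "2 * \<dots> \<le> E"
    unfolding E_def using sum_squares_bound[of "norm (u $ 2)" "norm (u $ 1)"] by (simp add: add.commute)
  finally have E: "\<bar>cform v\<bar> \<le> E / 2" by (simp add: uv)
  have y0: "y \<ge> 0" using y by (simp add: y_def)
  have s: "sinh (2 * y) \<ge> 0" using y0 by simp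
  have ge: "cform (w v) \<ge> cosh (2 * y) * cform v + sinh (2 * y) * \<bar>cform v\<bar>"
    using eq uv mult_left_mono[OF E s] by simp
  have ep: "exp (2 * y) = cosh (2 * y) + sinh (2 * y)" "exp (- (2 * y)) = cosh (2 * y) - sinh (2 * y)"
    by (simp_all add: cosh_plus_sinh cosh_minus_sinh)
  have le: "sinh (2 * y) * cform v \<le> sinh (2 * y) * \<bar>cform v\<bar>" "- sinh (2 * y) * cform v \<le> sinh (2 * y) * \<bar>cform v\<bar>"
    using mult_left_mono[OF abs_ge_self s, of "cform v"] mult_left_mono[OF abs_ge_minus_self s, of "cform v"] by auto
  show "exp (2 * Im z) * cform v \<le> cform (w v)" "exp (- (2 * Im z)) * cform v \<le> cform (w v)"
    using ge le unfolding y_def[symmetric] ep by (simp_all add: algebra_simps)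
  assume "Im z > 0" "v \<noteq> 0" "cform v \<ge> 0"
  have "u \<noteq> 0" using matrix_vector_eq_0[of "cmat B" v] B \<open>v \<noteq> 0\<close> by (auto simp: u_def det_cmat)
  then have "E > 0" unfolding E_def by (auto simp: vec_eq_iff forall_2 sum_power2_gt_zero_iff)
  moreover have "sinh (2 * y) > 0" using \<open>Im z > 0\<close> by (simp add: y_def)
  ultimately have "sinh (2 * y) * (E / 2) > 0" by simp
  moreover have "cosh (2 * y) * cform v \<ge> 0" using \<open>cform v \<ge> 0\<close> cosh_real_pos[of "2 * y"] by simp
  ultimately show "cform (w v) > 0" unfolding eq uv by linarith
qed

text \<open>The estimates for one letter multiply along the word. The strict claim needs at least
  one letter, and uses that the product of the remaining ones is invertible and keeps the vector
  nonzero.\<close>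

lemma cform_crword:
  fixes z :: complex
  assumes "\<And>B. B \<in> set Bs \<Longrightarrow> det B = 1" and y: "Im z > 0"
  shows "exp (2 * length Bs * Im z) * cform v \<le> cform (crword z Bs *v v) \<and>
    exp (- (2 * length Bs * Im z)) * cform v \<le> cform (crword z Bs *v v) \<and>
    (Bs \<noteq> [] \<longrightarrow> v \<noteq> 0 \<longrightarrow> cform v \<ge> 0 \<longrightarrow> cform (crword z Bs *v v) > 0)"
  using assms(1)
proof (induction Bs)
  case (Cons B Bs)
  define u where "u = crword z Bs *v v"
  have eq: "crword z (B # Bs) *v v = (crot z ** cmat B) *v u"
    by (simp add: u_def matrix_vector_mul_assoc matrix_mul_assoc)
  have "det B = 1" using Cons.prems by simp
  note l = cform_letter[OF this less_imp_le[OF y], of u]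
  have IH: "exp (2 * length Bs * Im z) * cform v \<le> cform u"
    "exp (- (2 * length Bs * Im z)) * cform v \<le> cform u"
    "Bs \<noteq> [] \<longrightarrow> v \<noteq> 0 \<longrightarrow> cform v \<ge> 0 \<longrightarrow> cform u > 0"
    using Cons by (simp_all add: u_def)
  have "exp (2 * length (B # Bs) * Im z) * cform v = exp (2 * Im z) * (exp (2 * length Bs * Im z) * cform v)"
    by (simp add: ring_distribs exp_add mult_ac)
  also have "\<dots> \<le> exp (2 * Im z) * cform u" using IH by simp
  finally have 1: "exp (2 * length (B # Bs) * Im z) * cform v \<le> cform (crword z (B # Bs) *v v)"
    using l(1) eq by simp
  have "exp (- (2 * length (B # Bs) * Im z)) * cform v = exp (- (2 * Im z)) * (exp (- (2 * length Bs * Im z)) * cform v)"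
    by (simp add: ring_distribs exp_add exp_diff exp_minus mult_ac field_simps)
  also have "\<dots> \<le> exp (- (2 * Im z)) * cform u" using IH by simp
  finally have 2: "exp (- (2 * length (B # Bs) * Im z)) * cform v \<le> cform (crword z (B # Bs) *v v)"
    using l(2) eq by simp
  have 3: "cform (crword z (B # Bs) *v v) > 0" if "v \<noteq> 0" "cform v \<ge> 0"
  proof -
    have "cform u \<ge> 0" using IH(3) that by (cases "Bs = []") (auto simp: u_def)
    moreover have "u \<noteq> 0"
      using matrix_vector_eq_0[of "crword z Bs" v] det_crword[of Bs z] Cons.prems that by (auto simp: u_def)
    ultimately show ?thesis using l(3) y eq by simp
  qed
  from 1 2 3 show ?case by blast
qed simp

text \<open>\<open>root\<close> is the characteristic equation of a matrix of determinant 1. On an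
  eigenvector the form is multiplied by the squared modulus of \<mu>; comparison with the bounds for
  words gives expansion if the form is positive there, contraction if it is negative, and strictness
  excludes null eigenvectors. The lower half-plane follows by conjugation.\<close>

lemma crword_eigenvalue:
  fixes z :: complex
  assumes B: "\<And>B. B \<in> set Bs \<Longrightarrow> det B = 1" and y: "Im z \<noteq> 0" and ne: "Bs \<noteq> []"
    and root: "\<mu>\<^sup>2 - trace (crword z Bs) * \<mu> + 1 = 0"
  shows "norm \<mu> \<ge> exp (length Bs * \<bar>Im z\<bar>) \<or> norm \<mu> \<le> exp (- (length Bs * \<bar>Im z\<bar>))"
proof -
  have *: "norm \<mu> \<ge> exp (length Bs * Im z) \<or> norm \<mu> \<le> exp (- (length Bs * Im z))"
    if y: "Im z > 0" and root: "\<mu>\<^sup>2 - trace (crword z Bs) * \<mu> + 1 = 0" for z \<mu>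
  proof -
    define P where "P = crword z Bs"
    have "det P = 1" using det_crword B by (simp add: P_def)
    then have "det (P - mat \<mu>) = 0"
      using root by (simp add: det_2 mat_def P_def power2_eq_square algebra_simps)
    then have "\<not> invertible (P - mat \<mu>)" by (simp add: invertible_det_nz)
    then obtain v where v: "v \<noteq> 0" "(P - mat \<mu>) *v v = 0"
      using invertible_left_inverse matrix_left_invertible_ker by blast
    have Pv: "(P *v v) $ i = \<mu> * v $ i" for i
    proof -
      have "((P - mat \<mu>) *v v) $ i = 0" using v by simp
      moreover have "i = 1 \<or> i = 2" by (rule exhaust_2)
      ultimately show ?thesis by (auto simp: matrix_vector_mult_2 mat_def algebra_simps)
    qed
    have c: "cform (P *v v) = (norm \<mu>)\<^sup>2 * cform v"
      unfolding cform_def Pv cmod_power2 by (simp add: power2_eq_square algebra_simps)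
    note w = cform_crword[where v = v and Bs = Bs and z = z, OF B y, folded P_def]
    have e: "exp (2 * length Bs * Im z) = (exp (length Bs * Im z))\<^sup>2"
      "exp (- (2 * length Bs * Im z)) = (exp (- (length Bs * Im z)))\<^sup>2"
      by (simp_all flip: exp_double)
    consider "cform v > 0" | "cform v < 0" | "cform v = 0" by linarith
    then show ?thesis
    proof cases
      case 1
      then have "(exp (length Bs * Im z))\<^sup>2 \<le> (norm \<mu>)\<^sup>2" using w c unfolding e by simp
      then show ?thesis by (simp add: power2_le_iff_abs_le)
    next
      case 2
      then have "(norm \<mu>)\<^sup>2 \<le> (exp (- (length Bs * Im z)))\<^sup>2" using w c unfolding e by simp
      then show ?thesis by (simp add: power2_le_iff_abs_le)
    next
      case 3 then show ?thesis using w c ne v by simp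
    qed
  qed
  show ?thesis
  proof (cases "Im z > 0")
    case True then show ?thesis using * root by simp
  next
    case False
    have "cnj (\<mu>\<^sup>2 - trace (crword z Bs) * \<mu> + 1) = 0" using root by simp
    then have "(cnj \<mu>)\<^sup>2 - trace (crword (cnj z) Bs) * cnj \<mu> + 1 = 0" by (simp add: crword_cnj)
    from *[OF _ this] False y show ?thesis by simp
  qed
qed

text \<open>The exponential growth comes from Schwarz's lemma: rotating every letter by the complex angle \<open>z\<close>
  makes the product hyperbolic with expansion at least \<open>exp (n \<bar>Im z\<bar>)\<close> off the real axis, and by
  assumption the contracting eigenvalue \<open>\<lambda>\<close> extends holomorphically across the real axis. The factor
  \<open>exp (n (r/2 - z\<^sup>2/(2r)))\<close> has modulus \<open>exp (n (Im z)\<^sup>2 / r) \<le> exp (n \<bar>Im z\<bar>)\<close> on \<open>\<bar>z\<bar> = r\<close>.\<close>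

lemma trace_wprod_growth:
  fixes r :: real
  assumes B: "\<And>B. B \<in> set Bs \<Longrightarrow> det B = 1" and ne: "Bs \<noteq> []" and r: "r > 0"
    and tr: "\<And>t. \<bar>t\<bar> \<le> r \<Longrightarrow> \<bar>trace (wprod (map (\<lambda>B. rot t ** B) Bs))\<bar> > 2"
  shows "exp (length Bs * r / 2) \<le> \<bar>trace (wprod Bs)\<bar> + 1"
proof -
  define n where "n = length Bs"
  define \<tau> where "\<tau> = (\<lambda>z. trace (crword z Bs))"
  have n: "n > 0" using ne by (simp add: n_def)
  have hol_\<tau>: "\<tau> holomorphic_on S" for S
    unfolding \<tau>_def trace_2 by (intro holomorphic_intros holomorphic_crword)
  have \<tau>_real: "\<tau> (of_real t) = of_real (trace (wprod (map (\<lambda>B. rot t ** B) Bs)))" for t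
    by (simp add: \<tau>_def crword_of_real)
  have root_unit: "norm \<mu> = 1" if "\<mu>\<^sup>2 - of_real x * \<mu> + 1 = 0" "\<bar>x\<bar> \<le> 2" for \<mu> :: complex and x :: real
  proof -
    have x2: "x\<^sup>2 \<le> 4" using that(2) power_mono[of "\<bar>x\<bar>" 2 2] by simp
    have im: "Im \<mu> * (2 * Re \<mu> - x) = 0" and re: "(Re \<mu>)\<^sup>2 - (Im \<mu>)\<^sup>2 - x * Re \<mu> + 1 = 0"
      using that(1) by (auto simp: complex_eq_iff power2_eq_square algebra_simps)
    have "(Re \<mu>)\<^sup>2 + (Im \<mu>)\<^sup>2 = 1"
    proof (cases "Im \<mu> = 0")
      case True
      then have "(Re \<mu> - x / 2)\<^sup>2 = x\<^sup>2 / 4 - 1" using re by (simp add: power2_eq_square field_simps)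
      then have "(Re \<mu> - x / 2)\<^sup>2 \<le> 0" using x2 by simp
      then have "Re \<mu> - x / 2 = 0" by simp
      moreover from this have x4: "x\<^sup>2 / 4 - 1 = 0" using \<open>(Re \<mu> - x / 2)\<^sup>2 = x\<^sup>2 / 4 - 1\<close> by (metis zero_power2)
      moreover have "x = 2 * Re \<mu>" using \<open>Re \<mu> - x / 2 = 0\<close> by linarith
      ultimately show ?thesis using True by (simp add: power_mult_distrib)
    next
      case False
      then have "x = 2 * Re \<mu>" using im by simp
      then show ?thesis using re by (simp add: power2_eq_square)
    qed
    then show ?thesis by (simp add: cmod_def)
  qed
  \<comment> \<open>Off the real axis a real trace between -2 and 2 would give eigenvalues of
    modulus 1, against the dichotomy for eigenvalues; on the axis this is the hypothesis
    \<open>tr\<close>.\<close>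
  have \<tau>_ne: "\<not> (Im (\<tau> z) = 0 \<and> \<bar>Re (\<tau> z)\<bar> \<le> 2)" if "norm z \<le> r" for z
  proof (cases "Im z = 0")
    case True
    then have "z = of_real (Re z)" by (simp add: complex_eq_iff)
    then have "\<tau> z = of_real (trace (wprod (map (\<lambda>B. rot (Re z) ** B) Bs)))" by (metis \<tau>_real)
    then show ?thesis using tr[of "Re z"] that abs_Re_le_cmod[of z] by simp
  next
    case False
    show ?thesis
    proof
      assume a: "Im (\<tau> z) = 0 \<and> \<bar>Re (\<tau> z)\<bar> \<le> 2"
      define x where "x = Re (\<tau> z)"
      have x: "\<tau> z = of_real x" using a by (simp add: complex_eq_iff x_def)
      define c where "c = csqrt ((of_real x)\<^sup>2 - 4)"
      have c2: "c\<^sup>2 = (of_real x)\<^sup>2 - 4" by (simp add: c_def)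
      define \<mu> where "\<mu> = (of_real x + c) / 2"
      have "2 * \<mu> = of_real x + c" by (simp add: \<mu>_def)
      with c2 have "4 * (\<mu>\<^sup>2 - of_real x * \<mu> + 1) = 0" by algebra
      then have root: "\<mu>\<^sup>2 - of_real x * \<mu> + 1 = 0" by (metis mult_eq_0_iff zero_neq_numeral)
      then have "norm \<mu> = 1" using root_unit a x_def by blast
      moreover have "norm \<mu> \<ge> exp (n * \<bar>Im z\<bar>) \<or> norm \<mu> \<le> exp (- (n * \<bar>Im z\<bar>))"
        using crword_eigenvalue[OF B False ne, of \<mu>] root x by (simp add: \<tau>_def n_def)
      ultimately show False using n False by (auto simp: mult_le_0_iff)
    qed
  qed
  \<comment> \<open>The eigenvalues are half of \<tau> times 1 plus or minus the root of
    \<open>w\<close>. Since \<tau> avoids the real interval from -2 to 2, it is nonzero and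
    \<open>w\<close> stays off the nonpositive reals; so the principal root is holomorphic with
    positive real part, and \<open>lam\<close> is the smaller eigenvalue on the whole disc.\<close>
  define w where "w = (\<lambda>z. 1 - 4 / (\<tau> z)\<^sup>2)"
  have \<tau>0: "\<tau> z \<noteq> 0" if "norm z \<le> r" for z using \<tau>_ne[OF that] by auto
  have w: "w z \<notin> \<real>\<^sub>\<le>\<^sub>0" if z: "norm z \<le> r" for z
  proof
    assume "w z \<in> \<real>\<^sub>\<le>\<^sub>0"
    then obtain s where s: "w z = of_real s" "s \<le> 0" by (auto elim: nonpos_Reals_cases)
    then have "4 / (\<tau> z)\<^sup>2 = of_real (1 - s)" by (simp add: w_def algebra_simps)
    then have "4 = of_real (1 - s) * (\<tau> z)\<^sup>2" using \<tau>0[OF z] by (metis nonzero_eq_divide_eq power_not_zero)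
    then have "(\<tau> z)\<^sup>2 = 4 / of_real (1 - s)" using s by (simp add: field_simps)
    then have sq: "(\<tau> z)\<^sup>2 = (of_real (2 / sqrt (1 - s)))\<^sup>2"
      using s by (simp add: power_divide flip: of_real_power)
    then have "\<tau> z = of_real (2 / sqrt (1 - s)) \<or> \<tau> z = - of_real (2 / sqrt (1 - s))"
      by (simp only: power2_eq_iff)
    then have "Im (\<tau> z) = 0 \<and> \<bar>Re (\<tau> z)\<bar> = 2 / sqrt (1 - s)" using s by auto
    moreover have "2 / sqrt (1 - s) \<le> 2" using s by (simp add: field_simps)
    ultimately show False using \<tau>_ne[OF z] by simp
  qed
  define lam where "lam = (\<lambda>z. \<tau> z / 2 * (1 - csqrt (w z)))"
  define lam' where "lam' = (\<lambda>z. \<tau> z / 2 * (1 + csqrt (w z)))"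
  have hol: "lam holomorphic_on cball 0 r"
    unfolding lam_def w_def
    by (intro holomorphic_intros hol_\<tau>) (use w \<tau>0 in \<open>auto simp: w_def\<close>)
  have prod: "lam z * lam' z = 1" and sum: "lam z + lam' z = \<tau> z" if "norm z \<le> r" for z
  proof -
    have "lam z * lam' z = (\<tau> z)\<^sup>2 / 4 * (1 - (csqrt (w z))\<^sup>2)"
      by (simp add: lam_def lam'_def power2_eq_square algebra_simps)
    then show "lam z * lam' z = 1" using \<tau>0[OF that] by (simp add: w_def)
    show "lam z + lam' z = \<tau> z" by (simp add: lam_def lam'_def algebra_simps add_divide_distrib[symmetric])
  qed
  have lt1: "norm (lam z) < 1" if z: "norm z \<le> r" for z
  proof -
    have "Re (csqrt (w z)) > 0"
    proof -
      have "Re (csqrt (w z)) \<noteq> 0"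
      proof
        assume "Re (csqrt (w z)) = 0"
        then have "csqrt (w z) = \<i> * of_real (Im (csqrt (w z)))" by (simp add: complex_eq_iff)
        then have "w z = (\<i> * of_real (Im (csqrt (w z))))\<^sup>2" by (metis power2_csqrt)
        then have "w z = of_real (- (Im (csqrt (w z)))\<^sup>2)" by (simp add: power_mult_distrib)
        then show False using w[OF z] by (metis nonpos_Reals_of_real_iff neg_le_0_iff_le zero_le_power2)
      qed
      then show ?thesis using csqrt_principal[of "w z"] by auto
    qed
    then have "norm (1 - csqrt (w z)) < norm (1 + csqrt (w z))"
      by (simp add: cmod_def power2_eq_square algebra_simps)
    then have lt: "norm (lam z) < norm (lam' z)" using \<tau>0[OF z] by (simp add: lam_def lam'_def norm_mult)
    have "norm (lam z) * norm (lam' z) = 1" using prod[OF z] by (metis norm_mult norm_one)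
    show ?thesis
    proof (rule ccontr)
      assume "\<not> norm (lam z) < 1"
      then have 1: "1 \<le> norm (lam z)" "1 < norm (lam' z)" using lt by linarith+
      have "1 * norm (lam' z) \<le> norm (lam z) * norm (lam' z)" using 1 by (intro mult_right_mono) auto
      then show False using 1 \<open>norm (lam z) * norm (lam' z) = 1\<close> by linarith
    qed
  qed
  \<comment> \<open>Modulus below 1 selects the contracting case of the dichotomy, on both sides of
    the real axis; so one holomorphic function obeys the bound everywhere.\<close>
  have bd: "norm (lam z) \<le> exp (- (n * \<bar>Im z\<bar>))" if z: "norm z \<le> r" for z
  proof (cases "Im z = 0")
    case True then show ?thesis using lt1[OF z] by simp
  next
    case False
    have "lam z * (\<tau> z - lam z) = 1" using prod[OF z] sum[OF z] by (metis add_diff_cancel_left')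
    then have "(lam z)\<^sup>2 - \<tau> z * lam z + 1 = 0" by (simp add: power2_eq_square algebra_simps)
    then have "norm (lam z) \<ge> exp (n * \<bar>Im z\<bar>) \<or> norm (lam z) \<le> exp (- (n * \<bar>Im z\<bar>))"
      using crword_eigenvalue[OF B False ne, of "lam z"] by (simp add: \<tau>_def n_def)
    moreover have "exp (n * \<bar>Im z\<bar>) \<ge> 1" by simp
    ultimately show ?thesis using lt1[OF z] by linarith
  qed
  define h where "h = (\<lambda>z. lam z * exp (of_nat n * (of_real r / 2 - z\<^sup>2 / (2 * of_real r))))"
  have hh: "h holomorphic_on cball 0 r" unfolding h_def using hol r by (intro holomorphic_intros) auto
  have "norm (h 0) \<le> 1"
  proof (rule maximum_modulus_frontier[where S = "cball 0 r" and f = h])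
    show "h holomorphic_on interior (cball 0 r)" using hh by (rule holomorphic_on_subset) auto
    show "continuous_on (closure (cball 0 r)) h" using hh holomorphic_on_imp_continuous_on by simp
    fix z :: complex assume "z \<in> frontier (cball 0 r)"
    then have z: "norm z = r" by (simp add: frontier_cball)
    have zr: "(Re z)\<^sup>2 = r\<^sup>2 - (Im z)\<^sup>2" using z cmod_power2[of z] by simp
    define q where "q = z\<^sup>2 / (2 * of_real r)"
    have "q = z\<^sup>2 / of_real (2 * r)" by (simp add: q_def)
    then have "Re q = ((Re z)\<^sup>2 - (Im z)\<^sup>2) / (2 * r)"
      by (simp only: Re_divide_of_real) (simp add: power2_eq_square)
    then have "Re q = r / 2 - (Im z)\<^sup>2 / r"
      unfolding zr using r by (simp add: field_simps power2_eq_square)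
    then have "Re (of_nat n * (of_real r / 2 - z\<^sup>2 / (2 * of_real r))) = n * ((Im z)\<^sup>2 / r)"
      unfolding q_def[symmetric] by simp
    also have "\<dots> \<le> n * \<bar>Im z\<bar>"
    proof (intro mult_left_mono)
      have "(Im z)\<^sup>2 \<le> \<bar>Im z\<bar> * r" using abs_Im_le_cmod[of z] z
        by (metis abs_ge_zero mult_left_mono power2_abs power2_eq_square)
      then show "(Im z)\<^sup>2 / r \<le> \<bar>Im z\<bar>" using r by (simp add: field_simps)
    qed simp
    finally have "norm (h z) \<le> exp (- (n * \<bar>Im z\<bar>)) * exp (n * \<bar>Im z\<bar>)"
      unfolding h_def norm_mult norm_exp_eq_Re using bd[of z] z by (intro mult_mono) auto
    then show "norm (h z) \<le> 1" by (simp flip: exp_add)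
  qed (use r in auto)
  then have "norm (lam 0) * exp (n * r / 2) \<le> 1"
    by (simp add: h_def norm_mult norm_exp_eq_Re)
  moreover have p: "norm (lam 0) * norm (lam' 0) = 1" using prod[of 0] r by (simp flip: norm_mult)
  ultimately have "norm (lam 0) * exp (n * r / 2) \<le> norm (lam 0) * norm (lam' 0)" by simp
  moreover have "norm (lam 0) > 0" using p by auto
  ultimately have ge: "exp (n * r / 2) \<le> norm (lam' 0)" by (simp only: mult_le_cancel_left_pos)
  have "norm (lam' 0) \<le> norm (\<tau> 0) + norm (lam 0)"
  proof -
    have "lam' 0 = \<tau> 0 - lam 0" using sum[of 0] r by (simp add: algebra_simps)
    then show ?thesis using norm_triangle_ineq4[of "\<tau> 0" "lam 0"] by simp
  qed
  moreover have "norm (\<tau> 0) = \<bar>trace (wprod Bs)\<bar>"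
  proof -
    have "rot 0 = mat 1" by (simp add: matrix_eq_2)
    then have "\<tau> 0 = of_real (trace (wprod Bs))" using \<tau>_real[of 0] by simp
    then show ?thesis by (simp only: norm_of_real)
  qed
  moreover have "norm (lam 0) < 1" using lt1[of 0] r by simp
  ultimately show ?thesis using ge unfolding n_def by linarith
qed

section \<open>Traces and norms of products with rotations\<close>

lemma norm_matrix_mult_le: "norm (A ** B) \<le> norm A * norm B" for A B :: "real ^ 2 ^ 2"
proof (rule power2_le_imp_le)
  have cs: "(a * b + c * d)\<^sup>2 \<le> (a\<^sup>2 + c\<^sup>2) * (b\<^sup>2 + d\<^sup>2)" for a b c d :: real
    using zero_le_power2[of "a * d - c * b"] by (simp add: power2_eq_square algebra_simps)
  show "(norm (A ** B))\<^sup>2 \<le> (norm A * norm B)\<^sup>2"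
    unfolding power_mult_distrib norm_matrix_2 matrix_mult_2
    using cs[of "A$1$1" "B$1$1" "A$1$2" "B$2$1"] cs[of "A$1$1" "B$1$2" "A$1$2" "B$2$2"]
      cs[of "A$2$1" "B$1$1" "A$2$2" "B$2$1"] cs[of "A$2$1" "B$1$2" "A$2$2" "B$2$2"]
    by (simp add: algebra_simps)
qed simp

lemma norm_matrix_vector_le: "norm (A *v v) \<le> norm A * norm v" for A :: "real ^ 2 ^ 2"
proof (rule power2_le_imp_le)
  have cs: "(a * b + c * d)\<^sup>2 \<le> (a\<^sup>2 + c\<^sup>2) * (b\<^sup>2 + d\<^sup>2)" for a b c d :: real
    using zero_le_power2[of "a * d - c * b"] by (simp add: power2_eq_square algebra_simps)
  have n: "(norm w)\<^sup>2 = (w $ 1)\<^sup>2 + (w $ 2)\<^sup>2" for w :: "real ^ 2"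
    by (simp add: norm_vec_def L2_set_def sum_2)
  show "(norm (A *v v))\<^sup>2 \<le> (norm A * norm v)\<^sup>2"
    unfolding power_mult_distrib norm_matrix_2 n matrix_vector_mult_2
    using cs[of "A$1$1" "v$1" "A$1$2" "v$2"] cs[of "A$2$1" "v$1" "A$2$2" "v$2"]
    by (simp add: algebra_simps)
qed simp

lemma norm_SL2_ge:
  assumes "det A = 1" shows "(norm A)\<^sup>2 \<ge> 2" "norm (A :: real ^ 2 ^ 2) \<ge> 1"
proof -
  have "(A$1$1 - A$2$2)\<^sup>2 + (A$1$2 + A$2$1)\<^sup>2 \<ge> 0" by simp
  then show *: "(norm A)\<^sup>2 \<ge> 2"
    using assms unfolding norm_matrix_2 det_2 by (simp add: power2_eq_square algebra_simps)
  show "norm A \<ge> 1" by (rule power2_le_imp_le) (use * in auto)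
qed

text \<open>As a function of \<open>t\<close> the trace is a sinusoid whose amplitude is the square
  root of \<open>(norm W)\<^sup>2 + 2\<close>. If it has no zero at distance at most
  \<open>r\<close> from 0, its value at 0 is at least \<open>sin r\<close> times the
  amplitude.\<close>

lemma abs_trace_ge_norm:
  assumes r: "0 < r" "r < pi / 2" and det: "det W = 1"
    and nz: "\<And>t. \<bar>t\<bar> \<le> r \<Longrightarrow> trace (rot t ** W) \<noteq> 0"
  shows "\<bar>trace W\<bar> \<ge> sin r * norm W"
proof -
  define a b where "a = W$1$1 + W$2$2" and "b = W$1$2 - W$2$1"
  have T: "trace (rot t ** W) = cos t * a + sin t * b" for t
    by (simp add: matrix_mult_2 a_def b_def algebra_simps)
  have cs: "cos r > 0" "sin r > 0" using r cos_gt_zero_pi[of r] sin_gt_zero[of r] by auto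
  have ab: "\<bar>b\<bar> * sin r \<le> \<bar>a\<bar> * cos r"
  proof (rule ccontr)
    assume "\<not> \<bar>b\<bar> * sin r \<le> \<bar>a\<bar> * cos r"
    then have lt: "\<bar>a\<bar> * cos r < \<bar>b\<bar> * sin r" by simp
    then have b: "b \<noteq> 0" using cs by (auto simp: mult_less_0_iff)
    define t where "t = - arctan (a / b)"
    have "\<bar>a / b\<bar> < tan r" using lt b cs by (simp add: tan_def field_simps)
    then have "arctan \<bar>a / b\<bar> < arctan (tan r)" by (rule arctan_monotone)
    then have "arctan \<bar>a / b\<bar> < r" using r by (simp add: arctan_tan)
    then have "\<bar>t\<bar> \<le> r" unfolding t_def by (auto simp: abs_if arctan_minus split: if_splits)
    moreover have "trace (rot t ** W) = 0"
    proof -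
      have "sin (arctan (a/b)) = tan (arctan (a/b)) * cos (arctan (a/b))"
        using cos_arctan_not_zero by (simp add: tan_def)
      then show ?thesis unfolding T t_def using b by (simp add: tan_arctan)
    qed
    ultimately show False using nz by blast
  qed
  have "(\<bar>b\<bar> * sin r)\<^sup>2 \<le> (\<bar>a\<bar> * cos r)\<^sup>2" using ab cs by (intro power_mono) auto
  then have "b\<^sup>2 * (sin r)\<^sup>2 \<le> a\<^sup>2 * (cos r)\<^sup>2" by (simp add: power_mult_distrib)
  then have "(sin r)\<^sup>2 * (a\<^sup>2 + b\<^sup>2) \<le> a\<^sup>2" by (simp add: cos_squared_eq algebra_simps)
  moreover have "a\<^sup>2 + b\<^sup>2 = (norm W)\<^sup>2 + 2"
    using det unfolding norm_matrix_2 a_def b_def det_2 by (simp add: power2_eq_square algebra_simps)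
  ultimately have "(sin r)\<^sup>2 * (norm W)\<^sup>2 \<le> a\<^sup>2" by (simp add: algebra_simps add_nonneg_nonneg) (smt (verit) zero_le_power2)
  then have "(sin r * norm W)\<^sup>2 \<le> \<bar>a\<bar>\<^sup>2" by (simp add: power_mult_distrib)
  then show ?thesis unfolding a_def trace_2 by (rule power2_le_imp_le) simp
qed

lemma le_from_sum_eq: "x + y = z \<Longrightarrow> 0 \<le> y \<Longrightarrow> x \<le> z" for x y z :: real
  by simp

lemma trace_rot_le: "\<bar>trace (W ** rot s)\<bar> \<le> 2 * norm W" if "det W = 1"
proof -
  define a b where "a = W$1$1 + W$2$2" and "b = W$1$2 - W$2$1"
  have "trace (W ** rot s) = cos s * a + sin s * b"
    by (simp add: matrix_mult_2 a_def b_def algebra_simps)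
  then have "(trace (W ** rot s))\<^sup>2 + (cos s * b - sin s * a)\<^sup>2 = ((sin s)\<^sup>2 + (cos s)\<^sup>2) * (a\<^sup>2 + b\<^sup>2)"
    by algebra
  then have "(trace (W ** rot s))\<^sup>2 \<le> a\<^sup>2 + b\<^sup>2" using zero_le_power2[of "cos s * b - sin s * a"]
    unfolding sin_cos_squared_add by (simp only: mult_1 le_from_sum_eq)
  also have "a\<^sup>2 + b\<^sup>2 = (norm W)\<^sup>2 + 2"
    using that unfolding norm_matrix_2 a_def b_def det_2 by (simp add: power2_eq_square algebra_simps)
  also have "\<dots> \<le> (2 * norm W)\<^sup>2" using norm_SL2_ge(1)[OF that] by (simp add: power_mult_distrib)
  finally have "\<bar>trace (W ** rot s)\<bar>\<^sup>2 \<le> (2 * norm W)\<^sup>2" by simp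
  then show ?thesis by (rule power2_le_imp_le) simp
qed

text \<open>\<open>rot r\<close> is \<open>cos r\<close> times the identity plus
  \<open>sin r\<close> times the quarter turn, and the cross terms cancel in the sum over
  \<open>r\<close> and \<open>- r\<close>. In dimension 2 a symmetric matrix plus its conjugate by
  the quarter turn is its trace times the identity, so the squared norms of \<open>U\<close> and
  \<open>V\<close> add up to the product of those of \<open>P\<close> and \<open>Q\<close>. Hence
  one of the two signs avoids cancellation.\<close>

lemma norm_mult_rot_sum_ge:
  fixes P Q :: "real ^ 2 ^ 2"
  assumes r: "0 < r" "r \<le> pi / 4"
  shows "(norm (P ** rot r ** Q))\<^sup>2 + (norm (P ** rot (- r) ** Q))\<^sup>2 \<ge> 2 * (sin r)\<^sup>2 * ((norm P)\<^sup>2 * (norm Q)\<^sup>2)"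
proof -
  define U where "U = P ** Q"
  define V where "V = P ** rot (pi / 2) ** Q"
  have id1: "(norm (P ** rot r ** Q))\<^sup>2 + (norm (P ** rot (- r) ** Q))\<^sup>2 = 2 * (cos r)\<^sup>2 * (norm U)\<^sup>2 + 2 * (sin r)\<^sup>2 * (norm V)\<^sup>2"
    unfolding norm_matrix_2 U_def V_def matrix_mult_2 by (simp add: power2_eq_square algebra_simps)
  have id2: "(norm U)\<^sup>2 + (norm V)\<^sup>2 = (norm P)\<^sup>2 * (norm Q)\<^sup>2"
    unfolding norm_matrix_2 U_def V_def matrix_mult_2 by (simp add: power2_eq_square algebra_simps)
  have "(sin r)\<^sup>2 \<le> (cos r)\<^sup>2"
  proof (rule power_mono)
    have "sin r \<le> sin (pi / 4)" using r by (intro sin_monotone_2pi_le) auto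
    also have "\<dots> = cos (pi / 4)" by (simp add: sin_45 cos_45)
    also have "\<dots> \<le> cos r" using r by (intro cos_monotone_0_pi_le) auto
    finally show "sin r \<le> cos r" .
    show "0 \<le> sin r" using r by (intro sin_ge_zero) auto
  qed
  then have "(sin r)\<^sup>2 * (norm U)\<^sup>2 \<le> (cos r)\<^sup>2 * (norm U)\<^sup>2" by (rule mult_right_mono) simp
  then show ?thesis unfolding id1 id2[symmetric] by (simp add: algebra_simps)
qed

text \<open>By cyclicity the trace of \<open>P ** rot s ** Q\<close> is that of
  \<open>(Q ** P) ** rot s\<close>, which is at most \<open>2 * norm (Q ** P)\<close>; the absence
  of zeros bounds the same trace from below by \<open>sin r\<close> times the norm of
  \<open>P ** rot s ** Q\<close>. For \<open>s = r\<close> or \<open>s = - r\<close> that norm is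
  comparable to the product of the norms.\<close>

lemma norm_mult_ge_of_trace_ne_0:
  assumes det: "det P = 1" "det Q = 1" and r: "0 < r" "r \<le> pi / 4"
    and nz: "\<And>s t. \<bar>s\<bar> \<le> r \<Longrightarrow> \<bar>t\<bar> \<le> r \<Longrightarrow> trace ((Q ** rot t) ** (P ** rot s)) \<noteq> 0"
  shows "norm (Q ** P) \<ge> (sin r)\<^sup>2 / 2 * (norm Q * norm P)"
proof -
  have s: "sin r > 0" using r by (intro sin_gt_zero) auto
  have *: "sin r * norm (P ** rot s ** Q) \<le> 2 * norm (Q ** P)" if "\<bar>s\<bar> \<le> r" for s
  proof -
    have "sin r * norm (P ** rot s ** Q) \<le> \<bar>trace (P ** rot s ** Q)\<bar>"
    proof (rule abs_trace_ge_norm)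
      show "det (P ** rot s ** Q) = 1" by (simp add: det_mul det)
      fix t assume t: "\<bar>t\<bar> \<le> r"
      have "trace (rot t ** (P ** rot s ** Q)) = trace ((Q ** rot t) ** (P ** rot s))"
        using trace_mul_sym[of Q "rot t ** (P ** rot s)"] by (simp add: matrix_mul_assoc)
      then show "trace (rot t ** (P ** rot s ** Q)) \<noteq> 0" using nz[OF that t] by simp
    qed (use r in auto)
    also have "trace (P ** rot s ** Q) = trace ((Q ** P) ** rot s)"
      using trace_mul_sym[of Q "P ** rot s"] by (simp add: matrix_mul_assoc)
    also have "\<bar>\<dots>\<bar> \<le> 2 * norm (Q ** P)" by (rule trace_rot_le) (simp add: det_mul det)
    finally show ?thesis .
  qed
  have sq: "(sin r)\<^sup>2 * (norm (P ** rot s ** Q))\<^sup>2 \<le> (2 * norm (Q ** P))\<^sup>2" if "\<bar>s\<bar> \<le> r" for s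
    using power_mono[OF *[OF that], of 2] s by (simp add: power_mult_distrib)
  have "((sin r)\<^sup>2 * (norm Q * norm P))\<^sup>2 * 2 = (sin r)\<^sup>2 * (2 * (sin r)\<^sup>2 * ((norm P)\<^sup>2 * (norm Q)\<^sup>2))"
    by (simp add: power2_eq_square)
  also have "\<dots> \<le> (sin r)\<^sup>2 * ((norm (P ** rot r ** Q))\<^sup>2 + (norm (P ** rot (- r) ** Q))\<^sup>2)"
    by (intro mult_left_mono norm_mult_rot_sum_ge r) simp
  also have "\<dots> \<le> (2 * norm (Q ** P))\<^sup>2 * 2"
    using sq[of r] sq[of "- r"] r by (simp add: algebra_simps)
  finally have "((sin r)\<^sup>2 * (norm Q * norm P))\<^sup>2 \<le> (2 * norm (Q ** P))\<^sup>2" by simp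
  then have "(sin r)\<^sup>2 * (norm Q * norm P) \<le> 2 * norm (Q ** P)" by (rule power2_le_imp_le) simp
  then show ?thesis by simp
qed

text \<open>The rate is assumed from every starting index, so that the error at \<open>n\<close> is
  controlled by \<open>E n\<close> and not merely by a fixed geometric sequence; in
  \<open>stable_direction\<close>, \<open>E n\<close> is a multiple of
  \<open>1 / (norm (P n))\<^sup>2\<close>.\<close>

lemma geometric_Cauchy_limit:
  fixes X :: "nat \<Rightarrow> 'a::banach"
  assumes q: "0 \<le> q" "q < 1"
    and d: "\<And>n m. n \<le> m \<Longrightarrow> norm (X (Suc m) - X m) \<le> E n * q ^ (m - n)"
    and E: "\<And>n. 0 \<le> E n"
  obtains L where "X \<longlonglongrightarrow> L" "\<And>n. norm (L - X n) \<le> E n / (1 - q)"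
proof -
  have sm: "summable (\<lambda>k. q ^ k)" using q by (intro summable_geometric) auto
  have bd: "norm (X (n + k) - X n) \<le> E n / (1 - q)" for n k
  proof -
    have "X (n + k) - X n = (\<Sum>i<k. X (Suc (n + i)) - X (n + i))"
      using sum_lessThan_telescope[of "\<lambda>i. X (n + i)" k] by simp
    also have "norm \<dots> \<le> (\<Sum>i<k. E n * q ^ i)"
      using d[of n "n + _"] by (intro sum_norm_le) auto
    also have "\<dots> = E n * (\<Sum>i<k. q ^ i)" by (simp add: sum_distrib_left)
    also have "\<dots> \<le> E n * (\<Sum>i. q ^ i)" using sm q E by (intro mult_left_mono sum_le_suminf) auto
    also have "\<dots> = E n / (1 - q)" using q by (simp add: suminf_geometric)
    finally show ?thesis .
  qed
  have "summable (\<lambda>m. X (Suc m) - X m)"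
  proof (rule summable_comparison_test)
    show "\<exists>N. \<forall>n\<ge>N. norm (X (Suc n) - X n) \<le> E 0 * q ^ n" using d[of 0] by auto
    show "summable (\<lambda>n. E 0 * q ^ n)" using sm by (rule summable_mult)
  qed
  then have "(\<lambda>k. \<Sum>m<k. X (Suc m) - X m) \<longlonglongrightarrow> (\<Sum>m. X (Suc m) - X m)" by (rule summable_LIMSEQ)
  then have "(\<lambda>k. X k - X 0) \<longlonglongrightarrow> (\<Sum>m. X (Suc m) - X m)" by (simp add: sum_lessThan_telescope)
  then have "(\<lambda>k. (X k - X 0) + X 0) \<longlonglongrightarrow> (\<Sum>m. X (Suc m) - X m) + X 0" by (intro tendsto_add) auto
  then obtain L where L: "X \<longlonglongrightarrow> L" by auto
  have "norm (L - X n) \<le> E n / (1 - q)" for n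
  proof (rule Lim_bounded[of "\<lambda>k. norm (X (n + k) - X n)"])
    have "(\<lambda>k. X (k + n)) \<longlonglongrightarrow> L" using L by (rule LIMSEQ_ignore_initial_segment)
    then show "(\<lambda>k. norm (X (n + k) - X n)) \<longlonglongrightarrow> norm (L - X n)"
      by (intro tendsto_intros) (simp add: add.commute)
    show "\<forall>k\<ge>0. norm (X (n + k) - X n) \<le> E n / (1 - q)" using bd by simp
  qed
  with L that show ?thesis by blast
qed

section \<open>Most contracted directions and stable lines\<close>

lemma adj2_entries [simp]: "adj2 A $ 1 $ 1 = A $ 2 $ 2" "adj2 A $ 2 $ 2 = A $ 1 $ 1"
    "adj2 A $ 1 $ 2 = - A $ 1 $ 2" "adj2 A $ 2 $ 1 = - A $ 2 $ 1"
  by (simp_all add: adj2_def)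

lemma adj2_mult: "adj2 (A ** B) = adj2 B ** adj2 A"
  by (simp add: matrix_eq_2 matrix_mult_2 algebra_simps)

lemma matrix_mult_scaleR: "A ** (k *\<^sub>R B) = k *\<^sub>R (A ** B)" for A B :: "real ^ 2 ^ 2"
  by (simp add: matrix_eq_2 matrix_mult_2 algebra_simps)

lemma norm_adj2 [simp]: "norm (adj2 A) = norm A"
proof -
  have "(norm (adj2 A))\<^sup>2 = (norm A)\<^sup>2" unfolding norm_matrix_2 by simp
  then show ?thesis by simp
qed

lemma det_adj2 [simp]: "det (adj2 A) = det A"
  by (simp add: det_2 mult.commute)

lemma mult_adj2: "det A = 1 \<Longrightarrow> A ** adj2 A = mat 1" "det A = 1 \<Longrightarrow> adj2 A ** A = mat 1"
  by (auto simp: matrix_eq_2 matrix_mult_2 det_2 algebra_simps)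

text \<open>\<open>contracted P\<close> is \<open>P\<^sup>-\<^sup>1 P\<^sup>-\<^sup>T\<close> scaled to trace 1: for large \<open>norm P\<close> it is close to the orthogonal
  projection onto the direction most contracted by \<open>P\<close>.\<close>

definition contracted :: "real ^ 2 ^ 2 \<Rightarrow> real ^ 2 ^ 2" where
  "contracted P = (1 / (norm P)\<^sup>2) *\<^sub>R (adj2 P ** transpose (adj2 P))"

lemma transpose_entry: "transpose A $ i $ j = A $ j $ i"
  by (simp add: transpose_def)

lemma contracted_entries:
  "contracted P $ 1 $ 1 = ((P$2$2)\<^sup>2 + (P$1$2)\<^sup>2) / (norm P)\<^sup>2"
  "contracted P $ 2 $ 2 = ((P$1$1)\<^sup>2 + (P$2$1)\<^sup>2) / (norm P)\<^sup>2"
  "contracted P $ 1 $ 2 = - (P$2$2 * P$2$1 + P$1$2 * P$1$1) / (norm P)\<^sup>2"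
  "contracted P $ 2 $ 1 = - (P$2$2 * P$2$1 + P$1$2 * P$1$1) / (norm P)\<^sup>2"
  by (simp_all add: contracted_def matrix_mult_2 transpose_entry power2_eq_square algebra_simps diff_divide_distrib add_divide_distrib)

text \<open>\<open>P ** contracted P\<close> is the inverse transpose of \<open>P\<close> divided by
  the squared norm. Where norms grow the determinant tends to 0, so that limits have rank 1.\<close>

lemma contracted_props:
  assumes "det P = 1"
  shows "trace (contracted P) = 1" "contracted P $ 1 $ 2 = contracted P $ 2 $ 1"
    "det (contracted P) = 1 / (norm P) ^ 4" "norm (P ** contracted P) = 1 / norm P"
proof -
  have n: "norm P \<ge> 1" by (rule norm_SL2_ge[OF assms])
  have "trace (contracted P) = (norm P)\<^sup>2 / (norm P)\<^sup>2"
    unfolding trace_2 contracted_entries add_divide_distrib[symmetric] norm_matrix_2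
    by (simp add: algebra_simps)
  moreover have "norm P \<noteq> 0" using n by linarith
  ultimately show "trace (contracted P) = 1" by (simp del: trace_2)
  show "contracted P $ 1 $ 2 = contracted P $ 2 $ 1" by (simp add: contracted_entries)
  have "det (contracted P) = (det P)\<^sup>2 / ((norm P)\<^sup>2 * (norm P)\<^sup>2)"
    unfolding det_2 contracted_entries by (simp add: power2_eq_square algebra_simps flip: diff_divide_distrib add_divide_distrib)
  then show "det (contracted P) = 1 / (norm P) ^ 4" using assms by (simp flip: power_add)
  have "P ** contracted P = (1 / (norm P)\<^sup>2) *\<^sub>R ((P ** adj2 P) ** transpose (adj2 P))"
    by (simp add: contracted_def matrix_mult_scaleR matrix_mul_assoc)
  also have "\<dots> = (1 / (norm P)\<^sup>2) *\<^sub>R transpose (adj2 P)" by (simp add: mult_adj2 assms)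
  finally have "norm (P ** contracted P) = (1 / (norm P)\<^sup>2) * norm (transpose (adj2 P))" by simp
  moreover have "norm (transpose (adj2 P)) = norm P"
  proof -
    have "(norm (transpose (adj2 P)))\<^sup>2 = (norm P)\<^sup>2" unfolding norm_matrix_2 by (simp add: transpose_entry)
    then show ?thesis by simp
  qed
  ultimately show "norm (P ** contracted P) = 1 / norm P" using n by (simp add: power2_eq_square)
qed

text \<open>Before scaling, the two matrices are positive definite of determinant 1, and the trace
  of one times the inverse of the other is \<open>(norm B)\<^sup>2\<close>, whatever
  \<open>P\<close> is. The scaled matrices thus have inner product 1 minus
  \<open>(norm B)\<^sup>2\<close> over the product of the squared norms, while each of them has norm
  at most 1.\<close>

lemma norm_contracted_diff:
  assumes P: "det P = 1" and B: "det B = 1"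
  shows "(norm (contracted (B ** P) - contracted P))\<^sup>2 \<le> 2 * (norm B)\<^sup>2 / ((norm P)\<^sup>2 * (norm (B ** P))\<^sup>2)"
proof -
  define t t' where "t = (norm P)\<^sup>2" and "t' = (norm (B ** P))\<^sup>2"
  have t: "t > 0" "t' > 0"
    using norm_SL2_ge(1)[OF P] norm_SL2_ge(1)[of "B ** P"] P B by (auto simp: t_def t'_def det_mul)
  define a b c where "a = (P$2$2)\<^sup>2 + (P$1$2)\<^sup>2" and "b = (P$1$1)\<^sup>2 + (P$2$1)\<^sup>2"
    and "c = - (P$2$2 * P$2$1 + P$1$2 * P$1$1)"
  define P' where "P' = B ** P"
  define a' b' c' where "a' = (P'$2$2)\<^sup>2 + (P'$1$2)\<^sup>2" and "b' = (P'$1$1)\<^sup>2 + (P'$2$1)\<^sup>2"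
    and "c' = - (P'$2$2 * P'$2$1 + P'$1$2 * P'$1$1)"
  have d: "a * b - c\<^sup>2 = 1" "a' * b' - c'\<^sup>2 = 1"
  proof -
    have "a * b - c\<^sup>2 = (det P)\<^sup>2" unfolding a_def b_def c_def det_2 by algebra
    moreover have "a' * b' - c'\<^sup>2 = (det P')\<^sup>2" unfolding a'_def b'_def c'_def det_2 by algebra
    ultimately show "a * b - c\<^sup>2 = 1" "a' * b' - c'\<^sup>2 = 1" using P B by (simp_all add: P'_def det_mul)
  qed
  have tt: "a + b = t" "a' + b' = t'"
    unfolding t_def t'_def norm_matrix_2 a_def b_def a'_def b'_def P'_def by simp_all
  have cross: "a * b' + b * a' - 2 * c * c' = (norm B)\<^sup>2"
  proof -
    have dP: "P$1$1 * P$2$2 - P$1$2 * P$2$1 = 1" using P by (simp add: det_2)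
    have "a * b' + b * a' - 2 * c * c' = (norm B)\<^sup>2 * (P$1$1 * P$2$2 - P$1$2 * P$2$1)\<^sup>2"
      unfolding a_def b_def c_def a'_def b'_def c'_def P'_def norm_matrix_2 matrix_mult_2 by algebra
    then show ?thesis by (simp add: dP)
  qed
  have "(norm (contracted P' - contracted P))\<^sup>2 = (a' / t' - a / t)\<^sup>2 + 2 * (c' / t' - c / t)\<^sup>2 + (b' / t' - b / t)\<^sup>2"
    unfolding norm_matrix_2[of "contracted P' - contracted P"] vector_minus_component contracted_entries
    by (simp add: a_def b_def c_def a'_def b'_def c'_def t_def t'_def P'_def)
  also have "\<dots> = (a'\<^sup>2 + 2 * c'\<^sup>2 + b'\<^sup>2) / t'\<^sup>2 + (a\<^sup>2 + 2 * c\<^sup>2 + b\<^sup>2) / t\<^sup>2 - 2 * (a * a' + b * b' + 2 * c * c') / (t * t')"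
    using t by (simp add: power2_eq_square field_simps)
  also have "a'\<^sup>2 + 2 * c'\<^sup>2 + b'\<^sup>2 = t'\<^sup>2 - 2" using d(2) tt(2) by algebra
  also have "a\<^sup>2 + 2 * c\<^sup>2 + b\<^sup>2 = t\<^sup>2 - 2" using d(1) tt(1) by algebra
  also have "a * a' + b * b' + 2 * c * c' = t * t' - (norm B)\<^sup>2" using cross tt by algebra
  also have "(t'\<^sup>2 - 2) / t'\<^sup>2 + (t\<^sup>2 - 2) / t\<^sup>2 - 2 * (t * t' - (norm B)\<^sup>2) / (t * t')
      = 2 * (norm B)\<^sup>2 / (t * t') - 2 / t'\<^sup>2 - 2 / t\<^sup>2"
    using t by (simp add: diff_divide_distrib)
  also have "\<dots> \<le> 2 * (norm B)\<^sup>2 / (t * t')" using zero_le_power2[of t] zero_le_power2[of t'] by (smt (verit) divide_nonneg_nonneg)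
  finally show ?thesis by (simp add: P'_def t_def t'_def)
qed

text \<open>These are the orthogonal projections onto lines; as polynomial equations in the entries
  the conditions pass to limits.\<close>

definition line_proj :: "real ^ 2 ^ 2 \<Rightarrow> bool" where
  "line_proj Q \<longleftrightarrow> trace Q = 1 \<and> det Q = 0 \<and> Q $ 1 $ 2 = Q $ 2 $ 1"

definition cross2 :: "real ^ 2 \<Rightarrow> real ^ 2 \<Rightarrow> real" where
  "cross2 u v = u $ 1 * v $ 2 - u $ 2 * v $ 1"

lemma cross2_matrix: "cross2 (A *v u) (A *v v) = det A * cross2 u v"
  unfolding cross2_def matrix_vector_mult_2 det_2 by algebra

lemma vec_eq_2: "v = w \<longleftrightarrow> v $ 1 = w $ 1 \<and> v $ 2 = w $ (2::2)" for v w :: "'a ^ 2"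
  by (auto simp: vec_eq_iff forall_2)

lemma cross2_eq_0:
  assumes "cross2 u v = 0" "u \<noteq> 0"
  shows "\<exists>k. v = k *\<^sub>R u"
proof (cases "u $ 1 = 0")
  case True
  then have "u $ 2 \<noteq> 0" "v $ 1 = 0" using assms by (auto simp: vec_eq_2 cross2_def)
  then have "v = (v $ 2 / u $ 2) *\<^sub>R u" using True by (simp add: vec_eq_2)
  then show ?thesis by blast
next
  case False
  then have "v = (v $ 1 / u $ 1) *\<^sub>R u" using assms by (simp add: vec_eq_2 cross2_def field_simps)
  then show ?thesis by blast
qed

lemma line_proj_props:
  assumes Q: "line_proj Q"
  shows "Q *v (Q *v v) = Q *v v" and "\<exists>u. u \<noteq> 0 \<and> range ((*v) Q) = span {u}"
    and "subspace (range ((*v) Q))" and "dim (range ((*v) Q)) = 1"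
proof -
  define a b c where "a = Q$1$1" and "b = Q$2$2" and "c = Q$1$2"
  have abc: "a + b = 1" "a * b = c * c" "Q$1$1 = a" "Q$2$2 = b" "Q$1$2 = c" "Q$2$1 = c"
    using Q by (auto simp: line_proj_def a_def b_def c_def det_2)
  show "Q *v (Q *v v) = Q *v v" for v
    unfolding vec_eq_2 matrix_vector_mult_2 abc using abc(1,2) by algebra
  note idem = this
  have "\<exists>u. u \<noteq> 0 \<and> Q *v u = u"
  proof -
    have "Q \<noteq> 0" using abc by auto
    then have "Q *v axis 1 1 \<noteq> 0 \<or> Q *v axis 2 1 \<noteq> 0"
      unfolding vec_eq_2 matrix_vector_mult_2 matrix_eq_2 by (auto simp: axis_def)
    then show ?thesis using idem by blast
  qed
  then obtain u where u: "u \<noteq> 0" "Q *v u = u" by blast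
  have "range ((*v) Q) = span {u}"
  proof
    show "range ((*v) Q) \<subseteq> span {u}"
    proof
      fix v assume "v \<in> range ((*v) Q)"
      then obtain w where v: "v = Q *v w" by blast
      have "cross2 u v = det Q * cross2 u w" using cross2_matrix[of Q u w] u v by simp
      then have "cross2 u v = 0" using Q by (simp add: line_proj_def)
      then obtain k where "v = k *\<^sub>R u" using cross2_eq_0 u by blast
      then show "v \<in> span {u}" by (auto simp: span_singleton)
    qed
    show "span {u} \<subseteq> range ((*v) Q)"
    proof
      fix v assume "v \<in> span {u}"
      then obtain k where "v = k *\<^sub>R u" by (auto simp: span_singleton)
      then have "v = Q *v v" using u by (simp add: matrix_vector_mult_scaleR)
      then show "v \<in> range ((*v) Q)" by blast
    qed
  qed
  with u show "\<exists>u. u \<noteq> 0 \<and> range ((*v) Q) = span {u}" by blast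
  show "subspace (range ((*v) Q))" using \<open>range ((*v) Q) = span {u}\<close> by simp
  show "dim (range ((*v) Q)) = 1"
    unfolding \<open>range ((*v) Q) = span {u}\<close> using u by (simp add: dim_insert)
qed

text \<open>Successive contracted directions differ by at most a multiple of the reciprocal of two
  consecutive norms, hence converge geometrically. Growth counted from every time \<open>n\<close>,
  not just from 0, keeps \<open>P n ** Q\<close> of order \<open>1 / norm (P n)\<close>. The limit
  line contains all vectors that \<open>P n\<close> sends to 0, as two independent ones would
  contradict the preservation of area.\<close>

lemma stable_direction:
  fixes P B :: "nat \<Rightarrow> real ^ 2 ^ 2"
  assumes step: "\<And>n. P (Suc n) = B n ** P n" and det: "\<And>n. det (P n) = 1" "\<And>n. det (B n) = 1"
    and K: "\<And>n. norm (B n) \<le> K" and c: "0 < c" "c \<le> 1" and \<tau>: "1 < \<tau>"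
    and grow: "\<And>n m. n \<le> m \<Longrightarrow> c * \<tau> ^ (m - n) * norm (P n) \<le> norm (P m)"
  obtains Q where "(\<lambda>n. contracted (P n)) \<longlonglongrightarrow> Q" "line_proj Q"
    "\<And>n. norm (P n ** Q) \<le> (1 + 2 * K / c ^ 2 / (1 - 1 / \<tau>)) / norm (P n)"
    "range ((*v) Q) = {v. (\<lambda>n. P n *v v) \<longlonglongrightarrow> 0}"
proof -
  have P1: "norm (P n) \<ge> 1" for n by (rule norm_SL2_ge[OF det(1)])
  have K0: "K \<ge> 0" using K[of 0] norm_ge_zero order_trans by blast
  \<comment> \<open>The norms at times \<open>m\<close> and \<open>Suc m\<close> are at least
    \<open>c * \<tau> ^ (m - n) * norm (P n)\<close> and \<open>c * norm (P n)\<close>; this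
    accounts for \<open>c ^ 2\<close> and for the squared norm. The factor 2 rounds up a square root
    of 2.\<close>
  define E where "E = (\<lambda>n. 2 * K / c ^ 2 / (norm (P n))\<^sup>2)"
  have E0: "0 \<le> E n" for n using K0 c by (simp add: E_def)
  have d: "norm (contracted (P (Suc m)) - contracted (P m)) \<le> E n * (1 / \<tau>) ^ (m - n)" if "n \<le> m" for n m
  proof -
    define p where "p = c * \<tau> ^ (m - n) * norm (P n)"
    have p: "0 < p" "p \<le> norm (P m)" using grow[OF that] c \<tau> P1[of n] by (auto simp: p_def intro!: mult_pos_pos)
    have "c * norm (P n) \<le> c * \<tau> ^ (Suc m - n) * norm (P n)"
      using c \<tau> by (intro mult_right_mono) (auto simp: mult_le_cancel_left1 one_le_power)
    also have "\<dots> \<le> norm (P (Suc m))" using that by (intro grow) auto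
    finally have p': "c * norm (P n) \<le> norm (P (Suc m))" .
    have cp: "0 < c * norm (P n)" using c P1[of n] by (intro mult_pos_pos) auto
    have "(norm (contracted (P (Suc m)) - contracted (P m)))\<^sup>2 \<le> 2 * (norm (B m))\<^sup>2 / ((norm (P m))\<^sup>2 * (norm (P (Suc m)))\<^sup>2)"
      using norm_contracted_diff[OF det(1) det(2), of m m] by (simp add: step)
    also have "\<dots> \<le> 4 * K\<^sup>2 / (p\<^sup>2 * (c * norm (P n))\<^sup>2)"
    proof (rule frac_le)
      have "(norm (B m))\<^sup>2 \<le> K\<^sup>2" using K by (intro power_mono) auto
      then show "2 * (norm (B m))\<^sup>2 \<le> 4 * K\<^sup>2" using zero_le_power2[of K] by linarith
      show "p\<^sup>2 * (c * norm (P n))\<^sup>2 \<le> (norm (P m))\<^sup>2 * (norm (P (Suc m)))\<^sup>2"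
        using p p' cp by (intro mult_mono power_mono) auto
      show "0 < p\<^sup>2 * (c * norm (P n))\<^sup>2" by (rule mult_pos_pos[OF zero_less_power[OF p(1)] zero_less_power[OF cp]])
    qed simp
    also have "\<dots> = (2 * K / (p * (c * norm (P n))))\<^sup>2" by (simp add: power_divide power_mult_distrib)
    finally have "norm (contracted (P (Suc m)) - contracted (P m)) \<le> 2 * K / (p * (c * norm (P n)))"
      by (rule power2_le_imp_le) (intro divide_nonneg_nonneg mult_nonneg_nonneg, use p c K0 in auto)
    also have "\<dots> = E n * (1 / \<tau>) ^ (m - n)"
      by (simp add: E_def p_def power_divide power2_eq_square)
    finally show ?thesis .
  qed
  obtain Q where Q: "(\<lambda>n. contracted (P n)) \<longlonglongrightarrow> Q" and Qn: "\<And>n. norm (Q - contracted (P n)) \<le> E n / (1 - 1 / \<tau>)"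
    by (rule geometric_Cauchy_limit[of "1 / \<tau>" "\<lambda>n. contracted (P n)" E]) (use \<tau> d E0 in auto)
  have ent: "(\<lambda>n. contracted (P n) $ i $ j) \<longlonglongrightarrow> Q $ i $ j" for i j
    by (intro tendsto_vec_nth Q)
  have inv0: "(\<lambda>n. 1 / norm (P n)) \<longlonglongrightarrow> 0"
  proof (rule tendsto_sandwich[OF _ _ tendsto_const])
    have "1 / norm (P n) \<le> (1 / c) * (1 / \<tau>) ^ n" for n
    proof -
      have "c * \<tau> ^ n \<le> c * \<tau> ^ n * norm (P 0)" using mult_left_mono[OF P1[of 0], of "c * \<tau> ^ n"] c \<tau> by simp
      also have "\<dots> \<le> norm (P n)" using grow[of 0 n] by simp
      finally have "1 / norm (P n) \<le> 1 / (c * \<tau> ^ n)" using c \<tau> by (intro divide_left_mono) (auto intro!: mult_pos_pos P1[THEN less_le_trans[OF zero_less_one]])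
      then show ?thesis by (simp add: power_divide)
    qed
    then show "\<forall>\<^sub>F n in sequentially. 1 / norm (P n) \<le> (1 / c) * (1 / \<tau>) ^ n" by simp
    show "(\<lambda>n. 1 / c * (1 / \<tau>) ^ n) \<longlonglongrightarrow> 0"
      using \<tau> by (intro tendsto_mult_right_zero LIMSEQ_power_zero) auto
  qed simp
  have proj: "line_proj Q"
  proof -
    have "(\<lambda>n. contracted (P n) $ 1 $ 1 + contracted (P n) $ 2 $ 2) \<longlonglongrightarrow> Q $ 1 $ 1 + Q $ 2 $ 2"
      by (intro tendsto_intros ent)
    moreover have "contracted (P n) $ 1 $ 1 + contracted (P n) $ 2 $ 2 = 1" for n
      using contracted_props(1)[OF det(1)] by simp
    ultimately have 1: "Q $ 1 $ 1 + Q $ 2 $ 2 = 1" by (simp add: LIMSEQ_const_iff)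
    have 2: "Q $ 1 $ 2 = Q $ 2 $ 1"
      using ent[of 1 2] ent[of 2 1] LIMSEQ_unique contracted_props(2)[OF det(1)] by auto
    have "(\<lambda>n. det (contracted (P n))) \<longlonglongrightarrow> det Q"
      unfolding det_2 by (intro tendsto_intros ent)
    moreover have "(\<lambda>n. det (contracted (P n))) \<longlonglongrightarrow> 0"
      using tendsto_power[OF inv0, of 4] by (simp add: contracted_props(3)[OF det(1)] power_divide)
    ultimately have "det Q = 0" by (rule LIMSEQ_unique)
    then show ?thesis using 1 2 by (simp add: line_proj_def)
  qed
  have bd: "norm (P n ** Q) \<le> (1 + 2 * K / c ^ 2 / (1 - 1 / \<tau>)) / norm (P n)" for n
  proof -
    have "P n ** Q = P n ** contracted (P n) + P n ** (Q - contracted (P n))"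
      by (simp add: matrix_eq_2 matrix_mult_2 algebra_simps)
    then have "norm (P n ** Q) \<le> norm (P n ** contracted (P n)) + norm (P n ** (Q - contracted (P n)))"
      by (metis norm_triangle_ineq)
    also have "\<dots> \<le> 1 / norm (P n) + norm (P n) * (E n / (1 - 1 / \<tau>))"
      using contracted_props(4)[OF det(1)] norm_matrix_mult_le[of "P n" "Q - contracted (P n)"]
        mult_left_mono[OF Qn[of n], of "norm (P n)"] by simp
    also have "\<dots> = (1 + 2 * K / c ^ 2 / (1 - 1 / \<tau>)) / norm (P n)"
      using P1[of n] by (simp add: E_def power2_eq_square add_divide_distrib)
    finally show ?thesis .
  qed
  define C where "C = 1 + 2 * K / c ^ 2 / (1 - 1 / \<tau>)"
  have tends: "(\<lambda>n. P n *v (Q *v w)) \<longlonglongrightarrow> 0" for w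
  proof (rule Lim_null_comparison)
    show "\<forall>\<^sub>F n in sequentially. norm (P n *v (Q *v w)) \<le> C * norm w * (1 / norm (P n))"
    proof (intro always_eventually allI)
      fix n
      have "norm (P n *v (Q *v w)) \<le> norm (P n ** Q) * norm w"
        using norm_matrix_vector_le[of "P n ** Q" w] by (simp add: matrix_vector_mul_assoc)
      also have "\<dots> \<le> C / norm (P n) * norm w" unfolding C_def by (intro mult_right_mono bd) auto
      finally show "norm (P n *v (Q *v w)) \<le> C * norm w * (1 / norm (P n))" by (simp add: mult_ac)
    qed
    show "(\<lambda>n. C * norm w * (1 / norm (P n))) \<longlonglongrightarrow> 0" by (intro tendsto_mult_right_zero inv0)
  qed
  have "range ((*v) Q) = {v. (\<lambda>n. P n *v v) \<longlonglongrightarrow> 0}"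
  proof (intro equalityI subsetI CollectI)
    fix v assume "v \<in> range ((*v) Q)"
    then show "(\<lambda>n. P n *v v) \<longlonglongrightarrow> 0" using tends by auto
  next
    fix v assume "v \<in> {v. (\<lambda>n. P n *v v) \<longlonglongrightarrow> 0}"
    then have v: "(\<lambda>n. P n *v v) \<longlonglongrightarrow> 0" by simp
    obtain u where u: "u \<noteq> 0" "range ((*v) Q) = span {u}" using line_proj_props(2)[OF proj] by blast
    then have "u \<in> range ((*v) Q)" by (simp add: span_base)
    then have u0: "(\<lambda>n. P n *v u) \<longlonglongrightarrow> 0" using tends by auto
    have "(\<lambda>n. cross2 (P n *v u) (P n *v v)) \<longlonglongrightarrow> cross2 0 0"
      unfolding cross2_def by (intro tendsto_intros u0 v)
    then have "(\<lambda>n. cross2 u v) \<longlonglongrightarrow> 0" by (simp add: cross2_matrix det cross2_def[of 0])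
    then have "cross2 u v = 0" using LIMSEQ_const_iff by blast
    then obtain k where "v = k *\<^sub>R u" using cross2_eq_0 u by blast
    then show "v \<in> range ((*v) Q)" unfolding u(2) by (auto simp: span_singleton)
  qed
  with Q proj bd that show ?thesis by blast
qed

section \<open>Uniform growth of words\<close>

lemma norm_rot_diff: "norm (rot t - mat 1) \<le> 2 * \<bar>t\<bar>"
proof (rule power2_le_imp_le)
  have "\<bar>sin (t / 2)\<bar> \<le> \<bar>t / 2\<bar>" by (rule abs_sin_x_le_abs_x)
  then have s: "(sin (t / 2))\<^sup>2 \<le> t\<^sup>2 / 4" using power_mono[of "\<bar>sin (t / 2)\<bar>" "\<bar>t / 2\<bar>" 2] by (simp add: power_divide)
  have "cos t = 1 - 2 * (sin (t / 2))\<^sup>2" using cos_double_sin[of "t / 2"] by simp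
  moreover have "(norm (rot t - mat 1))\<^sup>2 = 2 * (cos t - 1)\<^sup>2 + 2 * (sin t)\<^sup>2"
    unfolding norm_matrix_2 by simp
  moreover have "\<dots> = 4 - 4 * cos t" using sin_cos_squared_add[of t] by algebra
  ultimately have "(norm (rot t - mat 1))\<^sup>2 = 8 * (sin (t / 2))\<^sup>2" by simp
  also have "\<dots> \<le> 4 * t\<^sup>2" using s zero_le_power2[of t] by linarith
  also have "\<dots> = (2 * \<bar>t\<bar>)\<^sup>2" by (simp add: power_mult_distrib)
  finally show "(norm (rot t - mat 1))\<^sup>2 \<le> (2 * \<bar>t\<bar>)\<^sup>2" .
qed simp

lemma norm_rot_mult_diff:
  "norm (rot t ** B - B) \<le> 2 * \<bar>t\<bar> * norm B" "norm (B ** rot t - B) \<le> 2 * \<bar>t\<bar> * norm B" for B :: "real ^ 2 ^ 2"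
proof -
  have 1: "rot t ** B - B = (rot t - mat 1) ** B" "B ** rot t - B = B ** (rot t - mat 1)"
    by (simp_all add: matrix_eq_2 matrix_mult_2 algebra_simps)
  have "norm ((rot t - mat 1) ** B) \<le> norm (rot t - mat 1) * norm B" by (rule norm_matrix_mult_le)
  also have "\<dots> \<le> 2 * \<bar>t\<bar> * norm B" by (intro mult_right_mono norm_rot_diff) simp
  finally show "norm (rot t ** B - B) \<le> 2 * \<bar>t\<bar> * norm B" unfolding 1 .
  have "norm (B ** (rot t - mat 1)) \<le> norm B * norm (rot t - mat 1)" by (rule norm_matrix_mult_le)
  also have "\<dots> \<le> norm B * (2 * \<bar>t\<bar>)" by (intro mult_left_mono norm_rot_diff) simp
  finally show "norm (B ** rot t - B) \<le> 2 * \<bar>t\<bar> * norm B" unfolding 1 by (simp add: mult_ac)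
qed

lemma wprod_mult_rot:
  assumes "Bs \<noteq> []"
  shows "wprod Bs ** rot t = wprod (butlast Bs @ [last Bs ** rot t])"
proof -
  have "wprod Bs = wprod (butlast Bs @ [last Bs])" using assms by simp
  then show ?thesis unfolding wprod_append by (simp add: matrix_mul_assoc)
qed

text \<open>A rotation to the right of a word is absorbed into its last letter, which stays in
  \<open>S'\<close>; so no product of two words rotated in this way has trace 0, and the norm of a
  product is comparable to the product of the norms. Combined with the exponential growth of one
  factor this gives growth from any intermediate time, on either side. In \<open>c\<close>, a factor
  1/2 comes from the product estimate, 1/4 from the growth of a single word, and 1/2 is
  slack.\<close>

lemma word_growth:
  assumes S: "\<And>B. B \<in> S \<Longrightarrow> det B = 1"
    and r: "0 < r" "r \<le> pi / 4"
    and S': "\<And>B t. B \<in> S \<Longrightarrow> \<bar>t\<bar> \<le> r \<Longrightarrow> rot t ** B \<in> S'" "\<And>B t. B \<in> S \<Longrightarrow> \<bar>t\<bar> \<le> r \<Longrightarrow> B ** rot t \<in> S'"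
    and tr: "\<And>Bs. Bs \<noteq> [] \<Longrightarrow> set Bs \<subseteq> S' \<Longrightarrow> \<bar>trace (wprod Bs)\<bar> > 2"
    and Bs: "set Bs \<subseteq> S" and Cs: "set Cs \<subseteq> S"
  defines "c \<equiv> (sin r)\<^sup>2 / 16"
  shows "c * exp (r / 2) ^ length Cs * norm (wprod Bs) \<le> norm (wprod (Cs @ Bs))"
    and "c * exp (r / 2) ^ length Bs * norm (wprod Cs) \<le> norm (wprod (Cs @ Bs))"
proof -
  have rot0: "rot 0 = mat 1" by (simp add: matrix_eq_2)
  have SS: "S \<subseteq> S'"
  proof
    fix B assume "B \<in> S"
    then have "rot 0 ** B \<in> S'" using r by (intro S'(1)) auto
    then show "B \<in> S'" by (simp add: rot0)
  qed
  have c: "0 < c" "c \<le> 1 / 16"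
    unfolding c_def using r sin_gt_zero[of r] abs_sin_le_one[of r] by (auto simp: abs_square_le_1)
  have n1: "norm (mat 1 :: real ^ 2 ^ 2) \<le> 2"
    by (rule power2_le_imp_le) (simp_all add: norm_matrix_2)
  have d: "det (wprod Ds) = 1" if "set Ds \<subseteq> S" for Ds using det_wprod S that by blast
  have g: "exp (r / 2) ^ length Ds / 4 \<le> norm (wprod Ds)" if "set Ds \<subseteq> S" for Ds
  proof (cases "Ds = []")
    case True then show ?thesis using norm_SL2_ge(2)[OF d[OF that]] by simp
  next
    case False
    have t2: "\<bar>trace (wprod Ds)\<bar> > 2" using tr False that SS by blast
    have "exp (length Ds * r / 2) \<le> \<bar>trace (wprod Ds)\<bar> + 1"
    proof (rule trace_wprod_growth[OF _ False r(1)])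
      fix t assume "\<bar>t\<bar> \<le> r"
      then show "\<bar>trace (wprod (map (\<lambda>B. rot t ** B) Ds))\<bar> > 2"
        using False that S'(1) by (intro tr) auto
    qed (use S that in auto)
    also have "\<dots> \<le> 2 * \<bar>trace (wprod Ds)\<bar>" using t2 by simp
    also have "\<bar>trace (wprod Ds)\<bar> \<le> 2 * norm (wprod Ds)"
      using trace_rot_le[OF d[OF that], of 0] by (simp add: rot0 del: trace_2)
    finally show ?thesis by (simp add: exp_of_nat_mult[symmetric] mult.commute)
  qed
  have e: "exp (r / 2) ^ k \<ge> 1" for k using r by (intro one_le_power) auto
  have q: "norm (wprod (Cs @ Bs)) \<ge> 8 * c * (norm (wprod Cs) * norm (wprod Bs))" if ne: "Bs \<noteq> []" "Cs \<noteq> []"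
  proof -
    have "norm (wprod Cs ** wprod Bs) \<ge> (sin r)\<^sup>2 / 2 * (norm (wprod Cs) * norm (wprod Bs))"
    proof (rule norm_mult_ge_of_trace_ne_0[OF d[OF Bs] d[OF Cs] r])
      fix s t assume st: "\<bar>s\<bar> \<le> r" "\<bar>t\<bar> \<le> r"
      have sub: "set (butlast Ds @ [last Ds ** rot u]) \<subseteq> S'" if "set Ds \<subseteq> S" "Ds \<noteq> []" "\<bar>u\<bar> \<le> r" for Ds u
        using that S'(2)[of "last Ds" u] SS last_in_set[of Ds] subsetD[OF that(1), of "last Ds"] by (auto dest: in_set_butlastD)
      have "\<bar>trace ((wprod Cs ** rot t) ** (wprod Bs ** rot s))\<bar> > 2"
        unfolding wprod_mult_rot[OF ne(1)] wprod_mult_rot[OF ne(2)] wprod_append[symmetric]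
        using sub[OF Bs ne(1) st(1)] sub[OF Cs ne(2) st(2)] by (intro tr) auto
      then show "trace ((wprod Cs ** rot t) ** (wprod Bs ** rot s)) \<noteq> 0" by auto
    qed
    then show ?thesis by (simp add: wprod_append c_def)
  qed
  have pos: "norm (wprod Bs) > 0" "norm (wprod Cs) > 0"
    using norm_SL2_ge(2)[OF d[OF Bs]] norm_SL2_ge(2)[OF d[OF Cs]] by auto
  have one: "c * E * N \<le> E / 4" if "N \<le> 2" "E \<ge> 1" for E N :: real
  proof -
    have "c * E * N \<le> (1/16) * E * 2"
      using that c by (intro order_trans[OF mult_left_mono[of N 2]] mult_right_mono) auto
    then show ?thesis using that by simp
  qed
  show "c * exp (r / 2) ^ length Cs * norm (wprod Bs) \<le> norm (wprod (Cs @ Bs))"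
  proof (cases "Bs = [] \<or> Cs = []")
    case True
    then show ?thesis
    proof
      assume "Bs = []"
      then show ?thesis using order_trans[OF one[OF n1 e[of "length Cs"]] g[OF Cs]] by simp
    next
      assume "Cs = []"
      then show ?thesis using mult_right_mono[of c 1 "norm (wprod Bs)"] c by simp
    qed
  next
    case False
    have "c * exp (r / 2) ^ length Cs * norm (wprod Bs) \<le> 4 * (c * (norm (wprod Cs) * norm (wprod Bs)))"
      using mult_right_mono[OF mult_left_mono[OF g[OF Cs], of "4 * c"], of "norm (wprod Bs)"] c
      by (simp add: mult_ac)
    moreover have "c * (norm (wprod Cs) * norm (wprod Bs)) \<ge> 0" using c by simp
    ultimately show ?thesis using q False by linarith
  qed
  show "c * exp (r / 2) ^ length Bs * norm (wprod Cs) \<le> norm (wprod (Cs @ Bs))"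
  proof (cases "Bs = [] \<or> Cs = []")
    case True
    then show ?thesis
    proof
      assume "Cs = []"
      then show ?thesis using order_trans[OF one[OF n1 e[of "length Bs"]] g[OF Bs]] by simp
    next
      assume "Bs = []"
      then show ?thesis using mult_right_mono[of c 1 "norm (wprod Cs)"] c by simp
    qed
  next
    case False
    have "c * exp (r / 2) ^ length Bs * norm (wprod Cs) \<le> 4 * (c * (norm (wprod Cs) * norm (wprod Bs)))"
      using mult_right_mono[OF mult_left_mono[OF g[OF Bs], of "4 * c"], of "norm (wprod Cs)"] c
      by (simp add: mult_ac)
    moreover have "c * (norm (wprod Cs) * norm (wprod Bs)) \<ge> 0" using c by simp
    ultimately show ?thesis using q False by linarith
  qed
qed

section \<open>Automorphisms and their cocycles\<close>

lemma automorphism_space: "f \<in> automorphisms L \<Longrightarrow> x \<in> space L \<Longrightarrow> f x \<in> space L"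
  by (auto simp: automorphisms_def bij_betw_def)

lemma automorphism_measurable: "f \<in> automorphisms L \<Longrightarrow> f \<in> measurable L L"
  by (simp add: automorphisms_def)

lemma automorphism_AE:
  assumes "f \<in> automorphisms L" "AE x in L. P x" shows "AE x in L. P (f x)"
proof -
  have "distr L L f = L" "f \<in> measurable L L" using assms by (auto simp: automorphisms_def)
  then show ?thesis using AE_distrD[of f L L P] assms(2) by metis
qed

lemma automorphism_inv_into:
  assumes f: "f \<in> automorphisms L"
  defines "g \<equiv> inv_into (space L) f"
  shows "x \<in> space L \<Longrightarrow> g (f x) = x" "x \<in> space L \<Longrightarrow> f (g x) = x" "g \<in> automorphisms L"
proof -
  have b: "bij_betw f (space L) (space L)" using f by (simp add: automorphisms_def)
  show gf: "x \<in> space L \<Longrightarrow> g (f x) = x" for x using b by (simp add: g_def bij_betw_inv_into_left)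
  show fg: "x \<in> space L \<Longrightarrow> f (g x) = x" for x using b by (simp add: g_def bij_betw_inv_into_right)
  have bg: "bij_betw g (space L) (space L)" using b by (simp add: g_def bij_betw_inv_into)
  have gm: "g \<in> measurable L L" and fm: "f \<in> measurable L L" and d: "distr L L f = L"
    using f by (auto simp: automorphisms_def g_def)
  have "inv_into (space L) g x = f x" if "x \<in> space L" for x
    using that bg gf by (metis automorphism_space f bij_betw_inv_into_left)
  then have "inv_into (space L) g \<in> measurable L L" using fm measurable_cong by blast
  moreover have "distr L L g = L"
  proof -
    have "distr L L g = distr (distr L L f) L g" by (simp add: d)
    also have "\<dots> = distr L L (g \<circ> f)" by (rule distr_distr[OF gm fm])
    also have "\<dots> = distr L L (\<lambda>x. x)" by (rule distr_cong) (auto simp: gf)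
    finally show ?thesis by (simp add: distr_id2)
  qed
  ultimately show "g \<in> automorphisms L" using bg gm by (simp add: automorphisms_def)
qed

lemma automorphism_funpow_space: "f \<in> automorphisms L \<Longrightarrow> x \<in> space L \<Longrightarrow> (f ^^ n) x \<in> space L"
  by (induction n) (auto simp: automorphism_space)

lemma automorphism_funpow_measurable: "f \<in> automorphisms L \<Longrightarrow> f ^^ n \<in> measurable L L"
  by (induction n) (auto simp: automorphism_measurable id_def intro: measurable_comp)

lemma automorphism_funpow_AE:
  assumes "f \<in> automorphisms L" "AE x in L. P x" shows "AE x in L. P ((f ^^ n) x)"
  using assms(2)
proof (induction n arbitrary: P)
  case (Suc n)
  from Suc.IH[OF automorphism_AE[OF assms(1) Suc.prems]] show ?case by simp
qed simp

lemma cocycle_add: "cocycle f A (m + n) x = cocycle f A m ((f ^^ n) x) ** cocycle f A n x"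
proof (induction m)
  case (Suc m)
  have "(f ^^ (m + n)) x = (f ^^ m) ((f ^^ n) x)" by (simp add: funpow_add)
  then show ?case using Suc by (simp add: matrix_mul_assoc)
qed simp

primrec letters :: "('a \<Rightarrow> 'a) \<Rightarrow> ('a \<Rightarrow> real ^ 2 ^ 2) \<Rightarrow> nat \<Rightarrow> 'a \<Rightarrow> (real ^ 2 ^ 2) list" where
  "letters f A 0 x = []"
| "letters f A (Suc n) x = A ((f ^^ n) x) # letters f A n x"

lemma wprod_letters: "wprod (letters f A n x) = cocycle f A n x"
  by (induction n) simp_all

lemma length_letters [simp]: "length (letters f A n x) = n"
  by (induction n) simp_all

lemma set_letters: "set (letters f A n x) = (\<lambda>i. A ((f ^^ i) x)) ` {..<n}"
  by (induction n) (auto simp: lessThan_Suc)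

lemma det_cocycle:
  assumes "f \<in> automorphisms L" "A \<in> bounded_SL2 L" "x \<in> space L"
  shows "det (cocycle f A n x) = 1"
  by (induction n)
    (use assms automorphism_funpow_space[OF assms(1,3)] in \<open>auto simp: det_mul bounded_SL2_def\<close>)

lemma borel_measurable_matrix:
  fixes F :: "'a \<Rightarrow> real ^ 2 ^ 2"
  assumes "\<And>i j. (\<lambda>x. F x $ i $ j) \<in> borel_measurable M"
  shows "F \<in> borel_measurable M"
proof (rule borel_measurable_euclidean_space[THEN iffD2], rule ballI)
  fix b :: "real ^ 2 ^ 2" assume "b \<in> Basis"
  then obtain i j where "b = axis i (axis j 1)" by (auto simp: Basis_vec_def)
  then have "(\<lambda>x. F x \<bullet> b) = (\<lambda>x. F x $ i $ j)" by (simp add: inner_axis fun_eq_iff)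
  then show "(\<lambda>x. F x \<bullet> b) \<in> borel_measurable M" using assms by simp
qed

lemma borel_measurable_matrix_nth [measurable (raw)]:
  fixes F :: "'a \<Rightarrow> real ^ 2 ^ 2"
  assumes "F \<in> borel_measurable M"
  shows "(\<lambda>x. F x $ i $ j) \<in> borel_measurable M"
  by (rule borel_measurable_continuous_on[OF _ assms]) (intro continuous_intros)

lemma measurable_matrix_mult [measurable (raw)]:
  fixes F G :: "'a \<Rightarrow> real ^ 2 ^ 2"
  assumes [measurable]: "F \<in> borel_measurable M" "G \<in> borel_measurable M"
  shows "(\<lambda>x. F x ** G x) \<in> borel_measurable M"
  by (rule borel_measurable_matrix) (simp add: matrix_mult_2)

lemma measurable_adj2 [measurable (raw)]:
  assumes [measurable]: "F \<in> borel_measurable M"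
  shows "(\<lambda>x. adj2 (F x)) \<in> borel_measurable M"
  by (rule borel_measurable_continuous_on[OF continuous_adj2 assms])

lemma measurable_contracted [measurable (raw)]:
  assumes [measurable]: "F \<in> borel_measurable M"
  shows "(\<lambda>x. contracted (F x)) \<in> borel_measurable M"
proof (rule borel_measurable_matrix)
  fix i j :: 2
  show "(\<lambda>x. contracted (F x) $ i $ j) \<in> borel_measurable M"
    using exhaust_2[of i] exhaust_2[of j] by (auto simp: contracted_entries)
qed

lemma measurable_cocycle:
  assumes f: "f \<in> automorphisms L" and A: "A \<in> borel_measurable L"
  shows "(\<lambda>x. cocycle f A n x) \<in> borel_measurable L"
proof (induction n)
  case (Suc n)
  have [measurable]: "(\<lambda>x. A ((f ^^ n) x)) \<in> borel_measurable L"
    using measurable_compose[OF automorphism_funpow_measurable[OF f] A] .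
  note Suc [measurable]
  show ?case by simp
qed simp

lemma opnorm_le_norm: "opnorm A \<le> norm A" for A :: "real ^ 2 ^ 2"
  unfolding opnorm_def by (rule onorm_le) (rule norm_matrix_vector_le)

lemma norm_le_opnorm: "norm A \<le> 2 * opnorm A" for A :: "real ^ 2 ^ 2"
proof (rule power2_le_imp_le)
  have "(A $ i $ j)\<^sup>2 \<le> (opnorm A)\<^sup>2" for i j
    using power_mono[OF entry_le_opnorm[of A i j], of 2] by simp
  from this[of 1 1] this[of 1 2] this[of 2 1] this[of 2 2]
  show "(norm A)\<^sup>2 \<le> (2 * opnorm A)\<^sup>2"
    unfolding norm_matrix_2 power_mult_distrib by simp
qed (use opnorm_nonneg[of A] in simp)

section \<open>Robust hyperbolicity\<close>

text \<open>Positive measure replaces attained values, so that null sets do not matter and orbits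
  can be routed through points where \<open>A\<close> is close to the given matrix.\<close>

definition near_values :: "'a measure \<Rightarrow> ('a \<Rightarrow> real ^ 2 ^ 2) \<Rightarrow> real \<Rightarrow> (real ^ 2 ^ 2) set" where
  "near_values L A \<delta> = {B. det B = 1 \<and> emeasure L {x \<in> space L. norm (A x - B) < \<delta>} > 0}"

definition robustly_hyperbolic :: "'a measure \<Rightarrow> ('a \<Rightarrow> real ^ 2 ^ 2) \<Rightarrow> bool" where
  "robustly_hyperbolic L A \<longleftrightarrow> (\<exists>\<delta>>0. \<forall>Bs. Bs \<noteq> [] \<longrightarrow> set Bs \<subseteq> near_values L A \<delta> \<longrightarrow> \<bar>trace (wprod Bs)\<bar> > 2)"

lemma near_set_measurable:
  assumes "A \<in> borel_measurable L"
  shows "{x \<in> space L. norm (A x - (B :: real ^ 2 ^ 2)) < \<delta>} \<in> sets L"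
  using assms by measurable

text \<open>In a countable dense set only countably many members are approached by \<open>A\<close>
  merely on a null set; off the union of these null sets, a dense point close to \<open>A x\<close>
  witnesses the claim.\<close>

lemma AE_near_values:
  assumes A: "A \<in> bounded_SL2 L" and \<delta>: "\<delta> > 0"
  shows "AE x in L. A x \<in> near_values L A \<delta>"
proof -
  have Am [measurable]: "A \<in> borel_measurable L" and det: "\<And>x. x \<in> space L \<Longrightarrow> det (A x) = 1"
    using A by (auto simp: bounded_SL2_def)
  obtain D :: "(real ^ 2 ^ 2) set" where D: "countable D" "\<And>X. open X \<Longrightarrow> X \<noteq> {} \<Longrightarrow> \<exists>d\<in>D. d \<in> X"
    using countable_dense_exists[where 'a = "real ^ 2 ^ 2"] by blast
  define Z where "Z = {d \<in> D. emeasure L {x \<in> space L. norm (A x - d) < \<delta> / 2} = 0}"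
  have "AE x in L. \<forall>d\<in>Z. \<not> norm (A x - d) < \<delta> / 2"
  proof (rule AE_ball_countable[THEN iffD2], rule countable_subset[OF _ D(1)])
    show "Z \<subseteq> D" by (auto simp: Z_def)
    show "\<forall>d\<in>Z. AE x in L. \<not> norm (A x - d) < \<delta> / 2"
    proof
      fix d assume d: "d \<in> Z"
      show "AE x in L. \<not> norm (A x - d) < \<delta> / 2"
        by (rule AE_I[where N = "{x \<in> space L. norm (A x - d) < \<delta> / 2}"])
          (use d near_set_measurable[OF Am] in \<open>auto simp: Z_def\<close>)
    qed
  qed
  then show ?thesis using AE_space
  proof eventually_elim
    case (elim x)
    obtain d where d: "d \<in> D" "d \<in> ball (A x) (\<delta> / 2)" using D(2)[of "ball (A x) (\<delta> / 2)"] \<delta> by auto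
    then have xd: "norm (A x - d) < \<delta> / 2" by (simp add: dist_norm)
    then have "d \<notin> Z" using elim by auto
    then have "0 < emeasure L {y \<in> space L. norm (A y - d) < \<delta> / 2}"
      using d by (auto simp: Z_def zero_less_iff_neq_zero)
    also have "\<dots> \<le> emeasure L {y \<in> space L. norm (A y - A x) < \<delta>}"
    proof (rule emeasure_mono[OF _ near_set_measurable[OF Am]], intro subsetI CollectI conjI)
      fix y assume y: "y \<in> {y \<in> space L. norm (A y - d) < \<delta> / 2}"
      then show "y \<in> space L" by simp
      have "norm ((A y - d) - (A x - d)) \<le> norm (A y - d) + norm (A x - d)" by (rule norm_triangle_ineq4)
      then show "norm (A y - A x) < \<delta>" using y xd by simp
    qed
    finally show ?case using det elim by (simp add: near_values_def)
  qed
qed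

lemma near_values_perturb:
  assumes B: "B \<in> near_values L A \<delta>" and B': "det B' = 1" "norm (B' - B) \<le> \<epsilon>" and A: "A \<in> borel_measurable L"
  shows "B' \<in> near_values L A (\<delta> + \<epsilon>)"
proof -
  have "0 < emeasure L {y \<in> space L. norm (A y - B) < \<delta>}" using B by (simp add: near_values_def)
  also have "\<dots> \<le> emeasure L {y \<in> space L. norm (A y - B') < \<delta> + \<epsilon>}"
  proof (rule emeasure_mono[OF _ near_set_measurable[OF A]], intro subsetI CollectI conjI)
    fix y assume y: "y \<in> {y \<in> space L. norm (A y - B) < \<delta>}"
    then show "y \<in> space L" by simp
    have "norm ((A y - B) - (B' - B)) \<le> norm (A y - B) + norm (B' - B)" by (rule norm_triangle_ineq4)
    then show "norm (A y - B') < \<delta> + \<epsilon>" using y B' by simp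
  qed
  finally show ?thesis using B' by (simp add: near_values_def)
qed

text \<open>The range of a matrix meets an open set iff it does so at the image of a member of a
  fixed countable dense set, which turns the condition into a countable union.\<close>

lemma measurable_line_field_range:
  fixes Q :: "'a \<Rightarrow> real ^ 2 ^ 2"
  assumes Q: "Q \<in> borel_measurable L" and proj: "\<And>x. x \<in> space L \<Longrightarrow> line_proj (Q x)"
  shows "measurable_line_field L (\<lambda>x. range ((*v) (Q x)))"
  unfolding measurable_line_field_def
proof (intro conjI ballI allI impI)
  fix U :: "(real ^ 2) set" assume U: "open U"
  obtain D :: "(real ^ 2) set" where D: "countable D" "\<And>X. open X \<Longrightarrow> X \<noteq> {} \<Longrightarrow> \<exists>d\<in>D. d \<in> X"
    using countable_dense_exists[where 'a = "real ^ 2"] by blast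
  have "{x \<in> space L. range ((*v) (Q x)) \<inter> U \<noteq> {}} = (\<Union>d\<in>D. {x \<in> space L. Q x *v d \<in> U})"
  proof (intro equalityI subsetI)
    fix x assume x: "x \<in> {x \<in> space L. range ((*v) (Q x)) \<inter> U \<noteq> {}}"
    have "open ((*v) (Q x) -` U)"
      by (rule open_vimage[OF U]) (intro linear_continuous_on bounded_linear_matrix)
    moreover have "(*v) (Q x) -` U \<noteq> {}" using x by auto
    ultimately obtain d where "d \<in> D" "Q x *v d \<in> U" using D(2) by blast
    then show "x \<in> (\<Union>d\<in>D. {x \<in> space L. Q x *v d \<in> U})" using x by auto
  qed auto
  also have "\<dots> \<in> sets L"
  proof -
    have "{x \<in> space L. Q x *v d \<in> U} \<in> sets L" for d
    proof -
      have "continuous_on UNIV (\<lambda>M :: real ^ 2 ^ 2. M *v d)"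
        unfolding matrix_vector_mult_def by (intro continuous_intros continuous_on_vec_lambda)
      then have "(\<lambda>x. Q x *v d) \<in> borel_measurable L" by (rule borel_measurable_continuous_on[OF _ Q])
      from measurable_sets[OF this, of U] U show ?thesis
        by (simp add: vimage_def Int_def conj_commute)
    qed
    then show ?thesis using D(1) by (intro sets.countable_UN') auto
  qed
  finally show "{x \<in> space L. range ((*v) (Q x)) \<inter> U \<noteq> {}} \<in> sets L" .
qed (use proj line_proj_props in auto)

lemma onorm_on_le:
  fixes E :: "'a::real_normed_vector set" and T :: "'a \<Rightarrow> 'b::real_normed_vector"
  assumes "E \<noteq> {}" "0 \<le> b" "\<And>v. v \<in> E \<Longrightarrow> norm (T v) \<le> b * norm v"
  shows "onorm_on E T \<le> b"
  unfolding onorm_on_def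
proof (rule cSUP_least[OF assms(1)])
  fix v assume "v \<in> E"
  show "norm (T v) / norm v \<le> b" using assms(3)[OF \<open>v \<in> E\<close>] assms(2)
    by (cases "v = 0") (auto simp: field_simps)
qed

text \<open>The stable line consists of the vectors contracted by the forward products, the unstable
  line of those contracted by the inverse products along the backward orbit. Word growth holds for
  all words in nearby values, so the constants are the same at all points of a set of full
  measure.\<close>

lemma robustly_hyperbolic_imp_uniformly_hyperbolic:
  assumes f: "f \<in> automorphisms L" and A: "A \<in> bounded_SL2 L" and rob: "robustly_hyperbolic L A"
  shows "uniformly_hyperbolic L f A"
proof -
  define g where "g = inv_into (space L) f"
  note gf = automorphism_inv_into(1)[OF f, folded g_def] and fg = automorphism_inv_into(2)[OF f, folded g_def]
    and g = automorphism_inv_into(3)[OF f, folded g_def]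
  have Am [measurable]: "A \<in> borel_measurable L" and det: "\<And>x. x \<in> space L \<Longrightarrow> det (A x) = 1"
    using A by (auto simp: bounded_SL2_def)
  obtain \<delta> where \<delta>: "\<delta> > 0" and tr: "\<And>Bs. Bs \<noteq> [] \<Longrightarrow> set Bs \<subseteq> near_values L A \<delta> \<Longrightarrow> \<bar>trace (wprod Bs)\<bar> > 2"
    using rob unfolding robustly_hyperbolic_def by blast
  obtain K0 where "AE x in L. opnorm (A x) \<le> K0" using A by (auto simp: bounded_SL2_def)
  define K where "K = max 1 (2 * K0)"
  have K: "K \<ge> 1" by (simp add: K_def)
  have AK: "AE x in L. norm (A x) \<le> K"
    using \<open>AE x in L. opnorm (A x) \<le> K0\<close>
  proof eventually_elim
    case (elim x) then show ?case using norm_le_opnorm[of "A x"] by (auto simp: K_def)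
  qed
  have "AE x in L. A x \<in> near_values L A (\<delta> / 2) \<and> norm (A x) \<le> K"
    using AE_near_values[OF A, of "\<delta> / 2"] AK \<delta> by auto
  then obtain N where N: "N \<in> sets L" "emeasure L N = 0"
    "\<And>x. x \<in> space L \<Longrightarrow> x \<notin> N \<Longrightarrow> A x \<in> near_values L A (\<delta> / 2) \<and> norm (A x) \<le> K"
    by (blast elim!: AE_E)
  \<comment> \<open>Invariant in both directions, so that every letter read along the past or the
    future of a point is near an essential value and bounded by \<open>K\<close>.\<close>
  define G where "G = {x \<in> space L. \<forall>n. (f ^^ n) x \<notin> N \<and> (g ^^ n) x \<notin> N}"
  have Gm [measurable]: "G \<in> sets L"
  proof -
    have [measurable]: "f ^^ n \<in> measurable L L" "g ^^ n \<in> measurable L L" "N \<in> sets L" for n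
      using automorphism_funpow_measurable f g N by blast+
    show ?thesis unfolding G_def by measurable
  qed
  have "AE x in L. x \<notin> N" using N by (intro AE_not_in) auto
  then have "AE x in L. \<forall>n. (f ^^ n) x \<notin> N \<and> (g ^^ n) x \<notin> N"
    unfolding AE_all_countable by (intro allI AE_conjI automorphism_funpow_AE[OF f] automorphism_funpow_AE[OF g])
  then have AEG: "AE x in L. x \<in> G" using AE_space by eventually_elim (simp add: G_def)
  have Gs: "x \<in> space L" if "x \<in> G" for x using that by (simp add: G_def)
  have Gf: "f x \<in> G" if x: "x \<in> G" for x
  proof -
    have xs: "x \<in> space L" using x by (rule Gs)
    have "(f ^^ n) (f x) \<notin> N" for n using x by (simp add: G_def funpow_swap1[symmetric]) (metis funpow.simps(2) o_apply)
    moreover have "(g ^^ n) (f x) \<notin> N" for n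
    proof (cases n)
      case 0 then show ?thesis using x by (simp add: G_def) (metis funpow_0 funpow.simps(2) o_apply)
    next
      case (Suc m)
      then have "(g ^^ n) (f x) = (g ^^ m) x" using gf[OF xs] by (simp add: funpow_swap1)
      then show ?thesis using x by (simp add: G_def)
    qed
    ultimately show ?thesis using automorphism_space[OF f xs] by (simp add: G_def)
  qed
  have Gg: "g x \<in> G" if x: "x \<in> G" for x
  proof -
    have xs: "x \<in> space L" using x by (rule Gs)
    have "(g ^^ n) (g x) \<notin> N" for n using x by (simp add: G_def funpow_swap1[symmetric]) (metis funpow.simps(2) o_apply)
    moreover have "(f ^^ n) (g x) \<notin> N" for n
    proof (cases n)
      case 0 then show ?thesis using x by (simp add: G_def) (metis funpow_0 funpow.simps(2) o_apply)
    next
      case (Suc m)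
      then have "(f ^^ n) (g x) = (f ^^ m) x" using fg[OF xs] by (simp add: funpow_swap1)
      then show ?thesis using x by (simp add: G_def)
    qed
    ultimately show ?thesis using automorphism_space[OF g xs] by (simp add: G_def)
  qed
  have Gfn: "(f ^^ n) x \<in> G" and Ggn: "(g ^^ n) x \<in> G" if "x \<in> G" for n x
    using that Gf Gg by (induction n) auto
  have fngn: "(f ^^ n) ((g ^^ n) x) = x" and gnfn: "(g ^^ n) ((f ^^ n) x) = x" if "x \<in> space L" for n x
    using that
    by (induction n arbitrary: x)
      (simp_all add: automorphism_space[OF f] automorphism_space[OF g] funpow_swap1 fg gf
        automorphism_funpow_space[OF g] automorphism_funpow_space[OF f])
  have AG: "A x \<in> near_values L A (\<delta> / 2)" "norm (A x) \<le> K" if "x \<in> G" for x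
    using N(3)[OF Gs[OF that]] that unfolding G_def by (metis (mono_tags, lifting) funpow_0 mem_Collect_eq)+

  define S where "S = {B \<in> near_values L A (\<delta> / 2). norm B \<le> K}"
  \<comment> \<open>Rotating a matrix of norm at most \<open>K\<close> by an angle at most
    \<open>r\<close> moves it by at most \<open>2 * r * K\<close>, hence by at most
    \<open>\<delta> / 2\<close>: letters from \<open>near_values L A (\<delta> / 2)\<close> then
    stay in \<open>near_values L A \<delta>\<close>, where \<open>tr\<close> applies.\<close>
  define r where "r = min (pi / 4) (\<delta> / (4 * K))"
  have r: "0 < r" "r \<le> pi / 4" using \<delta> K by (auto simp: r_def)
  have rK: "2 * r * K \<le> \<delta> / 2"
  proof -
    have "r \<le> \<delta> / (4 * K)" by (simp add: r_def)
    then show ?thesis using K by (simp add: field_simps)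
  qed
  have Sdet: "det B = 1" if "B \<in> S" for B using that by (simp add: S_def near_values_def)
  have rot_near: "rot t ** B \<in> near_values L A \<delta>" "B ** rot t \<in> near_values L A \<delta>" if "B \<in> S" "\<bar>t\<bar> \<le> r" for B t
  proof -
    have "2 * \<bar>t\<bar> * norm B \<le> 2 * r * K" using that r by (intro mult_mono) (auto simp: S_def)
    then have "2 * \<bar>t\<bar> * norm B \<le> \<delta> / 2" using rK by simp
    then have le: "norm (rot t ** B - B) \<le> \<delta> / 2" "norm (B ** rot t - B) \<le> \<delta> / 2"
      using norm_rot_mult_diff[where t = t and B = B] by linarith+
    have B: "B \<in> near_values L A (\<delta> / 2)" using that by (simp add: S_def)
    show "rot t ** B \<in> near_values L A \<delta>" "B ** rot t \<in> near_values L A \<delta>"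
      using near_values_perturb[OF B _ le(1) Am] near_values_perturb[OF B _ le(2) Am] Sdet[OF that(1)]
      by (simp_all add: det_mul)
  qed
  define c where "c = (sin r)\<^sup>2 / 16"
  define \<tau> where "\<tau> = exp (r / 2)"
  have c: "0 < c" "c \<le> 1"
    unfolding c_def using r sin_gt_zero[of r] power_mono[OF abs_sin_le_one[of r], of 2] by (auto intro: order_trans)
  have \<tau>: "1 < \<tau>" using r by (simp add: \<tau>_def)
  have wg: "c * \<tau> ^ length Cs * norm (wprod Bs) \<le> norm (wprod (Cs @ Bs))"
    "c * \<tau> ^ length Bs * norm (wprod Cs) \<le> norm (wprod (Cs @ Bs))" if "set Bs \<subseteq> S" "set Cs \<subseteq> S" for Bs Cs
    unfolding c_def \<tau>_def
    using word_growth[where S = S and S' = "near_values L A \<delta>", OF Sdet r rot_near tr that] by blast+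
  have letS: "set (letters f A n x) \<subseteq> S" if "x \<in> G" for n x
    unfolding set_letters using AG[OF Gfn[OF that]] by (auto simp: S_def)
  have split: "cocycle f A (m + n) x = wprod (letters f A m ((f ^^ n) x) @ letters f A n x)" for m n x
    by (simp add: cocycle_add wprod_append wprod_letters)
  have detc: "det (cocycle f A n x) = 1" if "x \<in> G" for n x by (rule det_cocycle[OF f A Gs[OF that]])

  \<comment> \<open>The inverse of the product that leads from the point \<open>n\<close> steps in
    the past to \<open>x\<close>.\<close>
  define Pu where "Pu = (\<lambda>n x. adj2 (cocycle f A n ((g ^^ n) x)))"
  have Pu_Suc: "Pu (Suc n) x = adj2 (A ((g ^^ Suc n) x)) ** Pu n x" if x: "x \<in> G" for n x
  proof -
    have "f (g ((g ^^ n) x)) = (g ^^ n) x" using fg Gs Ggn x by blast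
    then have "cocycle f A (n + 1) ((g ^^ Suc n) x) = cocycle f A n ((g ^^ n) x) ** A ((g ^^ Suc n) x)"
      by (simp only: cocycle_add) simp
    then show ?thesis unfolding Pu_def by (simp add: adj2_mult)
  qed
  define Cc where "Cc = 1 + 2 * K / c ^ 2 / (1 - 1 / \<tau>)"
  have S0: "\<exists>Q. (\<lambda>n. contracted (cocycle f A n x)) \<longlonglongrightarrow> Q \<and> line_proj Q \<and>
      (\<forall>n. norm (cocycle f A n x ** Q) \<le> Cc / norm (cocycle f A n x)) \<and>
      range ((*v) Q) = {v. (\<lambda>n. cocycle f A n x *v v) \<longlonglongrightarrow> 0}" if x: "x \<in> G" for x
  proof (rule stable_direction[of "\<lambda>n. cocycle f A n x" "\<lambda>n. A ((f ^^ n) x)" K c \<tau>])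
    show "det (A ((f ^^ n) x)) = 1" for n using det Gs Gfn x by blast
    show "norm (A ((f ^^ n) x)) \<le> K" for n using AG Gfn x by blast
    show "c * \<tau> ^ (m - n) * norm (cocycle f A n x) \<le> norm (cocycle f A m x)" if "n \<le> m" for n m
      using wg(1)[of "letters f A n x" "letters f A (m - n) ((f ^^ n) x)", OF letS[OF x] letS[OF Gfn[OF x]]] split[of "m - n" n x] that by (simp add: wprod_letters)
  qed (use detc x c \<tau> in \<open>auto simp: Cc_def\<close>)
  have U0: "\<exists>Q. (\<lambda>n. contracted (Pu n x)) \<longlonglongrightarrow> Q \<and> line_proj Q \<and>
      (\<forall>n. norm (Pu n x ** Q) \<le> Cc / norm (Pu n x)) \<and>
      range ((*v) Q) = {v. (\<lambda>n. Pu n x *v v) \<longlonglongrightarrow> 0}" if x: "x \<in> G" for x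
  proof (rule stable_direction[of "\<lambda>n. Pu n x" "\<lambda>n. adj2 (A ((g ^^ Suc n) x))" K c \<tau>])
    show "det (adj2 (A ((g ^^ Suc n) x))) = 1" for n using det[OF Gs[OF Ggn[OF x]], of "Suc n"] by simp
    show "norm (adj2 (A ((g ^^ Suc n) x))) \<le> K" for n using AG(2)[OF Ggn[OF x], of "Suc n"] by simp
    show "det (Pu n x) = 1" for n using detc[OF Ggn[OF x]] by (simp add: Pu_def)
    \<comment> \<open>A longer past extends the word by older letters, at the right end of the
      product; so the second inequality of \<open>word_growth\<close> is used here, where
      \<open>S0\<close> used the first.\<close>
    show "c * \<tau> ^ (m - n) * norm (Pu n x) \<le> norm (Pu m x)" if "n \<le> m" for n m
    proof -
      have "(f ^^ (m - n)) ((g ^^ m) x) = (g ^^ n) x"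
      proof -
        have "(g ^^ m) x = (g ^^ (m - n)) ((g ^^ n) x)" using that by (simp flip: funpow_add[unfolded o_def fun_eq_iff, rule_format])
        then show ?thesis using fngn Gs Ggn x by simp
      qed
      then show ?thesis
        using wg(2)[of "letters f A (m - n) ((g ^^ m) x)" "letters f A n ((g ^^ n) x)", OF letS[OF Ggn[OF x]] letS[OF Ggn[OF x]]] split[of n "m - n" "(g ^^ m) x"] that
        by (simp add: wprod_letters Pu_def)
    qed
  qed (use Pu_Suc x c \<tau> in \<open>auto simp: Cc_def\<close>)

  \<comment> \<open>Default value off \<open>G\<close>: \<open>measurable_line_field\<close> asks
    for a line at every point of the space.\<close>
  define D0 :: "real ^ 2 ^ 2" where "D0 = (\<chi> i j. if i = 1 \<and> j = 1 then 1 else 0)"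
  have D0: "line_proj D0" by (simp add: line_proj_def D0_def det_2)
  have gm: "(\<lambda>x. cocycle f A n x) \<in> borel_measurable L" "(\<lambda>x. Pu n x) \<in> borel_measurable L" for n
  proof -
    show 1: "(\<lambda>x. cocycle f A n x) \<in> borel_measurable L" by (rule measurable_cocycle[OF f Am])
    have [measurable]: "(\<lambda>x. cocycle f A n ((g ^^ n) x)) \<in> borel_measurable L"
      using measurable_compose[OF automorphism_funpow_measurable[OF g] 1] .
    show "(\<lambda>x. Pu n x) \<in> borel_measurable L" unfolding Pu_def by measurable
  qed
  define Qs where "Qs = (\<lambda>x. if x \<in> G then lim (\<lambda>n. contracted (cocycle f A n x)) else D0)"
  define Qu where "Qu = (\<lambda>x. if x \<in> G then lim (\<lambda>n. contracted (Pu n x)) else D0)"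
  have Qs: "(\<lambda>n. contracted (cocycle f A n x)) \<longlonglongrightarrow> Qs x" "line_proj (Qs x)"
      "norm (cocycle f A n x ** Qs x) \<le> Cc / norm (cocycle f A n x)"
      "range ((*v) (Qs x)) = {v. (\<lambda>n. cocycle f A n x *v v) \<longlonglongrightarrow> 0}" if "x \<in> G" for x n
    using S0[OF that] that by (auto simp: Qs_def limI)
  have Qu: "(\<lambda>n. contracted (Pu n x)) \<longlonglongrightarrow> Qu x" "line_proj (Qu x)"
      "norm (Pu n x ** Qu x) \<le> Cc / norm (Pu n x)"
      "range ((*v) (Qu x)) = {v. (\<lambda>n. Pu n x *v v) \<longlonglongrightarrow> 0}" if "x \<in> G" for x n
    using U0[OF that] that by (auto simp: Qu_def limI)
  have Qsm: "Qs \<in> borel_measurable L"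
  proof (rule borel_measurable_LIMSEQ_metric)
    note gm [measurable]
    show "(\<lambda>x. if x \<in> G then contracted (cocycle f A n x) else D0) \<in> borel_measurable L" for n by measurable
    show "(\<lambda>n. if x \<in> G then contracted (cocycle f A n x) else D0) \<longlonglongrightarrow> Qs x" for x
      using Qs(1) by (cases "x \<in> G") (auto simp: Qs_def)
  qed
  have Qum: "Qu \<in> borel_measurable L"
  proof (rule borel_measurable_LIMSEQ_metric)
    note gm [measurable]
    show "(\<lambda>x. if x \<in> G then contracted (Pu n x) else D0) \<in> borel_measurable L" for n by measurable
    show "(\<lambda>n. if x \<in> G then contracted (Pu n x) else D0) \<longlonglongrightarrow> Qu x" for x
      using Qu(1) by (cases "x \<in> G") (auto simp: Qu_def)
  qed
  define Es where "Es = (\<lambda>x. range ((*v) (Qs x)))"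
  define Eu where "Eu = (\<lambda>x. range ((*v) (Qu x)))"
  have mEs: "measurable_line_field L Es" and mEu: "measurable_line_field L Eu"
    unfolding Es_def Eu_def
    by (rule measurable_line_field_range[OF Qsm], use Qs(2) D0 in \<open>auto simp: Qs_def\<close>)
      (rule measurable_line_field_range[OF Qum], use Qu(2) D0 in \<open>auto simp: Qu_def\<close>)
  define C where "C = Cc / c"
  have Cc: "Cc \<ge> 1" using K c \<tau> by (simp add: Cc_def)
  have C: "C > 0" using Cc c by (simp add: C_def)
  have grow: "c * \<tau> ^ n \<le> norm (cocycle f A n x)" if "x \<in> G" for n x
  proof -
    have "c * \<tau> ^ n * 1 \<le> c * \<tau> ^ n * norm (wprod [])"
      using c \<tau> norm_SL2_ge(2)[of "mat 1"] by (intro mult_left_mono) auto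
    also have "\<dots> \<le> norm (cocycle f A n x)" using wg(1)[of "[]" "letters f A n x"] letS[OF that] by (simp add: wprod_letters)
    finally show ?thesis by simp
  qed
  have contr: "norm (P *v v) \<le> C * (1 / \<tau>) ^ n * norm v"
    if P: "c * \<tau> ^ n \<le> norm P" "norm (P ** Q) \<le> Cc / norm P" and v: "v \<in> range ((*v) Q)" and Q: "line_proj Q" for P Q :: "real ^ 2 ^ 2" and n v
  proof -
    have "v = Q *v v" using v line_proj_props(1)[OF Q] by auto
    then have "norm (P *v v) \<le> norm (P ** Q) * norm v"
      using norm_matrix_vector_le[of "P ** Q" v] by (metis matrix_vector_mul_assoc)
    also have "\<dots> \<le> Cc / norm P * norm v" using P by (intro mult_right_mono) auto
    also have "\<dots> \<le> Cc / (c * \<tau> ^ n) * norm v"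
    proof (intro mult_right_mono divide_left_mono P(1))
      have "0 < c * \<tau> ^ n" using c \<tau> by simp
      then show "0 < norm P * (c * \<tau> ^ n)" using P(1) by (intro mult_pos_pos[OF _ \<open>0 < c * \<tau> ^ n\<close>]) linarith
    qed (use Cc in auto)
    finally show ?thesis by (simp add: C_def power_divide)
  qed
  have Es_bd: "norm (cocycle f A n x *v v) \<le> C * (1 / \<tau>) ^ n * norm v" if "x \<in> G" "v \<in> Es x" for n x v
    using contr[OF grow[OF that(1)] Qs(3)[OF that(1)] _ Qs(2)[OF that(1)]] that(2) by (simp add: Es_def)
  have Eu_bd: "norm (Pu n x *v v) \<le> C * (1 / \<tau>) ^ n * norm v" if "x \<in> G" "v \<in> Eu x" for n x v
    using contr[of n "Pu n x", OF _ Qu(3)[OF that(1)] _ Qu(2)[OF that(1)]] grow[OF Ggn[OF that(1)]] that(2) by (simp add: Eu_def Pu_def)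
  have image: "(*v) (A x) ` Es x = Es (f x)" "(*v) (A x) ` Eu x = Eu (f x)" if x: "x \<in> G" for x
  proof -
    have dA: "det (A x) = 1" using det Gs x by blast
    have inv: "A x *v (adj2 (A x) *v w) = w" for w by (simp add: matrix_vector_mul_assoc mult_adj2[OF dA])
    have s: "cocycle f A n (f x) *v (A x *v v) = cocycle f A (Suc n) x *v v" for n v
      using cocycle_add[of f A n 1 x] by (simp add: matrix_vector_mul_assoc del: cocycle.simps(2)) (simp add: cocycle.simps)
    \<comment> \<open>Membership is convergence to 0, and the sequence at \<open>f x\<close> is the
      one at \<open>x\<close> shifted by one step; invariance needs no estimate.\<close>
    have "v \<in> Es x \<longleftrightarrow> A x *v v \<in> Es (f x)" for v
      unfolding Es_def Qs(4)[OF x] Qs(4)[OF Gf[OF x]] mem_Collect_eq s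
      by (rule filterlim_sequentially_Suc[symmetric])
    then show "(*v) (A x) ` Es x = Es (f x)" using inv by (metis (no_types, lifting) image_iff set_eq_iff)
    have u: "Pu (Suc n) (f x) *v (A x *v v) = Pu n x *v v" for n v
    proof -
      have "(g ^^ Suc n) (f x) = (g ^^ n) x" using gf Gs x by (simp add: funpow_swap1)
      then have "Pu (Suc n) (f x) = adj2 (A ((f ^^ n) ((g ^^ n) x)) ** cocycle f A n ((g ^^ n) x))"
        by (simp add: Pu_def)
      also have "\<dots> = Pu n x ** adj2 (A x)" using fngn Gs x by (simp add: Pu_def adj2_mult)
      finally show ?thesis using mult_adj2(2)[OF dA] by (simp add: matrix_vector_mul_assoc flip: matrix_mul_assoc)
    qed
    have "v \<in> Eu x \<longleftrightarrow> A x *v v \<in> Eu (f x)" for v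
      unfolding Eu_def Qu(4)[OF x] Qu(4)[OF Gf[OF x]] mem_Collect_eq u[symmetric]
      by (rule filterlim_sequentially_Suc)
    then show "(*v) (A x) ` Eu x = Eu (f x)" using inv by (metis (no_types, lifting) image_iff set_eq_iff)
  qed
  have Eun: "cocycle f A n x *v v \<in> Eu ((f ^^ n) x)" if "x \<in> G" "v \<in> Eu x" for n x v
  proof (induction n)
    case (Suc n)
    have "A ((f ^^ n) x) *v (cocycle f A n x *v v) \<in> Eu (f ((f ^^ n) x))"
      using image(2)[OF Gfn[OF that(1)], of n] Suc by blast
    then show ?case by (simp add: matrix_vector_mul_assoc)
  qed (use that in simp)
  \<comment> \<open>At \<open>(f ^^ n) x\<close> the matrix \<open>Pu n\<close> inverts the forward
    product from \<open>x\<close>, so contraction towards the past becomes expansion towards the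
    future.\<close>
  have bwd: "norm v \<le> C * (1 / \<tau>) ^ n * norm (cocycle f A n x *v v)" if x: "x \<in> G" and v: "v \<in> Eu x" for n x v
  proof -
    have "Pu n ((f ^^ n) x) = adj2 (cocycle f A n x)" using gnfn Gs x by (simp add: Pu_def)
    then have "Pu n ((f ^^ n) x) *v (cocycle f A n x *v v) = v"
      by (simp add: matrix_vector_mul_assoc mult_adj2 detc[OF x])
    then show ?thesis using Eu_bd[OF Gfn[OF x] Eun[OF x v], of n n] by simp
  qed
  \<comment> \<open>On a common vector, expansion and contraction together bound its norm by a null
    sequence times itself.\<close>
  have zero: "v = 0" if x: "x \<in> G" and v: "v \<in> Es x" "v \<in> Eu x" for x v
  proof -
    have "norm v \<le> C * (1 / \<tau>) ^ n * (C * (1 / \<tau>) ^ n * norm v)" for n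
      by (rule order_trans[OF bwd[OF x v(2)] mult_left_mono[OF Es_bd[OF x v(1)]]]) (use C \<tau> in auto)
    moreover have "(\<lambda>n. C * (1 / \<tau>) ^ n * (C * (1 / \<tau>) ^ n * norm v)) \<longlonglongrightarrow> C * 0 * (C * 0 * norm v)"
      using \<tau> by (intro tendsto_intros LIMSEQ_power_zero) auto
    ultimately have "norm v \<le> 0" using LIMSEQ_le_const by (metis (no_types, lifting) mult_zero_right mult_zero_left)
    then show ?thesis by simp
  qed
  have main: "Es x \<inter> Eu x = {0} \<and> {v + w |v w. v \<in> Es x \<and> w \<in> Eu x} = UNIV \<and>
          (*v) (A x) ` Es x = Es (f x) \<and> (*v) (A x) ` Eu x = Eu (f x) \<and>
          (\<forall>n\<ge>1. let T = (*v) (cocycle f A n x) in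
             onorm_on (Es x) T \<le> C * (1 / \<tau>) ^ n \<and>
             onorm_on (T ` Eu x) (inv_into (Eu x) T) \<le> C * (1 / \<tau>) ^ n)" if x: "x \<in> G" for x
  proof -
    have sub: "subspace (Es x)" "subspace (Eu x)"
      using line_proj_props(3)[OF Qs(2)[OF x]] line_proj_props(3)[OF Qu(2)[OF x]] by (auto simp: Es_def Eu_def)
    then have 0: "0 \<in> Es x" "0 \<in> Eu x" by (auto intro: subspace_0)
    obtain u w where u: "u \<noteq> 0" "Es x = span {u}" and w: "w \<noteq> 0" "Eu x = span {w}"
      using line_proj_props(2)[OF Qs(2)[OF x]] line_proj_props(2)[OF Qu(2)[OF x]] unfolding Es_def Eu_def by blast
    have ne: "cross2 u w \<noteq> 0"
    proof
      assume "cross2 u w = 0"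
      then have "w \<in> span {u}" using cross2_eq_0[OF _ u(1)] by (auto simp: span_singleton)
      then have "w \<in> Es x" "w \<in> Eu x" using u w by (auto simp: span_base)
      then show False using zero[OF x] w by blast
    qed
    have "z \<in> {v + w |v w. v \<in> Es x \<and> w \<in> Eu x}" for z
    proof -
      \<comment> \<open>Cramer's rule for the basis \<open>u\<close>, \<open>w\<close>.\<close>
      have "z $ i * cross2 u w = (cross2 z w * u $ i + cross2 u z * w $ i)" for i
        using exhaust_2[of i] by (auto simp: cross2_def algebra_simps)
      then have "z = (cross2 z w / cross2 u w) *\<^sub>R u + (cross2 u z / cross2 u w) *\<^sub>R w"
        using ne by (simp add: vec_eq_iff divide_simps mult.commute)
      moreover have "k *\<^sub>R u \<in> Es x" "k *\<^sub>R w \<in> Eu x" for k unfolding u w by (auto simp: span_singleton)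
      ultimately show ?thesis by blast
    qed
    moreover have "onorm_on (Es x) ((*v) (cocycle f A n x)) \<le> C * (1 / \<tau>) ^ n" for n
      by (rule onorm_on_le) (use Es_bd[OF x] 0 C \<tau> in auto)
    moreover have "onorm_on ((*v) (cocycle f A n x) ` Eu x) (inv_into (Eu x) ((*v) (cocycle f A n x))) \<le> C * (1 / \<tau>) ^ n" for n
    proof (rule onorm_on_le)
      have inj: "inj_on ((*v) (cocycle f A n x)) (Eu x)"
        by (rule inj_onI) (metis detc[OF x] matrix_vector_mul_assoc matrix_vector_mul_lid mult_adj2(2))
      fix y assume "y \<in> (*v) (cocycle f A n x) ` Eu x"
      then obtain v where v: "v \<in> Eu x" "y = cocycle f A n x *v v" by blast
      then have "inv_into (Eu x) ((*v) (cocycle f A n x)) y = v" using inj by (simp add: inv_into_f_f)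
      then show "norm (inv_into (Eu x) ((*v) (cocycle f A n x)) y) \<le> C * (1 / \<tau>) ^ n * norm y"
        using bwd[OF x v(1)] v by simp
    qed (use 0 C \<tau> in auto)
    ultimately show ?thesis using image[OF x] zero[OF x] 0 unfolding Let_def by blast
  qed
  show ?thesis
    unfolding uniformly_hyperbolic_def
    by (rule exI[of _ C], rule conjI[OF C], rule exI[of _ "1 / \<tau>"], intro conjI exI[of _ Es] exI[of _ Eu] mEs mEu)
      (use \<tau> AEG main in \<open>auto elim: eventually_mono\<close>)
qed

lemma automorphism_comp:
  assumes f: "f \<in> automorphisms L" and g: "g \<in> automorphisms L"
  shows "(\<lambda>x. f (g x)) \<in> automorphisms L"
proof -
  have b: "bij_betw f (space L) (space L)" "bij_betw g (space L) (space L)" using f g by (auto simp: automorphisms_def)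
  have m: "f \<in> measurable L L" "g \<in> measurable L L" "inv_into (space L) f \<in> measurable L L"
    "inv_into (space L) g \<in> measurable L L" using f g by (auto simp: automorphisms_def)
  have bc: "bij_betw (\<lambda>x. f (g x)) (space L) (space L)" using bij_betw_trans[OF b(2,1)] by (simp add: o_def)
  have "inv_into (space L) (\<lambda>x. f (g x)) y = inv_into (space L) g (inv_into (space L) f y)" if y: "y \<in> space L" for y
  proof (rule inv_into_f_eq[OF bij_betw_imp_inj_on[OF bc]])
    have 1: "inv_into (space L) f y \<in> space L" using m(3) y by (rule measurable_space)
    then show "inv_into (space L) g (inv_into (space L) f y) \<in> space L" using m(4) by (rule measurable_space[rotated])
    show "f (g (inv_into (space L) g (inv_into (space L) f y))) = y"
      using automorphism_inv_into(2)[OF g 1] automorphism_inv_into(2)[OF f y] by simp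
  qed
  then have "inv_into (space L) (\<lambda>x. f (g x)) \<in> measurable L L"
    using measurable_compose[OF m(3,4)] by (subst measurable_cong)
  moreover have "distr L L (\<lambda>x. f (g x)) = L"
    using distr_distr[OF m(1,2)] f g by (simp add: automorphisms_def o_def)
  ultimately show ?thesis using bc measurable_compose[OF m(2,1)] by (simp add: automorphisms_def)
qed

lemma automorphism_funpow: "f \<in> automorphisms L \<Longrightarrow> f ^^ n \<in> automorphisms L"
proof (induction n)
  case 0 then show ?case using id_automorphism[of L] by (simp add: id_def)
next
  case (Suc n) then show ?case using automorphism_comp[of f L "f ^^ n"] by (simp add: o_def)
qed

lemma automorphism_vimage:
  assumes f: "f \<in> automorphisms L" and S: "S \<in> sets L"
  shows "f -` S \<inter> space L \<in> sets L" "emeasure L (f -` S \<inter> space L) = emeasure L S"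
    "measure L (f -` S \<inter> space L) = measure L S"
proof -
  have m: "f \<in> measurable L L" and d: "distr L L f = L" using f by (auto simp: automorphisms_def)
  show "f -` S \<inter> space L \<in> sets L" using m S by (rule measurable_sets)
  show "emeasure L (f -` S \<inter> space L) = emeasure L S" using emeasure_distr[OF m S] d by simp
  then show "measure L (f -` S \<inter> space L) = measure L S" by (simp add: measure_def)
qed

section \<open>Small growth\<close>

definition visits :: "('a \<Rightarrow> 'a) \<Rightarrow> 'a set \<Rightarrow> nat \<Rightarrow> 'a \<Rightarrow> real" where
  "visits f B n x = (\<Sum>j<n. indicator B ((f ^^ j) x))"

lemma visits_0 [simp]: "visits f B 0 x = 0" by (simp add: visits_def)

lemma visits_add: "visits f B (n + m) x = visits f B n x + visits f B m ((f ^^ n) x)"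
proof (induction m)
  case (Suc m)
  have "(f ^^ (n + m)) x = (f ^^ m) ((f ^^ n) x)" by (subst add.commute) (simp add: funpow_add)
  then show ?case using Suc by (simp add: visits_def)
qed simp

lemma visits_1: "visits f B (Suc 0) x = indicator B x" by (simp add: visits_def)

lemma visits_nonneg: "0 \<le> visits f B n x" by (simp add: visits_def sum_nonneg)

lemma visits_le: "visits f B n x \<le> n"
proof -
  have "visits f B n x \<le> (\<Sum>j<n. 1)" unfolding visits_def by (intro sum_mono) (simp add: indicator_def)
  then show ?thesis by simp
qed

text \<open>Cut the orbit segment greedily: from a point of \<open>E\<close> jump over a block in
  which the visits to \<open>B\<close> exceed \<open>a\<close> times its length, from any other
  point move one step. All visits to \<open>E\<close> lie in such blocks; only a last incomplete
  block costs the extra \<open>a * N\<close>.\<close>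

lemma visits_overshoot:
  assumes a: "0 \<le> a" and E: "\<And>x. x \<in> E \<Longrightarrow> \<exists>n. 1 \<le> n \<and> n \<le> N \<and> a * real n < visits f B n x"
  shows "a * visits f E M x \<le> visits f B M x + a * N"
proof (induction M arbitrary: x rule: less_induct)
  case (less M)
  show ?case
  proof (cases "x \<in> E \<and> M > 0")
    case xE: True
    then obtain n where n: "1 \<le> n" "n \<le> N" "a * real n < visits f B n x" using E by blast
    show ?thesis
    proof (cases "n \<le> M")
      case True
      have "a * visits f E M x = a * visits f E n x + a * visits f E (M - n) ((f ^^ n) x)"
        using visits_add[of f E n "M - n" x] True by (simp add: algebra_simps)
      also have "\<dots> \<le> a * n + (visits f B (M - n) ((f ^^ n) x) + a * N)"
        using n xE by (intro add_mono mult_left_mono visits_le a less.IH) auto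
      also have "\<dots> \<le> visits f B n x + visits f B (M - n) ((f ^^ n) x) + a * N" using n by simp
      also have "\<dots> = visits f B M x + a * N" using visits_add[of f B n "M - n" x] True by simp
      finally show ?thesis .
    next
      case False
      have "a * visits f E M x \<le> a * M" by (intro mult_left_mono visits_le a)
      also have "\<dots> \<le> a * N" using False n a by (intro mult_left_mono) auto
      finally show ?thesis using visits_nonneg[of f B M x] by simp
    qed
  next
    case False
    show ?thesis
    proof (cases M)
      case 0 then show ?thesis using a by simp
    next
      case (Suc m)
      then have "x \<notin> E" using False by simp
      then have "a * visits f E M x = a * visits f E m (f x)"
        using visits_add[of f E 1 m x] Suc by (simp add: visits_1)
      also have "\<dots> \<le> visits f B m (f x) + a * N" using Suc by (intro less.IH) auto
      also have "\<dots> \<le> visits f B M x + a * N"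
        using visits_add[of f B 1 m x] Suc visits_nonneg[of f B 1 x] by simp
      finally show ?thesis .
    qed
  qed
qed

lemma visits_measurable:
  assumes f: "f \<in> automorphisms L" and B: "B \<in> sets L"
  shows "visits f B n \<in> borel_measurable L"
proof -
  have "(\<lambda>x. indicator B ((f ^^ j) x) :: real) \<in> borel_measurable L" for j
    using measurable_compose[OF automorphism_funpow_measurable[OF f] borel_measurable_indicator[OF B]] .
  then show ?thesis unfolding visits_def[abs_def] by measurable
qed

lemma integral_visits:
  assumes "finite_measure L" and f: "f \<in> automorphisms L" and B: "B \<in> sets L"
  shows "integrable L (visits f B n)" "integral\<^sup>L L (visits f B n) = n * measure L B"
proof -
  interpret finite_measure L by fact
  have eq: "indicator B ((f ^^ j) x) = (indicator ((f ^^ j) -` B \<inter> space L) x :: real)" if "x \<in> space L" for j x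
    using that by (simp add: indicator_def)
  have s: "(f ^^ j) -` B \<inter> space L \<in> sets L" for j by (rule automorphism_vimage(1)[OF automorphism_funpow[OF f] B])
  have 1: "integrable L (\<lambda>x. indicator B ((f ^^ j) x) :: real)" for j
    by (subst Bochner_Integration.integrable_cong[OF refl eq]) (use s in \<open>auto simp: emeasure_eq_measure\<close>)
  have 2: "integral\<^sup>L L (\<lambda>x. indicator B ((f ^^ j) x) :: real) = measure L B" for j
  proof -
    have "integral\<^sup>L L (\<lambda>x. indicator B ((f ^^ j) x) :: real) = integral\<^sup>L L (indicator ((f ^^ j) -` B \<inter> space L))"
      by (rule Bochner_Integration.integral_cong[OF refl eq])
    also have "\<dots> = measure L ((f ^^ j) -` B \<inter> space L)" using s by simp
    finally show ?thesis using automorphism_vimage(3)[OF automorphism_funpow[OF f] B] by simp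
  qed
  show "integrable L (visits f B n)" unfolding visits_def[abs_def] using 1 by simp
  show "integral\<^sup>L L (visits f B n) = n * measure L B" unfolding visits_def[abs_def] using 1 2 by simp
qed

text \<open>The maximal ergodic inequality for an indicator function. Invariance of the measure
  turns the bound on orbit segments of length \<open>M\<close> into one on measures; division by
  \<open>M\<close> removes the boundary term.\<close>

lemma maximal_visits:
  assumes "finite_measure L" and f: "f \<in> automorphisms L" and B: "B \<in> sets L" and a: "0 < a"
  defines "E \<equiv> {x \<in> space L. \<exists>n\<ge>1. a * real n < visits f B n x}"
  shows "E \<in> sets L" "measure L E \<le> measure L B / a"
proof -
  interpret finite_measure L by fact
  \<comment> \<open>Block lengths are bounded first, as \<open>visits_overshoot\<close> needs one
    \<open>N\<close> for all points; the bound is released by monotone convergence at the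
    end.\<close>
  define EN where "EN = (\<lambda>N. {x \<in> space L. \<exists>n\<in>{1..N}. a * real n < visits f B n x})"
  have ENs: "EN N \<in> sets L" for N
    unfolding EN_def using visits_measurable[OF f B] by measurable
  have EU: "E = (\<Union>N. EN N)" by (force simp: E_def EN_def)
  then show Es: "E \<in> sets L" using ENs by auto
  have "measure L (EN N) \<le> measure L B / a" for N
  proof -
    have "a * (M * measure L (EN N)) \<le> M * measure L B + a * N * measure L (space L)" for M :: nat
    proof -
      have "a * (M * measure L (EN N)) = integral\<^sup>L L (\<lambda>x. a * visits f (EN N) M x)"
        using integral_visits[OF \<open>finite_measure L\<close> f ENs] by simp
      also have "\<dots> \<le> integral\<^sup>L L (\<lambda>x. visits f B M x + a * N)"
      proof (rule integral_mono)
        show "a * visits f (EN N) M x \<le> visits f B M x + a * N" for x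
          by (rule visits_overshoot) (use a in \<open>auto simp: EN_def\<close>)
      qed (use integral_visits[OF \<open>finite_measure L\<close> f] ENs B in auto)
      also have "\<dots> = M * measure L B + a * N * measure L (space L)"
        using integral_visits[OF \<open>finite_measure L\<close> f B] by simp
      finally show ?thesis .
    qed
    then have le: "a * measure L (EN N) \<le> measure L B + a * N * measure L (space L) / real (Suc M)" for M
    proof -
      assume *: "\<And>M::nat. a * (M * measure L (EN N)) \<le> M * measure L B + a * N * measure L (space L)"
      show "a * measure L (EN N) \<le> measure L B + a * N * measure L (space L) / real (Suc M)"
        using *[of "Suc M"] by (simp add: field_simps)
    qed
    have "(\<lambda>M. measure L B + a * N * measure L (space L) / real (Suc M)) \<longlonglongrightarrow> measure L B + 0"
      by (intro tendsto_add tendsto_const LIMSEQ_Suc[OF lim_const_over_n])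
    then have "a * measure L (EN N) \<le> measure L B" using LIMSEQ_le_const[of _ "measure L B + 0"] le by auto
    then show ?thesis using a by (simp add: field_simps)
  qed
  moreover have "(\<lambda>N. measure L (EN N)) \<longlonglongrightarrow> measure L E"
    unfolding EU using ENs by (intro finite_Lim_measure_incseq) (auto simp: incseq_def EN_def)
  ultimately show "measure L E \<le> measure L B / a" using LIMSEQ_le_const2 by blast
qed

text \<open>The margin \<open>\<eta>\<close> makes the condition stable under perturbations of \<open>f\<close> and of \<open>A\<close>.\<close>

definition small_growth :: "'a measure \<Rightarrow> real \<Rightarrow> ('a \<Rightarrow> 'a) \<Rightarrow> ('a \<Rightarrow> real ^ 2 ^ 2) \<Rightarrow> bool" where
  "small_growth L \<epsilon> f A \<longleftrightarrow> (\<exists>k>0. \<exists>\<eta>>0.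
     measure L {x \<in> space L. norm (cocycle f A k x) > exp (\<epsilon> * real k) - \<eta>} < \<epsilon>)"

lemma bounded_SL2_norm:
  assumes "A \<in> bounded_SL2 L"
  obtains K where "K \<ge> 1" "AE x in L. norm (A x) \<le> K"
proof -
  obtain K0 where "AE x in L. opnorm (A x) \<le> K0" using assms by (auto simp: bounded_SL2_def)
  then have "AE x in L. norm (A x) \<le> max 1 (2 * K0)"
  proof eventually_elim
    case (elim x) then show ?case using norm_le_opnorm[of "A x"] by auto
  qed
  then show ?thesis by (rule that[rotated]) simp
qed

lemma norm_mat_1_le: "norm (mat 1 :: real ^ 2 ^ 2) \<le> 2"
  by (rule power2_le_imp_le) (simp_all add: norm_matrix_2)

lemma norm_cocycle_le:
  assumes K: "\<And>i. i < n \<Longrightarrow> norm (A ((f ^^ i) x)) \<le> K"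
  shows "norm (cocycle f A n x) \<le> 2 * K ^ n"
  using K
proof (induction n)
  case 0 then show ?case using norm_mat_1_le by simp
next
  case (Suc n)
  have K0: "0 \<le> K" using Suc.prems[of n] norm_ge_zero order_trans by blast
  have "norm (cocycle f A (Suc n) x) \<le> norm (A ((f ^^ n) x)) * norm (cocycle f A n x)" by (simp add: norm_matrix_mult_le)
  also have "\<dots> \<le> K * (2 * K ^ n)" using Suc K0 by (intro mult_mono) auto
  finally show ?case by simp
qed

text \<open>At each scale one time \<open>k\<close> with small growth off a bad set is iterated:
  outside the bad set the orbit jumps \<open>k\<close> steps, inside it moves one step at a cost of
  at most \<open>C\<close>. The maximal inequality makes bad steps rare off a small set. Existence
  of the limit comes out together with its value and is not presupposed.\<close>

lemma small_growth_imp_trivial_spectrum: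
  assumes fin: "finite_measure L" and f: "f \<in> automorphisms L" and A: "A \<in> bounded_SL2 L"
    and small: "\<And>m. 0 < m \<Longrightarrow> small_growth L (1 / real m) f A"
  shows "trivial_spectrum L f A"
proof -
  interpret finite_measure L by fact
  have Am: "A \<in> borel_measurable L" using A by (simp add: bounded_SL2_def)
  obtain K where K: "K \<ge> 1" "AE x in L. norm (A x) \<le> K" using bounded_SL2_norm[OF A] .
  define C where "C = ln K"
  have C: "0 \<le> C" using K by (simp add: C_def)
  define G where "G = {x \<in> space L. \<forall>n. norm (A ((f ^^ n) x)) \<le> K}"
  have AEG: "AE x in L. x \<in> G"
  proof -
    have "AE x in L. \<forall>n. norm (A ((f ^^ n) x)) \<le> K"
      unfolding AE_all_countable by (intro allI automorphism_funpow_AE[OF f K(2)])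
    then show ?thesis using AE_space by eventually_elim (simp add: G_def)
  qed
  have Gf: "(f ^^ k) x \<in> G" if "x \<in> G" for x k
    using that automorphism_funpow_space[OF f] by (auto simp: G_def simp flip: funpow_add[unfolded o_def fun_eq_iff, rule_format])
  define g where "g = (\<lambda>n x. ln (norm (cocycle f A n x)))"
  have n1: "1 \<le> norm (cocycle f A n x)" if "x \<in> G" for n x
    using norm_SL2_ge(2)[OF det_cocycle[OF f A]] that by (simp add: G_def)
  have g_add: "g (n + k) x \<le> g n ((f ^^ k) x) + g k x" if "x \<in> G" for n k x
  proof -
    have "g (n + k) x \<le> ln (norm (cocycle f A n ((f ^^ k) x)) * norm (cocycle f A k x))"
      unfolding g_def cocycle_add using n1[OF that, of "n + k"]
      by (intro ln_mono norm_matrix_mult_le) (auto simp: cocycle_add)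
    also have "\<dots> = g n ((f ^^ k) x) + g k x"
      unfolding g_def using n1[OF that, of k] n1[OF Gf[OF that], of n k] by (intro ln_mult_pos) auto
    finally show ?thesis .
  qed
  have g1: "g (Suc 0) x \<le> C" if "x \<in> G" for x
  proof -
    have "norm (A x) \<le> K" using that unfolding G_def by (metis (mono_tags, lifting) funpow_0 mem_Collect_eq)
    moreover have "1 \<le> norm (A x)" using n1[OF that, of 1] by simp
    ultimately show ?thesis by (auto simp: g_def C_def intro!: ln_mono)
  qed
  have gn: "g n x \<le> n * C + 1" if "x \<in> G" for n x
  proof -
    have "norm (cocycle f A n x) \<le> 2 * K ^ n" by (rule norm_cocycle_le) (use that in \<open>auto simp: G_def\<close>)
    then have "g n x \<le> ln (2 * K ^ n)" unfolding g_def using n1[OF that, of n] by (intro ln_mono) auto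
    also have "\<dots> = ln 2 + n * C" using K by (simp add: ln_mult ln_realpow C_def)
    also have "ln 2 \<le> (1::real)" using ln_le_minus_one[of 2] by simp
    finally show ?thesis by simp
  qed
  \<comment> \<open>The last incomplete block costs at most \<open>k * C + 1\<close>; the 1 absorbs
    the logarithm of the bound 2 for the norm of the identity.\<close>
  have jump: "g n x \<le> \<epsilon> * n + C * visits f B n x + k * C + 1"
    if k: "0 < k" and \<epsilon>: "0 \<le> \<epsilon>" and B: "\<And>x. x \<in> G \<Longrightarrow> x \<notin> B \<Longrightarrow> g k x \<le> \<epsilon> * k" and x: "x \<in> G" for k \<epsilon> B n x
    using x
  proof (induction n arbitrary: x rule: less_induct)
    case (less n)
    show ?case
    proof (cases "n < k")
      case True
      have "n * C \<le> k * C" using True C by (intro mult_right_mono) auto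
      then show ?thesis using gn[OF less.prems, of n] \<epsilon> C visits_nonneg[of f B n x] mult_nonneg_nonneg[OF C visits_nonneg[of f B n x]]
        mult_nonneg_nonneg[OF \<epsilon>, of n] by linarith
    next
      case False
      show ?thesis
      proof (cases "x \<in> B")
        case True
        obtain n' where n': "n = Suc n'" using False k by (cases n) auto
        have "g n x \<le> g n' (f x) + g 1 x" using g_add[OF less.prems, of n' 1] n' by simp
        also have "\<dots> \<le> (\<epsilon> * n' + C * visits f B n' (f x) + k * C + 1) + C"
          using less.IH[of n' "f x"] n' Gf[OF less.prems, of 1] g1[OF less.prems] by simp
        also have "\<dots> \<le> \<epsilon> * n + C * (1 + visits f B n' (f x)) + k * C + 1"
          using \<epsilon> n' by (simp add: algebra_simps)
        also have "1 + visits f B n' (f x) = visits f B n x"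
          using visits_add[of f B 1 n' x] True n' by (simp add: visits_1)
        finally show ?thesis .
      next
        case nB: False
        have "g n x \<le> g (n - k) ((f ^^ k) x) + g k x" using g_add[OF less.prems, of "n - k" k] False by simp
        also have "\<dots> \<le> (\<epsilon> * (n - k) + C * visits f B (n - k) ((f ^^ k) x) + k * C + 1) + \<epsilon> * k"
          using B[OF less.prems nB] less.IH[of "n - k" "(f ^^ k) x"] Gf[OF less.prems, of k] k False by simp
        also have "\<dots> = \<epsilon> * n + C * visits f B (n - k) ((f ^^ k) x) + k * C + 1"
          using False by (simp add: algebra_simps of_nat_diff)
        also have "visits f B (n - k) ((f ^^ k) x) \<le> visits f B n x"
          using visits_add[of f B k "n - k" x] False visits_nonneg[of f B k x] by simp
        finally show ?thesis using C by (simp add: mult_left_mono)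
      qed
    qed
  qed
  have ex: "\<exists>F D. F \<in> sets L \<and> measure L F \<le> 1 / real (Suc j) \<and>
      (\<forall>x\<in>G - F. \<forall>n\<ge>1. g n x \<le> (1 + C) / Suc j * n + D)" for j
  proof -
    \<comment> \<open>The maximal inequality shares out the square: with
      \<open>a = 1 / Suc j\<close>, both the frequency of bad steps and the measure of the
      exceptional set are at most \<open>1 / Suc j\<close>.\<close>
    define m where "m = (Suc j)\<^sup>2"
    have m: "0 < m" "real m = (real (Suc j))\<^sup>2" by (auto simp: m_def)
    have sq: "1 / (real (Suc j))\<^sup>2 \<le> 1 / real (Suc j)"
      "1 / (real (Suc j))\<^sup>2 / (1 / real (Suc j)) = 1 / real (Suc j)"
    proof -
      have "real (Suc j) \<le> (real (Suc j))\<^sup>2" by (rule self_le_power) auto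
      then show "1 / (real (Suc j))\<^sup>2 \<le> 1 / real (Suc j)" by (intro divide_left_mono) (auto simp del: of_nat_Suc)
    qed (simp add: power2_eq_square del: of_nat_Suc)
    obtain k \<eta> where k: "0 < k" "0 < \<eta>"
      and ms: "measure L {x \<in> space L. norm (cocycle f A k x) > exp (1 / m * real k) - \<eta>} < 1 / m"
      using small[OF m(1)] unfolding small_growth_def by blast
    define B where "B = {x \<in> space L. norm (cocycle f A k x) > exp (1 / m * real k) - \<eta>}"
    have Bs: "B \<in> sets L" unfolding B_def using measurable_cocycle[OF f Am] by measurable
    have B: "g k x \<le> 1 / m * k" if "x \<in> G" "x \<notin> B" for x
    proof -
      have "norm (cocycle f A k x) \<le> exp (1 / m * real k)" using that k by (auto simp: B_def G_def)
      then have "g k x \<le> ln (exp (1 / m * real k))" unfolding g_def using n1[OF that(1), of k] by (intro ln_mono) auto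
      then show ?thesis by simp
    qed
    define a where "a = 1 / real (Suc j)"
    have a: "0 < a" by (simp add: a_def)
    define F where "F = {x \<in> space L. \<exists>n\<ge>1. a * real n < visits f B n x}"
    note mx = maximal_visits[OF fin f Bs a, folded F_def]
    have "measure L F \<le> (1 / m) / a"
      using mx(2) ms a by (smt (verit) B_def divide_right_mono)
    also have "(1 / m) / a = 1 / real (Suc j)" unfolding a_def m(2) by (rule sq)
    finally have mF: "measure L F \<le> 1 / real (Suc j)" .
    have "g n x \<le> (1 + C) / Suc j * n + (k * C + 1)" if "x \<in> G - F" "1 \<le> n" for x n
    proof -
      have v: "visits f B n x \<le> a * n" using that by (force simp: F_def G_def)
      have "g n x \<le> 1 / m * n + C * visits f B n x + k * C + 1"
        by (rule jump[OF k(1) _ B]) (use that in auto)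
      also have "\<dots> \<le> a * n + C * (a * n) + k * C + 1"
      proof -
        have "1 / real m \<le> a" unfolding a_def m(2) by (rule sq)
        then show ?thesis using mult_left_mono[OF v C] mult_right_mono[of "1 / real m" a n] by simp
      qed
      also have "\<dots> = (1 + C) / Suc j * n + (k * C + 1)" by (simp add: a_def add_divide_distrib algebra_simps)
      finally show ?thesis .
    qed
    then show ?thesis using mx(1) mF by blast
  qed
  then obtain F D where F: "\<And>j. F j \<in> sets L" "\<And>j. measure L (F j) \<le> 1 / real (Suc j)"
    and gF: "\<And>j x n. x \<in> G \<Longrightarrow> x \<notin> F j \<Longrightarrow> 1 \<le> n \<Longrightarrow> g n x \<le> (1 + C) / Suc j * n + D j"
    by (metis (no_types, lifting) DiffI)
  \<comment> \<open>The measures of the \<open>F j\<close> need not be summable. Lying outside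
    \<open>F j\<close> for infinitely many \<open>j\<close> is enough, since each tail of the
    sequence has an intersection of measure 0.\<close>
  have null: "AE x in L. \<exists>j\<ge>j0. x \<notin> F j" for j0
  proof -
    have s: "(\<Inter>j\<in>{j0..}. F j) \<in> sets L" using F(1) by auto
    have "measure L (\<Inter>j\<in>{j0..}. F j) \<le> 1 / real (Suc j)" if "j \<ge> j0" for j
      using finite_measure_mono[of "\<Inter>j\<in>{j0..}. F j" "F j"] that F by (force intro: order_trans)
    moreover have "(\<lambda>j. 1 / real (Suc j)) \<longlonglongrightarrow> 0" by (rule LIMSEQ_Suc[OF lim_const_over_n])
    ultimately have "measure L (\<Inter>j\<in>{j0..}. F j) \<le> 0" using LIMSEQ_le_const by blast
    then have "emeasure L (\<Inter>j\<in>{j0..}. F j) = 0" by (simp add: emeasure_eq_measure measure_le_0_iff)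
    then have "AE x in L. x \<notin> (\<Inter>j\<in>{j0..}. F j)" using s by (intro AE_not_in) auto
    then show ?thesis by eventually_elim auto
  qed
  have "AE x in L. \<forall>j0. \<exists>j\<ge>j0. x \<notin> F j" unfolding AE_all_countable using null by blast
  with AEG show ?thesis unfolding trivial_spectrum_def
  proof eventually_elim
    case (elim x)
    have g0: "(\<lambda>n. g n x / n) \<longlonglongrightarrow> 0"
    proof (rule LIMSEQ_I)
      fix e :: real assume e: "0 < e"
      obtain j0 where j0: "(1 + C) / Suc j0 < e / 2"
      proof -
        have "(\<lambda>j. (1 + C) / Suc j) \<longlonglongrightarrow> 0" by (rule LIMSEQ_Suc[OF lim_const_over_n])
        then have "\<forall>\<^sub>F j in sequentially. (1 + C) / Suc j < e / 2" using e by (intro order_tendstoD(2)) auto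
        then show ?thesis using that by (auto simp: eventually_sequentially)
      qed
      obtain j where j: "j \<ge> j0" "x \<notin> F j" using elim by blast
      have j': "(1 + C) / Suc j \<le> (1 + C) / Suc j0" using j C by (intro divide_left_mono) auto
      have "(\<lambda>n. D j / n) \<longlonglongrightarrow> 0" by (rule lim_const_over_n)
      then have "\<forall>\<^sub>F n in sequentially. D j / real n < e / 2" using e by (intro order_tendstoD(2)) auto
      then obtain n0 where n0: "\<And>n. n \<ge> n0 \<Longrightarrow> D j / real n < e / 2" by (auto simp: eventually_sequentially)
      have "norm (g n x / n - 0) < e" if n: "n \<ge> max n0 1" for n
      proof -
        have "g n x / n \<le> ((1 + C) / Suc j * n + D j) / n" using gF[of x j n] elim j n by (intro divide_right_mono) auto
        also have "\<dots> = (1 + C) / Suc j + D j / n" using n by (simp add: field_simps)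
        finally have "g n x / n < e" using n0[of n] n j0 j' by linarith
        moreover have "0 \<le> g n x / n" using n1[of x n] elim by (simp add: g_def)
        ultimately show ?thesis by simp
      qed
      then show "\<exists>no. \<forall>n\<ge>no. norm (g n x / n - 0) < e" by blast
    qed
    have "(\<lambda>n. ln (opnorm (cocycle f A n x)) / real n) \<longlonglongrightarrow> 0"
    proof (rule tendsto_sandwich)
      have b: "g n x - ln 2 \<le> ln (opnorm (cocycle f A n x)) \<and> ln (opnorm (cocycle f A n x)) \<le> g n x" for n
      proof -
        have 1: "1 \<le> norm (cocycle f A n x)" using n1 elim by blast
        have 2: "norm (cocycle f A n x) / 2 \<le> opnorm (cocycle f A n x)" using norm_le_opnorm[of "cocycle f A n x"] by simp
        have "g n x - ln 2 = ln (norm (cocycle f A n x) / 2)" using 1 unfolding g_def by (subst ln_div) auto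
        also have "\<dots> \<le> ln (opnorm (cocycle f A n x))" using 1 2 by (intro ln_mono) auto
        finally show ?thesis using 1 2 opnorm_le_norm[of "cocycle f A n x"] by (auto simp: g_def intro!: ln_mono)
      qed
      show "\<forall>\<^sub>F n in sequentially. g n x / n - ln 2 / n \<le> ln (opnorm (cocycle f A n x)) / real n"
        using b by (intro always_eventually allI) (simp add: divide_right_mono flip: diff_divide_distrib)
      show "\<forall>\<^sub>F n in sequentially. ln (opnorm (cocycle f A n x)) / real n \<le> g n x / n"
        using b by (intro always_eventually allI) (simp add: divide_right_mono)
      show "(\<lambda>n. g n x / n - ln 2 / n) \<longlonglongrightarrow> 0" using tendsto_diff[OF g0 lim_const_over_n[of "ln 2"]] by simp
    qed (rule g0)
    then show ?case unfolding lyapunov_exponent_def by (rule limI)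
  qed
qed

section \<open>Stability under perturbations of either variable\<close>

lemma cocycle_dist_AE:
  assumes A: "A \<in> bounded_SL2 L" and B: "B \<in> bounded_SL2 L"
  shows "AE x in L. norm (A x - B x) \<le> 2 * cocycle_dist L A B"
proof -
  note b = bounded_SL2_diff[OF A B]
  obtain C where C: "AE x in L. opnorm (A x - B x) \<le> C" using b(3) by blast
  obtain C' where C': "AE x in L. opnorm (matrix_inv (A x) - matrix_inv (B x)) \<le> C'" using b(4) by blast
  note 1 = ess_sup_bounds[OF b(1) opnorm_nonneg C]
  note 2 = ess_sup_bounds[OF b(2) opnorm_nonneg C']
  from 1(2) show ?thesis
  proof eventually_elim
    case (elim x)
    then show ?case using norm_le_opnorm[of "A x - B x"] 2(1) by (simp add: cocycle_dist_def)
  qed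
qed

lemma cocycle_dist_le:
  assumes A: "A \<in> bounded_SL2 L" and B: "B \<in> bounded_SL2 L"
    and d: "0 \<le> d" "AE x in L. norm (A x - B x) \<le> d"
  shows "cocycle_dist L A B \<le> 2 * d"
proof -
  note b = bounded_SL2_diff[OF A B]
  have 1: "AE x in L. opnorm (A x - B x) \<le> d"
    using d(2) by eventually_elim (rule order_trans[OF opnorm_le_norm])
  have 2: "AE x in L. opnorm (matrix_inv (A x) - matrix_inv (B x)) \<le> d"
    using d(2) AE_space
  proof eventually_elim
    case (elim x)
    then have "matrix_inv (A x) - matrix_inv (B x) = adj2 (A x - B x)"
      using A B by (simp add: bounded_SL2_def matrix_inv_SL2 adj2_diff)
    then show ?case using opnorm_le_norm[of "adj2 (A x - B x)"] elim by simp
  qed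
  show ?thesis
    using ess_sup_bounds(3)[OF b(1) opnorm_nonneg 1 d(1) 1] ess_sup_bounds(3)[OF b(2) opnorm_nonneg 2 d(1) 2]
    by (simp add: cocycle_dist_def)
qed

text \<open>A distance below \<open>\<delta> / 4\<close> means a pointwise distance below
  \<open>\<delta> / 2\<close> in \<open>norm\<close>, which is at most twice \<open>opnorm\<close>;
  so matrices \<open>\<delta> / 2\<close>-near to values of \<open>B\<close> are \<delta>-near to
  values of \<open>A\<close>.\<close>

lemma robustly_hyperbolic_open:
  assumes A: "A \<in> bounded_SL2 L" and rob: "robustly_hyperbolic L A"
  obtains d where "d > 0" "\<And>B. B \<in> bounded_SL2 L \<Longrightarrow> cocycle_dist L A B < d \<Longrightarrow> robustly_hyperbolic L B"
proof -
  obtain \<delta> where \<delta>: "\<delta> > 0" and tr: "\<And>Bs. Bs \<noteq> [] \<Longrightarrow> set Bs \<subseteq> near_values L A \<delta> \<Longrightarrow> \<bar>trace (wprod Bs)\<bar> > 2"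
    using rob unfolding robustly_hyperbolic_def by blast
  have Am: "A \<in> borel_measurable L" using A by (simp add: bounded_SL2_def)
  have "robustly_hyperbolic L B" if B: "B \<in> bounded_SL2 L" and d: "cocycle_dist L A B < \<delta> / 4" for B
  proof -
    have Bm: "B \<in> borel_measurable L" using B by (simp add: bounded_SL2_def)
    have "near_values L B (\<delta> / 2) \<subseteq> near_values L A \<delta>"
    proof
      fix C assume C: "C \<in> near_values L B (\<delta> / 2)"
      then have "0 < emeasure L {x \<in> space L. norm (B x - C) < \<delta> / 2}" by (simp add: near_values_def)
      also have "\<dots> \<le> emeasure L {x \<in> space L. norm (A x - C) < \<delta>}"
      proof (rule emeasure_mono_AE[OF _ near_set_measurable[OF Am]])
        show "AE x in L. x \<in> {x \<in> space L. norm (B x - C) < \<delta> / 2} \<longrightarrow> x \<in> {x \<in> space L. norm (A x - C) < \<delta>}"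
          using cocycle_dist_AE[OF A B]
        proof eventually_elim
          case (elim x)
          have "norm (A x - C) \<le> norm (A x - B x) + norm (B x - C)"
            using norm_triangle_ineq[of "A x - B x" "B x - C"] by simp
          then show ?case using elim d by auto
        qed
      qed
      finally show "C \<in> near_values L A \<delta>" using C by (simp add: near_values_def)
    qed
    then show ?thesis unfolding robustly_hyperbolic_def
      using tr \<delta> by (intro exI[of _ "\<delta> / 2"]) (meson half_gt_zero order_trans)
  qed
  with \<delta> that[of "\<delta> / 4"] show ?thesis by simp
qed

text \<open>Telescoping over the letters. Base map and cocycle may both differ, which serves the
  stability of small growth in either variable.\<close>

lemma norm_cocycle_diff_le:
  assumes K: "1 \<le> K" and d: "0 \<le> d"
    and A: "\<And>i. i < n \<Longrightarrow> norm (A ((f ^^ i) x)) \<le> K" and B: "\<And>i. i < n \<Longrightarrow> norm (B ((h ^^ i) y)) \<le> K"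
    and diff: "\<And>i. i < n \<Longrightarrow> norm (A ((f ^^ i) x) - B ((h ^^ i) y)) \<le> d"
  shows "norm (cocycle f A n x - cocycle h B n y) \<le> 2 * real n * K ^ n * d"
  using A B diff
proof (induction n)
  case (Suc n)
  define a b P Q where "a = A ((f ^^ n) x)" and "b = B ((h ^^ n) y)" and "P = cocycle f A n x" and "Q = cocycle h B n y"
  have IH: "norm (P - Q) \<le> 2 * real n * K ^ n * d" unfolding P_def Q_def by (rule Suc.IH) (use Suc.prems in auto)
  have P: "norm P \<le> 2 * K ^ n" unfolding P_def by (rule norm_cocycle_le) (use Suc.prems in auto)
  have ab: "norm b \<le> K" "norm (a - b) \<le> d" unfolding a_def b_def using Suc.prems by auto
  have Kn: "K ^ n \<le> K ^ Suc n" using K by simp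
  have K0: "0 \<le> K" "0 \<le> real n * K ^ n" using K by auto
  have "a ** P - b ** Q = (a - b) ** P + b ** (P - Q)"
    by (simp add: matrix_eq_2 matrix_mult_2 algebra_simps)
  then have "norm (a ** P - b ** Q) \<le> norm ((a - b) ** P) + norm (b ** (P - Q))" by (metis norm_triangle_ineq)
  also have "\<dots> \<le> norm (a - b) * norm P + norm b * norm (P - Q)" by (intro add_mono norm_matrix_mult_le)
  also have "\<dots> \<le> d * (2 * K ^ n) + K * (2 * real n * K ^ n * d)"
    using ab P IH d K by (intro add_mono mult_mono) auto
  also have "\<dots> \<le> d * (2 * K ^ Suc n) + K * (2 * real n * K ^ n * d)"
    using Kn d by (intro add_right_mono mult_left_mono) auto
  also have "\<dots> = 2 * real (Suc n) * K ^ Suc n * d" by (simp add: algebra_simps)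
  finally show ?case by (simp add: a_def b_def P_def Q_def)
qed simp

lemma small_growth_open_cocycle:
  assumes fin: "finite_measure L" and f: "f \<in> automorphisms L" and A: "A \<in> bounded_SL2 L" and sg: "small_growth L \<epsilon> f A"
  obtains d where "d > 0" "\<And>B. B \<in> bounded_SL2 L \<Longrightarrow> cocycle_dist L A B < d \<Longrightarrow> small_growth L \<epsilon> f B"
proof -
  interpret finite_measure L by fact
  have Am: "A \<in> borel_measurable L" using A by (simp add: bounded_SL2_def)
  obtain K where K: "K \<ge> 1" "AE x in L. norm (A x) \<le> K" using bounded_SL2_norm[OF A] .
  obtain k \<eta> where k: "k > 0" "\<eta> > 0" and m: "measure L {x \<in> space L. norm (cocycle f A k x) > exp (\<epsilon> * real k) - \<eta>} < \<epsilon>"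
    using sg unfolding small_growth_def by blast
  \<comment> \<open>The telescoping bound for letters of norm at most \<open>K + 2\<close> that
    differ by at most \<open>2 * d\<close>; with \<open>d\<close> as chosen next, half of the margin
    survives.\<close>
  define c where "c = 4 * real k * (K + 2) ^ k"
  have c: "c > 0" using k K by (simp add: c_def)
  define d where "d = min 1 (\<eta> / 2 / c)"
  have d: "d > 0" using k c by (simp add: d_def)
  have "small_growth L \<epsilon> f B" if B: "B \<in> bounded_SL2 L" and dB: "cocycle_dist L A B < d" for B
  proof -
    have Bm: "B \<in> borel_measurable L" using B by (simp add: bounded_SL2_def)
    have "AE x in L. norm (A x) \<le> K \<and> norm (A x - B x) \<le> 2 * d"
      using cocycle_dist_AE[OF A B] K(2) by eventually_elim (use dB in auto)
    then have ae: "AE x in L. \<forall>i. norm (A ((f ^^ i) x)) \<le> K \<and> norm (A ((f ^^ i) x) - B ((f ^^ i) x)) \<le> 2 * d"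
      unfolding AE_all_countable using automorphism_funpow_AE[OF f] by blast
    have "measure L {x \<in> space L. norm (cocycle f B k x) > exp (\<epsilon> * real k) - \<eta> / 2}
        \<le> measure L {x \<in> space L. norm (cocycle f A k x) > exp (\<epsilon> * real k) - \<eta>}"
    proof (rule finite_measure_mono_AE)
      show "{x \<in> space L. norm (cocycle f A k x) > exp (\<epsilon> * real k) - \<eta>} \<in> sets L"
        using measurable_cocycle[OF f Am] by measurable
      show "AE x in L. x \<in> {x \<in> space L. norm (cocycle f B k x) > exp (\<epsilon> * real k) - \<eta> / 2}
          \<longrightarrow> x \<in> {x \<in> space L. norm (cocycle f A k x) > exp (\<epsilon> * real k) - \<eta>}"
        using ae
      proof eventually_elim
        case (elim x)
        have d1: "d \<le> 1" "d \<le> \<eta> / 2 / c" by (simp_all add: d_def)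
        have nB: "norm (B y) \<le> K + 2" if "norm (A y) \<le> K \<and> norm (A y - B y) \<le> 2 * d" for y
          using that norm_triangle_ineq4[of "A y" "A y - B y"] d1 by simp
        have "norm (cocycle f A k x - cocycle f B k x) \<le> 2 * real k * (K + 2) ^ k * (2 * d)"
        proof (rule norm_cocycle_diff_le)
          fix i
          show "norm (A ((f ^^ i) x)) \<le> K + 2" "norm (B ((f ^^ i) x)) \<le> K + 2"
            "norm (A ((f ^^ i) x) - B ((f ^^ i) x)) \<le> 2 * d"
            using elim[rule_format, of i] nB[OF elim[rule_format, of i]] by auto
        qed (use K d in auto)
        also have "\<dots> = c * d" by (simp add: c_def)
        also have "\<dots> \<le> \<eta> / 2" using d1(2) c by (simp add: field_simps)
        finally have "norm (cocycle f B k x) \<le> norm (cocycle f A k x) + \<eta> / 2"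
          using norm_triangle_ineq2[of "cocycle f B k x" "cocycle f A k x"] by (simp add: norm_minus_commute)
        then show ?case by auto
      qed
    qed
    then have "measure L {x \<in> space L. norm (cocycle f B k x) > exp (\<epsilon> * real k) - \<eta> / 2} < \<epsilon>" using m by linarith
    then show ?thesis unfolding small_growth_def using k by (intro exI[of _ k] conjI exI[of _ "\<eta> / 2"]) auto
  qed
  with d that show ?thesis by blast
qed

text \<open>Replace \<open>f\<close> by \<open>h\<close> one step at a time; \<open>h\<close>
  preserves the measure, so earlier errors are carried along without growth.\<close>

lemma measure_funpow_image_diff:
  assumes fin: "finite_measure L" and f: "f \<in> automorphisms L" and h: "h \<in> automorphisms L" and R: "R \<in> sets L"
  shows "measure L ((h ^^ j) ` R - (f ^^ j) ` R) \<le> (\<Sum>i<j. measure L (sym_diff (h ` (f ^^ i) ` R) (f ` (f ^^ i) ` R)))"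
proof (induction j)
  case (Suc j)
  interpret finite_measure L by fact
  have fs: "(f ^^ i) ` R \<in> sets L" "(h ^^ i) ` R \<in> sets L" for i
    using automorphism_image_sets(1)[OF automorphism_funpow R] f h by auto
  have hi: "h ` S \<in> sets L" "f ` S \<in> sets L" "measure L (h ` S) = measure L S" if "S \<in> sets L" for S
    using automorphism_image_sets[OF h that] automorphism_image_sets[OF f that] by (auto simp: measure_def)
  let ?D = "(h ^^ j) ` R - (f ^^ j) ` R" and ?E = "sym_diff (h ` (f ^^ j) ` R) (f ` (f ^^ j) ` R)"
  have im: "(h ^^ Suc j) ` R = h ` (h ^^ j) ` R" "(f ^^ Suc j) ` R = f ` (f ^^ j) ` R" by (simp_all add: image_comp)
  have "measure L ((h ^^ Suc j) ` R - (f ^^ Suc j) ` R) \<le> measure L (h ` ?D \<union> ?E)"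
    unfolding im using fs hi by (intro finite_measure_mono) auto
  also have "\<dots> \<le> measure L (h ` ?D) + measure L ?E"
    using fs hi by (intro measure_subadditive) (auto simp: emeasure_eq_measure)
  also have "measure L (h ` ?D) = measure L ?D" using fs by (intro hi) auto
  finally show ?case using Suc by simp
qed simp

text \<open>Weak closeness controls the images of finitely many sets, not of points. The ball that
  contains the letters is therefore covered by finitely many small balls; if \<open>h\<close> moves
  the corresponding sets almost as \<open>f\<close> does up to time \<open>k\<close>, then for most
  points the letters read at equal times along the two orbits lie in a common small ball.\<close>

lemma small_growth_open_automorphism:
  assumes fin: "finite_measure L" and f: "f \<in> automorphisms L" and A: "A \<in> bounded_SL2 L" and sg: "small_growth L \<epsilon> f A"
  obtains \<K> d where "finite \<K>" "\<K> \<subseteq> sets L" "d > 0"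
    "\<And>h. h \<in> automorphisms L \<Longrightarrow> (\<And>K. K \<in> \<K> \<Longrightarrow> measure L (sym_diff (h ` K) (f ` K)) < d) \<Longrightarrow> small_growth L \<epsilon> h A"
proof -
  interpret finite_measure L by fact
  have Am: "A \<in> borel_measurable L" using A by (simp add: bounded_SL2_def)
  obtain K where K: "K \<ge> 1" "AE x in L. norm (A x) \<le> K" using bounded_SL2_norm[OF A] .
  obtain k \<eta> where k: "k > 0" "\<eta> > 0" and m: "measure L {x \<in> space L. norm (cocycle f A k x) > exp (\<epsilon> * real k) - \<eta>} < \<epsilon>"
    using sg unfolding small_growth_def by blast
  define c where "c = 2 * real k * K ^ k"
  have c: "c > 0" using k K by (simp add: c_def)
  define d where "d = \<eta> / 2 / c"
  have d: "d > 0" using k c by (simp add: d_def)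
  have "compact (cball (0 :: real ^ 2 ^ 2) K)" by simp
  then obtain D where D: "finite D" "cball (0 :: real ^ 2 ^ 2) K \<subseteq> (\<Union>c\<in>D. ball c (d / 2))"
    unfolding compact_eq_totally_bounded using d by (meson half_gt_zero)
  define P where "P = (\<lambda>c. {x \<in> space L. norm (A x - c) < d / 2})"
  have P: "P c \<in> sets L" for c unfolding P_def by (rule near_set_measurable[OF Am])
  define R where "R = (\<lambda>c j. (f ^^ j) -` P c \<inter> space L)"
  have R: "R c j \<in> sets L" for c j unfolding R_def by (rule automorphism_vimage(1)[OF automorphism_funpow[OF f] P])
  have fR: "(f ^^ j) ` R c j = P c" for c j
  proof (intro equalityI subsetI)
    fix y assume y: "y \<in> P c"
    then have "y \<in> (f ^^ j) ` space L"
      using automorphism_funpow[OF f, of j] by (auto simp: automorphisms_def bij_betw_def P_def)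
    then obtain x where "x \<in> space L" "y = (f ^^ j) x" by blast
    then show "y \<in> (f ^^ j) ` R c j" using y by (auto simp: R_def)
  qed (auto simp: R_def)
  define \<K> where "\<K> = (\<lambda>(c, j, i). (f ^^ i) ` R c j) ` (D \<times> {..<k} \<times> {..<k})"
  have \<K>: "(f ^^ i) ` R c j \<in> \<K>" if "c \<in> D" "j < k" "i < k" for c j i
    unfolding \<K>_def by (rule image_eqI[of _ _ "(c, j, i)"]) (use that in auto)
  define gap where "gap = \<epsilon> - measure L {x \<in> space L. norm (cocycle f A k x) > exp (\<epsilon> * real k) - \<eta>}"
  have gap: "gap > 0" using m by (simp add: gap_def)
  \<comment> \<open>The bad set is a union of \<open>card D * k\<close> sets of measure at most
    \<open>k * e\<close>; the 1 in the denominator keeps the total strictly below \<open>gap\<close>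
    and avoids a division by 0.\<close>
  define e where "e = gap / (real (card D * k * k) + 1)"
  have e: "e > 0" using gap by (simp add: e_def add_nonneg_pos)
  have "small_growth L \<epsilon> h A" if h: "h \<in> automorphisms L" and close: "\<And>K. K \<in> \<K> \<Longrightarrow> measure L (sym_diff (h ` K) (f ` K)) < e" for h
  proof -
    \<comment> \<open>The points of \<open>R c j\<close> that \<open>h ^^ j\<close> takes outside
      \<open>P c\<close>.\<close>
    define W where "W = (\<lambda>c j. (h ^^ j) -` ((h ^^ j) ` R c j - (f ^^ j) ` R c j) \<inter> space L)"
    have hR: "(h ^^ j) ` R c j - (f ^^ j) ` R c j \<in> sets L" for c j
      using automorphism_image_sets(1)[OF automorphism_funpow[OF h] R] automorphism_image_sets(1)[OF automorphism_funpow[OF f] R] by auto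
    have Ws: "W c j \<in> sets L" for c j unfolding W_def by (rule automorphism_vimage(1)[OF automorphism_funpow[OF h] hR])
    have W: "measure L (W c j) \<le> k * e" if "c \<in> D" "j < k" for c j
    proof -
      have "measure L (W c j) = measure L ((h ^^ j) ` R c j - (f ^^ j) ` R c j)"
        unfolding W_def by (rule automorphism_vimage(3)[OF automorphism_funpow[OF h] hR])
      also have "\<dots> \<le> (\<Sum>i<j. measure L (sym_diff (h ` (f ^^ i) ` R c j) (f ` (f ^^ i) ` R c j)))"
        by (rule measure_funpow_image_diff[OF fin f h R])
      also have "\<dots> \<le> (\<Sum>i<j. e)"
        by (intro sum_mono less_imp_le close \<K>) (use that in auto)
      also have "\<dots> \<le> k * e" using that e by simp
      finally show ?thesis .
    qed
    define Bad where "Bad = (\<Union>c\<in>D. \<Union>j\<in>{..<k}. W c j)"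
    have Bads: "Bad \<in> sets L" unfolding Bad_def using Ws D(1) by (intro sets.finite_UN) auto
    have "measure L Bad \<le> (\<Sum>c\<in>D. measure L (\<Union>j\<in>{..<k}. W c j))"
      unfolding Bad_def using Ws D(1) by (intro finite_measure_subadditive_finite) auto
    also have "\<dots> \<le> (\<Sum>c\<in>D. \<Sum>j<k. measure L (W c j))"
      using Ws by (intro sum_mono finite_measure_subadditive_finite) auto
    also have "\<dots> \<le> (\<Sum>c\<in>D. \<Sum>j<k. k * e)" by (intro sum_mono W) auto
    also have "\<dots> = real (card D * k * k) * e" by simp
    also have "\<dots> < gap"
    proof -
      have "(real (card D * k * k) + 1) * e = gap" by (simp add: e_def add_nonneg_eq_0_iff)
      then show ?thesis using e by (simp add: algebra_simps)
    qed
    finally have mBad: "measure L Bad < gap" .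
    have ae: "AE x in L. \<forall>i. norm (A ((f ^^ i) x)) \<le> K \<and> norm (A ((h ^^ i) x)) \<le> K"
      unfolding AE_all_countable by (intro allI AE_conjI automorphism_funpow_AE[OF f] automorphism_funpow_AE[OF h] K)
    let ?Sf = "{x \<in> space L. norm (cocycle f A k x) > exp (\<epsilon> * real k) - \<eta>}"
    have Sf: "?Sf \<in> sets L" using measurable_cocycle[OF f Am] by measurable
    have "measure L {x \<in> space L. norm (cocycle h A k x) > exp (\<epsilon> * real k) - \<eta> / 2} \<le> measure L (?Sf \<union> Bad)"
    proof (rule finite_measure_mono_AE)
      show "?Sf \<union> Bad \<in> sets L" using Sf Bads by auto
      show "AE x in L. x \<in> {x \<in> space L. norm (cocycle h A k x) > exp (\<epsilon> * real k) - \<eta> / 2} \<longrightarrow> x \<in> ?Sf \<union> Bad"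
        using ae AE_space
      proof eventually_elim
        case (elim x)
        have "norm (cocycle h A k x) \<le> norm (cocycle f A k x) + \<eta> / 2" if nb: "x \<notin> Bad"
        proof -
          have close: "norm (A ((f ^^ j) x) - A ((h ^^ j) x)) \<le> d" if j: "j < k" for j
          proof -
            have "A ((f ^^ j) x) \<in> cball 0 K" using elim by simp
            then obtain c where c: "c \<in> D" "A ((f ^^ j) x) \<in> ball c (d / 2)" using D(2) by blast
            then have xR: "x \<in> R c j" using elim automorphism_funpow_space[OF f, of x j]
              by (auto simp: R_def P_def dist_norm norm_minus_commute)
            have "x \<notin> W c j" using nb c j by (auto simp: Bad_def)
            then have "(h ^^ j) x \<in> (f ^^ j) ` R c j" using xR elim by (auto simp: W_def)
            then have "(h ^^ j) x \<in> P c" by (simp add: fR)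
            then have 2: "norm (A ((h ^^ j) x) - c) < d / 2" by (simp add: P_def)
            have 1: "norm (A ((f ^^ j) x) - c) < d / 2" using c by (simp add: dist_norm norm_minus_commute)
            show ?thesis using norm_triangle_ineq4[of "A ((f ^^ j) x) - c" "A ((h ^^ j) x) - c"] 1 2 by simp
          qed
          have "norm (cocycle f A k x - cocycle h A k x) \<le> 2 * real k * K ^ k * d"
            by (rule norm_cocycle_diff_le) (use K d elim close in auto)
          also have "\<dots> = \<eta> / 2" using c by (simp add: d_def flip: c_def)
          finally show ?thesis
            using norm_triangle_ineq2[of "cocycle h A k x" "cocycle f A k x"] by (simp add: norm_minus_commute)
        qed
        then show ?case by auto
      qed
    qed
    also have "\<dots> \<le> measure L ?Sf + measure L Bad"
      using Sf Bads by (intro measure_subadditive) (auto simp: emeasure_eq_measure)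
    also have "\<dots> < \<epsilon>" using mBad by (simp add: gap_def)
    finally show ?thesis unfolding small_growth_def using k by (intro exI[of _ k] conjI exI[of _ "\<eta> / 2"]) auto
  qed
  moreover have "\<K> \<subseteq> sets L" unfolding \<K>_def using automorphism_image_sets(1)[OF automorphism_funpow[OF f] R] by auto
  moreover have "finite \<K>" unfolding \<K>_def using D by auto
  ultimately show ?thesis using that[of \<K> e] e by blast
qed

section \<open>Finite Borel measures without atoms on compact spaces\<close>

text \<open>The measure-theoretic side of a compact manifold with its volume. The last assumption
  excludes atoms, so that sets can be cut into pieces of any prescribed measure and modelled on an
  interval.\<close>

locale standard_space = finite_measure L for L :: "'a measure" +
  fixes M :: "'a topology"
  assumes compact_M: "compact_space M" and Hausdorff_M: "Hausdorff_space M"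
    and second_countable_M: "second_countable M"
    and space_L: "space L = topspace M"
    and sets_L: "sets L = sigma_sets (topspace M) {U. openin M U}"
    and null_points: "\<And>x. x \<in> space L \<Longrightarrow> emeasure L {x} = 0"
begin

lemma open_sets: "openin M U \<Longrightarrow> U \<in> sets L"
  unfolding sets_L by (rule sigma_sets.Basic) simp

lemma closed_sets: "closedin M C \<Longrightarrow> C \<in> sets L"
proof -
  assume C: "closedin M C"
  then have "space L - (topspace M - C) \<in> sets L" by (intro sets.compl_sets open_sets) auto
  then show ?thesis using closedin_subset[OF C] by (simp add: space_L double_diff)
qed

lemma sets_induct [consumes 1, case_names Open Compl Union]:
  assumes "S \<in> sets L" "\<And>U. openin M U \<Longrightarrow> P U"
    "\<And>S. S \<in> sets L \<Longrightarrow> P S \<Longrightarrow> P (space L - S)"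
    "\<And>A :: nat \<Rightarrow> 'a set. (\<And>i. A i \<in> sets L) \<Longrightarrow> (\<And>i. P (A i)) \<Longrightarrow> P (\<Union>i. A i)"
  shows "P S"
proof -
  have "S \<in> sigma_sets (topspace M) {U. openin M U}" using assms(1) by (simp add: sets_L)
  then show ?thesis
  proof induction
    case (Basic a) then show ?case using assms(2) by simp
  next
    case Empty then show ?case using assms(2) by simp
  next
    case (Compl a) then show ?case using assms(3)[of a] by (simp add: sets_L space_L)
  next
    case (Union a) then show ?case using assms(4)[of a] by (simp add: sets_L)
  qed
qed

text \<open>The space is regular, so \<open>U\<close> is the union of those closures of members of a
  countable base that it contains; finite unions of these closed sets exhaust its measure.\<close>

lemma open_approx:
  assumes U: "openin M U" and e: "e > 0"
  obtains C where "closedin M C" "C \<subseteq> U" "measure L (U - C) < e"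
proof (cases "U = {}")
  case True then show ?thesis using that[of "{}"] e by simp
next
  case False
  obtain \<B> where \<B>: "countable \<B>" "\<And>V. V \<in> \<B> \<Longrightarrow> openin M V"
    "\<And>U x. openin M U \<Longrightarrow> x \<in> U \<Longrightarrow> \<exists>V\<in>\<B>. x \<in> V \<and> V \<subseteq> U"
    using second_countable_M unfolding second_countable_def by metis
  define \<C> where "\<C> = {M closure_of V | V. V \<in> \<B> \<and> M closure_of V \<subseteq> U}"
  have cC: "countable \<C>" using \<B>(1) unfolding \<C>_def by (auto intro: countable_subset[OF _ countable_image[OF \<B>(1)]])
  have UC: "U = \<Union>\<C>"
  proof (intro equalityI subsetI)
    fix x assume x: "x \<in> U"
    obtain W where W: "openin M W" "x \<in> W" "disjnt (topspace M - U) (M closure_of W)"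
      using compact_Hausdorff_imp_regular_space[OF compact_M Hausdorff_M] U x openin_subset[OF U]
      unfolding regular_space by (metis DiffD2 Diff_Diff_Int Diff_iff closedin_diff closedin_topspace in_mono)
    obtain V where V: "V \<in> \<B>" "x \<in> V" "V \<subseteq> W" using \<B>(3)[OF W(1,2)] by blast
    have "M closure_of V \<subseteq> M closure_of W" using V by (intro closure_of_mono)
    also have "\<dots> \<subseteq> U" using W(3) closure_of_subset_topspace[of M W] by (auto simp: disjnt_def)
    finally have "M closure_of V \<in> \<C>" using V by (auto simp: \<C>_def)
    moreover have "x \<in> M closure_of V" using closure_of_subset[OF openin_subset[OF \<B>(2)[OF V(1)]]] V by blast
    ultimately show "x \<in> \<Union>\<C>" by blast
  qed (auto simp: \<C>_def)
  then have ne: "\<C> \<noteq> {}" using False by auto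
  define T where "T = (\<lambda>n. \<Union>i\<le>n. from_nat_into \<C> i)"
  have Tc: "closedin M (T n)" for n
  proof -
    have "closedin M c" if "c \<in> \<C>" for c using that by (auto simp: \<C>_def)
    then have "closedin M (from_nat_into \<C> i)" for i using from_nat_into[OF ne] by blast
    then show ?thesis unfolding T_def by (intro closedin_Union) auto
  qed
  have TU: "(\<Union>n. T n) = U"
    unfolding T_def UC by (subst (2) range_from_nat_into[OF ne cC, symmetric]) auto
  have "(\<lambda>n. measure L (T n)) \<longlonglongrightarrow> measure L (\<Union>n. T n)"
  proof (rule finite_Lim_measure_incseq)
    show "incseq T" unfolding incseq_def T_def by (auto intro: order_trans)
  qed (use closed_sets[OF Tc] in auto)
  then have "\<forall>\<^sub>F n in sequentially. measure L (T n) > measure L U - e"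
    unfolding TU using e by (intro order_tendstoD(1)) auto
  then obtain n where n: "measure L (T n) > measure L U - e" by (auto simp: eventually_sequentially)
  have "T n \<subseteq> U" using TU by blast
  then have "measure L (U - T n) = measure L U - measure L (T n)"
    using closed_sets[OF Tc] open_sets[OF U] by (intro finite_measure_Diff) auto
  then show ?thesis using that[OF Tc \<open>T n \<subseteq> U\<close>] n by simp
qed

lemma measure_Union_geometric:
  assumes A: "\<And>i. A i \<in> sets L" "\<And>i. measure L (A i) \<le> e * (1 / 2) ^ Suc i"
  shows "measure L (\<Union>i. A i) \<le> e"
proof -
  have s: "(\<lambda>i. e * (1 / 2) ^ Suc i) sums (e * 1)" by (intro sums_mult power_half_series)
  have sm: "summable (\<lambda>i. measure L (A i))"
    by (rule summable_comparison_test[OF _ sums_summable[OF s]]) (use A(2) in auto)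
  have "measure L (\<Union>i. A i) \<le> (\<Sum>i. measure L (A i))"
    using A(1) sm by (intro finite_measure_subadditive_countably) auto
  also have "\<dots> \<le> (\<Sum>i. e * (1 / 2) ^ Suc i)" by (intro suminf_le A sm sums_summable[OF s])
  also have "\<dots> = e" using sums_unique[OF s] by simp
  finally show ?thesis .
qed

text \<open>Asking for a closed set inside and an open set outside makes the property symmetric
  under complements. For a countable union the closed sets are truncated to a finite union, as an
  infinite one need not be closed.\<close>

lemma regular:
  assumes "S \<in> sets L" "e > 0"
  shows "\<exists>C U. closedin M C \<and> openin M U \<and> C \<subseteq> S \<and> S \<subseteq> U \<and> measure L (U - C) < e"
  using assms
proof (induction arbitrary: e rule: sets_induct)
  case (Open U)
  obtain C where "closedin M C" "C \<subseteq> U" "measure L (U - C) < e" using open_approx[OF Open(1,2)] .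
  then show ?case using Open(1) by (intro exI[of _ C] exI[of _ U] conjI) auto
next
  case (Compl S)
  obtain C U where CU: "closedin M C" "openin M U" "C \<subseteq> S" "S \<subseteq> U" "measure L (U - C) < e"
    using Compl.IH[OF Compl.prems] by auto
  have "(space L - C) - (space L - U) = U - C" using openin_subset[OF CU(2)] by (auto simp: space_L)
  then show ?case using CU
    by (intro exI[of _ "space L - U"] exI[of _ "space L - C"]) (auto simp: space_L)
next
  case (Union A)
  have "\<exists>C U. closedin M C \<and> openin M U \<and> C \<subseteq> A i \<and> A i \<subseteq> U \<and> measure L (U - C) < e / 2 * (1 / 2) ^ Suc i" for i
    using Union.prems by (intro Union.IH) auto
  then obtain C U where CU: "\<And>i. closedin M (C i)" "\<And>i. openin M (U i)" "\<And>i. C i \<subseteq> A i" "\<And>i. A i \<subseteq> U i"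
    "\<And>i. measure L (U i - C i) < e / 2 * (1 / 2) ^ Suc i" by metis
  define T where "T = (\<lambda>n. \<Union>i\<le>n. C i)"
  have Tc: "closedin M (T n)" for n unfolding T_def using CU(1) by (intro closedin_Union) auto
  have TU: "(\<Union>n. T n) = (\<Union>i. C i)" unfolding T_def by auto
  have "(\<lambda>n. measure L (T n)) \<longlonglongrightarrow> measure L (\<Union>n. T n)"
  proof (rule finite_Lim_measure_incseq)
    show "incseq T" unfolding incseq_def T_def by (auto intro: order_trans)
  qed (use closed_sets[OF Tc] in auto)
  then have "\<forall>\<^sub>F n in sequentially. measure L (T n) > measure L (\<Union>i. C i) - e / 2"
    unfolding TU using Union.prems by (intro order_tendstoD(1)) auto
  then obtain n where n: "measure L (T n) > measure L (\<Union>i. C i) - e / 2" by (auto simp: eventually_sequentially)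
  have s: "C i \<in> sets L" "U i \<in> sets L" for i using CU closed_sets open_sets by auto
  have "measure L (\<Union>i. U i - C i) \<le> e / 2"
    using s CU(5) by (intro measure_Union_geometric) (auto intro: less_imp_le)
  moreover have "measure L ((\<Union>i. U i) - T n) \<le> measure L ((\<Union>i. U i - C i) \<union> ((\<Union>i. C i) - T n))"
    using s closed_sets[OF Tc] by (intro finite_measure_mono) auto
  moreover have "measure L ((\<Union>i. U i - C i) \<union> ((\<Union>i. C i) - T n)) \<le> measure L (\<Union>i. U i - C i) + measure L ((\<Union>i. C i) - T n)"
    using s closed_sets[OF Tc] by (intro measure_subadditive) (auto simp: emeasure_eq_measure)
  moreover have "measure L ((\<Union>i. C i) - T n) = measure L (\<Union>i. C i) - measure L (T n)"
    using s closed_sets[OF Tc] by (intro finite_measure_Diff) (auto simp: T_def)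
  ultimately have "measure L ((\<Union>i. U i) - T n) < e" using n by linarith
  moreover have "T n \<subseteq> (\<Union>i. A i)" unfolding T_def using CU(3) by blast
  moreover have "(\<Union>i. A i) \<subseteq> (\<Union>i. U i)" by (rule UN_mono) (use CU(4) in auto)
  moreover have "openin M (\<Union>i. U i)" using CU(2) by auto
  ultimately show ?case using Tc by (intro exI[of _ "T n"] exI[of _ "\<Union>i. U i"] conjI) auto
qed

lemma inner_regular_closed:
  assumes "S \<in> sets L" "e > 0"
  obtains C where "closedin M C" "C \<subseteq> S" "measure L (S - C) < e"
proof -
  obtain C U where CU: "closedin M C" "openin M U" "C \<subseteq> S" "S \<subseteq> U" "measure L (U - C) < e"
    using regular[OF assms] by blast
  have "measure L (S - C) \<le> measure L (U - C)"
    using CU closed_sets open_sets by (intro finite_measure_mono) auto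
  then show ?thesis using that CU by force
qed

text \<open>For every rational \<open>q n\<close>, shrink the sublevel set and its complement in
  \<open>S\<close> to closed sets. On the intersection \<open>K\<close> of the unions of these pairs
  each rational sublevel set is relatively clopen, which gives continuity.\<close>

lemma Lusin:
  fixes G :: "'a \<Rightarrow> real"
  assumes G: "G \<in> borel_measurable L" and S: "S \<in> sets L" and e: "e > 0"
  obtains C where "closedin M C" "C \<subseteq> S" "measure L (S - C) \<le> e" "continuous_map (subtopology M C) euclidean G"
proof -
  define q :: "nat \<Rightarrow> real" where "q = (\<lambda>n. real_of_rat (from_nat_into UNIV n))"
  have q: "\<exists>n. a < q n \<and> q n < b" if ab: "a < b" for a b
  proof -
    obtain r where "a < real_of_rat r" "real_of_rat r < b" using of_rat_dense[OF ab] by blast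
    moreover obtain n where "r = from_nat_into UNIV n" by (metis UNIV_I countableI_type from_nat_into_surj)
    ultimately show ?thesis unfolding q_def by blast
  qed
  define A where "A = (\<lambda>n. {x \<in> S. G x < q n})"
  have A: "A n \<in> sets L" for n
  proof -
    have "A n = {x \<in> space L. G x < q n} \<inter> S" using sets.sets_into_space[OF S] by (auto simp: A_def)
    then show ?thesis using G S by auto
  qed
  have "\<exists>C D. closedin M C \<and> C \<subseteq> A n \<and> measure L (A n - C) < e / 2 * (1 / 2) ^ Suc n \<and>
      closedin M D \<and> D \<subseteq> S - A n \<and> measure L (S - A n - D) < e / 2 * (1 / 2) ^ Suc n" for n
  proof -
    have e': "e / 2 * (1 / 2) ^ Suc n > 0" using e by simp
    obtain C where "closedin M C" "C \<subseteq> A n" "measure L (A n - C) < e / 2 * (1 / 2) ^ Suc n"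
      using inner_regular_closed[OF A e'] .
    moreover obtain D where "closedin M D" "D \<subseteq> S - A n" "measure L (S - A n - D) < e / 2 * (1 / 2) ^ Suc n"
      using inner_regular_closed[OF sets.Diff[OF S A] e'] .
    ultimately show ?thesis by blast
  qed
  then obtain C D where C: "\<And>n. closedin M (C n)" "\<And>n. C n \<subseteq> A n" "\<And>n. measure L (A n - C n) < e / 2 * (1 / 2) ^ Suc n"
    and D: "\<And>n. closedin M (D n)" "\<And>n. D n \<subseteq> S - A n" "\<And>n. measure L (S - A n - D n) < e / 2 * (1 / 2) ^ Suc n"
    by metis
  define K where "K = (\<Inter>n. C n \<union> D n)"
  have Kc: "closedin M K" unfolding K_def using C(1) D(1) by (intro closedin_Inter) auto
  have KS: "K \<subseteq> S" unfolding K_def using C(2)[of 0] D(2)[of 0] by (auto simp: A_def)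
  have cs: "C n \<in> sets L" "D n \<in> sets L" for n using C(1) D(1) closed_sets by auto
  have "measure L (S - K) = measure L (\<Union>n. S - (C n \<union> D n))" by (rule arg_cong[where f = "measure L"]) (auto simp: K_def)
  also have "\<dots> \<le> e"
  proof (rule measure_Union_geometric)
    fix n
    have "S - (C n \<union> D n) \<subseteq> (A n - C n) \<union> (S - A n - D n)" by auto
    then have "measure L (S - (C n \<union> D n)) \<le> measure L ((A n - C n) \<union> (S - A n - D n))"
      using cs A S by (intro finite_measure_mono) auto
    also have "\<dots> \<le> measure L (A n - C n) + measure L (S - A n - D n)"
      using cs A S by (intro measure_subadditive) (auto simp: emeasure_eq_measure)
    finally show "measure L (S - (C n \<union> D n)) \<le> e * (1 / 2) ^ Suc n" using C(3)[of n] D(3)[of n] by simp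
  qed (use cs S in auto)
  finally have mK: "measure L (S - K) \<le> e" .
  have top: "topspace (subtopology M K) = K" using closedin_subset[OF Kc] by (simp add: topspace_subtopology Int_absorb1)
  have lt: "{x \<in> K. G x < q n} = K - D n" and ge: "{x \<in> K. q n \<le> G x} = K - C n" for n
  proof -
    have "x \<in> C n \<or> x \<in> D n" if "x \<in> K" for x using that by (auto simp: K_def)
    moreover have "x \<in> C n \<Longrightarrow> G x < q n" "x \<in> D n \<Longrightarrow> q n \<le> G x" for x
      using C(2)[of n] D(2)[of n] by (auto simp: A_def)
    ultimately show "{x \<in> K. G x < q n} = K - D n" "{x \<in> K. q n \<le> G x} = K - C n" by force+
  qed
  have op: "openin (subtopology M K) {x \<in> K. G x < q n}" "openin (subtopology M K) {x \<in> K. q n \<le> G x}" for n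
  proof -
    have "openin (subtopology M K) ((topspace M - D n) \<inter> K)" "openin (subtopology M K) ((topspace M - C n) \<inter> K)"
      using C(1) D(1) by (auto intro!: openin_subtopology_Int)
    moreover have "(topspace M - D n) \<inter> K = K - D n" "(topspace M - C n) \<inter> K = K - C n"
      using closedin_subset[OF Kc] by auto
    ultimately show "openin (subtopology M K) {x \<in> K. G x < q n}" "openin (subtopology M K) {x \<in> K. q n \<le> G x}"
      unfolding lt ge by simp_all
  qed
  have "continuous_map (subtopology M K) euclidean G"
    unfolding continuous_map_upper_lower_semicontinuous_lt top
  proof (intro conjI allI)
    fix a
    have "{x \<in> K. a < G x} = (\<Union>n\<in>{n. a < q n}. {x \<in> K. q n \<le> G x})"
      using q by (force intro: less_imp_le)
    then show "openin (subtopology M K) {x \<in> K. a < G x}" using op(2) by auto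
    have "{x \<in> K. G x < a} = (\<Union>n\<in>{n. q n < a}. {x \<in> K. G x < q n})"
      using q by force
    then show "openin (subtopology M K) {x \<in> K. G x < a}" using op(1) by auto
  qed
  then show ?thesis using that[OF Kc KS mK] by blast
qed

lemma injective_function:
  obtains \<phi> :: "'a \<Rightarrow> real" where "\<phi> \<in> borel_measurable L" "inj_on \<phi> (space L)"
proof -
  obtain \<B> where \<B>: "countable \<B>" "\<And>V. V \<in> \<B> \<Longrightarrow> openin M V"
    "\<And>U x. openin M U \<Longrightarrow> x \<in> U \<Longrightarrow> \<exists>V\<in>\<B>. x \<in> V \<and> V \<subseteq> U"
    using second_countable_M unfolding second_countable_def by metis
  define V where "V = from_nat_into (insert {} \<B>)"
  have Vr: "range V = insert {} \<B>" unfolding V_def using \<B>(1) by (intro range_from_nat_into) auto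
  have Vo: "openin M (V n)" for n using Vr \<B>(2) by (metis insert_iff openin_empty rangeI)
  define d where "d = (\<lambda>n x. 2 / 3 * (indicator (V n) x * (1 / 3) ^ n) :: real)"
  define \<phi> where "\<phi> = (\<lambda>x. \<Sum>n. d n x)"
  have d01: "0 \<le> d n x" "d n x \<le> 2 / 3 * (1 / 3) ^ n" for n x by (auto simp: d_def indicator_def)
  have geo: "(\<lambda>n. 2 / 3 * (1 / 3 :: real) ^ n) sums 1"
    using sums_mult[OF geometric_sums[of "1/3::real"], of "2/3"] by simp
  have sm: "summable (\<lambda>n. d n x)" for x
    by (rule summable_comparison_test[OF _ sums_summable[OF geo]]) (use d01 in auto)
  have dm: "d n \<in> borel_measurable L" for n unfolding d_def using open_sets[OF Vo] by measurable
  have \<phi>m: "\<phi> \<in> borel_measurable L"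
  proof (rule borel_measurable_LIMSEQ_metric)
    show "(\<lambda>x. \<Sum>n<k. d n x) \<in> borel_measurable L" for k using dm by measurable
    show "(\<lambda>k. \<Sum>n<k. d n x) \<longlonglongrightarrow> \<phi> x" for x unfolding \<phi>_def by (rule summable_LIMSEQ[OF sm])
  qed
  have "inj_on \<phi> (space L)"
  proof (rule inj_onI, rule ccontr)
    fix x y assume xy: "x \<in> space L" "y \<in> space L" "\<phi> x = \<phi> y" "x \<noteq> y"
    have "\<exists>n. (x \<in> V n) \<noteq> (y \<in> V n)"
    proof -
      obtain U where "openin M U" "x \<in> U" "y \<notin> U"
        using Hausdorff_M xy unfolding Hausdorff_space_def space_L disjnt_def by (metis IntI empty_iff)
      then obtain W where "W \<in> \<B>" "x \<in> W" "y \<notin> W" using \<B>(3) by blast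
      moreover from this obtain n where "W = V n" using Vr by (metis insertCI rangeE)
      ultimately show ?thesis by blast
    qed
    then have ex: "\<exists>n. (x \<in> V n) \<noteq> (y \<in> V n)" .
    define n where "n = (LEAST n. (x \<in> V n) \<noteq> (y \<in> V n))"
    have n: "(x \<in> V n) \<noteq> (y \<in> V n)" unfolding n_def using ex by (rule LeastI_ex)
    have nm: "(x \<in> V m) = (y \<in> V m)" if "m < n" for m
      using not_less_Least[OF that[unfolded n_def]] by simp
    have "\<phi> y < \<phi> x" if xy: "x \<in> V n" "y \<notin> V n" "\<And>m. m < n \<Longrightarrow> (x \<in> V m) = (y \<in> V m)" for x y
    proof -
      have tail: "(\<Sum>k. d (k + Suc n) y) \<le> (1 / 3) ^ Suc n"
      proof -
        have "(\<lambda>k. (1 / 3) ^ Suc n * (2 / 3 * (1 / 3 :: real) ^ k)) sums ((1 / 3) ^ Suc n * 1)" by (rule sums_mult[OF geo])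
        then have g: "(\<lambda>k. 2 / 3 * (1 / 3 :: real) ^ (k + Suc n)) sums ((1 / 3) ^ Suc n)" by (simp add: power_add mult_ac)
        have "(\<Sum>k. d (k + Suc n) y) \<le> (\<Sum>k. 2 / 3 * (1 / 3 :: real) ^ (k + Suc n))"
          by (intro suminf_le d01(2) summable_ignore_initial_segment[OF sm] sums_summable[OF g])
        also have "\<dots> = (1 / 3) ^ Suc n" using sums_unique[OF g] by simp
        finally show ?thesis .
      qed
      have "\<phi> y = (\<Sum>k. d (k + Suc n) y) + (\<Sum>k<Suc n. d k y)" unfolding \<phi>_def by (rule suminf_split_initial_segment[OF sm])
      also have "(\<Sum>k<Suc n. d k y) = (\<Sum>k<n. d k y)" using xy by (simp add: d_def)
      also have "(\<Sum>k<n. d k y) = (\<Sum>k<n. d k x)" using xy by (intro sum.cong) (auto simp: d_def indicator_def)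
      also have "(\<Sum>k<n. d k x) = (\<Sum>k<Suc n. d k x) - 2 * (1 / 3) ^ Suc n" using xy by (simp add: d_def)
      finally have 1: "\<phi> y \<le> (\<Sum>k<Suc n. d k x) - (1 / 3) ^ Suc n" using tail by simp
      have "(\<Sum>k<Suc n. d k x) \<le> \<phi> x" unfolding \<phi>_def using d01 by (intro sum_le_suminf[OF sm]) auto
      moreover have "(0::real) < (1 / 3) ^ Suc n" by simp
      ultimately show ?thesis using 1 by linarith
    qed
    from this[of x y] this[of y x] show False using n nm xy(3) by auto
  qed
  with \<phi>m that show ?thesis by blast
qed

end

text \<open>The probability integral transform. Without atoms the distribution function
  \<open>F\<close> is continuous, so for \<open>t < 1\<close> the set where \<open>F\<close> is at
  most \<open>t\<close>, if nonempty, is a ray ending at a point with value exactly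
  \<open>t\<close>.\<close>

lemma cdf_transform_uniform:
  assumes "real_distribution P" and atom: "\<And>t. measure P {t} = 0"
  shows "distr P borel (cdf P) = uniform_measure lborel {0..1}"
proof -
  interpret P: real_distribution P by fact
  define F where "F = cdf P"
  have cont: "isCont F t" for t unfolding F_def P.isCont_cdf by (rule atom)
  have mono: "mono F" unfolding F_def by (rule monoI) (rule P.cdf_nondecreasing)
  have Fm: "F \<in> borel_measurable borel" by (rule borel_measurable_mono[OF mono])
  then have FmP: "F \<in> borel_measurable P" by simp
  have F01: "0 \<le> F t" "F t \<le> 1" for t by (simp_all add: F_def P.cdf_nonneg P.cdf_bounded_prob)
  have rd1: "real_distribution (distr P borel F)" using FmP by simp
  have prob: "prob_space (uniform_measure lborel {0..1::real})" by (intro prob_space_uniform_measure) auto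
  have rd2: "real_distribution (uniform_measure lborel {0..1::real})"
    unfolding real_distribution_def real_distribution_axioms_def using prob by simp
  have "cdf (distr P borel F) t = cdf (uniform_measure lborel {0..1}) t" for t
  proof -
    have 2: "cdf (uniform_measure lborel {0..1}) t = measure lborel ({0..1} \<inter> {..t})"
      unfolding cdf_def by (subst measure_uniform_measure) auto
    have 1: "cdf (distr P borel F) t = measure P {s. F s \<le> t}"
      unfolding cdf_def using FmP by (subst measure_distr) (auto simp: vimage_def)
    consider "t < 0" | "1 \<le> t" | "0 \<le> t" "t < 1" by linarith
    then show ?thesis
    proof cases
      case 1
      then have "{s. F s \<le> t} = {}" "{0..1} \<inter> {..t} = {}" using F01 by (auto simp: not_le intro: less_le_trans)
      then show ?thesis using 2 \<open>cdf (distr P borel F) t = _\<close> by simp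
    next
      case 2
      then have "{s. F s \<le> t} = UNIV" "{0..1} \<inter> {..t} = {0..1}" using F01 by (auto intro: order_trans)
      then show ?thesis using \<open>cdf (uniform_measure lborel {0..1}) t = _\<close> 1 P.prob_space by (simp add: P.space_eq_univ)
    next
      case 3
      have "{0..1} \<inter> {..t} = {0..t}" using 3 by auto
      then have r: "cdf (uniform_measure lborel {0..1}) t = t" using 2 3 by simp
      have "measure P {s. F s \<le> t} = t"
      proof (cases "{s. F s \<le> t} = {}")
        case True
        have "t \<le> 0"
        proof (rule tendsto_lowerbound[of F 0 at_bot])
          show "(F \<longlongrightarrow> 0) at_bot" unfolding F_def by (rule P.cdf_lim_at_bot)
          show "\<forall>\<^sub>F x in at_bot. t \<le> F x" using True by (intro always_eventually allI) (auto simp: not_le intro: less_imp_le)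
        qed simp
        then show ?thesis using True 3 by simp
      next
        case False
        have "\<forall>\<^sub>F x in at_top. t < F x"
          using order_tendstoD(1)[OF P.cdf_lim_at_top_prob 3(2)] unfolding F_def .
        then obtain b where b: "\<And>x. x \<ge> b \<Longrightarrow> t < F x" by (auto simp: eventually_at_top_linorder)
        define T where "T = Sup {s. F s \<le> t}"
        have bdd: "bdd_above {s. F s \<le> t}" using b by (intro bdd_aboveI[of _ b]) (metis mem_Collect_eq linorder_le_cases not_le)
        have cl: "closed {s. F s \<le> t}"
          using cont by (intro closed_Collect_le continuous_on_const continuous_at_imp_continuous_on) auto
        have FT: "F T \<le> t" using closed_contains_Sup[OF False bdd cl] by (simp add: T_def)
        have gt: "t < F s" if "T < s" for s using cSup_upper[OF _ bdd, of s] that by (auto simp: T_def not_less[symmetric])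
        have "t \<le> F T"
        proof (rule tendsto_lowerbound[of F "F T" "at_right T"])
          show "(F \<longlongrightarrow> F T) (at_right T)" using cont[of T] by (simp add: isCont_def filterlim_at_split)
          show "\<forall>\<^sub>F x in at_right T. t \<le> F x" unfolding eventually_at_right_field using gt by (intro exI[of _ "T + 1"]) (auto intro: less_imp_le)
        qed simp
        then have "F T = t" using FT by simp
        have "{s. F s \<le> t} = {..T}"
        proof (intro equalityI subsetI)
          fix s assume "s \<in> {s. F s \<le> t}"
          then show "s \<in> {..T}" using gt[of s] by (cases "T < s") auto
        next
          fix s assume "s \<in> {..T}"
          then show "s \<in> {s. F s \<le> t}" using monoD[OF mono, of s T] FT by simp
        qed
        then show ?thesis using \<open>F T = t\<close> by (simp add: F_def cdf_def)
      qed
      then show ?thesis using r 1 by simp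
    qed
  qed
  then have "cdf (distr P borel F) = cdf (uniform_measure lborel {0..1})" by (rule ext)
  then show ?thesis unfolding F_def[symmetric] using cdf_unique[OF rd1 rd2] by simp
qed

context standard_space
begin

text \<open>An injective measurable function followed by the distribution function of its law
  carries the normalised measure to Lebesgue measure. Passing to \<open>S1\<close> removes two
  defects: \<open>F\<close> may have plateaus, and images of measurable sets must be Borel. The
  first concerns countably many null sets; for the second, Lusin's theorem makes \<open>S1\<close> a
  union of closed sets on which \<theta> is continuous, so that their closed subsets have compact
  images.\<close>

lemma interval_iso:
  assumes S: "S \<in> sets L" and pos: "measure L S > 0"
  obtains \<theta> :: "'a \<Rightarrow> real" and S1 where "S1 \<in> sets L" "S1 \<subseteq> S" "measure L (S - S1) = 0" "\<theta> \<in> borel_measurable L" "inj_on \<theta> S1"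
    "\<And>R. R \<in> sets L \<Longrightarrow> R \<subseteq> S1 \<Longrightarrow> \<theta> ` R \<in> sets borel \<and> \<theta> ` R \<subseteq> {0..1} \<and>
      measure L R = measure L S * measure lborel (\<theta> ` R)"
proof -
  obtain \<phi> :: "'a \<Rightarrow> real" where \<phi>m: "\<phi> \<in> borel_measurable L" and \<phi>: "inj_on \<phi> (space L)" using injective_function .
  define U where "U = uniform_measure L S"
  have U: "prob_space U" unfolding U_def using pos by (intro prob_space_uniform_measure) (auto simp: emeasure_eq_measure)
  have mU: "measure U X = measure L (S \<inter> X) / measure L S" if "X \<in> sets L" for X
    unfolding U_def using S that pos by (subst measure_uniform_measure) (auto simp: emeasure_eq_measure)
  have sU: "space U = space L" "sets U = sets L" by (simp_all add: U_def)
  have mUL: "borel_measurable U = (borel_measurable L :: ('a \<Rightarrow> real) set)" by (rule measurable_cong_sets) (simp_all add: sU)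
  define P where "P = distr U borel \<phi>"
  interpret U: prob_space U by (rule U)
  have P: "real_distribution P" unfolding P_def using \<phi>m mUL by (intro U.real_distribution_distr) auto
  interpret P: real_distribution P by (rule P)
  have atom: "measure P {t} = 0" for t
  proof -
    have "measure P {t} = measure U (\<phi> -` {t} \<inter> space L)"
      unfolding P_def using \<phi>m mUL by (subst measure_distr) (auto simp: sU)
    also have "\<dots> = 0"
    proof -
      have "\<phi> -` {t} \<inter> space L \<subseteq> {x}" if "x \<in> \<phi> -` {t} \<inter> space L" for x using that \<phi> by (auto simp: inj_on_def)
      then consider x where "x \<in> space L" "\<phi> -` {t} \<inter> space L \<subseteq> {x}" | "\<phi> -` {t} \<inter> space L = {}" by blast
      then have "measure L (S \<inter> (\<phi> -` {t} \<inter> space L)) = 0"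
      proof cases
        case 1
        have x: "{x} \<in> sets L" using 1 by (intro closed_sets closedin_Hausdorff_singleton Hausdorff_M) (simp add: space_L)
        have "measure L (S \<inter> (\<phi> -` {t} \<inter> space L)) \<le> measure L {x}" using 1 x by (intro finite_measure_mono) auto
        also have "measure L {x} = 0" using null_points[OF 1(1)] by (simp add: measure_def)
        finally show ?thesis by (simp add: measure_le_0_iff)
      qed simp
      then show ?thesis using mU[of "\<phi> -` {t} \<inter> space L"] measurable_sets[OF \<phi>m, of "{t}"] by simp
    qed
    finally show ?thesis .
  qed
  define F where "F = cdf P"
  have mono: "F s \<le> F t" if "s \<le> t" for s t unfolding F_def using that by (rule P.cdf_nondecreasing)
  have Fm: "F \<in> borel_measurable borel" by (rule borel_measurable_mono) (auto intro: monoI mono)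
  define \<theta> where "\<theta> = (\<lambda>x. F (\<phi> x))"
  have \<theta>m: "\<theta> \<in> borel_measurable L" unfolding \<theta>_def using \<phi>m Fm by (rule measurable_compose)
  have dist: "distr U borel \<theta> = uniform_measure lborel {0..1}"
  proof -
    have "distr U borel \<theta> = distr P borel F"
      unfolding P_def using distr_distr[of F borel borel \<phi> U] \<phi>m Fm unfolding mUL by (simp add: \<theta>_def o_def)
    then show ?thesis unfolding F_def by (simp add: cdf_transform_uniform[OF P atom])
  qed
  have \<theta>U: "measure L (S \<inter> (\<theta> -` T \<inter> space L)) = measure L S * measure lborel ({0..1} \<inter> T)" if T: "T \<in> sets borel" for T
  proof -
    have "measure (distr U borel \<theta>) T = measure U (\<theta> -` T \<inter> space L)"
      using \<theta>m mUL T by (subst measure_distr) (auto simp: sU)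
    moreover have "measure (uniform_measure lborel {0..1::real}) T = measure lborel ({0..1} \<inter> T)"
      using T by (subst measure_uniform_measure) auto
    ultimately have "measure L (S \<inter> (\<theta> -` T \<inter> space L)) / measure L S = measure lborel ({0..1} \<inter> T)"
      unfolding dist using mU[of "\<theta> -` T \<inter> space L"] measurable_sets[OF \<theta>m T] by simp
    then show ?thesis using pos by (simp add: field_simps)
  qed
  have level: "measure L (S \<inter> (\<theta> -` {c} \<inter> space L)) = 0" for c
  proof -
    have "measure lborel ({0..1} \<inter> {c}) = 0" by (cases "c \<in> {0..1}") auto
    then show ?thesis using \<theta>U[of "{c}"] by simp
  qed
  \<comment> \<open>If \<theta> identifies two points, there is a rational \<open>q\<close> between
    their values of \<phi>, and \<open>F (of_rat q)\<close> is the common value of \<theta>; the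
    points to the left of \<open>q\<close> with this value are discarded. Level sets of \<theta> are
    null, so this costs no measure.\<close>
  define Bd where "Bd = (\<Union>q::rat. S \<inter> (\<theta> -` {F (of_rat q)} \<inter> space L) \<inter> {x \<in> space L. \<phi> x < of_rat q})"
  have lev_s: "S \<inter> (\<theta> -` {c} \<inter> space L) \<in> sets L" for c using S measurable_sets[OF \<theta>m, of "{c}"] by auto
  have lt_s: "{x \<in> space L. \<phi> x < c} \<in> sets L" for c using \<phi>m by measurable
  have Bd_s: "Bd \<in> sets L" unfolding Bd_def using lev_s lt_s by (intro sets.countable_UN) auto
  have "Bd \<in> null_sets L" unfolding Bd_def
  proof (rule null_sets_UN)
    fix q :: rat
    have "S \<inter> (\<theta> -` {F (of_rat q)} \<inter> space L) \<in> null_sets L"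
      using lev_s level by (auto simp: null_sets_def emeasure_eq_measure)
    then show "S \<inter> (\<theta> -` {F (of_rat q)} \<inter> space L) \<inter> {x \<in> space L. \<phi> x < of_rat q} \<in> null_sets L"
      using lt_s by (rule null_set_Int2)
  qed
  then have Bd0: "measure L Bd = 0" by (simp add: null_sets_def measure_def)
  define S0 where "S0 = S - Bd"
  have S0: "S0 \<in> sets L" "S0 \<subseteq> S" using S Bd_s by (auto simp: S0_def)
  have Ssp: "S \<subseteq> space L" using sets.sets_into_space[OF S] .
  have inj: "inj_on \<theta> S0"
  proof -
    have False if xy: "x \<in> S0" "y \<in> S0" "\<phi> x < \<phi> y" "\<theta> x = \<theta> y" for x y
    proof -
      obtain q where q: "\<phi> x < of_rat q" "of_rat q < \<phi> y" using of_rat_dense[OF xy(3)] by blast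
      have "F (of_rat q) = \<theta> x" using mono[of "\<phi> x" "of_rat q"] mono[of "of_rat q" "\<phi> y"] q xy(4) by (simp add: \<theta>_def)
      then have "x \<in> Bd" unfolding Bd_def by (intro UN_I[of q]) (use q xy(1) Ssp S0 in auto)
      then show False using xy by (simp add: S0_def)
    qed
    then show ?thesis using \<phi> S0 Ssp unfolding inj_on_def by (metis linorder_neqE_linordered_idom subsetD)
  qed
  have "\<exists>C. closedin M C \<and> C \<subseteq> S0 \<and> measure L (S0 - C) \<le> 1 / real (Suc n) \<and> continuous_map (subtopology M C) euclidean \<theta>" for n
    using Lusin[OF \<theta>m S0(1), of "1 / real (Suc n)"] by (metis of_nat_0_less_iff zero_less_Suc zero_less_divide_1_iff)
  then obtain C where C: "\<And>n. closedin M (C n)" "\<And>n. C n \<subseteq> S0" "\<And>n. measure L (S0 - C n) \<le> 1 / real (Suc n)"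
    "\<And>n. continuous_map (subtopology M (C n)) euclidean \<theta>" by metis
  define S1 where "S1 = (\<Union>n. C n)"
  have S1: "S1 \<in> sets L" "S1 \<subseteq> S0" unfolding S1_def using C closed_sets by auto
  have m1: "measure L (S - S1) = 0"
  proof -
    have "measure L (S - S1) \<le> 1 / real (Suc n)" for n
    proof -
      have "measure L (S - S1) \<le> measure L (Bd \<union> (S0 - C n))"
        using S Bd_s S0 C(1) closed_sets by (intro finite_measure_mono) (auto simp: S0_def S1_def)
      also have "\<dots> \<le> measure L Bd + measure L (S0 - C n)"
        using S0 Bd_s C(1) closed_sets by (intro measure_subadditive) (auto simp: emeasure_eq_measure)
      finally show ?thesis using C(3)[of n] Bd0 by simp
    qed
    moreover have "(\<lambda>n. 1 / real (Suc n)) \<longlonglongrightarrow> 0" by (rule LIMSEQ_Suc[OF lim_const_over_n])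
    ultimately have "measure L (S - S1) \<le> 0" using LIMSEQ_le_const by blast
    then show ?thesis by (simp add: measure_le_0_iff)
  qed
  have closed_image: "\<theta> ` K \<in> sets borel" if K: "closedin M K" "K \<subseteq> C n" for K n
  proof -
    have "compactin M K" using K(1) compact_M by (rule closedin_compact_space[rotated])
    then have "compactin (subtopology M (C n)) K" using K by (simp add: compactin_subtopology)
    then have "compactin euclidean (\<theta> ` K)" using C(4) by (rule image_compactin)
    then show ?thesis by (simp add: borel_compact)
  qed
  \<comment> \<open>By injectivity images commute with differences, which carries the Borel property
    through complements.\<close>
  have imC: "\<theta> ` (R \<inter> C n) \<in> sets borel" if "R \<in> sets L" for R n
    using that
  proof (induction rule: sets_induct)
    case (Open U)
    have "\<theta> ` (U \<inter> C n) = \<theta> ` C n - \<theta> ` (C n - U)"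
      using inj_on_image_set_diff[OF inj, of "C n" "C n - U"] C(2)[of n] by (auto simp: Diff_Diff_Int Int_commute)
    moreover have "\<theta> ` (C n - U) \<in> sets borel" using C(1) Open by (intro closed_image[of _ n] closedin_diff) auto
    moreover have "\<theta> ` C n \<in> sets borel" using C(1) by (intro closed_image[of _ n]) auto
    ultimately show ?case by auto
  next
    case (Compl R)
    have "C n \<subseteq> space L" using C(2)[of n] S0 Ssp by blast
    then have "(space L - R) \<inter> C n = C n - R \<inter> C n" by blast
    then have "\<theta> ` ((space L - R) \<inter> C n) = \<theta> ` C n - \<theta> ` (R \<inter> C n)"
      using inj_on_image_set_diff[OF inj, of "C n" "R \<inter> C n"] C(2)[of n] by auto
    moreover have "\<theta> ` C n \<in> sets borel" using C(1) by (intro closed_image[of _ n]) auto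
    ultimately show ?case using Compl.IH by auto
  next
    case (Union A)
    have "\<theta> ` ((\<Union>i. A i) \<inter> C n) = (\<Union>i. \<theta> ` (A i \<inter> C n))" by auto
    then show ?case using Union.IH by auto
  qed
  show ?thesis
  proof (rule that[OF S1(1) _ m1 \<theta>m])
    show "S1 \<subseteq> S" using S1 S0 by blast
    show "inj_on \<theta> S1" using inj S1(2) by (rule inj_on_subset)
    fix R assume R: "R \<in> sets L" "R \<subseteq> S1"
    have "\<theta> ` R = (\<Union>n. \<theta> ` (R \<inter> C n))" using R(2) unfolding S1_def by blast
    then have b: "\<theta> ` R \<in> sets borel" using imC[OF R(1)] by auto
    have i: "\<theta> ` R \<subseteq> {0..1}" by (auto simp: \<theta>_def F_def P.cdf_nonneg P.cdf_bounded_prob)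
    have "measure L R = measure L (S \<inter> (\<theta> -` (\<theta> ` R) \<inter> space L))"
    proof (rule antisym)
      have s: "S \<inter> (\<theta> -` (\<theta> ` R) \<inter> space L) \<in> sets L" using S measurable_sets[OF \<theta>m b] by auto
      show "measure L R \<le> measure L (S \<inter> (\<theta> -` (\<theta> ` R) \<inter> space L))"
        using R S1 S0 Ssp s by (intro finite_measure_mono) auto
      have "S \<inter> (\<theta> -` (\<theta> ` R) \<inter> space L) \<subseteq> R \<union> (S - S1)"
      proof
        fix x assume x: "x \<in> S \<inter> (\<theta> -` (\<theta> ` R) \<inter> space L)"
        then obtain y where y: "y \<in> R" "\<theta> x = \<theta> y" by auto
        show "x \<in> R \<union> (S - S1)"
        proof (cases "x \<in> S1")
          case True
          then have "x = y" using inj y R S1(2) by (auto simp: inj_on_def)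
          then show ?thesis using y by simp
        qed (use x in auto)
      qed
      then have "measure L (S \<inter> (\<theta> -` (\<theta> ` R) \<inter> space L)) \<le> measure L (R \<union> (S - S1))"
        using R S S1 by (intro finite_measure_mono) auto
      also have "\<dots> \<le> measure L R + measure L (S - S1)"
        using R S S1 by (intro measure_subadditive) (auto simp: emeasure_eq_measure)
      finally show "measure L (S \<inter> (\<theta> -` (\<theta> ` R) \<inter> space L)) \<le> measure L R" using m1 by simp
    qed
    also have "\<dots> = measure L S * measure lborel ({0..1} \<inter> \<theta> ` R)" by (rule \<theta>U[OF b])
    also have "{0..1} \<inter> \<theta> ` R = \<theta> ` R" using i by blast
    finally show "\<theta> ` R \<in> sets borel \<and> \<theta> ` R \<subseteq> {0..1} \<and> measure L R = measure L S * measure lborel (\<theta> ` R)"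
      using b i by blast
  qed
qed

end

section \<open>Pieces of prescribed measure and automorphisms that permute them\<close>

context standard_space
begin

text \<open>Cut the interval model of \<open>S\<close> at
  \<open>t = w / measure L S\<close>.\<close>

lemma subset_measure:
  assumes S: "S \<in> sets L" and w: "0 \<le> w" "w \<le> measure L S"
  obtains R where "R \<in> sets L" "R \<subseteq> S" "measure L R = w"
proof (cases "measure L S = 0")
  case True
  then show ?thesis using that[of "{}"] w by simp
next
  case False
  then have pos: "measure L S > 0" using measure_nonneg[of L S] by linarith
  obtain \<theta> :: "'a \<Rightarrow> real" and S1 where S1: "S1 \<in> sets L" "S1 \<subseteq> S" "measure L (S - S1) = 0" "\<theta> \<in> borel_measurable L" "inj_on \<theta> S1"
    and im: "\<And>R. R \<in> sets L \<Longrightarrow> R \<subseteq> S1 \<Longrightarrow> \<theta> ` R \<in> sets borel \<and> \<theta> ` R \<subseteq> {0..1} \<and>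
      measure L R = measure L S * measure lborel (\<theta> ` R)" by (rule interval_iso[OF S pos]) blast
  define t where "t = w / measure L S"
  have t: "0 \<le> t" "t \<le> 1" using w pos by (auto simp: t_def)
  have "measure L S1 = measure L S"
    using finite_measure_Diff[OF S S1(1,2)] S1(3) by simp
  then have one: "measure lborel (\<theta> ` S1) = 1" using im[OF S1(1) order_refl] pos by simp
  define R where "R = {x \<in> S1. \<theta> x \<le> t}"
  have "R = {x \<in> space L. \<theta> x \<le> t} \<inter> S1" using sets.sets_into_space[OF S1(1)] by (auto simp: R_def)
  then have R: "R \<in> sets L" "R \<subseteq> S1" using S1(1,4) by (auto simp: R_def)
  have b: "\<theta> ` S1 \<in> sets borel" "\<theta> ` S1 \<subseteq> {0..1}" using im[OF S1(1) order_refl] by auto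
  have null: "{0..1} - \<theta> ` S1 \<in> null_sets lborel"
  proof -
    have le: "emeasure lborel (\<theta> ` S1) \<le> emeasure lborel {0..1::real}" by (rule emeasure_mono[OF b(2)]) simp
    then have fin: "emeasure lborel (\<theta> ` S1) \<noteq> \<infinity>" by (auto simp: top_unique)
    then have "emeasure lborel ({0..1} - \<theta> ` S1) = emeasure lborel {0..1::real} - emeasure lborel (\<theta> ` S1)"
      using b by (intro emeasure_Diff) auto
    moreover have "emeasure lborel (\<theta> ` S1) = 1"
      using one fin by (simp add: emeasure_eq_ennreal_measure)
    ultimately show ?thesis using b by (auto simp: null_sets_def)
  qed
  have "measure lborel (\<theta> ` R) = measure lborel {0..t}"
  proof (rule measure_eq_AE)
    have "AE x in lborel. x \<notin> {0..1} - \<theta> ` S1" using null by (rule AE_not_in)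
    then show "AE x in lborel. (x \<in> \<theta> ` R) = (x \<in> {0..t})"
    proof eventually_elim
      case (elim x)
      show ?case using elim t b(2) by (auto simp: R_def)
    qed
  qed (use im[OF R] in auto)
  then have "measure L R = w" using im[OF R] t pos by (simp add: t_def)
  then show ?thesis using that[OF R(1)] R(2) S1(2) by blast
qed

text \<open>Greedy choice: when \<open>T a\<close> is treated, only the pieces chosen inside those
  \<open>T j\<close> that meet it can have used up some of it, and by assumption their total weight
  leaves room for \<open>w a\<close>.\<close>

lemma select_disjoint:
  assumes "finite I" "\<And>i. i \<in> I \<Longrightarrow> T i \<in> sets L" "\<And>i. i \<in> I \<Longrightarrow> 0 \<le> w i"
    "\<And>i. i \<in> I \<Longrightarrow> w i + (\<Sum>j\<in>{j \<in> I. j \<noteq> i \<and> T j \<inter> T i \<noteq> {}}. w j) \<le> measure L (T i)"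
  shows "\<exists>E. disjoint_family_on E I \<and> (\<forall>i\<in>I. E i \<in> sets L \<and> E i \<subseteq> T i \<and> measure L (E i) = w i)"
  using assms
proof (induction I rule: finite_induct)
  case empty then show ?case by (simp add: disjoint_family_on_def)
next
  case (insert a I)
  have "\<exists>E. disjoint_family_on E I \<and> (\<forall>i\<in>I. E i \<in> sets L \<and> E i \<subseteq> T i \<and> measure L (E i) = w i)"
  proof (rule insert.IH)
    fix i assume i: "i \<in> I"
    have "(\<Sum>j\<in>{j \<in> I. j \<noteq> i \<and> T j \<inter> T i \<noteq> {}}. w j) \<le> (\<Sum>j\<in>{j \<in> insert a I. j \<noteq> i \<and> T j \<inter> T i \<noteq> {}}. w j)"
      using insert.hyps insert.prems(2) by (intro sum_mono2) auto
    moreover have "w i + \<dots> \<le> measure L (T i)" using i by (intro insert.prems) auto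
    ultimately show "w i + (\<Sum>j\<in>{j \<in> I. j \<noteq> i \<and> T j \<inter> T i \<noteq> {}}. w j) \<le> measure L (T i)" by linarith
  qed (use insert.prems in auto)
  then obtain E where E: "disjoint_family_on E I" "\<And>i. i \<in> I \<Longrightarrow> E i \<in> sets L \<and> E i \<subseteq> T i \<and> measure L (E i) = w i" by blast
  have Ta: "T a \<in> sets L" and wa: "0 \<le> w a" using insert.prems by auto
  define J where "J = {j \<in> I. T j \<inter> T a \<noteq> {}}"
  define U where "U = (\<Union>j\<in>J. E j)"
  have U: "U \<in> sets L" unfolding U_def using E(2) insert.hyps by (intro sets.finite_UN) (auto simp: J_def)
  have "measure L U \<le> (\<Sum>j\<in>J. measure L (E j))"
    unfolding U_def using E(2) insert.hyps by (intro finite_measure_subadditive_finite) (auto simp: J_def)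
  also have "\<dots> = (\<Sum>j\<in>J. w j)" using E(2) by (intro sum.cong) (auto simp: J_def)
  also have "J = {j \<in> insert a I. j \<noteq> a \<and> T j \<inter> T a \<noteq> {}}" using insert.hyps by (auto simp: J_def)
  finally have "w a + measure L U \<le> measure L (T a)" using insert.prems(3)[of a] by simp
  moreover have "measure L (T a) \<le> measure L (T a - U) + measure L U"
  proof -
    have "measure L (T a) \<le> measure L ((T a - U) \<union> U)" using Ta U by (intro finite_measure_mono) auto
    also have "\<dots> \<le> measure L (T a - U) + measure L U"
      using Ta U by (intro measure_subadditive) (auto simp: emeasure_eq_measure)
    finally show ?thesis .
  qed
  ultimately have "w a \<le> measure L (T a - U)" by linarith
  then obtain R where R: "R \<in> sets L" "R \<subseteq> T a - U" "measure L R = w a"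
    using subset_measure[of "T a - U" "w a"] Ta U wa by blast
  have disj: "R \<inter> E j = {}" if "j \<in> I" for j
    using E(2)[OF that] R(2) that by (cases "j \<in> J") (auto simp: U_def J_def)
  define E' where "E' = E(a := R)"
  have "disjoint_family_on E' (insert a I)"
    using E(1) disj insert.hyps(2) unfolding E'_def disjoint_family_on_def by (auto simp: Int_commute)
  moreover have "\<forall>i\<in>insert a I. E' i \<in> sets L \<and> E' i \<subseteq> T i \<and> measure L (E' i) = w i"
    using E(2) R by (auto simp: E'_def)
  ultimately show ?case by blast
qed

text \<open>All pieces are modelled on the same interval, and \<open>h\<close> keeps the interval
  coordinate while \<sigma> moves the index. Hence a cycle of \<sigma> makes \<open>h\<close> return
  every point exactly to itself, not only to its piece.\<close>

lemma permutation_automorphism: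
  assumes I: "finite I" and disj: "disjoint_family_on E I" and Es: "\<And>i. i \<in> I \<Longrightarrow> E i \<in> sets L"
    and Epos: "\<And>i. i \<in> I \<Longrightarrow> measure L (E i) > 0"
    and \<sigma>: "bij_betw \<sigma> I I" and \<sigma>E: "\<And>i. i \<in> I \<Longrightarrow> measure L (E (\<sigma> i)) = measure L (E i)"
  shows "\<exists>h E'. h \<in> automorphisms L \<and>
    (\<forall>i\<in>I. E' i \<in> sets L \<and> E' i \<subseteq> E i \<and> measure L (E i - E' i) = 0 \<and> h ` E' i \<subseteq> E' (\<sigma> i) \<and>
      (\<forall>x\<in>E' i. \<forall>n. (\<sigma> ^^ n) i = i \<longrightarrow> (h ^^ n) x = x))"
proof -
  have "\<exists>\<theta>i Si. Si \<in> sets L \<and> Si \<subseteq> E i \<and> measure L (E i - Si) = 0 \<and> \<theta>i \<in> borel_measurable L \<and> inj_on \<theta>i Si \<and>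
    (\<forall>R. R \<in> sets L \<longrightarrow> R \<subseteq> Si \<longrightarrow> \<theta>i ` R \<in> sets borel \<and> \<theta>i ` R \<subseteq> {0..1} \<and>
      measure L R = measure L (E i) * measure lborel (\<theta>i ` R :: real set))" if "i \<in> I" for i
    by (rule interval_iso[OF Es[OF that] Epos[OF that]]) blast
  then obtain \<theta> :: "'b \<Rightarrow> 'a \<Rightarrow> real" and S where
    S: "\<And>i. i \<in> I \<Longrightarrow> S i \<in> sets L \<and> S i \<subseteq> E i \<and> measure L (E i - S i) = 0 \<and> \<theta> i \<in> borel_measurable L \<and> inj_on (\<theta> i) (S i)"
    and im: "\<And>i R. i \<in> I \<Longrightarrow> R \<in> sets L \<Longrightarrow> R \<subseteq> S i \<Longrightarrow> \<theta> i ` R \<in> sets borel \<and> \<theta> i ` R \<subseteq> {0..1} \<and>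
      measure L R = measure L (E i) * measure lborel (\<theta> i ` R)"
    by metis
  \<comment> \<open>The coordinates that occur in every piece; restriction to them gives all
    coordinate maps the same image, at the price of a null set.\<close>
  define T where "T = {0..1} \<inter> (\<Inter>i\<in>I. \<theta> i ` S i)"
  have Ss: "S i \<in> sets L" "S i \<subseteq> E i" "\<theta> i \<in> borel_measurable L" "inj_on (\<theta> i) (S i)" if "i \<in> I" for i using S[OF that] by auto
  have TB: "T \<in> sets borel" unfolding T_def
    using im[OF _ Ss(1) order_refl] I by (cases "I = {}") (auto intro!: sets.Int sets.finite_INT)
  have mS: "measure lborel (\<theta> i ` S i) = 1" if i: "i \<in> I" for i
  proof -
    have "measure L (S i) = measure L (E i)" using finite_measure_Diff[OF Es[OF i] Ss(1,2)[OF i]] S[OF i] by simp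
    then show ?thesis using im[OF i Ss(1)[OF i] order_refl] Epos[OF i] by simp
  qed
  have null: "{0..1} - \<theta> i ` S i \<in> null_sets lborel" if i: "i \<in> I" for i
  proof -
    have b: "\<theta> i ` S i \<in> sets borel" "\<theta> i ` S i \<subseteq> {0..1}" using im[OF i Ss(1)[OF i] order_refl] by auto
    have le: "emeasure lborel (\<theta> i ` S i) \<le> emeasure lborel {0..1::real}" by (rule emeasure_mono[OF b(2)]) simp
    then have fin: "emeasure lborel (\<theta> i ` S i) \<noteq> \<infinity>" by (auto simp: top_unique)
    then have "emeasure lborel ({0..1} - \<theta> i ` S i) = emeasure lborel {0..1::real} - emeasure lborel (\<theta> i ` S i)"
      using b by (intro emeasure_Diff) auto
    moreover have "emeasure lborel (\<theta> i ` S i) = 1" using mS[OF i] fin by (simp add: emeasure_eq_ennreal_measure)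
    ultimately show ?thesis using b by (auto simp: null_sets_def)
  qed
  have Tnull: "{0..1} - T \<in> null_sets lborel"
  proof -
    have "{0..1} - T = (\<Union>i\<in>I. {0..1} - \<theta> i ` S i)" by (auto simp: T_def)
    also have "\<dots> \<in> null_sets lborel" using null I by (intro null_sets.finite_UN) auto
    finally show ?thesis .
  qed
  have mT: "measure lborel T = 1"
  proof -
    have "measure lborel T = measure lborel {0..1::real}"
    proof (rule measure_eq_AE)
      show "AE x in lborel. (x \<in> T) = (x \<in> {0..1})"
        using AE_not_in[OF Tnull] by eventually_elim (auto simp: T_def)
    qed (use TB in auto)
    then show ?thesis by simp
  qed
  define E' where "E' = (\<lambda>i. {x \<in> S i. \<theta> i x \<in> T})"
  have E's: "E' i \<in> sets L" "E' i \<subseteq> S i" "E' i \<subseteq> E i" if i: "i \<in> I" for i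
  proof -
    have "E' i = S i \<inter> (\<theta> i -` T \<inter> space L)" using sets.sets_into_space[OF Ss(1)[OF i]] by (auto simp: E'_def)
    then show "E' i \<in> sets L" using Ss[OF i] measurable_sets[OF Ss(3)[OF i], of T] TB by auto
    show "E' i \<subseteq> S i" "E' i \<subseteq> E i" using Ss(2)[OF i] by (auto simp: E'_def)
  qed
  have \<theta>E': "\<theta> i ` E' i = T" if i: "i \<in> I" for i
  proof (intro equalityI subsetI)
    fix t assume t: "t \<in> T"
    then have "t \<in> \<theta> i ` S i" using i by (simp add: T_def)
    then obtain x where "x \<in> S i" "t = \<theta> i x" by auto
    then show "t \<in> \<theta> i ` E' i" using t by (simp add: E'_def)
  qed (auto simp: E'_def)
  have inj: "inj_on (\<theta> i) (E' i)" if "i \<in> I" for i using Ss(4)[OF that] E's(2)[OF that] by (rule inj_on_subset)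
  have mE': "measure L (E i - E' i) = 0" if i: "i \<in> I" for i
  proof -
    have "measure L (E' i) = measure L (E i)" using im[OF i E's(1,2)[OF i]] \<theta>E'[OF i] mT by simp
    then show ?thesis using finite_measure_Diff[OF Es[OF i] E's(1,3)[OF i]] by simp
  qed
  have uniq: "i = j" if "i \<in> I" "j \<in> I" "x \<in> E' i" "x \<in> E' j" for i j x
    using disj that E's(3) unfolding disjoint_family_on_def by blast
  define D where "D = (\<Union>i\<in>I. E' i)"
  have Ds: "D \<in> sets L" unfolding D_def using E's(1) I by (intro sets.finite_UN) auto
  define idx where "idx = (\<lambda>x. THE i. i \<in> I \<and> x \<in> E' i)"
  have idx: "idx x = i" if "i \<in> I" "x \<in> E' i" for i x
    unfolding idx_def using that uniq by (intro the_equality) auto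
  \<comment> \<open>Defined for arbitrary index maps \<rho>, so that the inverse of
    \<open>H \<sigma>\<close> is \<open>H\<close> of the inverse permutation and inherits all its
    properties.\<close>
  define H where "H = (\<lambda>\<rho> x. if x \<in> D then inv_into (E' (\<rho> (idx x))) (\<theta> (\<rho> (idx x))) (\<theta> (idx x) x) else x)"
  have H: "H \<rho> x \<in> E' (\<rho> i)" "\<theta> (\<rho> i) (H \<rho> x) = \<theta> i x" if "i \<in> I" "\<rho> i \<in> I" "x \<in> E' i" for \<rho> i x
  proof -
    have "\<theta> i x \<in> \<theta> (\<rho> i) ` E' (\<rho> i)" using \<theta>E'[OF that(1)] \<theta>E'[OF that(2)] that(3) by blast
    moreover have "H \<rho> x = inv_into (E' (\<rho> i)) (\<theta> (\<rho> i)) (\<theta> i x)" using that idx[OF that(1,3)] by (auto simp: H_def D_def)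
    ultimately show "H \<rho> x \<in> E' (\<rho> i)" "\<theta> (\<rho> i) (H \<rho> x) = \<theta> i x"
      by (auto simp: inv_into_into f_inv_into_f)
  qed
  have Hout: "H \<rho> x = x" if "x \<notin> D" for \<rho> x using that by (simp add: H_def)
  have Hinv: "H \<rho>' (H \<rho> x) = x" if \<rho>: "\<And>i. i \<in> I \<Longrightarrow> \<rho> i \<in> I" "\<And>i. i \<in> I \<Longrightarrow> \<rho>' (\<rho> i) = i" for \<rho> \<rho>' x
  proof (cases "x \<in> D")
    case True
    then obtain i where i: "i \<in> I" "x \<in> E' i" by (auto simp: D_def)
    note 1 = H[of i \<rho>, OF i(1) \<rho>(1)[OF i(1)] i(2)]
    have "\<rho>' (\<rho> i) \<in> I" using \<rho>(2)[OF i(1)] i(1) by simp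
    note 2 = H[of "\<rho> i" \<rho>', OF \<rho>(1)[OF i(1)] this 1(1), unfolded \<rho>(2)[OF i(1)] 1(2)]
    show ?thesis using inj[OF i(1)] 2 i(2) by (auto simp: inj_on_def)
  qed (simp add: Hout)
  have Dsp: "D \<subseteq> space L" using sets.sets_into_space[OF Ds] .
  have Hsp: "H \<rho> x \<in> space L" if "\<And>i. i \<in> I \<Longrightarrow> \<rho> i \<in> I" "x \<in> space L" for \<rho> x
  proof (cases "x \<in> D")
    case True
    then obtain i where i: "i \<in> I" "x \<in> E' i" by (auto simp: D_def)
    then show ?thesis using H(1)[of i \<rho> x] that(1)[OF i(1)] sets.sets_into_space[OF E's(1)] by blast
  qed (use that in \<open>simp add: Hout\<close>)
  have Hpre: "H \<rho> -` R \<inter> space L \<in> sets L \<and> measure L (H \<rho> -` R \<inter> space L) = measure L R"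
    if \<rho>: "bij_betw \<rho> I I" "\<And>i. i \<in> I \<Longrightarrow> measure L (E (\<rho> i)) = measure L (E i)" and R: "R \<in> sets L" for \<rho> R
  proof -
    have \<rho>I: "\<rho> i \<in> I" if "i \<in> I" for i using \<rho>(1) that by (auto simp: bij_betw_def)
    define B where "B = (\<lambda>i. \<theta> (\<rho> i) ` (R \<inter> E' (\<rho> i)))"
    define Z where "Z = (\<lambda>i. E' i \<inter> (\<theta> i -` B i \<inter> space L))"
    have RE: "R \<inter> E' (\<rho> i) \<in> sets L" "R \<inter> E' (\<rho> i) \<subseteq> S (\<rho> i)" if "i \<in> I" for i
      using R E's(1,2)[OF \<rho>I[OF that]] by auto
    have B: "B i \<in> sets borel" "measure L (R \<inter> E' (\<rho> i)) = measure L (E i) * measure lborel (B i)" "B i \<subseteq> T" if i: "i \<in> I" for i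
      using im[OF \<rho>I[OF i] RE[OF i]] \<rho>(2)[OF i] \<theta>E'[OF \<rho>I[OF i]] by (auto simp: B_def)
    have Z: "Z i \<in> sets L" "Z i \<subseteq> S i" if i: "i \<in> I" for i
      using E's(1,2)[OF i] measurable_sets[OF Ss(3)[OF i] B(1)[OF i]] by (auto simp: Z_def)
    have "\<theta> i ` Z i = B i" if i: "i \<in> I" for i
    proof (intro equalityI subsetI)
      fix t assume t: "t \<in> B i"
      then have "t \<in> \<theta> i ` E' i" using B(3)[OF i] \<theta>E'[OF i] by blast
      then obtain x where "x \<in> E' i" "t = \<theta> i x" by blast
      then show "t \<in> \<theta> i ` Z i" using t sets.sets_into_space[OF E's(1)[OF i]] by (auto simp: Z_def)
    qed (auto simp: Z_def)
    then have mZ: "measure L (Z i) = measure L (R \<inter> E' (\<rho> i))" if i: "i \<in> I" for i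
      using im[OF i Z[OF i]] B(2)[OF i] i by simp
    have split: "H \<rho> -` R \<inter> space L = (\<Union>i\<in>I. Z i) \<union> (R - D)"
    proof (intro equalityI subsetI)
      fix x assume x: "x \<in> H \<rho> -` R \<inter> space L"
      show "x \<in> (\<Union>i\<in>I. Z i) \<union> (R - D)"
      proof (cases "x \<in> D")
        case True
        then obtain i where i: "i \<in> I" "x \<in> E' i" by (auto simp: D_def)
        note 1 = H[of i \<rho>, OF i(1) \<rho>I[OF i(1)] i(2)]
        have "\<theta> i x \<in> B i" unfolding B_def using 1 x by (metis IntI image_eqI vimage_eq IntD1)
        then show ?thesis using i x by (auto simp: Z_def)
      qed (use x in \<open>auto simp: Hout\<close>)
    next
      fix x assume x: "x \<in> (\<Union>i\<in>I. Z i) \<union> (R - D)"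
      then consider i where "i \<in> I" "x \<in> Z i" | "x \<in> R - D" by blast
      then show "x \<in> H \<rho> -` R \<inter> space L"
      proof cases
        case 1
        then have xE: "x \<in> E' i" "\<theta> i x \<in> B i" "x \<in> space L" by (auto simp: Z_def)
        note h = H[of i \<rho>, OF 1(1) \<rho>I[OF 1(1)] xE(1)]
        obtain y where y: "y \<in> R" "y \<in> E' (\<rho> i)" "\<theta> i x = \<theta> (\<rho> i) y" using xE(2) by (auto simp: B_def)
        have "H \<rho> x = y" using inj[OF \<rho>I[OF 1(1)]] h y by (auto simp: inj_on_def)
        then show ?thesis using y xE by simp
      next
        case 2 then show ?thesis using sets.sets_into_space[OF R] by (auto simp: Hout)
      qed
    qed
    have s: "H \<rho> -` R \<inter> space L \<in> sets L" unfolding split using Z R Ds I by (intro sets.Un sets.finite_UN) auto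
    have djZ: "disjoint_family_on Z I" using uniq unfolding disjoint_family_on_def Z_def by blast
    have djR: "disjoint_family_on (\<lambda>i. R \<inter> E' i) I" using uniq unfolding disjoint_family_on_def by blast
    have "measure L (H \<rho> -` R \<inter> space L) = measure L (\<Union>i\<in>I. Z i) + measure L (R - D)"
      unfolding split using Z R Ds I by (intro finite_measure_Union) (auto simp: Z_def D_def)
    also have "measure L (\<Union>i\<in>I. Z i) = (\<Sum>i\<in>I. measure L (Z i))"
      using Z I djZ by (intro finite_measure_finite_Union) auto
    also have "\<dots> = (\<Sum>i\<in>I. measure L (R \<inter> E' (\<rho> i)))" using mZ by simp
    also have "\<dots> = (\<Sum>i\<in>I. measure L (R \<inter> E' i))" by (rule sum.reindex_bij_betw[OF \<rho>(1)])
    also have "\<dots> = measure L (\<Union>i\<in>I. R \<inter> E' i)"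
      using E's(1) R I djR by (intro finite_measure_finite_Union[symmetric]) auto
    also have "(\<Union>i\<in>I. R \<inter> E' i) = R \<inter> D" by (auto simp: D_def)
    also have "measure L (R \<inter> D) + measure L (R - D) = measure L ((R \<inter> D) \<union> (R - D))"
      using R Ds by (intro finite_measure_Union[symmetric]) auto
    also have "(R \<inter> D) \<union> (R - D) = R" by blast
    finally show ?thesis using s by blast
  qed
  define \<tau> where "\<tau> = inv_into I \<sigma>"
  have \<tau>: "bij_betw \<tau> I I" unfolding \<tau>_def by (rule bij_betw_inv_into[OF \<sigma>])
  have \<sigma>I: "\<sigma> i \<in> I" "\<tau> i \<in> I" "\<tau> (\<sigma> i) = i" "\<sigma> (\<tau> i) = i" if "i \<in> I" for i
    using \<sigma> \<tau> that by (auto simp: bij_betw_def \<tau>_def f_inv_into_f inv_into_f_f intro: inv_into_into)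
  have \<tau>E: "measure L (E (\<tau> i)) = measure L (E i)" if "i \<in> I" for i using \<sigma>E[OF \<sigma>I(2)[OF that]] \<sigma>I(4)[OF that] by simp
  have m: "H \<sigma> \<in> measurable L L" "H \<tau> \<in> measurable L L"
    using Hsp[of \<sigma>] Hsp[of \<tau>] Hpre[OF \<sigma> \<sigma>E] Hpre[OF \<tau> \<tau>E] \<sigma>I by (auto intro!: measurableI)
  have inv: "H \<tau> (H \<sigma> x) = x" "H \<sigma> (H \<tau> x) = x" for x using Hinv \<sigma>I by blast+
  have bij: "bij_betw (H \<sigma>) (space L) (space L)"
    by (rule bij_betw_byWitness[where f' = "H \<tau>"]) (use inv Hsp \<sigma>I in auto)
  have "inv_into (space L) (H \<sigma>) x = H \<tau> x" if "x \<in> space L" for x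
    by (rule inv_into_f_eq[OF bij_betw_imp_inj_on[OF bij]]) (use inv Hsp \<sigma>I that in auto)
  then have mi: "inv_into (space L) (H \<sigma>) \<in> measurable L L" using m(2) by (subst measurable_cong)
  have "distr L L (H \<sigma>) = L"
  proof (rule measure_eqI)
    fix R assume "R \<in> sets (distr L L (H \<sigma>))"
    then have R: "R \<in> sets L" by simp
    show "emeasure (distr L L (H \<sigma>)) R = emeasure L R"
      using Hpre[OF \<sigma> \<sigma>E R] by (simp add: emeasure_distr[OF m(1) R] emeasure_eq_measure)
  qed simp
  then have "H \<sigma> \<in> automorphisms L" using bij m mi by (simp add: automorphisms_def)
  moreover have "H \<sigma> ` E' i \<subseteq> E' (\<sigma> i)" if "i \<in> I" for i using H(1) that \<sigma>I by blast
  moreover have "(H \<sigma> ^^ n) x = x" if i: "i \<in> I" and x: "x \<in> E' i" and n: "(\<sigma> ^^ n) i = i" for i x n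
  proof -
    have "(\<sigma> ^^ k) i \<in> I \<and> (H \<sigma> ^^ k) x \<in> E' ((\<sigma> ^^ k) i) \<and> \<theta> ((\<sigma> ^^ k) i) ((H \<sigma> ^^ k) x) = \<theta> i x" for k
    proof (induction k)
      case (Suc k)
      then show ?case using H[of "(\<sigma> ^^ k) i" \<sigma> "(H \<sigma> ^^ k) x"] \<sigma>I(1) by simp
    qed (use i x in simp)
    from this[of n] show ?thesis using inj[OF i] x n by (auto simp: inj_on_def)
  qed
  ultimately show ?thesis
    by (intro exI[of _ "H \<sigma>"] exI[of _ E'] conjI ballI E's mE') auto
qed

end

section \<open>Approximation by periodic automorphisms\<close>

lemma finite_positive_lower_bound:
  fixes g :: "'b \<Rightarrow> real"
  assumes "finite A"
  shows "\<exists>e>0. \<forall>a\<in>A. g a > 0 \<longrightarrow> e \<le> g a"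
proof (cases "{a \<in> A. g a > 0} = {}")
  case True then show ?thesis by (intro exI[of _ 1]) auto
next
  case False
  define e where "e = Min (g ` {a \<in> A. g a > 0})"
  have fin: "finite (g ` {a \<in> A. g a > 0})" using assms by simp
  have "e \<in> g ` {a \<in> A. g a > 0}" unfolding e_def using False fin by (intro Min_in) auto
  then have "e > 0" by auto
  moreover have "\<forall>a\<in>A. g a > 0 \<longrightarrow> e \<le> g a" unfolding e_def using fin by (auto intro: Min_le)
  ultimately show ?thesis by blast
qed

context standard_space
begin

lemma measure_finite_partition:
  assumes "finite A" "\<And>a. a \<in> A \<Longrightarrow> S a \<in> sets L" "disjoint_family_on S A" "(\<Union>a\<in>A. S a) = R"
  shows "(\<Sum>a\<in>A. measure L (S a)) = measure L R"
proof -
  have "S ` A \<subseteq> sets L" using assms(2) by auto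
  from finite_measure_finite_Union[OF assms(1) this assms(3)] show ?thesis using assms(4) by simp
qed

text \<open>The orbits of \<open>h\<close> follow the itineraries of \<open>f\<close> with respect to the partition generated by
  the sets \<open>K\<close> and \<open>f ` K\<close> for \<open>N\<close> steps, each itinerary with the frequency with which it occurs for
  \<open>f\<close>; then they pass through \<open>D 0, \<dots>, D (c - 1)\<close> and close up.\<close>

lemma tower_approximation:
  assumes f: "f \<in> automorphisms L" and \<K>: "finite \<K>" "\<K> \<subseteq> sets L"
    and D: "\<And>q. q < c \<Longrightarrow> D q \<in> sets L" "\<And>q. q < c \<Longrightarrow> measure L (D q) > 0" and \<eta>: "\<eta> > 0"
  shows "\<exists>N h B. N > 0 \<and> h \<in> automorphisms L \<and>
    (\<forall>j<N + c. B j \<in> sets L \<and> (\<forall>x\<in>B j. h x \<in> B (Suc j mod (N + c)) \<and> (h ^^ (N + c)) x = x)) \<and>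
    disjoint_family_on B {..<N + c} \<and> (\<forall>q<c. B (N + q) \<subseteq> D q) \<and>
    measure L (space L - (\<Union>j<N + c. B j)) < \<eta> \<and>
    (\<forall>K\<in>\<K>. measure L (sym_diff (h ` K) (f ` K)) < \<eta>)"
proof -
  define \<mu> where "\<mu> = measure L (space L)"
  have \<mu>0: "\<mu> \<ge> 0" by (simp add: \<mu>_def)
  \<comment> \<open>Labels also record membership in the images under \<open>f\<close>: a set is
    tested at a point and its image at the next point.\<close>
  define \<S> where "\<S> = \<K> \<union> (`) f ` \<K>"
  have \<S>: "finite \<S>" "\<S> \<subseteq> sets L"
    using \<K> automorphism_image_sets(1)[OF f] by (auto simp: \<S>_def)
  define lab where "lab = (\<lambda>x. {K \<in> \<S>. x \<in> K})"
  define Q where "Q = (\<lambda>a. {x \<in> space L. lab x = a})"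
  have Qs: "Q a \<in> sets L" if "a \<subseteq> \<S>" for a
  proof -
    have "Q a = {x \<in> space L. \<forall>K\<in>\<S>. (x \<in> K) = (K \<in> a)}" using that by (auto simp: Q_def lab_def)
    also have "\<dots> \<in> sets L"
    proof (rule sets.sets_Collect_finite_All[OF _ \<S>(1)])
      fix K assume "K \<in> \<S>"
      then have K: "K \<in> sets L" using \<S> by blast
      show "{x \<in> space L. (x \<in> K) = (K \<in> a)} \<in> sets L"
      proof (cases "K \<in> a")
        case True
        then have "{x \<in> space L. (x \<in> K) = (K \<in> a)} = K" using sets.sets_into_space[OF K] by auto
        then show ?thesis using K by simp
      next
        case False
        then have "{x \<in> space L. (x \<in> K) = (K \<in> a)} = space L - K" by auto
        then show ?thesis using K by auto
      qed
    qed
    finally show ?thesis .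
  qed
  obtain q0 where q0: "q0 > 0" "\<And>a. a \<subseteq> \<S> \<Longrightarrow> measure L (Q a) > 0 \<Longrightarrow> q0 \<le> measure L (Q a)"
    using finite_positive_lower_bound[of "Pow \<S>" "\<lambda>a. measure L (Q a)"] \<S>(1) by (auto simp: Pow_def)
  obtain d0 where d0: "d0 > 0" "\<And>q. q < c \<Longrightarrow> d0 \<le> measure L (D q)"
    using finite_positive_lower_bound[of "{..<c}" "\<lambda>q. measure L (D q)"] D(2) by auto
  define \<kappa> where "\<kappa> = min (1 / 2) (\<eta> / (4 * (\<mu> + 1)))"
  have \<kappa>: "0 < \<kappa>" "\<kappa> \<le> 1 / 2"
  proof -
    show "0 < \<kappa>" using \<eta> \<mu>0 by (simp add: \<kappa>_def)
    show "\<kappa> \<le> 1 / 2" unfolding \<kappa>_def by (rule min.cobounded1)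
  qed
  have \<kappa>\<mu>: "\<kappa> * \<mu> \<le> \<eta> / 4"
  proof -
    have "\<kappa> * \<mu> \<le> \<eta> / (4 * (\<mu> + 1)) * (\<mu> + 1)" using \<mu>0 \<kappa> by (intro mult_mono) (auto simp: \<kappa>_def)
    also have "\<dots> = \<eta> / 4" using \<mu>0 by (simp add: field_simps)
    finally show ?thesis .
  qed
  obtain N :: nat where N: "max 1 (max (c * \<mu> / (\<kappa> * q0)) (max (c * \<mu> / d0) (4 * \<mu> / \<eta>))) < N"
    using reals_Archimedean2 by blast
  have N0: "N > 1" using N by simp
  have "c * \<mu> / (\<kappa> * q0) < N" "c * \<mu> / d0 < N" "4 * \<mu> / \<eta> < N" using N by simp_all
  then have "c * \<mu> < N * (\<kappa> * q0)" "c * \<mu> < N * d0" "4 * \<mu> < N * \<eta>"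
    using \<kappa>(1) q0(1) d0(1) \<eta> by (simp_all add: pos_divide_less_eq)
  then have Nq: "c * \<mu> / N \<le> \<kappa> * q0" and Nd: "c * \<mu> / N \<le> d0" and N\<eta>: "\<mu> / N < \<eta> / 4"
    using N0 by (auto simp: field_simps)
  define words where "words = {\<omega>. set \<omega> \<subseteq> Pow \<S> \<and> length \<omega> = N}"
  have wfin: "finite words" unfolding words_def using \<S>(1) by (intro finite_lists_length_eq) simp
  define P where "P = (\<lambda>\<omega>. {x \<in> space L. \<forall>j<N. lab ((f ^^ j) x) = \<omega> ! j})"
  have lsub: "lab x \<subseteq> \<S>" for x by (auto simp: lab_def)
  have wsub: "\<omega> ! j \<subseteq> \<S>" if "\<omega> \<in> words" "j < N" for \<omega> j
  proof -
    have "\<omega> ! j \<in> set \<omega>" using that by (simp add: words_def)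
    then show ?thesis using that unfolding words_def by blast
  qed
  have Ps: "P \<omega> \<in> sets L" if \<omega>: "\<omega> \<in> words" for \<omega>
  proof -
    have "P \<omega> = {x \<in> space L. \<forall>j\<in>{..<N}. lab ((f ^^ j) x) = \<omega> ! j}" by (auto simp: P_def)
    also have "\<dots> \<in> sets L"
    proof (rule sets.sets_Collect_finite_All)
      fix j assume j: "j \<in> {..<N}"
      have "{x \<in> space L. lab ((f ^^ j) x) = \<omega> ! j} = (f ^^ j) -` Q (\<omega> ! j) \<inter> space L"
        using automorphism_funpow_space[OF f] by (auto simp: Q_def)
      also have "\<dots> \<in> sets L" using j by (intro automorphism_vimage(1)[OF automorphism_funpow[OF f] Qs] wsub \<omega>) auto
      finally show "{x \<in> space L. lab ((f ^^ j) x) = \<omega> ! j} \<in> sets L" .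
    qed (use N0 in auto)
    finally show ?thesis .
  qed
  have Pdisj: "disjoint_family_on P A" if "A \<subseteq> words" for A
    unfolding disjoint_family_on_def
  proof (intro ballI impI)
    fix \<omega> \<omega>' assume w: "\<omega> \<in> A" "\<omega>' \<in> A" "\<omega> \<noteq> \<omega>'"
    then have "length \<omega> = N" "length \<omega>' = N" using that by (auto simp: words_def)
    then obtain j where "j < N" "\<omega> ! j \<noteq> \<omega>' ! j" using w(3) by (metis nth_equalityI)
    then show "P \<omega> \<inter> P \<omega>' = {}" by (auto simp: P_def)
  qed
  have itin: "\<exists>\<omega>\<in>words. x \<in> P \<omega> \<and> (\<forall>j<N. \<omega> ! j = lab ((f ^^ j) x))" if "x \<in> space L" for x
    using that lsub by (intro bexI[of _ "map (\<lambda>j. lab ((f ^^ j) x)) [0..<N]"]) (auto simp: P_def words_def)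
  have sumP: "(\<Sum>\<omega>\<in>words. measure L (P \<omega>)) = \<mu>"
    unfolding \<mu>_def
  proof (intro measure_finite_partition wfin Ps Pdisj)
    have "P \<omega> \<subseteq> space L" for \<omega> by (auto simp: P_def)
    then show "(\<Union>\<omega>\<in>words. P \<omega>) = space L" using itin by blast
  qed simp_all
  have sumPj: "(\<Sum>\<omega>\<in>{\<omega> \<in> words. \<omega> ! j = a}. measure L (P \<omega>)) = measure L (Q a)" if j: "j < N" and a: "a \<subseteq> \<S>" for j a
  proof -
    have "(\<Sum>\<omega>\<in>{\<omega> \<in> words. \<omega> ! j = a}. measure L (P \<omega>)) = measure L ((f ^^ j) -` Q a \<inter> space L)"
    proof (rule measure_finite_partition)
      show "(\<Union>\<omega>\<in>{\<omega> \<in> words. \<omega> ! j = a}. P \<omega>) = (f ^^ j) -` Q a \<inter> space L"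
      proof (intro equalityI subsetI)
        fix x assume x: "x \<in> (f ^^ j) -` Q a \<inter> space L"
        then obtain \<omega> where "\<omega> \<in> words" "x \<in> P \<omega>" "\<omega> ! j = lab ((f ^^ j) x)" using itin[of x] j by auto
        then show "x \<in> (\<Union>\<omega>\<in>{\<omega> \<in> words. \<omega> ! j = a}. P \<omega>)" using x by (auto simp: Q_def)
      qed (use j automorphism_funpow_space[OF f] in \<open>auto simp: P_def Q_def\<close>)
    qed (use wfin Ps Pdisj in auto)
    then show ?thesis using automorphism_vimage(3)[OF automorphism_funpow[OF f] Qs[OF a]] by simp
  qed
  define \<Omega> where "\<Omega> = {\<omega> \<in> words. measure L (P \<omega>) > 0}"
  have \<Omega>: "finite \<Omega>" "\<Omega> \<subseteq> words" using wfin by (auto simp: \<Omega>_def)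
  \<comment> \<open>Every level over the itinerary \<omega> gets this measure. As \<open>f\<close>
    preserves the measure, the itineraries with label \<open>a\<close> at a given time have in total
    the measure of \<open>Q a\<close>; summed over the \<open>N\<close> times, the levels placed in
    \<open>Q a\<close> need at most the fraction \<open>1 - \<kappa>\<close> of it.\<close>
  define w where "w = (\<lambda>\<omega>. (1 - \<kappa>) * measure L (P \<omega>) / N)"
  have w0: "w \<omega> \<ge> 0" for \<omega> using \<kappa> by (simp add: w_def)
  have wpos: "w \<omega> > 0" if "\<omega> \<in> \<Omega>" for \<omega> using that \<kappa> N0 by (simp add: w_def \<Omega>_def)
  have sum\<Omega>: "(\<Sum>\<omega>\<in>\<Omega>. measure L (P \<omega>)) = \<mu>"
    unfolding sumP[symmetric] using wfin measure_nonneg[of L]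
    by (intro sum.mono_neutral_left) (auto simp: \<Omega>_def not_less intro: antisym)
  have sumw: "(\<Sum>\<omega>\<in>\<Omega>. w \<omega>) = (1 - \<kappa>) * \<mu> / N"
    unfolding w_def sum\<Omega>[symmetric] by (simp add: sum_distrib_left sum_divide_distrib)
  have sumwj: "(\<Sum>\<omega>\<in>{\<omega> \<in> \<Omega>. \<omega> ! j = a}. w \<omega>) \<le> (1 - \<kappa>) * measure L (Q a) / N" if j: "j < N" and a: "a \<subseteq> \<S>" for j a
  proof -
    have "(\<Sum>\<omega>\<in>{\<omega> \<in> \<Omega>. \<omega> ! j = a}. w \<omega>) \<le> (\<Sum>\<omega>\<in>{\<omega> \<in> words. \<omega> ! j = a}. w \<omega>)"
      using \<Omega> wfin w0 by (intro sum_mono2) auto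
    also have "\<dots> = (1 - \<kappa>) * measure L (Q a) / N"
      unfolding w_def sumPj[OF that, symmetric] by (simp add: sum_distrib_left sum_divide_distrib)
    finally show ?thesis .
  qed

  have tot: "(\<Sum>i\<in>\<Omega> \<times> {..<c}. w (fst i)) \<le> c * \<mu> / N"
  proof -
    have "(\<Sum>i\<in>\<Omega> \<times> {..<c}. w (fst i)) = (\<Sum>\<omega>\<in>\<Omega>. \<Sum>q<c. w \<omega>)" by (simp only: sum.cartesian_product split_def)
    also have "\<dots> = c * (\<Sum>\<omega>\<in>\<Omega>. w \<omega>)" by (simp add: sum_distrib_left)
    also have "\<dots> = c * ((1 - \<kappa>) * \<mu> / N)" by (simp only: sumw)
    also have "\<dots> \<le> c * (1 * \<mu> / N)" using \<kappa> \<mu>0 by (intro mult_left_mono divide_right_mono mult_right_mono) auto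
    finally show ?thesis by simp
  qed
  \<comment> \<open>The closing levels are chosen before the itinerary levels: they are confined to
    the sets \<open>D q\<close>, whereas the atoms have room to spare by the choice of
    \<kappa>.\<close>
  have "\<exists>Z. disjoint_family_on Z (\<Omega> \<times> {..<c}) \<and>
      (\<forall>i\<in>\<Omega> \<times> {..<c}. Z i \<in> sets L \<and> Z i \<subseteq> D (snd i) \<and> measure L (Z i) = w (fst i))"
  proof (rule select_disjoint)
    fix i assume i: "i \<in> \<Omega> \<times> {..<c}"
    have "w (fst i) + (\<Sum>j\<in>{j \<in> \<Omega> \<times> {..<c}. j \<noteq> i \<and> D (snd j) \<inter> D (snd i) \<noteq> {}}. w (fst j))
        = (\<Sum>j\<in>insert i {j \<in> \<Omega> \<times> {..<c}. j \<noteq> i \<and> D (snd j) \<inter> D (snd i) \<noteq> {}}. w (fst j))"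
      using \<Omega> by (subst sum.insert) auto
    also have "\<dots> \<le> (\<Sum>j\<in>\<Omega> \<times> {..<c}. w (fst j))" using \<Omega> w0 i by (intro sum_mono2) auto
    also have "\<dots> \<le> d0" using tot Nd by linarith
    also have "\<dots> \<le> measure L (D (snd i))" using i by (intro d0) auto
    finally show "w (fst i) + (\<Sum>j\<in>{j \<in> \<Omega> \<times> {..<c}. j \<noteq> i \<and> D (snd j) \<inter> D (snd i) \<noteq> {}}. w (fst j)) \<le> measure L (D (snd i))" .
  qed (use \<Omega> w0 D in auto)
  then obtain Z where Z: "disjoint_family_on Z (\<Omega> \<times> {..<c})"
    "\<And>i. i \<in> \<Omega> \<times> {..<c} \<Longrightarrow> Z i \<in> sets L \<and> Z i \<subseteq> D (snd i) \<and> measure L (Z i) = w (fst i)" by metis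
  define Za where "Za = (\<Union>i\<in>\<Omega> \<times> {..<c}. Z i)"
  have Zas: "Za \<in> sets L" unfolding Za_def using Z \<Omega> by (intro sets.finite_UN) auto
  have mZa: "measure L Za \<le> \<kappa> * q0"
  proof -
    have "measure L Za \<le> (\<Sum>i\<in>\<Omega> \<times> {..<c}. measure L (Z i))"
      unfolding Za_def using Z(2) \<Omega> by (intro finite_measure_subadditive_finite) auto
    also have "\<dots> = (\<Sum>i\<in>\<Omega> \<times> {..<c}. w (fst i))" using Z(2) by (intro sum.cong) auto
    finally show ?thesis using tot Nq by linarith
  qed
  define T where "T = (\<lambda>i. Q (fst i ! snd i) - Za)"
  have Ts: "T i \<in> sets L" if "i \<in> \<Omega> \<times> {..<N}" for i
    unfolding T_def using that \<Omega>(2) by (intro sets.Diff Qs Zas wsub) auto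
  have "\<exists>Y. disjoint_family_on Y (\<Omega> \<times> {..<N}) \<and>
      (\<forall>i\<in>\<Omega> \<times> {..<N}. Y i \<in> sets L \<and> Y i \<subseteq> T i \<and> measure L (Y i) = w (fst i))"
  proof (rule select_disjoint)
    fix i assume i: "i \<in> \<Omega> \<times> {..<N}"
    define a where "a = fst i ! snd i"
    have a: "a \<subseteq> \<S>" unfolding a_def using i \<Omega>(2) by (intro wsub) auto
    have "w (fst i) + (\<Sum>j\<in>{j \<in> \<Omega> \<times> {..<N}. j \<noteq> i \<and> T j \<inter> T i \<noteq> {}}. w (fst j))
        = (\<Sum>j\<in>insert i {j \<in> \<Omega> \<times> {..<N}. j \<noteq> i \<and> T j \<inter> T i \<noteq> {}}. w (fst j))"
      using \<Omega> by (subst sum.insert) auto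
    also have "\<dots> \<le> (\<Sum>j\<in>{j \<in> \<Omega> \<times> {..<N}. fst j ! snd j = a}. w (fst j))"
    proof (rule sum_mono2)
      show "insert i {j \<in> \<Omega> \<times> {..<N}. j \<noteq> i \<and> T j \<inter> T i \<noteq> {}} \<subseteq> {j \<in> \<Omega> \<times> {..<N}. fst j ! snd j = a}"
        using i by (auto simp: T_def Q_def a_def)
    qed (use \<Omega> w0 in auto)
    also have "\<dots> = (\<Sum>k<N. \<Sum>\<omega>\<in>{\<omega> \<in> \<Omega>. \<omega> ! k = a}. w \<omega>)"
    proof -
      have "(\<Sum>k<N. \<Sum>\<omega>\<in>{\<omega> \<in> \<Omega>. \<omega> ! k = a}. w \<omega>) = (\<Sum>p\<in>(SIGMA k:{..<N}. {\<omega> \<in> \<Omega>. \<omega> ! k = a}). w (snd p))"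
        using \<Omega>(1) by (subst sum.Sigma) (auto simp: split_def)
      also have "\<dots> = (\<Sum>j\<in>{j \<in> \<Omega> \<times> {..<N}. fst j ! snd j = a}. w (fst j))"
        by (rule sum.reindex_bij_witness[of _ "\<lambda>j. (snd j, fst j)" "\<lambda>p. (snd p, fst p)"]) auto
      finally show ?thesis by simp
    qed
    also have "\<dots> \<le> (\<Sum>k<N. (1 - \<kappa>) * measure L (Q a) / N)" by (intro sum_mono sumwj a) auto
    also have "\<dots> = (1 - \<kappa>) * measure L (Q a)" using N0 by simp
    also have "\<dots> \<le> measure L (Q a) - measure L Za"
    proof -
      obtain \<omega> j where ij: "i = (\<omega>, j)" "\<omega> \<in> \<Omega>" "j < N" using i by auto
      have "0 < measure L (P \<omega>)" using ij by (simp add: \<Omega>_def)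
      also have "\<dots> \<le> (\<Sum>\<omega>'\<in>{\<omega>' \<in> words. \<omega>' ! j = a}. measure L (P \<omega>'))"
        using ij \<Omega>(2) wfin by (intro member_le_sum) (auto simp: a_def)
      also have "\<dots> = measure L (Q a)" using ij a by (intro sumPj) auto
      finally have "q0 \<le> measure L (Q a)" using q0(2)[OF a] by simp
      then have "\<kappa> * q0 \<le> \<kappa> * measure L (Q a)" using \<kappa> by (intro mult_left_mono) auto
      then show ?thesis using mZa by (simp add: algebra_simps)
    qed
    also have "\<dots> \<le> measure L (T i)"
    proof -
      have "measure L (Q a) \<le> measure L (T i \<union> Za)"
        by (rule finite_measure_mono[OF _ sets.Un[OF Ts[OF i] Zas]]) (auto simp: T_def a_def)
      also have "\<dots> \<le> measure L (T i) + measure L Za"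
        using Ts[OF i] Zas by (intro measure_subadditive) (auto simp: emeasure_eq_measure)
      finally show ?thesis by simp
    qed
    finally show "w (fst i) + (\<Sum>j\<in>{j \<in> \<Omega> \<times> {..<N}. j \<noteq> i \<and> T j \<inter> T i \<noteq> {}}. w (fst j)) \<le> measure L (T i)" .
  qed (use \<Omega> w0 Ts in auto)
  then obtain Y where Y: "disjoint_family_on Y (\<Omega> \<times> {..<N})"
    "\<And>i. i \<in> \<Omega> \<times> {..<N} \<Longrightarrow> Y i \<in> sets L \<and> Y i \<subseteq> T i \<and> measure L (Y i) = w (fst i)" by metis

  define l where "l = N + c"
  have l: "l > 0" "N \<le> l" using N0 by (auto simp: l_def)
  define I where "I = \<Omega> \<times> {..<l}"
  define E where "E = (\<lambda>i. if snd i < N then Y i else Z (fst i, snd i - N))"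
  have E1: "E (\<omega>, j) = Y (\<omega>, j)" "E (\<omega>, j) \<subseteq> Q (\<omega> ! j) - Za" if "\<omega> \<in> \<Omega>" "j < N" for \<omega> j
    using that Y(2)[of "(\<omega>, j)"] by (auto simp: E_def T_def)
  have E2: "E (\<omega>, N + q) = Z (\<omega>, q)" "E (\<omega>, N + q) \<subseteq> D q" "E (\<omega>, N + q) \<subseteq> Za" if "\<omega> \<in> \<Omega>" "q < c" for \<omega> q
    using that Z(2)[of "(\<omega>, q)"] by (auto simp: E_def Za_def)
  have Ew: "E i \<in> sets L \<and> measure L (E i) = w (fst i)" if "i \<in> I" for i
  proof (cases "snd i < N")
    case True then show ?thesis using that Y(2)[of i] by (auto simp: E_def I_def)
  next
    case False then show ?thesis using that Z(2)[of "(fst i, snd i - N)"] by (auto simp: E_def I_def l_def)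
  qed
  have Edisj: "disjoint_family_on E I"
    unfolding disjoint_family_on_def
  proof (intro ballI impI)
    fix i j assume ij: "i \<in> I" "j \<in> I" "i \<noteq> j"
    have big: "(fst k, snd k - N) \<in> \<Omega> \<times> {..<c}" "Z (fst k, snd k - N) \<subseteq> Za" if "k \<in> I" "\<not> snd k < N" for k
    proof -
      show k: "(fst k, snd k - N) \<in> \<Omega> \<times> {..<c}" using that by (auto simp: I_def l_def)
      show "Z (fst k, snd k - N) \<subseteq> Za" unfolding Za_def by (rule UN_upper[OF k])
    qed
    have small: "k \<in> \<Omega> \<times> {..<N}" "Y k \<inter> Za = {}" if "k \<in> I" "snd k < N" for k
    proof -
      show "k \<in> \<Omega> \<times> {..<N}" using that by (auto simp: I_def)
      then show "Y k \<inter> Za = {}" using Y(2)[of k] by (auto simp: T_def)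
    qed
    show "E i \<inter> E j = {}"
    proof (cases "snd i < N"; cases "snd j < N")
      assume "snd i < N" "snd j < N"
      then show ?thesis using disjoint_family_onD[OF Y(1) small(1)[of i] small(1)[of j] ij(3)] ij by (simp add: E_def)
    next
      assume a: "\<not> snd i < N" "\<not> snd j < N"
      then have "(fst i, snd i - N) \<noteq> (fst j, snd j - N)" using ij(3) by (auto simp: prod_eq_iff)
      then show ?thesis using Z(1) big(1)[of i] big(1)[of j] ij a unfolding E_def disjoint_family_on_def by simp
    next
      assume "snd i < N" "\<not> snd j < N"
      then show ?thesis using small(2)[of i] big(2)[of j] ij by (auto simp: E_def)
    next
      assume "\<not> snd i < N" "snd j < N"
      then show ?thesis using small(2)[of j] big(2)[of i] ij by (auto simp: E_def)
    qed
  qed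
  \<comment> \<open>The levels over one itinerary, closing levels included, form one cycle of length
    \<open>l\<close>.\<close>
  define \<sigma> where "\<sigma> = (\<lambda>i :: 'a set set list \<times> nat. (fst i, Suc (snd i) mod l))"
  have \<sigma>n: "(\<sigma> ^^ n) i = (fst i, (snd i + n) mod l)" if "snd i < l" for n i
    using that by (induction n) (auto simp: \<sigma>_def mod_Suc_eq prod_eq_iff)
  have \<sigma>: "bij_betw \<sigma> I I"
  proof (rule bij_betw_byWitness[where f' = "\<lambda>i. (\<sigma> ^^ (l - 1)) i"])
    have s: "\<sigma> i \<in> I" if "i \<in> I" for i using that l by (auto simp: \<sigma>_def I_def)
    then show "\<sigma> ` I \<subseteq> I" by auto
    have sn: "(\<sigma> ^^ n) i \<in> I" if "i \<in> I" for i n using that s by (induction n) auto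
    then show "(\<lambda>i. (\<sigma> ^^ (l - 1)) i) ` I \<subseteq> I" by auto
    have id: "(\<sigma> ^^ l) i = i" if "i \<in> I" for i using that \<sigma>n[of i l] by (auto simp: I_def)
    have ll: "l = Suc (l - 1)" using l by simp
    show "\<forall>i\<in>I. (\<sigma> ^^ (l - 1)) (\<sigma> i) = i"
    proof
      fix i assume "i \<in> I"
      then have "(\<sigma> ^^ Suc (l - 1)) i = i" using id ll by simp
      then show "(\<sigma> ^^ (l - 1)) (\<sigma> i) = i" by (simp add: funpow_Suc_right del: funpow.simps)
    qed
    show "\<forall>i\<in>I. \<sigma> ((\<sigma> ^^ (l - 1)) i) = i"
    proof
      fix i assume "i \<in> I"
      then have "(\<sigma> ^^ Suc (l - 1)) i = i" using id ll by simp
      then show "\<sigma> ((\<sigma> ^^ (l - 1)) i) = i" by simp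
    qed
  qed
  have Ifin: "finite I" using \<Omega> by (simp add: I_def)
  have "\<exists>h E'. h \<in> automorphisms L \<and>
    (\<forall>i\<in>I. E' i \<in> sets L \<and> E' i \<subseteq> E i \<and> measure L (E i - E' i) = 0 \<and> h ` E' i \<subseteq> E' (\<sigma> i) \<and>
      (\<forall>x\<in>E' i. \<forall>n. (\<sigma> ^^ n) i = i \<longrightarrow> (h ^^ n) x = x))"
  proof (rule permutation_automorphism[OF Ifin Edisj _ _ \<sigma>])
    fix i assume i: "i \<in> I"
    show "E i \<in> sets L" "0 < measure L (E i)" using Ew[OF i] wpos i by (auto simp: I_def)
    have "\<sigma> i \<in> I" using i l by (auto simp: \<sigma>_def I_def)
    then show "measure L (E (\<sigma> i)) = measure L (E i)" using Ew[OF i] Ew[of "\<sigma> i"] by (simp add: \<sigma>_def)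
  qed
  then obtain h E' where h: "h \<in> automorphisms L"
    and E': "\<And>i. i \<in> I \<Longrightarrow> E' i \<in> sets L \<and> E' i \<subseteq> E i \<and> measure L (E i - E' i) = 0 \<and> h ` E' i \<subseteq> E' (\<sigma> i)"
    and per: "\<And>i x n. i \<in> I \<Longrightarrow> x \<in> E' i \<Longrightarrow> (\<sigma> ^^ n) i = i \<Longrightarrow> (h ^^ n) x = x" by metis
  have mE': "measure L (E' i) = w (fst i)" if "i \<in> I" for i
    using finite_measure_Diff[of "E i" "E' i"] E'[OF that] Ew[OF that] by simp
  have E'disj: "disjoint_family_on E' A" if "A \<subseteq> I" for A
    using Edisj E' that unfolding disjoint_family_on_def by blast
  have mUn: "measure L (\<Union>i\<in>\<Omega> \<times> {..<k}. E' i) = k * ((1 - \<kappa>) * \<mu> / N)" if k: "k \<le> l" for k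
  proof -
    have sub: "\<Omega> \<times> {..<k} \<subseteq> I" using k by (auto simp: I_def)
    have "measure L (\<Union>i\<in>\<Omega> \<times> {..<k}. E' i) = (\<Sum>i\<in>\<Omega> \<times> {..<k}. measure L (E' i))"
      using \<Omega> E' sub by (intro finite_measure_finite_Union E'disj) auto
    also have "\<dots> = (\<Sum>i\<in>\<Omega> \<times> {..<k}. w (fst i))" using mE' sub by (intro sum.cong) auto
    also have "\<dots> = (\<Sum>\<omega>\<in>\<Omega>. \<Sum>q<k. w \<omega>)" by (simp only: sum.cartesian_product split_def)
    also have "\<dots> = k * (\<Sum>\<omega>\<in>\<Omega>. w \<omega>)" by (simp add: sum_distrib_left)
    finally show ?thesis by (simp only: sumw)
  qed
  have UnS: "(\<Union>i\<in>\<Omega> \<times> {..<k}. E' i) \<in> sets L" if "k \<le> l" for k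
    using E' \<Omega> that by (intro sets.finite_UN) (auto simp: I_def)
  have compl: "measure L (space L - (\<Union>i\<in>\<Omega> \<times> {..<k}. E' i)) < \<eta>" if k: "N - 1 \<le> k" "k \<le> l" for k
  proof -
    have "measure L (space L - (\<Union>i\<in>\<Omega> \<times> {..<k}. E' i)) = \<mu> - k * ((1 - \<kappa>) * \<mu> / N)"
      using mUn[OF k(2)] UnS[OF k(2)] by (simp add: finite_measure_compl \<mu>_def)
    also have "\<dots> \<le> \<mu> - (real N - 1) * ((1 - \<kappa>) * \<mu> / N)"
      using k(1) N0 \<kappa> \<mu>0 by (intro diff_left_mono mult_right_mono) auto
    also have "\<dots> = \<kappa> * \<mu> + (1 - \<kappa>) * (\<mu> / N)" using N0 by (simp add: field_simps)
    also have "\<dots> \<le> \<kappa> * \<mu> + 1 * (\<mu> / N)" using \<kappa> \<mu>0 by (intro add_left_mono mult_right_mono) auto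
    also have "\<dots> < \<eta>" using \<kappa>\<mu> N\<eta> \<eta> by linarith
    finally show ?thesis .
  qed
  define B where "B = (\<lambda>j. \<Union>\<omega>\<in>\<Omega>. E' (\<omega>, j))"
  have BU: "(\<Union>j<l. B j) = (\<Union>i\<in>\<Omega> \<times> {..<l}. E' i)" by (auto simp: B_def)
  have Bj: "B j \<in> sets L \<and> (\<forall>x\<in>B j. h x \<in> B (Suc j mod l) \<and> (h ^^ l) x = x)" if j: "j < l" for j
  proof (intro conjI ballI)
    have I: "(\<omega>, j) \<in> I" if "\<omega> \<in> \<Omega>" for \<omega> using that j by (simp add: I_def)
    show "B j \<in> sets L" unfolding B_def using E' I \<Omega> by (intro sets.finite_UN) auto
    fix x assume "x \<in> B j"
    then obtain \<omega> where \<omega>: "\<omega> \<in> \<Omega>" "x \<in> E' (\<omega>, j)" by (auto simp: B_def)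
    have "h x \<in> E' (\<sigma> (\<omega>, j))" using E'[OF I[OF \<omega>(1)]] \<omega>(2) by blast
    then show "h x \<in> B (Suc j mod l)" using \<omega> by (auto simp: B_def \<sigma>_def)
    have "(\<sigma> ^^ l) (\<omega>, j) = (\<omega>, j)" using \<sigma>n[of "(\<omega>, j)" l] j by simp
    then show "(h ^^ l) x = x" using per[OF I[OF \<omega>(1)] \<omega>(2)] by blast
  qed
  have Bdisj: "disjoint_family_on B {..<l}"
    unfolding disjoint_family_on_def B_def
  proof (intro ballI impI)
    fix j k assume jk: "j \<in> {..<l}" "k \<in> {..<l}" "j \<noteq> k"
    have "E' (\<omega>, j) \<inter> E' (\<omega>', k) = {}" if "\<omega> \<in> \<Omega>" "\<omega>' \<in> \<Omega>" for \<omega> \<omega>'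
      using disjoint_family_onD[OF E'disj[OF order_refl], of "(\<omega>, j)" "(\<omega>', k)"] that jk by (simp add: I_def)
    then show "(\<Union>\<omega>\<in>\<Omega>. E' (\<omega>, j)) \<inter> (\<Union>\<omega>\<in>\<Omega>. E' (\<omega>, k)) = {}" by blast
  qed
  have BD: "B (N + q) \<subseteq> D q" if q: "q < c" for q
  proof -
    have "E' (\<omega>, N + q) \<subseteq> D q" if "\<omega> \<in> \<Omega>" for \<omega>
      using E'[of "(\<omega>, N + q)"] E2(2)[OF that q] that q by (auto simp: I_def l_def)
    then show ?thesis by (auto simp: B_def)
  qed
  have close: "measure L (sym_diff (h ` K) (f ` K)) < \<eta>" if K: "K \<in> \<K>" for K
  proof -
    \<comment> \<open>Only the first \<open>N - 1\<close> levels: the point and its image must both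
      lie on itinerary levels.\<close>
    define Good where "Good = (\<Union>i\<in>\<Omega> \<times> {..<N - 1}. E' i)"
    have Gs: "Good \<in> sets L" unfolding Good_def using l by (intro UnS) auto
    have mG: "measure L (space L - Good) < \<eta>" unfolding Good_def using l by (intro compl) auto
    have Ks: "K \<in> sets L" using K \<K> by blast
    have Ksp: "K \<subseteq> space L" using sets.sets_into_space[OF Ks] .
    have iff: "x \<in> K \<longleftrightarrow> h x \<in> f ` K" if x: "x \<in> Good" for x
    proof -
      obtain \<omega> j where \<omega>: "\<omega> \<in> \<Omega>" "j < N - 1" "x \<in> E' (\<omega>, j)" using x by (auto simp: Good_def)
      have j: "j < N" "Suc j < N" "Suc j mod l = Suc j" "(\<omega>, j) \<in> I" "(\<omega>, Suc j) \<in> I"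
        using \<omega> l by (auto simp: I_def)
      have "x \<in> E (\<omega>, j)" using E'[OF j(4)] \<omega>(3) by blast
      then have 1: "lab x = \<omega> ! j" using E1(2)[OF \<omega>(1) j(1)] by (auto simp: Q_def)
      have "h x \<in> E' (\<omega>, Suc j)" using E'[OF j(4)] \<omega>(3) j(3) by (auto simp: \<sigma>_def)
      then have "h x \<in> E (\<omega>, Suc j)" using E'[OF j(5)] by blast
      then have 2: "lab (h x) = \<omega> ! Suc j" using E1(2)[OF \<omega>(1) j(2)] by (auto simp: Q_def)
      \<comment> \<open>Itineraries of positive weight are realised by true orbits of
        \<open>f\<close>. Along these, membership in \<open>K\<close> is equivalent to membership in
        its image one step later; this depends on the labels only, so \<open>h\<close> inherits
        it.\<close>
      have "P \<omega> \<noteq> {}" using \<omega>(1) by (auto simp: \<Omega>_def)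
      then obtain y where y: "y \<in> space L" "\<And>i. i < N \<Longrightarrow> lab ((f ^^ i) y) = \<omega> ! i" by (auto simp: P_def)
      define z where "z = (f ^^ j) y"
      have z: "z \<in> space L" "lab z = lab x" "lab (f z) = lab (h x)"
        using y(2)[OF j(1)] y(2)[OF j(2)] 1 2 automorphism_funpow_space[OF f y(1)] by (auto simp: z_def)
      have KS: "K \<in> \<S>" "f ` K \<in> \<S>" using K by (auto simp: \<S>_def)
      have lab_iff: "u \<in> W \<longleftrightarrow> W \<in> lab u" if "W \<in> \<S>" for u W using that by (simp add: lab_def)
      have "inj_on f (space L)" using f by (simp add: automorphisms_def bij_betw_def)
      then have "z \<in> K \<longleftrightarrow> f z \<in> f ` K" using z(1) Ksp by (auto simp: inj_on_def subset_iff)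
      then show ?thesis unfolding lab_iff[OF KS(1)] lab_iff[OF KS(2)] z by simp
    qed
    have "sym_diff (h ` K) (f ` K) \<subseteq> h ` (space L - Good)"
    proof
      fix v assume v: "v \<in> sym_diff (h ` K) (f ` K)"
      have "h ` space L = space L" using h by (simp add: automorphisms_def bij_betw_def)
      moreover have "h ` K \<subseteq> space L" "f ` K \<subseteq> space L"
        using automorphism_space[OF h] automorphism_space[OF f] Ksp by blast+
      ultimately obtain u where u: "u \<in> space L" "v = h u" using v by blast
      have inj: "inj_on h (space L)" using h by (simp add: automorphisms_def bij_betw_def)
      have "u \<notin> Good"
      proof
        assume "u \<in> Good"
        then have "u \<in> K \<longleftrightarrow> v \<in> f ` K" using iff[of u] u by simp
        moreover have "u \<in> K \<longleftrightarrow> v \<in> h ` K" using inj u Ksp by (auto simp: inj_on_def subset_iff)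
        ultimately show False using v by blast
      qed
      then show "v \<in> h ` (space L - Good)" using u by blast
    qed
    then have "measure L (sym_diff (h ` K) (f ` K)) \<le> measure L (h ` (space L - Good))"
      using automorphism_image_sets(1)[OF h, of "space L - Good"] Gs by (intro finite_measure_mono) auto
    also have "\<dots> = measure L (space L - Good)"
      using automorphism_image_sets(2)[OF h, of "space L - Good"] Gs by (simp add: measure_def)
    finally show ?thesis using mG by simp
  qed
  have "measure L (space L - (\<Union>j<l. B j)) < \<eta>" unfolding BU using l by (intro compl) auto
  then show ?thesis
    using N0 h Bj Bdisj BD close by (intro exI[of _ N] exI[of _ h] exI[of _ B]) (auto simp: l_def)
qed

end

section \<open>Bounded perturbations of the cocycle\<close>

text \<open>If the trace is 2 or -2, rotate in the direction in which the term with
  \<open>sin t\<close> opposes it: up to sign the result is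
  \<open>2 * cos s - \<bar>b\<bar> * sin s\<close>, which is below 2 because
  \<open>cos s < 1\<close>, and above -2 by the choice of \<open>s\<close>.\<close>

lemma elliptic_rotation:
  assumes det: "det W = 1" and tr: "\<bar>trace W\<bar> \<le> 2" and e: "e > 0"
  obtains t where "\<bar>t\<bar> \<le> e" "\<bar>trace (rot t ** W)\<bar> < 2"
proof (cases "\<bar>trace W\<bar> < 2")
  case True
  have "rot 0 = mat 1" by (simp add: matrix_eq_2)
  then show ?thesis using that[of 0] True e by simp
next
  case False
  define a b where "a = trace W" and "b = W$1$2 - W$2$1"
  have T: "trace (rot t ** W) = cos t * a + sin t * b" for t
    by (simp add: matrix_mult_2 a_def b_def algebra_simps)
  have a: "a = 2 \<or> a = - 2" using False tr unfolding a_def by linarith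
  define s where "s = min e (1 / (1 + \<bar>b\<bar>))"
  have s: "0 < s" "s \<le> e" "s \<le> 1" "\<bar>b\<bar> * s \<le> 1"
  proof -
    show s0: "0 < s" using e by (simp add: s_def add_pos_nonneg)
    show "s \<le> e" by (simp add: s_def)
    have "s \<le> 1 / (1 + \<bar>b\<bar>)" by (simp add: s_def)
    then have "s * (1 + \<bar>b\<bar>) \<le> 1" by (simp add: pos_le_divide_eq add_pos_nonneg)
    then have "s + \<bar>b\<bar> * s \<le> 1" by (simp add: algebra_simps)
    moreover have "0 \<le> \<bar>b\<bar> * s" using s0 by (intro mult_nonneg_nonneg) auto
    ultimately show "s \<le> 1" "\<bar>b\<bar> * s \<le> 1" using s0 by linarith+
  qed
  have sp: "s < pi / 2" using s pi_gt3 by linarith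
  have c: "0 < cos s" "cos s < 1" using s sp cos_gt_zero[of s] cos_monotone_0_pi[of 0 s] pi_gt3 by auto
  have sn: "0 \<le> sin s" "sin s \<le> s" using s sp sin_ge_zero[of s] sin_x_le_x[of s] by auto
  have bs: "\<bar>b\<bar> * sin s \<le> 1" "0 \<le> \<bar>b\<bar> * sin s" using mult_left_mono[OF sn(2), of "\<bar>b\<bar>"] s sn by auto
  define t where "t = (if a * b > 0 then - s else s)"
  have "\<bar>t\<bar> \<le> e" using s by (simp add: t_def)
  moreover have "\<bar>trace (rot t ** W)\<bar> < 2"
  proof -
    have "\<bar>2 * cos s - \<bar>b\<bar> * sin s\<bar> < 2" using c bs by linarith
    moreover have "cos t * a + sin t * b = 2 * cos s - \<bar>b\<bar> * sin s \<or> cos t * a + sin t * b = - (2 * cos s - \<bar>b\<bar> * sin s)"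
      unfolding t_def using a by (cases "b > 0") (auto simp: zero_less_mult_iff mult_less_0_iff)
    ultimately show ?thesis unfolding T by linarith
  qed
  ultimately show ?thesis using that by blast
qed

text \<open>An elliptic matrix is \<open>R \<alpha>\<close> for a one-parameter group \<open>R s = cos s + sin s J\<close> with
  \<open>J\<^sup>2 = -1\<close>, conjugate to the rotations.\<close>

lemma elliptic_one_parameter_group:
  assumes det: "det W = 1" and tr: "\<bar>trace W\<bar> < 2"
  obtains R :: "real \<Rightarrow> real ^ 2 ^ 2" and J :: "real ^ 2 ^ 2" and \<alpha> c where
    "\<And>s. R s = cos s *\<^sub>R mat 1 + sin s *\<^sub>R J" "\<And>s t. R (s + t) = R s ** R t" "R 0 = mat 1" "R pi = - mat 1" "R \<alpha> = W"
    "\<And>s. det (R s) = 1" "0 \<le> c" "\<And>s. norm (R s - mat 1) \<le> c * \<bar>s\<bar>"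
proof -
  define \<alpha> where "\<alpha> = arccos (trace W / 2)"
  have ca: "cos \<alpha> = trace W / 2" unfolding \<alpha>_def using tr by (intro cos_arccos) auto
  have "0 < \<alpha>" "\<alpha> < pi" unfolding \<alpha>_def using tr arccos_lt_bounded[of "trace W / 2"] by auto
  then have sa: "sin \<alpha> > 0" by (rule sin_gt_zero)
  define J where "J = (1 / sin \<alpha>) *\<^sub>R (W - cos \<alpha> *\<^sub>R mat 1)"
  define R where "R = (\<lambda>s. cos s *\<^sub>R mat 1 + sin s *\<^sub>R J)"
  have J0: "J$1$1 + J$2$2 = 0"
    unfolding J_def ca by (simp add: sa algebra_simps add_divide_distrib[symmetric])
  have sJ: "sin \<alpha> * J$i$j = W$i$j - cos \<alpha> * (mat 1 :: real ^ 2 ^ 2)$i$j" for i j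
    unfolding J_def using sa by simp
  have detJ: "J$1$1 * J$2$2 - J$1$2 * J$2$1 = 1"
  proof -
    have "(sin \<alpha>)\<^sup>2 * (J$1$1 * J$2$2 - J$1$2 * J$2$1) = (sin \<alpha> * J$1$1) * (sin \<alpha> * J$2$2) - (sin \<alpha> * J$1$2) * (sin \<alpha> * J$2$1)"
      by (simp add: power2_eq_square algebra_simps)
    also have "\<dots> = det W - cos \<alpha> * trace W + (cos \<alpha>)\<^sup>2"
      unfolding sJ by (simp add: det_2 power2_eq_square algebra_simps)
    also have "\<dots> = 1 - (cos \<alpha>)\<^sup>2" using det ca by (simp add: power2_eq_square del: trace_2)
    also have "\<dots> = (sin \<alpha>)\<^sup>2" by (simp add: sin_squared_eq)
    finally show ?thesis using sa by simp
  qed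
  have J2: "J$2$2 = - J$1$1" using J0 by simp
  have JJ: "J$1$2 * J$2$1 = - 1 - J$1$1 * J$1$1" using detJ J2 by simp
  have add: "R (s + t) = R s ** R t" for s t
  proof -
    define p q r where "p = J$1$1" and "q = J$1$2" and "r = J$2$1"
    have qr: "q * r = - 1 - p * p" using JJ by (simp add: p_def q_def r_def)
    have 1: "(cos s + sin s * p) * (cos t + sin t * p) + sin s * q * (sin t * r) = cos (s + t) + sin (s + t) * p"
    proof -
      have "(cos s + sin s * p) * (cos t + sin t * p) + sin s * q * (sin t * r)
          = cos s * cos t + (sin s * cos t + cos s * sin t) * p + sin s * sin t * (p * p + q * r)"
        by (simp add: algebra_simps)
      then show ?thesis by (simp add: qr cos_add sin_add)
    qed
    have 2: "sin s * r * (sin t * q) + (cos s - sin s * p) * (cos t - sin t * p) = cos (s + t) - sin (s + t) * p"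
    proof -
      have "sin s * r * (sin t * q) + (cos s - sin s * p) * (cos t - sin t * p)
          = cos s * cos t - (sin s * cos t + cos s * sin t) * p + sin s * sin t * (p * p + q * r)"
        by (simp add: algebra_simps)
      then show ?thesis by (simp add: qr cos_add sin_add)
    qed
    show ?thesis
      unfolding matrix_eq_2 matrix_mult_2 using 1 2
      by (simp add: R_def J2 p_def[symmetric] q_def[symmetric] r_def[symmetric]) (simp add: sin_add algebra_simps)
  qed
  have "det (R s) = 1" for s
  proof -
    have "det (R s) = (cos s)\<^sup>2 - (sin s)\<^sup>2 * (J$1$1 * J$1$1 + J$1$2 * J$2$1)"
      by (simp add: R_def det_2 J2 power2_eq_square algebra_simps)
    also have "\<dots> = (cos s)\<^sup>2 + (sin s)\<^sup>2" using JJ by simp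
    finally show ?thesis by simp
  qed
  moreover have "R 0 = mat 1" "R pi = - mat 1" by (simp_all add: R_def)
  moreover have "R \<alpha> = W" unfolding matrix_eq_2 R_def by (simp add: sJ)
  moreover have "norm (R s - mat 1) \<le> (2 + norm J) * \<bar>s\<bar>" for s
  proof -
    have "R s - mat 1 = (cos s - 1) *\<^sub>R mat 1 + sin s *\<^sub>R J" by (simp add: R_def algebra_simps)
    then have "norm (R s - mat 1) \<le> \<bar>cos s - 1\<bar> * norm (mat 1 :: real ^ 2 ^ 2) + \<bar>sin s\<bar> * norm J"
      by (metis norm_scaleR norm_triangle_ineq)
    also have "\<dots> \<le> \<bar>s\<bar> * 2 + \<bar>s\<bar> * norm J"
    proof (intro add_mono mult_mono mult_right_mono norm_mat_1_le)
      show "\<bar>sin s\<bar> \<le> \<bar>s\<bar>" by (rule abs_sin_x_le_abs_x)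
      have "\<bar>sin (s / 2)\<bar> \<le> \<bar>s\<bar> / 2" using abs_sin_x_le_abs_x[of "s / 2"] by simp
      moreover have "\<bar>sin (s / 2)\<bar> * \<bar>sin (s / 2)\<bar> \<le> \<bar>sin (s / 2)\<bar>" by (intro mult_left_le) auto
      moreover have "\<bar>cos s - 1\<bar> = 2 * (\<bar>sin (s / 2)\<bar> * \<bar>sin (s / 2)\<bar>)"
        using cos_double_sin[of "s / 2"] by (simp add: power2_eq_square flip: abs_mult)
      ultimately show "\<bar>cos s - 1\<bar> \<le> \<bar>s\<bar>" by linarith
    qed auto
    finally show ?thesis by (simp add: algebra_simps)
  qed
  ultimately show ?thesis using that[of R J \<alpha> "2 + norm J"] add by (simp add: R_def)
qed

text \<open>An angle \<gamma> that solves
  \<open>cos \<gamma> * trace X + sin \<gamma> * trace (J ** X) = 0\<close>, given by a formula and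
  not by choice so that it is measurable in \<open>X\<close>. Its range is bounded independently of
  the size of \<open>X\<close>.\<close>

definition zero_trace_angle :: "real ^ 2 ^ 2 \<Rightarrow> real ^ 2 ^ 2 \<Rightarrow> real" where
  "zero_trace_angle J X = (if trace X = 0 then 0 else pi / 2 + arctan (trace (J ** X) / trace X))"

lemma zero_trace_angle:
  "0 \<le> zero_trace_angle J X" "zero_trace_angle J X \<le> pi"
  "trace ((cos (zero_trace_angle J X) *\<^sub>R mat 1 + sin (zero_trace_angle J X) *\<^sub>R J) ** X) = 0"
proof -
  define a b \<gamma> where "a = trace X" and "b = trace (J ** X)" and "\<gamma> = zero_trace_angle J X"
  have g: "\<gamma> = (if a = 0 then 0 else pi / 2 + arctan (b / a))" unfolding \<gamma>_def a_def b_def zero_trace_angle_def ..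
  show "0 \<le> zero_trace_angle J X" "zero_trace_angle J X \<le> pi"
    unfolding \<gamma>_def[symmetric] g using arctan_bounded[of "b / a"] pi_gt_zero by auto
  have "trace ((cos \<gamma> *\<^sub>R mat 1 + sin \<gamma> *\<^sub>R J) ** X) = cos \<gamma> * a + sin \<gamma> * b"
    by (simp add: a_def b_def matrix_mult_2 algebra_simps)
  also have "\<dots> = 0"
  proof (cases "a = 0")
    case False
    have "cos \<gamma> = - sin (arctan (b / a))" "sin \<gamma> = cos (arctan (b / a))" using False g by (simp_all add: cos_add sin_add)
    moreover have "sin (arctan (b / a)) = b / a * cos (arctan (b / a))"
      using tan_arctan[of "b / a"] cos_arctan_not_zero[of "b / a"] by (simp add: tan_def field_simps)
    ultimately show ?thesis using False by simp
  qed (simp add: g)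
  finally show "trace ((cos (zero_trace_angle J X) *\<^sub>R mat 1 + sin (zero_trace_angle J X) *\<^sub>R J) ** X) = 0"
    by (simp only: \<gamma>_def)
qed

lemma measurable_zero_trace_angle:
  assumes [measurable]: "X \<in> borel_measurable L"
  shows "(\<lambda>x. zero_trace_angle J (X x)) \<in> borel_measurable L"
proof -
  have [measurable]: "(\<lambda>x. trace (X x)) \<in> borel_measurable L" "(\<lambda>x. trace (J ** X x)) \<in> borel_measurable L"
    unfolding trace_2 by measurable
  have [measurable]: "(\<lambda>x. arctan (trace (J ** X x) / trace (X x))) \<in> borel_measurable L"
    by (rule borel_measurable_continuous_on[of arctan]) (auto intro: continuous_intros)
  show ?thesis unfolding zero_trace_angle_def by measurable
qed

text \<open>The product of \<open>q\<close> letters of the periodic word \<open>bl\<^sup>\<infinity>\<close>, in which the last letter of every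
  period is rotated by \<open>R\<close>.\<close>

primrec periodic_prod :: "real ^ 2 ^ 2 \<Rightarrow> (real ^ 2 ^ 2) list \<Rightarrow> nat \<Rightarrow> real ^ 2 ^ 2" where
  "periodic_prod R bl 0 = mat 1"
| "periodic_prod R bl (Suc q) = (if Suc q mod length bl = 0 then R ** bl ! (q mod length bl) else bl ! (q mod length bl))
     ** periodic_prod R bl q"

lemma periodic_prod_partial:
  assumes "v < length bl"
  shows "periodic_prod R bl (u * length bl + v) = wprod (rev (take v bl)) ** periodic_prod R bl (u * length bl)"
  using assms
proof (induction v)
  case (Suc v)
  have m: "Suc (u * length bl + v) mod length bl = Suc v" "(u * length bl + v) mod length bl = v"
    using Suc.prems by (simp_all add: mod_mult_self3 flip: add_Suc_right)
  show ?case using Suc m by (simp add: take_Suc_conv_app_nth matrix_mul_assoc)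
qed simp

lemma periodic_prod_multiple:
  assumes "bl \<noteq> []"
  shows "periodic_prod R bl (Suc u * length bl) = (R ** wprod (rev bl)) ** periodic_prod R bl (u * length bl)"
proof -
  define l where "l = length bl - 1"
  have l: "length bl = Suc l" using assms by (simp add: l_def)
  define n where "n = u * length bl + l"
  have n: "Suc u * length bl = Suc n" using l by (simp add: n_def)
  have m: "Suc n mod length bl = 0" "n mod length bl = l"
  proof -
    show "Suc n mod length bl = 0" unfolding n[symmetric] by (rule mod_mult_self2_is_0)
    have "n mod length bl = l mod length bl" unfolding n_def by (rule mod_mult_self3)
    then show "n mod length bl = l" using l by simp
  qed
  have p: "periodic_prod R bl n = wprod (rev (take l bl)) ** periodic_prod R bl (u * length bl)"
    unfolding n_def by (rule periodic_prod_partial) (simp add: l)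
  have r: "rev bl = bl ! l # rev (take l bl)"
    using take_Suc_conv_app_nth[of l bl] l by simp
  show ?thesis unfolding n r using m p by (simp add: matrix_mul_assoc)
qed

lemma zero_trace_square:
  fixes X :: "real ^ 2 ^ 2"
  assumes "det X = 1" "trace X = 0"
  shows "X ** X = - mat 1"
proof -
  have "X$2$2 = - X$1$1" "X$1$1 * X$2$2 - X$1$2 * X$2$1 = 1" using assms by (auto simp: det_2)
  then show ?thesis by (simp add: matrix_eq_2 matrix_mult_2 algebra_simps)
qed

text \<open>The negation yields only a trace of modulus at most 2; half of \<delta> is kept for
  rotating the first letter, which makes the inequality strict.\<close>

lemma not_robustly_hyperbolic_elliptic_word:
  assumes A: "A \<in> borel_measurable L" and nr: "\<not> robustly_hyperbolic L A" and \<delta>: "\<delta> > 0"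
  obtains Bs where "Bs \<noteq> []" "set Bs \<subseteq> near_values L A \<delta>" "\<bar>trace (wprod Bs)\<bar> < 2"
proof -
  have "\<delta> / 2 > 0" using \<delta> by simp
  then obtain Cs where Cs: "Cs \<noteq> []" "set Cs \<subseteq> near_values L A (\<delta> / 2)" "\<not> \<bar>trace (wprod Cs)\<bar> > 2"
    using nr unfolding robustly_hyperbolic_def by blast
  obtain C Cs' where CC: "Cs = C # Cs'" using Cs(1) by (cases Cs) auto
  define e where "e = \<delta> / (4 * (norm C + 1))"
  have e: "e > 0" using \<delta> by (simp add: e_def add_nonneg_pos)
  have detw: "det (wprod Cs) = 1" using Cs(2) by (intro det_wprod) (auto simp: near_values_def)
  obtain t where t: "\<bar>t\<bar> \<le> e" "\<bar>trace (rot t ** wprod Cs)\<bar> < 2"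
    using elliptic_rotation[OF detw _ e] Cs(3) by (metis not_less)
  have "norm (rot t ** C - C) \<le> 2 * \<bar>t\<bar> * norm C" by (rule norm_rot_mult_diff)
  also have "\<dots> \<le> 2 * e * (norm C + 1)" using t e by (intro mult_mono) auto
  also have "\<dots> = \<delta> / 2"
  proof -
    have "2 * (\<delta> / (4 * d)) * d = \<delta> / 2" if "d \<noteq> 0" for d using that by simp
    moreover have "norm C + 1 \<noteq> 0" using norm_ge_zero[of C] by linarith
    ultimately show ?thesis unfolding e_def by blast
  qed
  finally have n: "norm (rot t ** C - C) \<le> \<delta> / 2" .
  have C: "C \<in> near_values L A (\<delta> / 2)" using Cs CC by simp
  have "rot t ** C \<in> near_values L A (\<delta> / 2 + \<delta> / 2)"
    by (rule near_values_perturb[OF C _ n A]) (use C in \<open>simp add: det_mul near_values_def\<close>)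
  moreover have "B \<in> near_values L A (\<delta> / 2 + \<delta> / 2)" if "B \<in> set Cs'" for B
    by (rule near_values_perturb[of B L A "\<delta> / 2" B]) (use that Cs CC A \<delta> in \<open>auto simp: near_values_def\<close>)
  ultimately have "set ((rot t ** C) # Cs') \<subseteq> near_values L A \<delta>" by auto
  moreover have "wprod ((rot t ** C) # Cs') = rot t ** wprod Cs" by (simp add: CC matrix_mul_assoc)
  ultimately show ?thesis using that[of "(rot t ** C) # Cs'"] t(2) by simp
qed

text \<open>The closing levels of the tower spell \<open>m'\<close> copies of an elliptic word. An
  additional angle \<open>s\<close> in each copy multiplies the block that follows \<open>f\<close>
  by \<open>R (m' * (s + \<alpha>))\<close>, and \<open>s\<close> is chosen at the base point of the
  orbit so that the product over a period has trace 0. Letters change on closing levels only, where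
  \<open>A\<close> is already close to the word.\<close>

lemma (in standard_space) approximate_small_growth:
  assumes f: "f \<in> automorphisms L" and A: "A \<in> bounded_SL2 L" and nr: "\<not> robustly_hyperbolic L A"
    and \<K>: "finite \<K>" "\<K> \<subseteq> sets L" and \<eta>: "\<eta> > 0" and \<delta>: "\<delta> > 0" and \<epsilon>: "\<epsilon> > 0"
  shows "\<exists>h A'. h \<in> automorphisms L \<and> A' \<in> bounded_SL2 L \<and>
    (\<forall>K\<in>\<K>. measure L (sym_diff (h ` K) (f ` K)) < \<eta>) \<and>
    (\<forall>x\<in>space L. norm (A x - A' x) \<le> \<delta>) \<and> small_growth L \<epsilon> h A'"
proof -
  have Am: "A \<in> borel_measurable L" and Adet: "\<And>x. x \<in> space L \<Longrightarrow> det (A x) = 1" using A by (auto simp: bounded_SL2_def)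
  obtain Bs where Bs: "Bs \<noteq> []" "set Bs \<subseteq> near_values L A (\<delta> / 2)" "\<bar>trace (wprod Bs)\<bar> < 2"
    using not_robustly_hyperbolic_elliptic_word[OF Am nr, of "\<delta> / 2"] \<delta> by auto
  have detw: "det (wprod Bs) = 1" using Bs(2) by (intro det_wprod) (auto simp: near_values_def)
  obtain R J \<alpha> c0 where R: "\<And>s. R s = cos s *\<^sub>R mat 1 + sin s *\<^sub>R J" and Radd: "\<And>s t. R (s + t) = R s ** R t"
    and R0: "R 0 = mat 1" and R\<alpha>: "R \<alpha> = wprod Bs" and Rdet: "\<And>s. det (R s) = 1"
    and c0: "0 \<le> c0" "\<And>s. norm (R s - mat 1) \<le> c0 * \<bar>s\<bar>"
    by (rule elliptic_one_parameter_group[OF detw Bs(3)]) blast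
  \<comment> \<open>The leftmost factor of a product is the latest letter, so the orbit meets the
    letters of \<open>Bs\<close> in reverse order.\<close>
  define bl where "bl = rev Bs"
  have bl: "bl \<noteq> []" "rev bl = Bs" "length bl > 0" using Bs by (auto simp: bl_def)
  define lb where "lb = (\<lambda>q. bl ! (q mod length bl))"
  have lbS: "lb q \<in> set Bs" for q
  proof -
    have "bl ! (q mod length bl) \<in> set bl" using bl(3) by (intro nth_mem) simp
    moreover have "set bl = set Bs" by (simp add: bl_def)
    ultimately show ?thesis by (simp only: lb_def)
  qed
  then have lb: "det (lb q) = 1" "emeasure L {x \<in> space L. norm (A x - lb q) < \<delta> / 2} > 0" for q
    using Bs(2) by (auto simp: near_values_def)
  obtain \<beta> where \<beta>: "\<beta> > 0" "\<And>q. norm (lb q) \<le> \<beta>"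
    using finite_imp_bounded[of "set Bs"] lbS unfolding bounded_pos by blast
  \<comment> \<open>Enough copies that an angle of \<open>pi / m'\<close> moves a letter by at most
    \<open>\<delta> / 2\<close>; the other half of \<delta> is the distance from \<open>A\<close> to
    the letter of its level.\<close>
  obtain m :: nat where m0: "2 * c0 * pi * \<beta> / \<delta> < m" using reals_Archimedean2 by blast
  define m' where "m' = Suc m"
  have m': "m' > 0" "c0 * (pi / m') * \<beta> \<le> \<delta> / 2"
  proof -
    show "m' > 0" by (simp add: m'_def)
    have "2 * c0 * pi * \<beta> < m * \<delta>" using m0 \<delta> by (simp add: pos_divide_less_eq)
    also have "\<dots> \<le> m' * \<delta>" using \<delta> by (simp add: m'_def)
    finally show "c0 * (pi / m') * \<beta> \<le> \<delta> / 2" by (simp add: m'_def field_simps)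
  qed
  define c where "c = m' * length bl"
  define D where "D = (\<lambda>q. {x \<in> space L. norm (A x - lb q) < \<delta> / 2})"
  have D: "D q \<in> sets L" "measure L (D q) > 0" for q
  proof -
    show "D q \<in> sets L" unfolding D_def by (rule near_set_measurable[OF Am])
    have "emeasure L (D q) > 0" unfolding D_def by (rule lb(2))
    then show "measure L (D q) > 0" by (simp add: emeasure_eq_measure)
  qed
  define \<eta>' where "\<eta>' = min \<eta> \<epsilon>"
  have \<eta>': "\<eta>' > 0" "\<eta>' \<le> \<eta>" "\<eta>' \<le> \<epsilon>" using \<eta> \<epsilon> by (auto simp: \<eta>'_def)
  have "\<exists>N h B. N > 0 \<and> h \<in> automorphisms L \<and>
    (\<forall>j<N + c. B j \<in> sets L \<and> (\<forall>x\<in>B j. h x \<in> B (Suc j mod (N + c)) \<and> (h ^^ (N + c)) x = x)) \<and>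
    disjoint_family_on B {..<N + c} \<and> (\<forall>q<c. B (N + q) \<subseteq> D q) \<and>
    measure L (space L - (\<Union>j<N + c. B j)) < \<eta>' \<and>
    (\<forall>K\<in>\<K>. measure L (sym_diff (h ` K) (f ` K)) < \<eta>')"
    by (rule tower_approximation[OF f \<K> D \<eta>'(1)])
  then obtain N h B where TA: "N > 0 \<and> h \<in> automorphisms L \<and>
    (\<forall>j<N + c. B j \<in> sets L \<and> (\<forall>x\<in>B j. h x \<in> B (Suc j mod (N + c)) \<and> (h ^^ (N + c)) x = x)) \<and>
    disjoint_family_on B {..<N + c} \<and> (\<forall>q<c. B (N + q) \<subseteq> D q) \<and>
    measure L (space L - (\<Union>j<N + c. B j)) < \<eta>' \<and>
    (\<forall>K\<in>\<K>. measure L (sym_diff (h ` K) (f ` K)) < \<eta>')"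
    by (elim exE) (rule that)
  have N: "N > 0" using TA by simp
  have h: "h \<in> automorphisms L" using TA by simp
  have Bdisj: "disjoint_family_on B {..<N + c}" using TA by simp
  have rest: "measure L (space L - (\<Union>j<N + c. B j)) < \<eta>'" using TA by simp
  have B: "B j \<in> sets L" "x \<in> B j \<Longrightarrow> h x \<in> B (Suc j mod (N + c))" "x \<in> B j \<Longrightarrow> (h ^^ (N + c)) x = x"
    if "j < N + c" for j x using TA that by simp_all
  have BD: "B (N + q) \<subseteq> D q" if "q < c" for q using TA that by simp
  have close: "measure L (sym_diff (h ` K) (f ` K)) < \<eta>'" if "K \<in> \<K>" for K using TA that by simp
  define l where "l = N + c"
  have l: "l > 0" "N + q < l \<longleftrightarrow> q < c" for q using N by (auto simp: l_def)
  define s where "s = (\<lambda>x. zero_trace_angle J (R (m' * \<alpha>) ** cocycle h A N x) / m')"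
  have sm: "s \<in> borel_measurable L"
  proof -
    note measurable_cocycle[OF h Am, measurable]
    have "(\<lambda>x. zero_trace_angle J (R (m' * \<alpha>) ** cocycle h A N x)) \<in> borel_measurable L"
      by (rule measurable_zero_trace_angle) measurable
    then show ?thesis unfolding s_def by measurable
  qed
  have s0: "0 \<le> s x" "s x \<le> pi / m'" for x
    using zero_trace_angle(1,2) m'(1) unfolding s_def by (auto intro: divide_right_mono)
  \<comment> \<open>\<open>s\<close> is to be evaluated at the base point. From level
    \<open>N + q\<close> the orbit reaches level 0 after \<open>c - q\<close> steps, and by
    periodicity this is the base point from which it came.\<close>
  define lt where "lt = (\<lambda>q x. if Suc q mod length bl = 0 then R (s ((h ^^ (c - q)) x)) ** lb q else lb q)"
  have ltdet: "det (lt q x) = 1" for q x using lb(1) Rdet by (simp add: lt_def det_mul)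
  have ltm: "lt q \<in> borel_measurable L" for q
  proof -
    have [measurable]: "(\<lambda>x. s ((h ^^ (c - q)) x)) \<in> borel_measurable L"
      using measurable_compose[OF automorphism_funpow_measurable[OF h] sm] .
    have [measurable]: "(\<lambda>x. R (s ((h ^^ (c - q)) x))) \<in> borel_measurable L"
      unfolding R by (intro borel_measurable_add borel_measurable_scaleR) measurable
    show ?thesis unfolding lt_def by (cases "Suc q mod length bl = 0") simp_all
  qed
  have ltn: "norm (lt q x - lb q) \<le> \<delta> / 2" for q x
  proof (cases "Suc q mod length bl = 0")
    case True
    define t where "t = s ((h ^^ (c - q)) x)"
    have "lt q x - lb q = (R t - mat 1) ** lb q"
      using True by (simp add: lt_def t_def matrix_eq_2 matrix_mult_2 algebra_simps)
    then have "norm (lt q x - lb q) \<le> norm (R t - mat 1) * norm (lb q)" using norm_matrix_mult_le by metis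
    also have "\<dots> \<le> c0 * (pi / m') * \<beta>"
    proof (intro mult_mono \<beta>(2))
      have "norm (R t - mat 1) \<le> c0 * \<bar>t\<bar>" by (rule c0)
      also have "\<dots> \<le> c0 * (pi / m')" using s0 c0 by (intro mult_left_mono) (auto simp: t_def)
      finally show "norm (R t - mat 1) \<le> c0 * (pi / m')" .
    qed (use c0 in auto)
    finally show ?thesis using m'(2) by linarith
  next
    case False then show ?thesis using \<delta> by (simp add: lt_def)
  qed
  define A' where "A' = (\<lambda>x. if \<exists>q<c. x \<in> B (N + q) then lt (THE q. q < c \<and> x \<in> B (N + q)) x else A x)"
  have uniq: "j = k" if "j < l" "k < l" "x \<in> B j" "x \<in> B k" for j k x
    using Bdisj that unfolding disjoint_family_on_def l_def by blast
  have A'1: "A' x = lt q x" if q: "q < c" "x \<in> B (N + q)" for q x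
  proof -
    have "(THE q. q < c \<and> x \<in> B (N + q)) = q"
    proof (rule the_equality)
      fix p assume p: "p < c \<and> x \<in> B (N + p)"
      then have "N + p = N + q" using q by (intro uniq) (auto simp: l_def)
      then show "p = q" by simp
    qed (use q in simp)
    moreover have "\<exists>q<c. x \<in> B (N + q)" using q by blast
    ultimately show ?thesis by (simp only: A'_def if_True)
  qed
  have A'2: "A' x = A x" if "j < N" "x \<in> B j" for j x
  proof -
    have "\<not> (\<exists>q<c. x \<in> B (N + q))"
    proof
      assume "\<exists>q<c. x \<in> B (N + q)"
      then obtain q where "q < c" "x \<in> B (N + q)" by blast
      then have "j = N + q" using that by (intro uniq) (auto simp: l_def)
      then show False using that by simp
    qed
    then show ?thesis unfolding A'_def by (rule if_not_P)
  qed
  have A'm: "A' \<in> borel_measurable L"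
  proof (rule measurableI)
    fix S :: "(real ^ 2 ^ 2) set" assume S: "S \<in> sets borel"
    define U where "U = (\<Union>q<c. B (N + q))"
    have Us: "U \<in> sets L" unfolding U_def using B(1) by (intro sets.finite_UN) auto
    have eq: "A' -` S \<inter> space L = (\<Union>q<c. B (N + q) \<inter> (lt q -` S \<inter> space L)) \<union> ((A -` S \<inter> space L) - U)"
    proof (intro equalityI subsetI)
      fix x assume x: "x \<in> A' -` S \<inter> space L"
      show "x \<in> (\<Union>q<c. B (N + q) \<inter> (lt q -` S \<inter> space L)) \<union> ((A -` S \<inter> space L) - U)"
      proof (cases "x \<in> U")
        case True
        then obtain q where "q < c" "x \<in> B (N + q)" by (auto simp: U_def)
        then show ?thesis using A'1[of q x] x by auto
      next
        case False
        then have "\<not> (\<exists>q<c. x \<in> B (N + q))" by (auto simp: U_def)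
        then have "A' x = A x" unfolding A'_def by (rule if_not_P)
        then show ?thesis using False x by auto
      qed
    next
      fix x assume x: "x \<in> (\<Union>q<c. B (N + q) \<inter> (lt q -` S \<inter> space L)) \<union> ((A -` S \<inter> space L) - U)"
      then consider q where "q < c" "x \<in> B (N + q)" "lt q x \<in> S" "x \<in> space L" | "A x \<in> S" "x \<in> space L" "x \<notin> U" by auto
      then show "x \<in> A' -` S \<inter> space L"
      proof cases
        case 1 then show ?thesis using A'1 by simp
      next
        case 2
        then have "\<not> (\<exists>q<c. x \<in> B (N + q))" by (auto simp: U_def)
        then have "A' x = A x" unfolding A'_def by (rule if_not_P)
        then show ?thesis using 2 by simp
      qed
    qed
    show "A' -` S \<inter> space L \<in> sets L" unfolding eq
      using B(1) Us S Am ltm by (intro sets.Un sets.finite_UN sets.Int sets.Diff measurable_sets[OF Am] measurable_sets[OF ltm]) auto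
  qed simp
  have A'c: "norm (A x - A' x) \<le> \<delta>" if x: "x \<in> space L" for x
  proof (cases "\<exists>q<c. x \<in> B (N + q)")
    case True
    then obtain q where q: "q < c" "x \<in> B (N + q)" by blast
    then have "norm (A x - lb q) < \<delta> / 2" using BD[OF q(1)] by (auto simp: D_def)
    moreover have "A x - A' x = (A x - lb q) - (lt q x - lb q)" using A'1[OF q] by simp
    ultimately show ?thesis using ltn[of q x] norm_triangle_ineq4[of "A x - lb q" "lt q x - lb q"] by simp
  next
    case False
    then have "A' x = A x" unfolding A'_def by (rule if_not_P)
    then show ?thesis using \<delta> by simp
  qed
  have A'B: "A' \<in> bounded_SL2 L"
  proof -
    have "det (A' x) = 1" if "x \<in> space L" for x using Adet[OF that] ltdet by (simp add: A'_def)
    moreover obtain K where K: "AE x in L. norm (A x) \<le> K" using bounded_SL2_norm[OF A] .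
    have "AE x in L. opnorm (A' x) \<le> K + \<delta>"
      using K AE_space
    proof eventually_elim
      case (elim x)
      have "norm (A' x) \<le> norm (A x) + norm (A x - A' x)" using norm_triangle_ineq4[of "A x" "A x - A' x"] by simp
      then show ?case using elim A'c[of x] opnorm_le_norm[of "A' x"] by simp
    qed
    ultimately show ?thesis using A'm by (auto simp: bounded_SL2_def)
  qed
  have orbit: "(h ^^ k) x \<in> B ((j + k) mod l)" if "j < l" "x \<in> B j" for j k x
  proof (induction k)
    case (Suc k)
    have "(j + k) mod l < l" using l by simp
    then have "h ((h ^^ k) x) \<in> B (Suc ((j + k) mod l) mod l)" using B(2) Suc unfolding l_def by blast
    then show ?case by (simp add: mod_Suc_eq)
  qed (use that in simp)
  have hl: "(h ^^ l) x = x" if "j < l" "x \<in> B j" for j x using B(3) that unfolding l_def by blast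
  have base: "trace (cocycle h A' l x) = 0" if x: "x \<in> B 0" for x
  proof -
    have orb: "(h ^^ k) x \<in> B k" if "k < l" for k using orbit[OF l(1) x, of k] that by simp
    have c1: "cocycle h A' k x = cocycle h A k x" if "k \<le> N" for k
      using that by (induction k) (auto simp: A'2[OF _ orb] l_def)
    have c2: "cocycle h A' (N + q) x = periodic_prod (R (s x)) bl q ** cocycle h A N x" if "q \<le> c" for q
      using that
    proof (induction q)
      case 0 then show ?case using c1[of N] by simp
    next
      case (Suc q)
      then have q: "q < c" by simp
      have "(h ^^ (c - q)) ((h ^^ (N + q)) x) = (h ^^ (c - q + (N + q))) x" by (simp add: funpow_add)
      also have "c - q + (N + q) = l" using q by (simp add: l_def)
      finally have hb: "(h ^^ (c - q)) ((h ^^ (N + q)) x) = x" using hl[OF l(1) x] by simp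
      have "A' ((h ^^ (N + q)) x) = (if Suc q mod length bl = 0 then R (s x) ** lb q else lb q)"
        using A'1[OF q orb] q l(2) by (simp only: lt_def hb)
      then show ?case using Suc q by (simp add: matrix_mul_assoc lb_def)
    qed
    have pp: "periodic_prod (R (s x)) bl (u * length bl) = R (u * (s x + \<alpha>))" for u
    proof (induction u)
      case 0 then show ?case by (simp add: R0)
    next
      case (Suc u)
      have "periodic_prod (R (s x)) bl (Suc u * length bl) = (R (s x) ** R \<alpha>) ** R (u * (s x + \<alpha>))"
        using periodic_prod_multiple[OF bl(1), of "R (s x)" u] Suc bl(2) R\<alpha> by simp
      also have "\<dots> = R ((s x + \<alpha>) + u * (s x + \<alpha>))" by (simp only: Radd)
      finally show ?case by (simp add: algebra_simps)
    qed
    define X where "X = R (m' * \<alpha>) ** cocycle h A N x"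
    have "cocycle h A' l x = R (m' * (s x + \<alpha>)) ** cocycle h A N x"
      using c2[of c] pp[of m'] by (simp add: l_def c_def)
    also have "m' * (s x + \<alpha>) = zero_trace_angle J X + m' * \<alpha>" using m'(1) by (simp add: s_def X_def algebra_simps)
    finally have "cocycle h A' l x = R (zero_trace_angle J X) ** X" by (simp add: Radd X_def matrix_mul_assoc)
    then show ?thesis using zero_trace_angle(3)[of J X] unfolding R by simp
  qed
  have Bsp: "x \<in> space L" if "j < l" "x \<in> B j" for j x using sets.sets_into_space[OF B(1)[of j]] that by (auto simp: l_def)
  \<comment> \<open>The products over a period from other levels are conjugate to the one from level
    0, so they have trace 0 as well.\<close>
  have sq: "cocycle h A' l x ** cocycle h A' l x = - mat 1" if j: "j < l" and x: "x \<in> B j" for j x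
  proof (rule zero_trace_square)
    show "det (cocycle h A' l x) = 1" by (rule det_cocycle[OF h A'B Bsp[OF j x]])
    define y where "y = (h ^^ (l - j)) x"
    have y: "y \<in> B 0" using orbit[OF j x, of "l - j"] j by (simp add: y_def)
    have "(h ^^ j) y = (h ^^ (j + (l - j))) x" unfolding y_def by (simp add: funpow_add)
    then have hy: "(h ^^ j) y = x" using hl[OF j x] j by simp
    define P where "P = cocycle h A' j y"
    have dP: "det P = 1" unfolding P_def by (rule det_cocycle[OF h A'B Bsp[OF l(1) y]])
    have "cocycle h A' l x ** P = cocycle h A' (l + j) y" by (simp only: cocycle_add hy P_def)
    also have "\<dots> = cocycle h A' (j + l) y" by (simp only: add.commute)
    also have "\<dots> = P ** cocycle h A' l y" unfolding cocycle_add hl[OF l(1) y] P_def ..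
    finally have "(cocycle h A' l x ** P) ** adj2 P = (P ** cocycle h A' l y) ** adj2 P" by simp
    then have "cocycle h A' l x = P ** (cocycle h A' l y ** adj2 P)"
      by (simp add: mult_adj2[OF dP] flip: matrix_mul_assoc)
    then have "trace (cocycle h A' l x) = trace ((cocycle h A' l y ** adj2 P) ** P)" using trace_mul_sym by metis
    also have "\<dots> = trace (cocycle h A' l y)" by (simp add: mult_adj2[OF dP] flip: matrix_mul_assoc)
    finally show "trace (cocycle h A' l x) = 0" using base[OF y] by simp
  qed
  have bdd: "norm (cocycle h A' (n * (l + l)) x) \<le> 2" if j: "j < l" and x: "x \<in> B j" for j x n
  proof -
    have "cocycle h A' (n * (l + l)) x \<in> {mat 1, - mat 1}"
    proof (induction n)
      case (Suc n)
      have "(h ^^ (l + l)) x = x" using hl[OF j x] by (simp add: funpow_add)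
      moreover have "cocycle h A' (l + l) x = - mat 1"
        using sq[OF j x] hl[OF j x] by (simp add: cocycle_add)
      moreover have "Suc n * (l + l) = n * (l + l) + (l + l)" by simp
      ultimately have "cocycle h A' (Suc n * (l + l)) x = cocycle h A' (n * (l + l)) x ** (- mat 1)"
        by (simp only: cocycle_add)
      then show ?case using Suc by (auto simp: matrix_eq_2 matrix_mult_2)
    qed simp
    then show ?thesis using norm_mat_1_le by auto
  qed
  have "small_growth L \<epsilon> h A'"
  proof -
    \<comment> \<open>At multiples of two periods the norm is at most 2 on the tower;
      \<open>\<epsilon> * k > 2\<close> gives \<open>exp (\<epsilon> * k) > 3\<close>, which leaves
      the margin 1.\<close>
    obtain n :: nat where n: "2 / (\<epsilon> * (l + l)) < n" using reals_Archimedean2 by blast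
    define k where "k = n * (l + l)"
    have ek: "2 < \<epsilon> * k"
    proof -
      have "0 < \<epsilon> * (l + l)" using \<epsilon> l(1) by simp
      then show ?thesis using n by (simp add: k_def pos_divide_less_eq mult_ac)
    qed
    have "k > 0" using ek by (cases "k = 0") auto
    have "exp (\<epsilon> * k) > 3" using exp_ge_add_one_self[of "\<epsilon> * k"] ek by linarith
    then have sub: "{x \<in> space L. norm (cocycle h A' k x) > exp (\<epsilon> * real k) - 1} \<subseteq> space L - (\<Union>j<N + c. B j)"
      using bdd[of _ _ n] unfolding k_def l_def by fastforce
    have s: "space L - (\<Union>j<N + c. B j) \<in> sets L" using B(1) by (intro sets.Diff sets.finite_UN) auto
    have "measure L {x \<in> space L. norm (cocycle h A' k x) > exp (\<epsilon> * real k) - 1} < \<epsilon>"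
      using finite_measure_mono[OF sub s] rest \<eta>' by linarith
    then show ?thesis unfolding small_growth_def using \<open>k > 0\<close> by (intro exI[of _ k] conjI exI[of _ 1]) auto
  qed
  moreover have "\<forall>K\<in>\<K>. measure L (sym_diff (h ` K) (f ` K)) < \<eta>" using close \<eta>' by fastforce
  ultimately show ?thesis using h A'B A'c by blast
qed

section \<open>Density in the separate topology\<close>

abbreviation aut_class :: "'a measure \<Rightarrow> ('a \<Rightarrow> 'a) \<Rightarrow> ('a \<Rightarrow> 'a) set" where
  "aut_class L f \<equiv> ae_equal L (automorphisms L) `` {f}"

abbreviation cocycle_class :: "'a measure \<Rightarrow> ('a \<Rightarrow> real ^ 2 ^ 2) \<Rightarrow> ('a \<Rightarrow> real ^ 2 ^ 2) set" where
  "cocycle_class L A \<equiv> ae_equal L (bounded_SL2 L) `` {A}"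

lemma Aut_class:
  assumes "F \<in> Aut L" "f \<in> F"
  shows "f \<in> automorphisms L" "F = aut_class L f"
proof -
  obtain g where g: "g \<in> automorphisms L" "F = aut_class L g" using assms(1) by (auto simp: Aut_def elim: quotientE)
  have gf: "(g, f) \<in> ae_equal L (automorphisms L)" using assms g by auto
  then show "f \<in> automorphisms L" by (auto simp: ae_equal_def)
  show "F = aut_class L f" unfolding g(2) by (rule equiv_class_eq[OF equiv_ae_equal gf])
qed

lemma aut_class_in:
  assumes "f \<in> automorphisms L" shows "aut_class L f \<in> Aut L" "f \<in> aut_class L f"
  unfolding Aut_def using assms equiv_class_self[OF equiv_ae_equal] by (blast intro: quotientI)+

lemma Linf_class:
  assumes "\<A> \<in> Linf_SL2 L" "A \<in> \<A>"
  shows "A \<in> bounded_SL2 L" "\<A> = cocycle_class L A"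
proof -
  obtain g where g: "g \<in> bounded_SL2 L" "\<A> = cocycle_class L g" using assms(1) by (auto simp: Linf_SL2_def elim: quotientE)
  have gf: "(g, A) \<in> ae_equal L (bounded_SL2 L)" using assms g by auto
  then show "A \<in> bounded_SL2 L" by (auto simp: ae_equal_def)
  show "\<A> = cocycle_class L A" unfolding g(2) by (rule equiv_class_eq[OF equiv_ae_equal gf])
qed

lemma cocycle_class_in:
  assumes "A \<in> bounded_SL2 L" shows "cocycle_class L A \<in> Linf_SL2 L" "A \<in> cocycle_class L A"
  unfolding Linf_SL2_def using assms equiv_class_self[OF equiv_ae_equal] by (blast intro: quotientI)+

lemma Aut_nonempty: "F \<in> Aut L \<Longrightarrow> \<exists>f. f \<in> F"
  using aut_class_in(2) by (auto simp: Aut_def elim!: quotientE)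

lemma Linf_nonempty: "\<A> \<in> Linf_SL2 L \<Longrightarrow> \<exists>A. A \<in> \<A>"
  using cocycle_class_in(2) by (auto simp: Linf_SL2_def elim!: quotientE)

lemma Linf_dist_cocycle_class:
  assumes "\<A> \<in> Linf_SL2 L" "A \<in> \<A>" "B \<in> bounded_SL2 L"
  shows "Linf_dist L \<A> (cocycle_class L B) = cocycle_dist L A B"
  using Linf_dist_class[OF assms(1) _ assms(2)] cocycle_class_in[OF assms(3)] by blast

lemma topspace_Linf: "topspace (Linf_topology L) = Linf_SL2 L"
  unfolding Linf_topology_def by (rule Metric_space.topspace_mtopology[OF Metric_space_Linf])

lemma openin_Linf:
  "openin (Linf_topology L) U \<longleftrightarrow> U \<subseteq> Linf_SL2 L \<and>
    (\<forall>\<A>\<in>U. \<exists>r>0. \<forall>\<B>\<in>Linf_SL2 L. Linf_dist L \<A> \<B> < r \<longrightarrow> \<B> \<in> U)"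
proof -
  interpret Metric_space "Linf_SL2 L" "Linf_dist L" by (rule Metric_space_Linf)
  have "mball \<A> r \<subseteq> U \<longleftrightarrow> (\<forall>\<B>\<in>Linf_SL2 L. Linf_dist L \<A> \<B> < r \<longrightarrow> \<B> \<in> U)" if "\<A> \<in> Linf_SL2 L" for \<A> r
    using that by (auto simp: mball_def)
  then have "(\<exists>r>0. mball \<A> r \<subseteq> U) \<longleftrightarrow> (\<exists>r>0. \<forall>\<B>\<in>Linf_SL2 L. Linf_dist L \<A> \<B> < r \<longrightarrow> \<B> \<in> U)"
    if "\<A> \<in> Linf_SL2 L" for \<A>
    using that by simp
  then show ?thesis
    unfolding Linf_topology_def openin_mtopology by (simp add: subset_iff Ball_def cong: conj_cong)
qed

text \<open>Off one null set the representatives converge uniformly, and the limit keeps determinant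
  1. Completeness makes Baire's theorem available in the space of cocycles.\<close>

lemma mcomplete_Linf: "Metric_space.mcomplete (Linf_SL2 L) (Linf_dist L)"
proof -
  interpret Metric_space "Linf_SL2 L" "Linf_dist L" by (rule Metric_space_Linf)
  show ?thesis unfolding mcomplete_def
  proof (intro allI impI)
    fix \<sigma> assume C: "MCauchy \<sigma>"
    then have \<sigma>: "\<sigma> n \<in> Linf_SL2 L" for n by (auto simp: MCauchy_def)
    then have "\<forall>n. \<exists>a. a \<in> \<sigma> n" using Linf_nonempty by blast
    then obtain A where A: "\<And>n. A n \<in> \<sigma> n" by metis
    have Ab: "A n \<in> bounded_SL2 L" for n using Linf_class(1)[OF \<sigma> A] .
    have d: "Linf_dist L (\<sigma> n) (\<sigma> m) = cocycle_dist L (A n) (A m)" for n m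
      by (rule Linf_dist_class[OF \<sigma> \<sigma> A A])
    have "AE x in L. \<forall>n m. norm (A n x - A m x) \<le> 2 * cocycle_dist L (A n) (A m)"
      unfolding AE_all_countable by (intro allI cocycle_dist_AE Ab)
    then obtain N where N: "N \<in> sets L" "emeasure L N = 0"
      "\<And>x n m. x \<in> space L \<Longrightarrow> x \<notin> N \<Longrightarrow> norm (A n x - A m x) \<le> 2 * Linf_dist L (\<sigma> n) (\<sigma> m)"
      unfolding d by (blast elim!: AE_E)
    \<comment> \<open>On the null set the value is constant in \<open>n\<close>, so that the limit
      exists and has determinant 1 at every point of the space, as \<open>bounded_SL2\<close>
      demands.\<close>
    define A' where "A' = (\<lambda>n x. if x \<in> N then mat 1 else A n x)"
    define B where "B = (\<lambda>x. lim (\<lambda>n. A' n x))"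
    have conv: "(\<lambda>n. A' n x) \<longlonglongrightarrow> B x" if x: "x \<in> space L" for x
    proof -
      have "Cauchy (\<lambda>n. A' n x)"
      proof (rule CauchyI)
        fix e :: real assume e: "0 < e"
        then obtain n0 where n0: "\<And>n m. n0 \<le> n \<Longrightarrow> n0 \<le> m \<Longrightarrow> Linf_dist L (\<sigma> n) (\<sigma> m) < e / 2"
          using C unfolding MCauchy_def by (meson half_gt_zero)
        have "norm (A' m x - A' n x) < e" if "n0 \<le> m" "n0 \<le> n" for m n
          using N(3)[OF x, of m n] n0[OF that] e by (auto simp: A'_def)
        then show "\<exists>M. \<forall>m\<ge>M. \<forall>n\<ge>M. norm (A' m x - A' n x) < e" by blast
      qed
      then show ?thesis unfolding B_def by (simp add: Cauchy_convergent_iff convergent_LIMSEQ_iff)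
    qed
    have Am: "A n \<in> borel_measurable L" "\<And>x. x \<in> space L \<Longrightarrow> det (A n x) = 1" for n
      using Ab by (auto simp: bounded_SL2_def)
    have A'm: "A' n \<in> borel_measurable L" for n unfolding A'_def using Am(1)[of n] N(1) by measurable
    have Bm: "B \<in> borel_measurable L" by (rule borel_measurable_LIMSEQ_metric[OF A'm conv])
    have Bdet: "det (B x) = 1" if x: "x \<in> space L" for x
    proof -
      have "(\<lambda>n. det (A' n x)) \<longlonglongrightarrow> det (B x)"
        unfolding det_2 by (intro tendsto_intros tendsto_vec_nth conv[OF x])
      moreover have "det (A' n x) = 1" for n using Am(2)[OF x] by (simp add: A'_def)
      ultimately show ?thesis by (simp add: LIMSEQ_const_iff)
    qed
    have near: "\<exists>n0. \<forall>n\<ge>n0. AE x in L. norm (A n x - B x) \<le> e" if e: "e > 0" for e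
    proof -
      obtain n0 where n0: "\<And>n m. n0 \<le> n \<Longrightarrow> n0 \<le> m \<Longrightarrow> Linf_dist L (\<sigma> n) (\<sigma> m) < e / 2"
        using C e unfolding MCauchy_def by (meson half_gt_zero)
      have "AE x in L. norm (A n x - B x) \<le> e" if n: "n \<ge> n0" for n
      proof -
        have "AE x in L. x \<notin> N" using N by (intro AE_not_in) auto
        then show ?thesis using AE_space
        proof eventually_elim
          case (elim x)
          have "(\<lambda>m. norm (A n x - A' m x)) \<longlonglongrightarrow> norm (A n x - B x)" using conv elim by (intro tendsto_intros) auto
          moreover have "\<forall>m\<ge>n0. norm (A n x - A' m x) \<le> e"
          proof (intro allI impI)
            fix m assume m: "n0 \<le> m"
            have "norm (A n x - A m x) \<le> 2 * Linf_dist L (\<sigma> n) (\<sigma> m)" by (rule N(3)) (use elim in auto)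
            then show "norm (A n x - A' m x) \<le> e" using n0[OF n m] elim by (simp add: A'_def)
          qed
          ultimately show ?case by (rule Lim_bounded)
        qed
      qed
      then show ?thesis by blast
    qed
    have Bb: "B \<in> bounded_SL2 L"
    proof -
      obtain n where n: "AE x in L. norm (A n x - B x) \<le> 1" using near[of 1] by auto
      obtain K where K: "AE x in L. norm (A n x) \<le> K" using bounded_SL2_norm[OF Ab] by metis
      have "AE x in L. opnorm (B x) \<le> K + 1"
        using n K
      proof eventually_elim
        case (elim x)
        then show ?case using opnorm_le_norm[of "B x"] norm_triangle_ineq4[of "A n x" "A n x - B x"] by simp
      qed
      then show ?thesis using Bm Bdet by (auto simp: bounded_SL2_def)
    qed
    have "limitin mtopology \<sigma> (cocycle_class L B) sequentially"
      unfolding limitin_metric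
    proof (intro conjI allI impI)
      show "cocycle_class L B \<in> Linf_SL2 L" by (rule cocycle_class_in[OF Bb])
      fix e :: real assume e: "0 < e"
      obtain n0 where n0: "\<And>n. n \<ge> n0 \<Longrightarrow> AE x in L. norm (A n x - B x) \<le> e / 4" using near[of "e / 4"] e by auto
      have "\<sigma> n \<in> Linf_SL2 L \<and> Linf_dist L (\<sigma> n) (cocycle_class L B) < e" if "n \<ge> n0" for n
      proof -
        have "cocycle_dist L (A n) B \<le> 2 * (e / 4)" by (rule cocycle_dist_le[OF Ab Bb _ n0[OF that]]) (use e in simp)
        then show ?thesis using Linf_dist_cocycle_class[OF \<sigma> A Bb, of n] \<sigma> e by simp
      qed
      then show "\<forall>\<^sub>F n in sequentially. \<sigma> n \<in> Linf_SL2 L \<and> Linf_dist L (\<sigma> n) (cocycle_class L B) < e"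
        unfolding eventually_sequentially by blast
    qed
    then show "\<exists>x. limitin mtopology \<sigma> x sequentially" by blast
  qed
qed

lemma measure_aut_class_image:
  assumes "F \<in> Aut L" "f \<in> F" "h \<in> F" "K \<in> sets L"
  shows "measure L (sym_diff (h ` K) (f ` K)) = 0"
proof -
  have "(f, h) \<in> ae_equal L (automorphisms L)" using Aut_class[OF assms(1,2)] assms(3) by auto
  then show ?thesis using ae_equal_image[of f h L K] assms(4) by (simp add: measure_def Un_commute)
qed

definition good_pairs :: "'a measure \<Rightarrow> real \<Rightarrow> (('a \<Rightarrow> 'a) set \<times> ('a \<Rightarrow> real ^ 2 ^ 2) set) set" where
  "good_pairs L \<epsilon> = {(F, \<A>). F \<in> Aut L \<and> \<A> \<in> Linf_SL2 L \<and>
     (\<forall>f\<in>F. \<forall>A\<in>\<A>. robustly_hyperbolic L A \<or> small_growth L \<epsilon> f A)}"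

text \<open>Two representatives of a class are at distance 0, so the stability of both alternatives
  under small perturbations already makes them independent of the representative.\<close>

lemma good_pairs_iff:
  assumes fin: "finite_measure L" and F: "F \<in> Aut L" "f \<in> F" and \<A>: "\<A> \<in> Linf_SL2 L" "A \<in> \<A>"
  shows "(F, \<A>) \<in> good_pairs L \<epsilon> \<longleftrightarrow> robustly_hyperbolic L A \<or> small_growth L \<epsilon> f A"
proof
  assume "(F, \<A>) \<in> good_pairs L \<epsilon>"
  then show "robustly_hyperbolic L A \<or> small_growth L \<epsilon> f A" using assms by (auto simp: good_pairs_def)
next
  assume *: "robustly_hyperbolic L A \<or> small_growth L \<epsilon> f A"
  note f = Aut_class[OF F] and A = Linf_class[OF \<A>]
  have "robustly_hyperbolic L A' \<or> small_growth L \<epsilon> f' A'" if f': "f' \<in> F" and A': "A' \<in> \<A>" for f' A'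
  proof -
    have AA': "(A, A') \<in> ae_equal L (bounded_SL2 L)" using A A' by auto
    have A'b: "A' \<in> bounded_SL2 L" by (rule Linf_class[OF \<A>(1) A'])
    have f'a: "f' \<in> automorphisms L" by (rule Aut_class[OF F(1) f'])
    have d0: "cocycle_dist L A A' = 0"
      using cocycle_dist_props(3)[OF A(1) A'b] AA' by (simp add: ae_equal_def)
    from * show ?thesis
    proof
      assume "robustly_hyperbolic L A"
      then obtain d where "d > 0" "\<And>B. B \<in> bounded_SL2 L \<Longrightarrow> cocycle_dist L A B < d \<Longrightarrow> robustly_hyperbolic L B"
        using robustly_hyperbolic_open[OF A(1)] by blast
      then show ?thesis using A'b d0 by auto
    next
      assume sg: "small_growth L \<epsilon> f A"
      obtain \<K> d where K: "\<K> \<subseteq> sets L" "d > 0"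
        "\<And>h. h \<in> automorphisms L \<Longrightarrow> (\<And>K. K \<in> \<K> \<Longrightarrow> measure L (sym_diff (h ` K) (f ` K)) < d) \<Longrightarrow> small_growth L \<epsilon> h A"
        using small_growth_open_automorphism[OF fin f(1) A(1) sg] by metis
      have "measure L (sym_diff (f' ` K) (f ` K)) = 0" if "K \<in> \<K>" for K
        using measure_aut_class_image[OF F f'] K(1) that by blast
      then have sg': "small_growth L \<epsilon> f' A" using K(2) by (intro K(3) f'a) auto
      obtain d where "d > 0" "\<And>B. B \<in> bounded_SL2 L \<Longrightarrow> cocycle_dist L A B < d \<Longrightarrow> small_growth L \<epsilon> f' B"
        using small_growth_open_cocycle[OF fin f'a A(1) sg'] by metis
      then show ?thesis using A'b d0 by auto
    qed
  qed
  then show "(F, \<A>) \<in> good_pairs L \<epsilon>" using F \<A> by (auto simp: good_pairs_def)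
qed

lemma openin_weak_basic:
  assumes "g \<in> automorphisms L" "K \<in> sets L" "e > 0"
  shows "openin (weak_topology L) {F \<in> Aut L. \<forall>f\<in>F. measure L (sym_diff (f ` K) (g ` K)) < e}"
  unfolding weak_topology_def by (rule topology_generated_by_Basis) (use assms in blast)

lemma openin_weak_Aut: "openin (weak_topology L) (Aut L)"
  using openin_topspace[of "weak_topology L"] by (simp add: topspace_weak_topology)

text \<open>With one variable fixed: a robustly hyperbolic cocycle is good over every automorphism,
  and robust hyperbolicity is open in the cocycle; in the other case small growth is stable in the
  free variable.\<close>

lemma openin_good_pairs:
  assumes fin: "finite_measure L"
  shows "openin (separate_topology (weak_topology L) (Linf_topology L)) (good_pairs L \<epsilon>)"
  unfolding openin_separate_topology topspace_weak_topology topspace_Linf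
proof (intro conjI)
  show "good_pairs L \<epsilon> \<subseteq> Aut L \<times> Linf_SL2 L" by (auto simp: good_pairs_def)
  have 1: "openin (weak_topology L) {F'. (F', \<A>) \<in> good_pairs L \<epsilon>}" for \<A>
  proof (subst openin_subopen, intro ballI)
    fix F assume "F \<in> {F'. (F', \<A>) \<in> good_pairs L \<epsilon>}"
    then have g: "(F, \<A>) \<in> good_pairs L \<epsilon>" by simp
    then have F: "F \<in> Aut L" and \<A>: "\<A> \<in> Linf_SL2 L" by (auto simp: good_pairs_def)
    obtain f A where f: "f \<in> F" and A: "A \<in> \<A>" using Aut_nonempty[OF F] Linf_nonempty[OF \<A>] by blast
    note fa = Aut_class(1)[OF F f] and Ab = Linf_class(1)[OF \<A> A]
    from g have "robustly_hyperbolic L A \<or> small_growth L \<epsilon> f A" using good_pairs_iff[OF fin F f \<A> A] by blast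
    then show "\<exists>T. openin (weak_topology L) T \<and> F \<in> T \<and> T \<subseteq> {F'. (F', \<A>) \<in> good_pairs L \<epsilon>}"
    proof
      assume r: "robustly_hyperbolic L A"
      have "(F', \<A>) \<in> good_pairs L \<epsilon>" if "F' \<in> Aut L" for F'
        using good_pairs_iff[OF fin that _ \<A> A] r Aut_nonempty[OF that] by blast
      then show ?thesis using F openin_weak_Aut by blast
    next
      assume sg: "small_growth L \<epsilon> f A"
      obtain \<K> d where K: "finite \<K>" "\<K> \<subseteq> sets L" "d > 0"
        "\<And>h. h \<in> automorphisms L \<Longrightarrow> (\<And>K. K \<in> \<K> \<Longrightarrow> measure L (sym_diff (h ` K) (f ` K)) < d) \<Longrightarrow> small_growth L \<epsilon> h A"
        using small_growth_open_automorphism[OF fin fa Ab sg] by metis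
      define T where "T = (\<Inter>K\<in>\<K>. {F \<in> Aut L. \<forall>h\<in>F. measure L (sym_diff (h ` K) (f ` K)) < d}) \<inter> topspace (weak_topology L)"
      have To: "openin (weak_topology L) T"
        unfolding T_def using K(1-3) fa by (intro openin_INT openin_weak_basic) auto
      have FT: "F \<in> T"
        unfolding T_def topspace_weak_topology using F K(2,3) measure_aut_class_image[OF F f] by auto
      have "T \<subseteq> {F'. (F', \<A>) \<in> good_pairs L \<epsilon>}"
      proof
        fix F' assume F': "F' \<in> T"
        then have F'A: "F' \<in> Aut L" by (auto simp: T_def topspace_weak_topology)
        obtain h where h: "h \<in> F'" using Aut_nonempty[OF F'A] by blast
        have "small_growth L \<epsilon> h A"
          using F' h by (intro K(4) Aut_class(1)[OF F'A h]) (auto simp: T_def)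
        then show "F' \<in> {F'. (F', \<A>) \<in> good_pairs L \<epsilon>}" using good_pairs_iff[OF fin F'A h \<A> A] by simp
      qed
      with To FT show ?thesis by blast
    qed
  qed
  have 2: "openin (Linf_topology L) {\<A>'. (F, \<A>') \<in> good_pairs L \<epsilon>}" for F
    unfolding openin_Linf
  proof (intro conjI ballI)
    show "{\<A>'. (F, \<A>') \<in> good_pairs L \<epsilon>} \<subseteq> Linf_SL2 L" by (auto simp: good_pairs_def)
    fix \<A> assume "\<A> \<in> {\<A>'. (F, \<A>') \<in> good_pairs L \<epsilon>}"
    then have g: "(F, \<A>) \<in> good_pairs L \<epsilon>" by simp
    then have F: "F \<in> Aut L" and \<A>: "\<A> \<in> Linf_SL2 L" by (auto simp: good_pairs_def)
    obtain f A where f: "f \<in> F" and A: "A \<in> \<A>" using Aut_nonempty[OF F] Linf_nonempty[OF \<A>] by blast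
    note fa = Aut_class(1)[OF F f] and Ab = Linf_class(1)[OF \<A> A]
    have "\<exists>d>0. \<forall>B\<in>bounded_SL2 L. cocycle_dist L A B < d \<longrightarrow> robustly_hyperbolic L B \<or> small_growth L \<epsilon> f B"
    proof (cases "robustly_hyperbolic L A")
      case True
      show ?thesis by (rule robustly_hyperbolic_open[OF Ab True]) blast
    next
      case False
      then have sg: "small_growth L \<epsilon> f A" using g good_pairs_iff[OF fin F f \<A> A] by blast
      show ?thesis by (rule small_growth_open_cocycle[OF fin fa Ab sg]) blast
    qed
    then obtain d where d: "d > 0" "\<And>B. B \<in> bounded_SL2 L \<Longrightarrow> cocycle_dist L A B < d \<Longrightarrow> robustly_hyperbolic L B \<or> small_growth L \<epsilon> f B" by blast
    have "\<B> \<in> {\<A>'. (F, \<A>') \<in> good_pairs L \<epsilon>}" if \<B>: "\<B> \<in> Linf_SL2 L" "Linf_dist L \<A> \<B> < d" for \<B>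
    proof -
      obtain B where B: "B \<in> \<B>" using Linf_nonempty[OF \<B>(1)] by blast
      have "cocycle_dist L A B < d" using Linf_dist_class[OF \<A> \<B>(1) A B] \<B>(2) by simp
      then have "robustly_hyperbolic L B \<or> small_growth L \<epsilon> f B" by (intro d(2) Linf_class(1)[OF \<B>(1) B])
      then show ?thesis using good_pairs_iff[OF fin F f \<B>(1) B] by simp
    qed
    then show "\<exists>r>0. \<forall>\<B>\<in>Linf_SL2 L. Linf_dist L \<A> \<B> < r \<longrightarrow> \<B> \<in> {\<A>'. (F, \<A>') \<in> good_pairs L \<epsilon>}" using d(1) by blast
  qed
  show "\<forall>(x, y)\<in>good_pairs L \<epsilon>. openin (weak_topology L) {x'. (x', y) \<in> good_pairs L \<epsilon>} \<and>
      openin (Linf_topology L) {y'. (x, y') \<in> good_pairs L \<epsilon>}" using 1 2 by blast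
qed

context standard_space
begin

text \<open>Finite unions of members of a countable base suffice: by regularity a measurable set
  lies between a compact and an open set of almost equal measure, and finitely many members inside
  the open set cover the compact one.\<close>

lemma countable_dense_sets:
  obtains C :: "nat \<Rightarrow> 'a set" where "\<And>i. C i \<in> sets L" "\<And>S e. S \<in> sets L \<Longrightarrow> e > 0 \<Longrightarrow> \<exists>i. measure L (sym_diff S (C i)) < e"
proof -
  obtain \<B> where \<B>: "countable \<B>" "\<And>V. V \<in> \<B> \<Longrightarrow> openin M V"
    "\<And>U x. openin M U \<Longrightarrow> x \<in> U \<Longrightarrow> \<exists>V\<in>\<B>. x \<in> V \<and> V \<subseteq> U"
    using second_countable_M unfolding second_countable_def by metis
  define \<F> where "\<F> = Union ` {\<X>. finite \<X> \<and> \<X> \<subseteq> \<B>}"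
  have cF: "countable \<F>" unfolding \<F>_def using \<B>(1) by (intro countable_image countable_Collect_finite_subset)
  have ne: "\<F> \<noteq> {}" unfolding \<F>_def by (auto intro!: exI[of _ "{}"])
  have FS: "X \<in> sets L" if "X \<in> \<F>" for X
    using that \<B>(2) open_sets unfolding \<F>_def by (auto intro!: openin_Union)
  define C where "C = from_nat_into \<F>"
  have Cr: "range C = \<F>" unfolding C_def by (rule range_from_nat_into[OF ne cF])
  have "\<exists>i. measure L (sym_diff S (C i)) < e" if S: "S \<in> sets L" and e: "e > 0" for S e
  proof -
    have "e / 2 > 0" using e by simp
    then obtain K U where KU: "closedin M K" "openin M U" "K \<subseteq> S" "S \<subseteq> U" "measure L (U - K) < e / 2"
      using regular[OF S, of "e / 2"] by auto
    define \<X> where "\<X> = {V \<in> \<B>. V \<subseteq> U}"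
    have "K \<subseteq> \<Union>\<X>" using \<B>(3)[OF KU(2)] KU(3,4) unfolding \<X>_def by blast
    moreover have "compactin M K" using closedin_compact_space[OF compact_M KU(1)] .
    moreover have "\<forall>V\<in>\<X>. openin M V" using \<B>(2) by (auto simp: \<X>_def)
    ultimately obtain \<Y> where Y: "finite \<Y>" "\<Y> \<subseteq> \<X>" "K \<subseteq> \<Union>\<Y>" unfolding compactin_def by metis
    have "\<Union>\<Y> \<in> \<F>" unfolding \<F>_def using Y(1,2) by (intro imageI) (auto simp: \<X>_def)
    then obtain i where i: "C i = \<Union>\<Y>" using Cr by (metis rangeE)
    have "\<Union>\<Y> \<subseteq> U" using Y(2) by (auto simp: \<X>_def)
    then have "sym_diff S (C i) \<subseteq> U - K" unfolding i using KU(3,4) Y(3) by blast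
    then have "measure L (sym_diff S (C i)) \<le> measure L (U - K)"
      using KU closed_sets open_sets by (intro finite_measure_mono) auto
    then show ?thesis using KU(5) e by (intro exI[of _ i]) linarith
  qed
  moreover have "C i \<in> sets L" for i using FS Cr by blast
  ultimately show ?thesis using that by blast
qed

text \<open>One index bounds both the number of test sets and the tolerance, so that the
  neighbourhoods decrease with \<open>k\<close> and are countable in number, as Baire's theorem
  requires.\<close>

definition weak_nbhd :: "(nat \<Rightarrow> 'a set) \<Rightarrow> ('a \<Rightarrow> 'a) \<Rightarrow> nat \<Rightarrow> ('a \<Rightarrow> 'a) set set" where
  "weak_nbhd C f k = {F \<in> Aut L. \<forall>h\<in>F. \<forall>i<k. measure L (sym_diff (h ` C i) (f ` C i)) < 1 / real (Suc k)}"

lemma weak_nbhd_antimono: "k \<le> l \<Longrightarrow> weak_nbhd C f l \<subseteq> weak_nbhd C f k"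
proof
  fix F assume kl: "k \<le> l" and F: "F \<in> weak_nbhd C f l"
  have "1 / real (Suc l) \<le> 1 / real (Suc k)" using kl by (intro divide_left_mono) auto
  then show "F \<in> weak_nbhd C f k" using F kl unfolding weak_nbhd_def by (auto intro: less_le_trans)
qed

lemma measure_image_sym_diff:
  assumes "f \<in> automorphisms L" "K \<in> sets L" "K' \<in> sets L"
  shows "measure L (sym_diff (f ` K) (f ` K')) = measure L (sym_diff K K')"
proof -
  have inj: "inj_on f (space L)" using assms(1) by (simp add: automorphisms_def bij_betw_def)
  have "sym_diff (f ` K) (f ` K') = f ` sym_diff K K'"
    using inj_on_image_set_diff[OF inj, of K K'] inj_on_image_set_diff[OF inj, of K' K]
      sets.sets_into_space[OF assms(2)] sets.sets_into_space[OF assms(3)] by (auto simp: image_Un)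
  then show ?thesis using automorphism_image_sets(2)[OF assms(1), of "sym_diff K K'"] assms by (simp add: measure_def)
qed

text \<open>A test set \<open>K\<close> may be replaced by a close \<open>C i\<close>: automorphisms
  preserve the measure, so the images of the two differ by as little as the sets themselves. Three
  errors, each below a quarter of the gap, are allowed for.\<close>

lemma weak_nbhd_subset_open:
  assumes C: "\<And>i. C i \<in> sets L" "\<And>S e. S \<in> sets L \<Longrightarrow> e > 0 \<Longrightarrow> \<exists>i. measure L (sym_diff S (C i)) < e"
    and W: "openin (weak_topology L) W" "F \<in> W" "f \<in> F"
  shows "\<exists>k. weak_nbhd C f k \<subseteq> W"
proof -
  have FA: "F \<in> Aut L" using openin_subset[OF W(1)] W(2) by (auto simp: topspace_weak_topology)
  have f: "f \<in> automorphisms L" by (rule Aut_class(1)[OF FA W(3)])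
  have "generate_topology_on {{F \<in> Aut L. \<forall>f\<in>F. measure L (sym_diff (f ` K) (g ` K)) < e} |g K e.
       g \<in> automorphisms L \<and> K \<in> sets L \<and> e > 0} W"
    using W(1) by (simp add: weak_topology_def openin_topology_generated_by_iff)
  then show ?thesis using W(2)
  proof (induction rule: generate_topology_on.induct)
    case Empty then show ?case by simp
  next
    case (Int a b)
    then obtain k l where "weak_nbhd C f k \<subseteq> a" "weak_nbhd C f l \<subseteq> b" by blast
    then have "weak_nbhd C f (max k l) \<subseteq> a \<inter> b"
      using weak_nbhd_antimono[of k "max k l" C f] weak_nbhd_antimono[of l "max k l" C f] by auto
    then show ?case by blast
  next
    case (UN \<K>)
    then obtain a where "a \<in> \<K>" "F \<in> a" by blast
    then obtain k where "weak_nbhd C f k \<subseteq> a" using UN.IH by blast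
    then show ?case using \<open>a \<in> \<K>\<close> by blast
  next
    case (Basis s)
    then obtain g K e where g: "g \<in> automorphisms L" and K: "K \<in> sets L" and e: "e > 0"
      and s: "s = {F \<in> Aut L. \<forall>f\<in>F. measure L (sym_diff (f ` K) (g ` K)) < e}" by blast
    define gap where "gap = e - measure L (sym_diff (f ` K) (g ` K))"
    have gap: "gap > 0" using Basis.prems W(3) unfolding s gap_def by auto
    obtain i where i: "measure L (sym_diff K (C i)) < gap / 4" using C(2)[OF K, of "gap / 4"] gap by auto
    obtain k0 :: nat where k0: "4 / gap < k0" using reals_Archimedean2 by blast
    define k where "k = max (Suc i) k0"
    have ik: "i < k" by (simp add: k_def)
    have k: "1 / real (Suc k) < gap / 4"
    proof -
      have "4 / gap < real (Suc k)" using k0 by (simp add: k_def)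
      then show ?thesis using gap by (simp add: field_simps)
    qed
    have "F' \<in> s" if F': "F' \<in> weak_nbhd C f k" for F'
      unfolding s
    proof (intro CollectI conjI ballI)
      show FA': "F' \<in> Aut L" using F' by (simp add: weak_nbhd_def)
      fix h assume h: "h \<in> F'"
      have ha: "h \<in> automorphisms L" by (rule Aut_class(1)[OF FA' h])
      note im = automorphism_image_sets(1)
      note tri = measure_sym_diff_triangle[OF finite_measure_axioms]
      have 1: "measure L (sym_diff (h ` K) (h ` C i)) < gap / 4" using measure_image_sym_diff[OF ha K C(1)] i by simp
      have 2: "measure L (sym_diff (h ` C i) (f ` C i)) < gap / 4" using F' h ik k unfolding weak_nbhd_def by fastforce
      have 3: "measure L (sym_diff (f ` C i) (f ` K)) < gap / 4"
        using measure_image_sym_diff[OF f C(1) K] i by (simp add: Un_commute)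
      have "measure L (sym_diff (h ` K) (g ` K)) \<le> measure L (sym_diff (h ` K) (h ` C i)) + measure L (sym_diff (h ` C i) (g ` K))"
        by (intro tri im ha g K C)
      also have "measure L (sym_diff (h ` C i) (g ` K)) \<le> measure L (sym_diff (h ` C i) (f ` C i)) + measure L (sym_diff (f ` C i) (g ` K))"
        by (intro tri im ha f g K C)
      also have "measure L (sym_diff (f ` C i) (g ` K)) \<le> measure L (sym_diff (f ` C i) (f ` K)) + measure L (sym_diff (f ` K) (g ` K))"
        by (intro tri im ha f g K C)
      finally show "measure L (sym_diff (h ` K) (g ` K)) < e" using 1 2 3 gap by (simp add: gap_def)
    qed
    then show ?case by blast
  qed
qed

text \<open>The weak topology is first countable and \<open>L\<^sup>\<infinity>\<close> is a Baire space, so by Baire's theorem a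
  separately open set \<open>U\<close> contains a dense subset of \<open>{F'} \<times> W\<close>, for all \<open>F'\<close> in a neighbourhood of
  some \<open>F\<close> and a fixed open \<open>W\<close>. Hence perturbations of the automorphism and then of the cocycle by
  amounts fixed in advance do not leave \<open>U\<close>.\<close>

lemma dense_good_pairs:
  assumes \<epsilon>: "\<epsilon> > 0"
  shows "separate_topology (weak_topology L) (Linf_topology L) closure_of (good_pairs L \<epsilon>) = Aut L \<times> Linf_SL2 L"
proof -
  note fin = finite_measure_axioms
  let ?X = "separate_topology (weak_topology L) (Linf_topology L)"
  have top: "topspace ?X = Aut L \<times> Linf_SL2 L"
    by (simp add: topspace_separate_topology topspace_weak_topology topspace_Linf)
  have "good_pairs L \<epsilon> \<inter> U \<noteq> {}" if U: "openin ?X U" "U \<noteq> {}" for U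
  proof -
    obtain F \<A> where FU: "(F, \<A>) \<in> U" using U(2) by auto
    have sub: "U \<subseteq> Aut L \<times> Linf_SL2 L" using openin_subset[OF U(1)] top by simp
    have secF: "openin (weak_topology L) {F'. (F', \<B>) \<in> U}" if "(F'', \<B>) \<in> U" for F'' \<B>
      using U(1) that unfolding openin_separate_topology by blast
    have secA: "openin (Linf_topology L) {\<B>. (F', \<B>) \<in> U}" if "(F', \<B>') \<in> U" for F' \<B>'
      using U(1) that unfolding openin_separate_topology by blast
    have F: "F \<in> Aut L" using FU sub by blast
    obtain f where f: "f \<in> F" using Aut_nonempty[OF F] by blast
    have fa: "f \<in> automorphisms L" by (rule Aut_class(1)[OF F f])
    obtain C :: "nat \<Rightarrow> 'a set" where C: "\<And>i. C i \<in> sets L" "\<And>S e. S \<in> sets L \<Longrightarrow> e > 0 \<Longrightarrow> \<exists>i. measure L (sym_diff S (C i)) < e"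
      by (rule countable_dense_sets) metis
    define V where "V = {\<B>. (F, \<B>) \<in> U}"
    have V: "openin (Linf_topology L) V" "\<A> \<in> V" unfolding V_def using secA[OF FU] FU by auto
    \<comment> \<open>The cocycles for which the whole \<open>k\<close>-th neighbourhood of
      \<open>f\<close> stays in \<open>U\<close>. These sets need not be open, but they exhaust
      \<open>V\<close>, so one of them is dense in a nonempty open set.\<close>
    define Vk where "Vk = (\<lambda>k. {\<B> \<in> V. \<forall>F'\<in>weak_nbhd C f k. (F', \<B>) \<in> U})"
    have VV: "V \<subseteq> (\<Union>k. Vk k)"
    proof
      fix \<B> assume \<B>: "\<B> \<in> V"
      then have FB: "(F, \<B>) \<in> U" by (simp add: V_def)
      obtain k where "weak_nbhd C f k \<subseteq> {F'. (F', \<B>) \<in> U}"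
        using weak_nbhd_subset_open[OF C secF[OF FB] _ f] FB by blast
      then show "\<B> \<in> (\<Union>k. Vk k)" using \<B> by (auto simp: Vk_def)
    qed
    let ?Y = "Linf_topology L"
    have Vksub: "Vk k \<subseteq> topspace ?Y" for k using openin_subset[OF V(1)] by (auto simp: Vk_def)
    have "\<exists>k. ?Y interior_of (?Y closure_of Vk k) \<noteq> {}"
    proof (rule ccontr)
      assume "\<not> ?thesis"
      then have e: "?Y interior_of (?Y closure_of Vk k) = {}" for k by blast
      have "completely_metrizable_space ?Y"
        unfolding Linf_topology_def
        by (rule Metric_space.completely_metrizable_space_mtopology[OF Metric_space_Linf mcomplete_Linf])
      then have "?Y interior_of (\<Union>(range (\<lambda>k. ?Y closure_of Vk k))) = {}"
        using e by (intro Baire_category_alt) auto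
      moreover have "V \<subseteq> \<Union>(range (\<lambda>k. ?Y closure_of Vk k))"
        using VV closure_of_subset[OF Vksub] by blast
      then have "V \<subseteq> ?Y interior_of (\<Union>(range (\<lambda>k. ?Y closure_of Vk k)))" using V(1) by (rule interior_of_maximal)
      ultimately show False using V(2) by blast
    qed
    then obtain k where k: "?Y interior_of (?Y closure_of Vk k) \<noteq> {}" by blast
    define W where "W = ?Y interior_of (?Y closure_of Vk k)"
    have W: "openin ?Y W" "W \<noteq> {}" "W \<subseteq> ?Y closure_of Vk k" using k by (auto simp: W_def interior_of_subset)
    have meets: "O' \<inter> Vk k \<noteq> {}" if O': "openin ?Y O'" "O' \<inter> W \<noteq> {}" for O'
    proof -
      obtain x where x: "x \<in> O'" "x \<in> W" using O'(2) by blast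
      then have "x \<in> ?Y closure_of Vk k" using W(3) by blast
      then show ?thesis unfolding in_closure_of using x(1) O'(1) by blast
    qed
    obtain \<A>0 where A0: "\<A>0 \<in> W" "\<A>0 \<in> Vk k" using meets[OF W(1)] W(2) by blast
    have A0L: "\<A>0 \<in> Linf_SL2 L" using Vksub A0(2) by (auto simp: topspace_Linf)
    obtain A where A: "A \<in> \<A>0" using Linf_nonempty[OF A0L] by blast
    have Ab: "A \<in> bounded_SL2 L" by (rule Linf_class(1)[OF A0L A])
    show ?thesis
    proof (cases "robustly_hyperbolic L A")
      case True
      then have "(F, \<A>0) \<in> good_pairs L \<epsilon>" using good_pairs_iff[OF fin F f A0L A] by blast
      moreover have "(F, \<A>0) \<in> U" using A0(2) by (simp add: Vk_def V_def)
      ultimately show ?thesis by blast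
    next
      case False
      obtain r where r: "r > 0" "\<And>\<B>. \<B> \<in> Linf_SL2 L \<Longrightarrow> Linf_dist L \<A>0 \<B> < r \<Longrightarrow> \<B> \<in> W"
        using W(1) A0(1) unfolding openin_Linf by blast
      \<comment> \<open>Both tolerances, \<open>1 / real (Suc k)\<close> for the automorphism and
        \<open>r\<close> for the cocycle, are fixed before \<open>h\<close> is known.\<close>
      have "\<exists>h A'. h \<in> automorphisms L \<and> A' \<in> bounded_SL2 L \<and>
        (\<forall>K\<in>C ` {..<k}. measure L (sym_diff (h ` K) (f ` K)) < 1 / real (Suc k)) \<and>
        (\<forall>x\<in>space L. norm (A x - A' x) \<le> r / 4) \<and> small_growth L \<epsilon> h A'"
        by (rule approximate_small_growth[OF fa Ab False]) (use C r \<epsilon> in auto)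
      then obtain h A' where h: "h \<in> automorphisms L" and A'b: "A' \<in> bounded_SL2 L"
        and hC: "\<And>i. i < k \<Longrightarrow> measure L (sym_diff (h ` C i) (f ` C i)) < 1 / real (Suc k)"
        and AA': "\<And>x. x \<in> space L \<Longrightarrow> norm (A x - A' x) \<le> r / 4" and sg: "small_growth L \<epsilon> h A'" by blast
      define F' where "F' = aut_class L h"
      define \<A>' where "\<A>' = cocycle_class L A'"
      have F': "F' \<in> Aut L" "h \<in> F'" unfolding F'_def using aut_class_in[OF h] by auto
      have \<A>': "\<A>' \<in> Linf_SL2 L" "A' \<in> \<A>'" unfolding \<A>'_def using cocycle_class_in[OF A'b] by auto
      have F'k: "F' \<in> weak_nbhd C f k"
        unfolding weak_nbhd_def
      proof (intro CollectI conjI ballI allI impI F'(1))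
        fix h' i assume h': "h' \<in> F'" and i: "i < k"
        have h'a: "h' \<in> automorphisms L" by (rule Aut_class(1)[OF F'(1) h'])
        note im = automorphism_image_sets(1)[OF _ C(1)]
        have "measure L (sym_diff (h' ` C i) (f ` C i)) \<le> measure L (sym_diff (h' ` C i) (h ` C i)) + measure L (sym_diff (h ` C i) (f ` C i))"
          by (rule measure_sym_diff_triangle[OF fin im[OF h'a] im[OF h] im[OF fa]])
        then show "measure L (sym_diff (h' ` C i) (f ` C i)) < 1 / real (Suc k)"
          unfolding measure_aut_class_image[OF F' h' C(1)] using hC[OF i] by linarith
      qed
      have "cocycle_dist L A A' \<le> 2 * (r / 4)" using AA' r by (intro cocycle_dist_le[OF Ab A'b]) auto
      then have "\<A>' \<in> W" using r Linf_dist_class[OF A0L \<A>'(1) A \<A>'(2)] \<A>' by (intro r(2)) auto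
      have "(F', \<A>') \<in> good_pairs L \<epsilon>" using good_pairs_iff[OF fin F' \<A>'] sg by blast
      \<comment> \<open>The new cocycle may itself lie outside \<open>Vk k\<close>; but the section
        of \<open>good_pairs\<close> over \<open>F'\<close> is open and meets \<open>W\<close>,
        hence contains a member of \<open>Vk k\<close>.\<close>
      then have "openin ?Y {\<B>. (F', \<B>) \<in> good_pairs L \<epsilon>}" "\<A>' \<in> {\<B>. (F', \<B>) \<in> good_pairs L \<epsilon>}"
        using openin_good_pairs[OF fin, of \<epsilon>] unfolding openin_separate_topology by blast+
      then obtain \<B> where "\<B> \<in> Vk k" "(F', \<B>) \<in> good_pairs L \<epsilon>"
        using meets[of "{\<B>. (F', \<B>) \<in> good_pairs L \<epsilon>}"] \<open>\<A>' \<in> W\<close> by blast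
      moreover from this have "(F', \<B>) \<in> U" using F'k by (simp add: Vk_def)
      ultimately show ?thesis by blast
    qed
  qed
  moreover have "good_pairs L \<epsilon> \<subseteq> topspace ?X" unfolding top by (auto simp: good_pairs_def)
  ultimately show ?thesis unfolding top[symmetric] dense_intersects_open by blast
qed

end

section \<open>The volume measure of a compact manifold\<close>

text \<open>In a chart the density is continuous, hence bounded on a small closed ball.\<close>

lemma finite_volume_neighbourhood:
  fixes M :: "'a topology" and atlas :: "('a, 'n::finite) chart set"
    and g :: "('a, 'n) chart \<Rightarrow> 'a \<Rightarrow> real ^ 'n ^ 'n" and Leb :: "'a measure"
  assumes rm: "riemannian_manifold M atlas g" and vol: "is_volume_measure M atlas g Leb" and p: "p \<in> topspace M"
  shows "\<exists>W. openin M W \<and> p \<in> W \<and> emeasure Leb W < \<infinity>"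
proof -
  interpret riemannian_manifold M atlas g by (rule rm)
  obtain c where c: "c \<in> atlas" "p \<in> fst c" using covering p by blast
  define U where "U = fst c"
  define \<phi> where "\<phi> = snd c"
  have ch: "openin M U" "open (\<phi> ` U)" "homeomorphic_map (subtopology M U) (top_of_set (\<phi> ` U)) \<phi>"
    using charts[OF c(1)] by (auto simp: is_chart_def U_def \<phi>_def split_def)
  define h where "h = (\<lambda>y. sqrt (det (g c (chart_inv c y))))"
  have "smooth_on (\<phi> ` U) (\<lambda>y. g c (chart_inv c y))" using metric_smooth[OF c(1)] by (simp add: U_def \<phi>_def)
  then have cg: "continuous_on (\<phi> ` U) (\<lambda>y. g c (chart_inv c y))"
    unfolding smooth_on_def by (metis C_on.simps(1))
  have "continuous_on (\<phi> ` U) (\<lambda>y. det (g c (chart_inv c y)))"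
    unfolding det_def by (intro continuous_intros continuous_on_component cg)
  then have h: "continuous_on (\<phi> ` U) h" unfolding h_def by (rule continuous_on_real_sqrt)
  have "\<phi> p \<in> \<phi> ` U" using c by (simp add: U_def)
  then obtain r where r: "r > 0" "cball (\<phi> p) r \<subseteq> \<phi> ` U" using ch(2) open_contains_cball by blast
  have "compact (h ` cball (\<phi> p) r)" using h r(2) by (intro compact_continuous_image continuous_on_subset[OF h]) auto
  then have "bounded (h ` cball (\<phi> p) r)" by (rule compact_imp_bounded)
  then obtain K where K: "\<And>y. y \<in> cball (\<phi> p) r \<Longrightarrow> norm (h y) \<le> K"
    unfolding bounded_iff by blast
  define W where "W = {x \<in> U. \<phi> x \<in> ball (\<phi> p) r}"
  have top: "topspace (subtopology M U) = U" using openin_subset[OF ch(1)] by (simp add: topspace_subtopology Int_absorb1)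
  have "openin (top_of_set (\<phi> ` U)) (ball (\<phi> p) r)" using r by (intro open_openin_trans) (auto intro: ch(2) order_trans[OF ball_subset_cball])
  then have "openin (subtopology M U) {x \<in> topspace (subtopology M U). \<phi> x \<in> ball (\<phi> p) r}"
    by (rule openin_continuous_map_preimage[OF homeomorphic_imp_continuous_map[OF ch(3)]])
  then have W: "openin M W" unfolding top W_def[symmetric] using openin_open_subtopology[OF ch(1)] by blast
  have "\<phi> ` W \<subseteq> cball (\<phi> p) r" by (auto simp: W_def)
  have "W \<in> sets Leb" using vol W by (simp add: is_volume_measure_def sigma_sets.Basic)
  moreover have "W \<subseteq> fst c" by (auto simp: W_def U_def)
  ultimately have "emeasure Leb W = (\<integral>\<^sup>+y\<in>snd c ` W. ennreal (sqrt (det (g c (chart_inv c y)))) \<partial>lborel)"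
    using vol c(1) unfolding is_volume_measure_def by blast
  also have "\<dots> \<le> (\<integral>\<^sup>+y. ennreal K * indicator (cball (\<phi> p) r) y \<partial>lborel)"
  proof (rule nn_integral_mono)
    fix y
    show "ennreal (sqrt (det (g c (chart_inv c y)))) * indicator (snd c ` W) y \<le> ennreal K * indicator (cball (\<phi> p) r) y"
      using \<open>\<phi> ` W \<subseteq> cball (\<phi> p) r\<close> K[of y] by (auto simp: indicator_def \<phi>_def h_def intro!: ennreal_leI)
  qed
  also have "\<dots> = ennreal K * emeasure lborel (cball (\<phi> p) r)" by (simp add: nn_integral_cmult_indicator)
  also have "\<dots> < \<infinity>" using emeasure_lborel_cball_finite[of "\<phi> p" r] by (simp add: ennreal_mult_less_top)
  finally have "emeasure Leb W < \<infinity>" .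
  moreover have "p \<in> W" using c r by (simp add: W_def U_def)
  ultimately show ?thesis using W by blast
qed

text \<open>Compactness reduces finiteness to a neighbourhood of each point; points are null because
  Lebesgue measure has no atoms.\<close>

lemma standard_space_volume:
  fixes M :: "'a topology" and atlas :: "('a, 'n::finite) chart set"
    and g :: "('a, 'n) chart \<Rightarrow> 'a \<Rightarrow> real ^ 'n ^ 'n" and Leb :: "'a measure"
  assumes "compact_riemannian_manifold M atlas g" and vol: "is_volume_measure M atlas g Leb"
  shows "standard_space Leb M"
proof -
  interpret compact_riemannian_manifold M atlas g by fact
  have sp: "space Leb = topspace M" and st: "sets Leb = sigma_sets (topspace M) {U. openin M U}"
    using vol by (auto simp: is_volume_measure_def)
  have os: "U \<in> sets Leb" if "openin M U" for U unfolding st using that by (intro sigma_sets.Basic) simp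
  have "\<exists>W. openin M W \<and> p \<in> W \<and> emeasure Leb W < \<infinity>" if "p \<in> topspace M" for p
    by (rule finite_volume_neighbourhood[OF riemannian_manifold_axioms vol that])
  then obtain W where W: "\<And>p. p \<in> topspace M \<Longrightarrow> openin M (W p) \<and> p \<in> W p \<and> emeasure Leb (W p) < \<infinity>" by metis
  have "(\<forall>U\<in>W ` topspace M. openin M U) \<and> topspace M \<subseteq> \<Union> (W ` topspace M)" using W by blast
  then obtain \<F> where F: "finite \<F>" "\<F> \<subseteq> W ` topspace M" "topspace M \<subseteq> \<Union>\<F>"
    using compact unfolding compact_space_alt by meson
  have "emeasure Leb (space Leb) \<le> emeasure Leb (\<Union>V\<in>\<F>. V)"
    using F W os by (intro emeasure_mono sets.finite_UN) (auto simp: sp)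
  also have "\<dots> \<le> (\<Sum>V\<in>\<F>. emeasure Leb V)" using F W os by (intro emeasure_subadditive_finite) auto
  also have "\<dots> < \<infinity>" using F W by (auto simp: less_top[symmetric])
  finally have fin: "finite_measure Leb" by (intro finite_measureI) simp
  have null: "emeasure Leb {p} = 0" if p: "p \<in> space Leb" for p
  proof -
    obtain c where c: "c \<in> atlas" "p \<in> fst c" using covering p sp by blast
    have "closedin M {p}" using Hausdorff p sp by (intro closedin_Hausdorff_singleton) auto
    then have "topspace M - {p} \<in> sets Leb" by (intro os) (simp add: openin_diff)
    then have "space Leb - (topspace M - {p}) \<in> sets Leb" by (rule sets.compl_sets)
    then have "{p} \<in> sets Leb" using p by (simp add: sp Diff_Diff_Int)
    then have "emeasure Leb {p} = (\<integral>\<^sup>+y\<in>snd c ` {p}. ennreal (sqrt (det (g c (chart_inv c y)))) \<partial>lborel)"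
      using vol c unfolding is_volume_measure_def by blast
    also have "\<dots> = (\<integral>\<^sup>+(y :: real ^ 'n). 0 \<partial>lborel)"
    proof (rule nn_integral_cong_AE)
      show "AE y in lborel. ennreal (sqrt (det (g c (chart_inv c y)))) * indicator (snd c ` {p}) y = 0"
        using AE_lborel_singleton[of "snd c p"] by eventually_elim (simp add: indicator_def)
    qed
    finally show ?thesis by simp
  qed
  show ?thesis
    using fin compact Hausdorff second_countable sp st null
    by (simp add: standard_space_def standard_space_axioms_def)
qed

theorem theorem3p1:
  fixes M :: "'a topology" and atlas :: "('a, 'n::finite) chart set"
    and g :: "('a, 'n) chart \<Rightarrow> 'a \<Rightarrow> real ^ 'n ^ 'n" and Leb :: "'a measure"
  assumes "compact_riemannian_manifold M atlas g"
    and "CARD('n) \<ge> 2"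
    and "is_volume_measure M atlas g Leb"
  shows "\<exists>\<R>. residual_in (separate_topology (weak_topology Leb) (Linf_topology Leb)) \<R> \<and>
    (\<forall>(F, \<A>)\<in>\<R>. \<forall>f\<in>F. \<forall>A\<in>\<A>. trivial_spectrum Leb f A \<or> uniformly_hyperbolic Leb f A)"
proof -
  interpret standard_space Leb M by (rule standard_space_volume[OF assms(1,3)])
  note fin = finite_measure_axioms
  let ?X = "separate_topology (weak_topology Leb) (Linf_topology Leb)"
  define \<G> where "\<G> = range (\<lambda>m. good_pairs Leb (1 / real (Suc m)))"
  have top: "topspace ?X = Aut Leb \<times> Linf_SL2 Leb"
    by (simp add: topspace_separate_topology topspace_weak_topology topspace_Linf)
  have "residual_in ?X (topspace ?X \<inter> \<Inter>\<G>)"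
    unfolding residual_in_def
  proof (intro conjI exI[of _ \<G>] ballI)
    fix G assume "G \<in> \<G>"
    then obtain m where G: "G = good_pairs Leb (1 / real (Suc m))" by (auto simp: \<G>_def)
    show "openin ?X G" unfolding G by (rule openin_good_pairs[OF fin])
    show "?X closure_of G = topspace ?X" unfolding G top by (rule dense_good_pairs) simp
  qed (auto simp: \<G>_def)
  moreover have "trivial_spectrum Leb f A \<or> uniformly_hyperbolic Leb f A"
    if R: "(F, \<A>) \<in> topspace ?X \<inter> \<Inter>\<G>" and f: "f \<in> F" and A: "A \<in> \<A>" for F \<A> f A
  proof -
    have F: "F \<in> Aut Leb" and \<A>: "\<A> \<in> Linf_SL2 Leb" using R unfolding top by auto
    note fa = Aut_class(1)[OF F f] and Ab = Linf_class(1)[OF \<A> A]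
    have g: "robustly_hyperbolic Leb A \<or> small_growth Leb (1 / real (Suc m)) f A" for m
      using R good_pairs_iff[OF fin F f \<A> A] by (auto simp: \<G>_def)
    show ?thesis
    \<comment> \<open>The first alternative does not depend on \<open>m\<close>: if it fails, small
      growth holds at every scale.\<close>
    proof (cases "robustly_hyperbolic Leb A")
      case True
      then show ?thesis using robustly_hyperbolic_imp_uniformly_hyperbolic[OF fa Ab] by blast
    next
      case False
      have "small_growth Leb (1 / real m) f A" if "0 < m" for m using g[of "m - 1"] that False by simp
      then show ?thesis using small_growth_imp_trivial_spectrum[OF fin fa Ab] by blast
    qed
  qed
  ultimately show ?thesis by blast
qed

end
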